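(* Varieties of $\Delta$-continuous algebras correspond bijectively, up to isomorphism, to strongly finitary monads on $\mathsf{DCPO}$: assigning to every variety its free-algebra monad yields a bijection between varieties of $\Delta$-continuous algebras (up to concrete isomorphism over $\mathsf{DCPO}$) and strongly finitary monads on $\mathsf{DCPO}$ (up to isomorphism of monads).
   Context: $\mathsf{DCPO}$ is the category of posets with joins of (nonempty) directed subsets ("dcpos") and continuous maps (maps preserving directed joins). Hom-sets are dcpos under the pointwise order. All endofunctors and monads are enriched, i.e. functors are locally continuous: they preserve directed joins in hom-sets (in particular are locally monotone). Natural transformations are ordinary ones. Strong finitarity: let $K:\mathsf{Set}_{\mathrm{fin}}\to\mathsf{DCPO}$ send a finite set to the discrete dcpo on it. An endofunctor $F$ of $\mathsf{DCPO}$ is strongly finitary if $F=\mathrm{Lan}_K(F\cdot K)$ (enriched left Kan extension): for every enriched endofunctor $G$ and every natural transformation $\sigma:FK\to GK$ there is a unique natural transformation $\bar\sigma:F\to G$ with $\bar\sigma K=\sigma$. A monad is strongly finitary if its underlying endofunctor is. $\Delta$-continuous algebras: for a finitary signature $\Sigma$, a $\Delta$-continuous algebra is a dcpo $A$ with a continuous operation $\sigma_A:A^n\to A$ for each $\sigma\in\Sigma_n$; $\Sigma\text{-}\mathsf{DCPO}$ is the category of these and continuous homomorphisms. Let $V$ be a fixed countably infinite set of variables, and $T_\Sigma V$ the set of usual terms. The class $\mathscr{T}^\Delta_\Sigma V$ of $\Delta$-extended terms is the smallest class containing $T_\Sigma V$ and such that for every nonzero ordinal $\alpha$ and every collection $t_k$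 ($k<\alpha$) of $\Delta$-extended terms containing altogether only finitely many variables, the formal join $\bigvee_{k<\alpha}t_k$ is a $\Delta$-extended term. For an algebra $A$ and a map $f:V\to A$, the partial map $f^{@}:\mathscr{T}^\Delta_\Sigma V\rightharpoonup A$ extends the usual interpretation of terms, and is defined in $\bigvee_{i<\alpha}t_i$ iff each $f^{@}(t_i)$ is defined and $f^{@}(t_i)\sqsubseteq f^{@}(t_j)$ for all $i<j<\alpha$; then its value is $\bigsqcup_{i<\alpha}f^{@}(t_i)$. An equation is a pair $t=t'$ of $\Delta$-extended terms; $A$ satisfies it if for every $f:V\to A$ both $f^{@}(t)$ and $f^{@}(t')$ are defined and equal. A variety of $\Delta$-continuous algebras is a full subcategory of some $\Sigma\text{-}\mathsf{DCPO}$ ($\Sigma$ a finitary signature) presented by a set of equations. The forgetful functor $U_{\mathcal V}:\mathcal V\to\mathsf{DCPO}$ of every variety has a left adjoint; the induced monad on $\mathsf{DCPO}$ is the free-algebra monad of $\mathcal V$. A concrete isomorphism between varieties is an isomorphism of categories commuting with the forgetful functors to $\mathsf{DCPO}$. *)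

theory Defs
  imports Main "HOL-Library.FuncSet"
begin

unbundle cardinal_syntax

section \<open>Universe of small sets\<close>

text \<open>
  HOL has no type of all sets, so the category of all (small) dcpos is taken with respect to a
  Grothendieck-style universe: a type \<open>'u\<close> whose cardinality is (uncountable and) strongly
  inaccessible.  A small set is one of cardinality less than that of \<open>'u\<close>; every small set is in
  bijection with a subset of \<open>'u\<close>.  Classes are arbitrary sets over \<open>'u\<close>.
\<close>

definition inaccessible_universe :: "'u itself \<Rightarrow> bool" where
  "inaccessible_universe _ \<longleftrightarrow>
     natLeq <o |UNIV :: 'u set| \<and>
     regularCard |UNIV :: 'u set| \<and>
     (\<forall>A :: 'u set. |A| <o |UNIV :: 'u set| \<longrightarrow> |Pow A| <o |UNIV :: 'u set| )"

definition small :: "'u itself \<Rightarrow> 'x set \<Rightarrow> bool" where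
  "small _ A \<longleftrightarrow> |A| <o |UNIV :: 'u set|"

text \<open>
  The well-order \<open>|UNIV :: 'u set|\<close> has the order type of the cardinality of \<open>'u\<close>, so its elements
  are in order-preserving bijection with the small ordinals: \<open>\<alpha> :: 'u\<close> stands for the order type
  of its set of strict predecessors.
\<close>

definition below :: "'u \<Rightarrow> 'u set" where
  "below \<alpha> = underS |UNIV :: 'u set| \<alpha>"


section \<open>Categories, functors, adjunctions, monads\<close>

text \<open>
  \<open>Comp C X Y Z g f\<close> is the composite of \<open>f : X \<rightarrow> Y\<close> and \<open>g : Y \<rightarrow> Z\<close>.  Hom-sets need not be
  disjoint, so arrow maps of functors take the domain and the codomain as arguments.
\<close>

record ('o, 'm) category =
  Obj :: "'o set"
  Hom :: "'o \<Rightarrow> 'o \<Rightarrow> 'm set"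
  Ide :: "'o \<Rightarrow> 'm"
  Comp :: "'o \<Rightarrow> 'o \<Rightarrow> 'o \<Rightarrow> 'm \<Rightarrow> 'm \<Rightarrow> 'm"

definition full_subcategory :: "('o, 'm) category \<Rightarrow> 'o set \<Rightarrow> ('o, 'm) category" where
  "full_subcategory C S = C\<lparr>Obj := S\<rparr>"

record ('o, 'm, 'p, 'n) cfunctor =
  FObj :: "'o \<Rightarrow> 'p"
  FArr :: "'o \<Rightarrow> 'o \<Rightarrow> 'm \<Rightarrow> 'n"

definition is_functor ::
    "('o, 'm) category \<Rightarrow> ('p, 'n) category \<Rightarrow> ('o, 'm, 'p, 'n) cfunctor \<Rightarrow> bool" where
  "is_functor C D F \<longleftrightarrow>
     (\<forall>X\<in>Obj C. FObj F X \<in> Obj D) \<and>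
     (\<forall>X\<in>Obj C. \<forall>Y\<in>Obj C. FArr F X Y \<in> Hom C X Y \<rightarrow> Hom D (FObj F X) (FObj F Y)) \<and>
     (\<forall>X\<in>Obj C. FArr F X X (Ide C X) = Ide D (FObj F X)) \<and>
     (\<forall>X\<in>Obj C. \<forall>Y\<in>Obj C. \<forall>Z\<in>Obj C. \<forall>f\<in>Hom C X Y. \<forall>g\<in>Hom C Y Z.
        FArr F X Z (Comp C X Y Z g f) =
        Comp D (FObj F X) (FObj F Y) (FObj F Z) (FArr F Y Z g) (FArr F X Y f))"

definition id_functor :: "('o, 'm, 'o, 'm) cfunctor" where
  "id_functor = \<lparr>FObj = (\<lambda>X. X), FArr = (\<lambda>X Y f. f)\<rparr>"

definition comp_functor (infixr \<open>\<odot>\<close> 75) where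
  "G \<odot> F = \<lparr>FObj = (\<lambda>X. FObj G (FObj F X)),
            FArr = (\<lambda>X Y f. FArr G (FObj F X) (FObj F Y) (FArr F X Y f))\<rparr>"

text \<open>Equality of functors with domain \<open>C\<close>, ignoring the values of the HOL functions outside \<open>C\<close>.\<close>

definition eq_functor ::
    "('o, 'm) category \<Rightarrow> ('o, 'm, 'p, 'n) cfunctor \<Rightarrow> ('o, 'm, 'p, 'n) cfunctor \<Rightarrow> bool" where
  "eq_functor C F G \<longleftrightarrow>
     (\<forall>X\<in>Obj C. FObj F X = FObj G X) \<and>
     (\<forall>X\<in>Obj C. \<forall>Y\<in>Obj C. \<forall>f\<in>Hom C X Y. FArr F X Y f = FArr G X Y f)"

definition nat_trans ::
    "('o, 'm) category \<Rightarrow> ('p, 'n) category \<Rightarrow>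
     ('o, 'm, 'p, 'n) cfunctor \<Rightarrow> ('o, 'm, 'p, 'n) cfunctor \<Rightarrow> ('o \<Rightarrow> 'n) \<Rightarrow> bool" where
  "nat_trans C D F G \<tau> \<longleftrightarrow>
     \<tau> \<in> (\<Pi>\<^sub>E X\<in>Obj C. Hom D (FObj F X) (FObj G X)) \<and>
     (\<forall>X\<in>Obj C. \<forall>Y\<in>Obj C. \<forall>f\<in>Hom C X Y.
        Comp D (FObj F X) (FObj F Y) (FObj G Y) (\<tau> Y) (FArr F X Y f) =
        Comp D (FObj F X) (FObj G X) (FObj G Y) (FArr G X Y f) (\<tau> X))"

text \<open>\<open>F : C \<rightarrow> D\<close> is left adjoint to \<open>U : D \<rightarrow> C\<close>, with unit \<open>\<eta>\<close> and counit \<open>\<epsilon>\<close>.\<close>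

definition adjunction ::
    "('o, 'm) category \<Rightarrow> ('p, 'n) category \<Rightarrow> ('o, 'm, 'p, 'n) cfunctor \<Rightarrow>
     ('p, 'n, 'o, 'm) cfunctor \<Rightarrow> ('o \<Rightarrow> 'm) \<Rightarrow> ('p \<Rightarrow> 'n) \<Rightarrow> bool" where
  "adjunction C D F U \<eta> \<epsilon> \<longleftrightarrow>
     is_functor C D F \<and> is_functor D C U \<and>
     nat_trans C C id_functor (U \<odot> F) \<eta> \<and> nat_trans D D (F \<odot> U) id_functor \<epsilon> \<and>
     (\<forall>X\<in>Obj C. let FX = FObj F X; UFX = FObj U FX; FUFX = FObj F UFX in
        Comp D FX FUFX FX (\<epsilon> FX) (FArr F X UFX (\<eta> X)) = Ide D FX) \<and>
     (\<forall>A\<in>Obj D. let UA = FObj U A; FUA = FObj F UA; UFUA = FObj U FUA in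
        Comp C UA UFUA UA (FArr U FUA A (\<epsilon> A)) (\<eta> UA) = Ide C UA)"

record ('o, 'm) monad =
  Fun :: "('o, 'm, 'o, 'm) cfunctor"
  unit :: "'o \<Rightarrow> 'm"
  mult :: "'o \<Rightarrow> 'm"

definition is_monad :: "('o, 'm) category \<Rightarrow> ('o, 'm) monad \<Rightarrow> bool" where
  "is_monad C M \<longleftrightarrow>
     is_functor C C (Fun M) \<and>
     nat_trans C C id_functor (Fun M) (unit M) \<and>
     nat_trans C C (Fun M \<odot> Fun M) (Fun M) (mult M) \<and>
     (\<forall>X\<in>Obj C.
        let TX = FObj (Fun M) X; TTX = FObj (Fun M) TX; TTTX = FObj (Fun M) TTX in
        Comp C TX TTX TX (mult M X) (unit M TX) = Ide C TX \<and>
        Comp C TX TTX TX (mult M X) (FArr (Fun M) X TX (unit M X)) = Ide C TX \<and>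
        Comp C TTTX TTX TX (mult M X) (mult M TX) =
        Comp C TTTX TTX TX (mult M X) (FArr (Fun M) TTX TX (mult M X)))"

definition monad_morphism ::
    "('o, 'm) category \<Rightarrow> ('o, 'm) monad \<Rightarrow> ('o, 'm) monad \<Rightarrow> ('o \<Rightarrow> 'm) \<Rightarrow> bool" where
  "monad_morphism C M N \<tau> \<longleftrightarrow>
     nat_trans C C (Fun M) (Fun N) \<tau> \<and>
     (\<forall>X\<in>Obj C.
        let MX = FObj (Fun M) X; MMX = FObj (Fun M) MX;
            NX = FObj (Fun N) X; NNX = FObj (Fun N) NX; MNX = FObj (Fun M) NX in
        Comp C X MX NX (\<tau> X) (unit M X) = unit N X \<and>
        Comp C MMX MX NX (\<tau> X) (mult M X) =
        Comp C MMX NNX NX (mult N X)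
          (Comp C MMX MNX NNX (\<tau> NX) (FArr (Fun M) MX NX (\<tau> X))))"

definition monad_isomorphic ::
    "('o, 'm) category \<Rightarrow> ('o, 'm) monad \<Rightarrow> ('o, 'm) monad \<Rightarrow> bool" where
  "monad_isomorphic C M N \<longleftrightarrow>
     (\<exists>\<tau> \<sigma>. monad_morphism C M N \<tau> \<and> monad_morphism C N M \<sigma> \<and>
        (\<forall>X\<in>Obj C. let MX = FObj (Fun M) X; NX = FObj (Fun N) X in
           Comp C MX NX MX (\<sigma> X) (\<tau> X) = Ide C MX \<and>
           Comp C NX MX NX (\<tau> X) (\<sigma> X) = Ide C NX))"

definition induced_monad ::
    "('o, 'm) category \<Rightarrow> ('o, 'm, 'p, 'n) cfunctor \<Rightarrow> ('p, 'n, 'o, 'm) cfunctor \<Rightarrow>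
     ('o \<Rightarrow> 'm) \<Rightarrow> ('p \<Rightarrow> 'n) \<Rightarrow> ('o, 'm) monad" where
  "induced_monad C F U \<eta> \<epsilon> =
     \<lparr>Fun = U \<odot> F,
      unit = \<eta>,
      mult = (\<lambda>X\<in>Obj C. FArr U (FObj F (FObj U (FObj F X))) (FObj F X) (\<epsilon> (FObj F X)))\<rparr>"


section \<open>The category of dcpos\<close>

record 'a dcpo =
  carr :: "'a set"
  leq :: "'a rel"

definition directed :: "'a dcpo \<Rightarrow> 'a set \<Rightarrow> bool" where
  "directed P D \<longleftrightarrow> D \<subseteq> carr P \<and> D \<noteq> {} \<and>
     (\<forall>x\<in>D. \<forall>y\<in>D. \<exists>z\<in>D. (x, z) \<in> leq P \<and> (y, z) \<in> leq P)"

definition is_join :: "'a dcpo \<Rightarrow> 'a set \<Rightarrow> 'a \<Rightarrow> bool" where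
  "is_join P D x \<longleftrightarrow> x \<in> carr P \<and> (\<forall>d\<in>D. (d, x) \<in> leq P) \<and>
     (\<forall>y\<in>carr P. (\<forall>d\<in>D. (d, y) \<in> leq P) \<longrightarrow> (x, y) \<in> leq P)"

definition join :: "'a dcpo \<Rightarrow> 'a set \<Rightarrow> 'a" where
  "join P D = (THE x. is_join P D x)"

definition is_dcpo :: "'a dcpo \<Rightarrow> bool" where
  "is_dcpo P \<longleftrightarrow> partial_order_on (carr P) (leq P) \<and>
     (\<forall>D. directed P D \<longrightarrow> (\<exists>x. is_join P D x))"

text \<open>Monotonicity is the case of directed sets \<open>{x, y}\<close> with \<open>x\<close> below \<open>y\<close>.\<close>

definition continuous :: "'a dcpo \<Rightarrow> 'b dcpo \<Rightarrow> ('a \<Rightarrow> 'b) \<Rightarrow> bool" where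
  "continuous P Q f \<longleftrightarrow> f \<in> carr P \<rightarrow> carr Q \<and>
     (\<forall>D x. directed P D \<longrightarrow> is_join P D x \<longrightarrow> is_join Q (f ` D) (f x))"

definition DCPO :: "('u dcpo, 'u \<Rightarrow> 'u) category" where
  "DCPO = \<lparr>Obj = {P. is_dcpo P \<and> small TYPE('u) (carr P)},
           Hom = (\<lambda>P Q. {f \<in> carr P \<rightarrow>\<^sub>E carr Q. continuous P Q f}),
           Ide = (\<lambda>P. \<lambda>x\<in>carr P. x),
           Comp = (\<lambda>P Q R g f. compose (carr P) g f)\<rparr>"

definition hom_dcpo :: "'u dcpo \<Rightarrow> 'u dcpo \<Rightarrow> ('u \<Rightarrow> 'u) dcpo" where
  "hom_dcpo P Q = \<lparr>carr = Hom DCPO P Q,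
     leq = {(f, g) \<in> Hom DCPO P Q \<times> Hom DCPO P Q. \<forall>x\<in>carr P. (f x, g x) \<in> leq Q}\<rparr>"

type_synonym 'u dcpo_functor = "('u dcpo, 'u \<Rightarrow> 'u, 'u dcpo, 'u \<Rightarrow> 'u) cfunctor"
type_synonym 'u dcpo_monad = "('u dcpo, 'u \<Rightarrow> 'u) monad"

definition enriched_endofunctor :: "'u dcpo_functor \<Rightarrow> bool" where
  "enriched_endofunctor F \<longleftrightarrow> is_functor DCPO DCPO F \<and>
     (\<forall>P\<in>Obj DCPO. \<forall>Q\<in>Obj DCPO.
        continuous (hom_dcpo P Q) (hom_dcpo (FObj F P) (FObj F Q)) (FArr F P Q))"

definition enriched_monad :: "'u dcpo_monad \<Rightarrow> bool" where
  "enriched_monad M \<longleftrightarrow> is_monad DCPO M \<and> enriched_endofunctor (Fun M)"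


section \<open>Strong finitarity\<close>

definition FinSet :: "('u set, 'u \<Rightarrow> 'u) category" where
  "FinSet = \<lparr>Obj = {X. finite X},
             Hom = (\<lambda>X Y. X \<rightarrow>\<^sub>E Y),
             Ide = (\<lambda>X. \<lambda>x\<in>X. x),
             Comp = (\<lambda>X Y Z g f. compose X g f)\<rparr>"

definition discrete :: "('u set, 'u \<Rightarrow> 'u, 'u dcpo, 'u \<Rightarrow> 'u) cfunctor" where
  "discrete = \<lparr>FObj = (\<lambda>X. \<lparr>carr = X, leq = Id_on X\<rparr>), FArr = (\<lambda>X Y f. f)\<rparr>"

definition strongly_finitary :: "'u dcpo_functor \<Rightarrow> bool" where
  "strongly_finitary F \<longleftrightarrow> enriched_endofunctor F \<and>
     (\<forall>G \<sigma>. enriched_endofunctor G \<and>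
        nat_trans FinSet DCPO (F \<odot> discrete) (G \<odot> discrete) \<sigma> \<longrightarrow>
        (\<exists>!\<tau>. nat_trans DCPO DCPO F G \<tau> \<and> (\<forall>X\<in>Obj FinSet. \<tau> (FObj discrete X) = \<sigma> X)))"

definition sf_monads :: "'u dcpo_monad set" where
  "sf_monads = {M. enriched_monad M \<and> strongly_finitary (Fun M)}"


section \<open>Continuous algebras and extended terms\<close>

text \<open>
  \<open>S n\<close> is the set of \<open>n\<close>-ary operation symbols.  The sets \<open>S n\<close> need not be disjoint: a symbol
  is always used together with a list of arguments, whose length is its arity.
\<close>

type_synonym 'u signature = "nat \<Rightarrow> 'u set"

definition is_signature :: "'u signature \<Rightarrow> bool" where
  "is_signature S \<longleftrightarrow> (\<forall>n. small TYPE('u) (S n))"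

definition power_dcpo :: "'a dcpo \<Rightarrow> nat \<Rightarrow> 'a list dcpo" where
  "power_dcpo P n = (let X = {xs. length xs = n \<and> set xs \<subseteq> carr P} in
     \<lparr>carr = X, leq = {(xs, ys) \<in> X \<times> X. list_all2 (\<lambda>x y. (x, y) \<in> leq P) xs ys}\<rparr>)"

record 'u algebra =
  und :: "'u dcpo"
  opn :: "'u \<Rightarrow> 'u list \<Rightarrow> 'u"

text \<open>
  The value of \<open>opn\<close> is fixed to be \<open>undefined\<close> on meaningless arguments, so that an algebra is
  determined by its dcpo and its operations.
\<close>

definition is_algebra :: "'u signature \<Rightarrow> 'u algebra \<Rightarrow> bool" where
  "is_algebra S A \<longleftrightarrow> und A \<in> Obj DCPO \<and>
     (\<forall>n. \<forall>s\<in>S n. continuous (power_dcpo (und A) n) (und A) (opn A s)) \<and>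
     (\<forall>s xs. \<not> (s \<in> S (length xs) \<and> set xs \<subseteq> carr (und A)) \<longrightarrow> opn A s xs = undefined)"

definition Alg :: "'u signature \<Rightarrow> ('u algebra, 'u \<Rightarrow> 'u) category" where
  "Alg S = \<lparr>Obj = {A. is_algebra S A},
            Hom = (\<lambda>A B. {h \<in> Hom DCPO (und A) (und B).
              \<forall>n. \<forall>s\<in>S n. \<forall>xs\<in>carr (power_dcpo (und A) n).
                h (opn A s xs) = opn B s (map h xs)}),
            Ide = (\<lambda>A. Ide DCPO (und A)),
            Comp = (\<lambda>A B C g f. Comp DCPO (und A) (und B) (und C) g f)\<rparr>"

definition forget :: "('u algebra, 'u \<Rightarrow> 'u, 'u dcpo, 'u \<Rightarrow> 'u) cfunctor" where
  "forget = \<lparr>FObj = und, FArr = (\<lambda>A B h. h)\<rparr>"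

text \<open>The fixed countably infinite set of variables is \<open>nat\<close>.\<close>

datatype 'u trm = Var nat | Op 'u "'u trm list"

primrec trm_vars :: "'u trm \<Rightarrow> nat set" where
  "trm_vars (Var v) = {v}"
| "trm_vars (Op s ts) = \<Union> (set (map trm_vars ts))"

inductive_set trms :: "'u signature \<Rightarrow> 'u trm set" for S :: "'u signature" where
  Var: "Var v \<in> trms S"
| Op: "s \<in> S (length ts) \<Longrightarrow> (\<And>t. t \<in> set ts \<Longrightarrow> t \<in> trms S) \<Longrightarrow> Op s ts \<in> trms S"

text \<open>
  \<open>Join \<alpha> t\<close> is the formal join of the terms \<open>t k\<close> for \<open>k\<close> in \<open>below \<alpha>\<close>.  Formal joins do not occur
  inside operation symbols.
\<close>

datatype 'u ext_trm = Trm "'u trm" | Join 'u "'u \<Rightarrow> 'u ext_trm"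

primrec ext_vars :: "'u ext_trm \<Rightarrow> nat set" where
  "ext_vars (Trm t) = trm_vars t"
| "ext_vars (Join \<alpha> t) = (\<Union>k\<in>below \<alpha>. ext_vars (t k))"

inductive_set ext_trms :: "'u signature \<Rightarrow> 'u ext_trm set" for S :: "'u signature" where
  Trm: "t \<in> trms S \<Longrightarrow> Trm t \<in> ext_trms S"
| Join: "below \<alpha> \<noteq> {} \<Longrightarrow> (\<And>k. k \<in> below \<alpha> \<Longrightarrow> t k \<in> ext_trms S) \<Longrightarrow>
         t \<in> extensional (below \<alpha>) \<Longrightarrow> finite (\<Union>k\<in>below \<alpha>. ext_vars (t k)) \<Longrightarrow>
         Join \<alpha> t \<in> ext_trms S"

primrec trm_val :: "'u algebra \<Rightarrow> (nat \<Rightarrow> 'u) \<Rightarrow> 'u trm \<Rightarrow> 'u" where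
  "trm_val A f (Var v) = f v"
| "trm_val A f (Op s ts) = opn A s (map (trm_val A f) ts)"

text \<open>The partial interpretation of extended terms; \<open>None\<close> means undefined.\<close>

primrec ext_val :: "'u algebra \<Rightarrow> (nat \<Rightarrow> 'u) \<Rightarrow> 'u ext_trm \<Rightarrow> 'u option" where
  "ext_val A f (Trm t) = Some (trm_val A f t)"
| "ext_val A f (Join \<alpha> t) =
     (if (\<forall>i\<in>below \<alpha>. ext_val A f (t i) \<noteq> None) \<and>
         (\<forall>j\<in>below \<alpha>. \<forall>i\<in>below j. (the (ext_val A f (t i)), the (ext_val A f (t j))) \<in> leq (und A))
      then Some (join (und A) ((\<lambda>i. the (ext_val A f (t i))) ` below \<alpha>))
      else None)"

definition satisfies :: "'u algebra \<Rightarrow> 'u ext_trm \<times> 'u ext_trm \<Rightarrow> bool" where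
  "satisfies A e \<longleftrightarrow> (\<forall>f \<in> UNIV \<rightarrow> carr (und A).
     ext_val A f (fst e) \<noteq> None \<and> ext_val A f (snd e) \<noteq> None \<and>
     ext_val A f (fst e) = ext_val A f (snd e))"


section \<open>Varieties\<close>

type_synonym 'u alg_category = "('u algebra, 'u \<Rightarrow> 'u) category"

definition varieties :: "'u alg_category set" where
  "varieties = {full_subcategory (Alg S) {A \<in> Obj (Alg S). \<forall>e\<in>E. satisfies A e} | S E.
     is_signature S \<and> E \<subseteq> ext_trms S \<times> ext_trms S \<and> small TYPE('u) E}"

definition concretely_isomorphic :: "'u alg_category \<Rightarrow> 'u alg_category \<Rightarrow> bool" where
  "concretely_isomorphic V W \<longleftrightarrow>
     (\<exists>I J. is_functor V W I \<and> is_functor W V J \<and>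
        eq_functor V (J \<odot> I) id_functor \<and> eq_functor W (I \<odot> J) id_functor \<and>
        eq_functor V (forget \<odot> I) forget)"

definition concrete_iso :: "'u alg_category rel" where
  "concrete_iso = {(V, W) \<in> varieties \<times> varieties. concretely_isomorphic V W}"

definition monad_iso :: "'u dcpo_monad rel" where
  "monad_iso = {(M, N) \<in> sf_monads \<times> sf_monads. monad_isomorphic DCPO M N}"

text \<open>
  A left adjoint is unique only up to isomorphism, so being the free-algebra monad is a relation.
\<close>

definition free_algebra_monad :: "'u alg_category \<Rightarrow> 'u dcpo_monad \<Rightarrow> bool" where
  "free_algebra_monad V M \<longleftrightarrow>
     (\<exists>F \<eta> \<epsilon>. adjunction DCPO V F forget \<eta> \<epsilon> \<and> M = induced_monad DCPO F forget \<eta> \<epsilon>)"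

end

theory Submission
  imports Defs "HOL-Library.Countable_Set"
begin

text \<open>Free algebras exist because the subalgebra generated by the image of a dcpo is small.  The
  free algebra on \<open>X\<close> is the colimit, weighted by \<open>[n, X]\<close>, of the free algebras on finite discrete
  dcpos \<open>n\<close>: the observations on these with values in a dcpo \<open>P\<close> separate enough points for the
  closure of the basic elements in a power of \<open>P\<close> to be an algebra, and continuous maps out of the free
  algebra are then determined by compatible cocones; hence the free-algebra monad is strongly finitary.

  A variety is recovered from its monad, as every model is an Eilenberg--Moore algebra whose
  operations are induced by its structure map; so the monads are isomorphic iff the varieties are.

  Conversely, let \<open>M\<close> be strongly finitary.  The enriched Yoneda lemma for the functors
  \<open>Y \<mapsto> [[Y, X], P]\<close> turns the universal property of the left Kan extension into an extension property
  for cocones on \<open>M X\<close>.  Take the elements of \<open>M k\<close> as the \<open>k\<close>-ary operations, with equations for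
  substitution, projections and joins.  As extended terms only provide joins of well-ordered chains,
  continuity in the operation symbol follows from Iwamura's lemma, and \<open>M X\<close> is the free algebra.\<close>

section \<open>Small sets\<close>

text \<open>What shapes the proof is that a colimit of dcpos is not visible on elements: the basic
  elements are known, the directed joins added to them are not, and an operation given on a dense
  subset need not extend. Inside a power of \<open>P\<close> it does, because an observation
  translated by an operation with all arguments but one fixed is again an observation
  (\<open>shift_obs\<close>); this extends one argument at a time, and for finitary operations
  separate continuity is joint continuity. A second obstacle is that finite discrete subsets of
  \<open>X\<close> forget its order, so continuity in the generators has to be imposed on
  observations; the element \<open>star\<close> outside \<open>X\<close> marks the generator that
  moves. Finally, satisfaction of an equation includes definedness of both sides. Homomorphisms
  preserve definedness; it is reflected by jointly order-reflecting families and passes to directed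
  joins in each of the finitely many variables. This is how free algebras and the colimit are seen
  to be models.\<close>

locale universe =
  fixes U :: "'u itself"
  assumes inaccessible: "inaccessible_universe TYPE('u)"
begin

abbreviation sml :: "'x set \<Rightarrow> bool" where "sml A \<equiv> small U A"

text \<open>The type token only fixes \<open>'u\<close>; this bridges the token
  \<open>TYPE('u)\<close> of the definitions and the locale parameter \<open>U\<close>.\<close>

lemma small_TYPE: "small TYPE('u) A \<longleftrightarrow> sml A"
  by (simp add: small_def)

lemma small_iff: "sml A \<longleftrightarrow> |A| <o |UNIV :: 'u set|"
  by (simp add: small_def)

lemma small_image: "sml A \<Longrightarrow> sml (f ` A)"
  unfolding small_iff by (rule ordLeq_ordLess_trans[OF card_of_image])

lemma small_subset: "sml B \<Longrightarrow> A \<subseteq> B \<Longrightarrow> sml A"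
  unfolding small_iff by (rule ordLeq_ordLess_trans[OF card_of_mono1])

lemma small_inj_on: "sml (f ` A) \<Longrightarrow> inj_on f A \<Longrightarrow> sml A"
  using small_image[of "f ` A" "inv_into A f"] by simp

lemma small_embedding:
  assumes "sml (A :: 'x set)"
  obtains g :: "'x \<Rightarrow> 'u" where "inj_on g A"
proof -
  have "|A| \<le>o |UNIV :: 'u set|"
    using assms small_iff ordLess_imp_ordLeq by blast
  then show thesis
    unfolding card_of_ordLeq[symmetric] using that by blast
qed

text \<open>The strong limit property concerns subsets of \<open>'u\<close>, so a small set of
  another type is first embedded there.\<close>

lemma small_Pow:
  assumes "sml (A :: 'x set)"
  shows "sml (Pow A)"
proof -
  obtain g :: "'x \<Rightarrow> 'u" where g: "inj_on g A"
    using small_embedding[OF assms] .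
  have "sml (Pow (g ` A))"
    using inaccessible small_image[OF assms, of g]
    by (simp add: small_iff inaccessible_universe_def)
  moreover have "Pow (g ` A) = image g ` Pow A"
    by (simp add: image_Pow_surj)
  moreover have "inj_on (image g) (Pow A)"
    using g by (simp add: inj_on_image_Pow)
  ultimately show ?thesis
    using small_inj_on by metis
qed

lemma small_countable:
  assumes "countable A"
  shows "sml A"
proof -
  have "|A| \<le>o |UNIV :: nat set|"
    using assms unfolding countable_def card_of_ordLeq[symmetric] by blast
  moreover have "|UNIV :: nat set| =o natLeq"
    by (rule card_of_nat)
  moreover have "natLeq <o |UNIV :: 'u set|"
    using inaccessible by (simp add: inaccessible_universe_def)
  ultimately show ?thesis
    unfolding small_iff using ordLeq_ordIso_trans ordLeq_ordLess_trans by blast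
qed

lemma small_finite: "finite A \<Longrightarrow> sml A"
  by (simp add: small_countable countable_finite)

lemma infinite_universe: "infinite (UNIV :: 'u set)"
  using small_finite[of "UNIV :: 'u set"] small_iff ordLess_irreflexive by blast

text \<open>Regularity of the cardinal of \<open>'u\<close>, in the form of stability under small
  unions. The closure properties that follow rest on this and on \<open>small_Pow\<close>.\<close>

lemma small_UNION:
  assumes "sml I" "\<And>i. i \<in> I \<Longrightarrow> sml (A i)"
  shows "sml (\<Union>i\<in>I. A i)"
proof -
  have "stable |UNIV :: 'u set|"
    using inaccessible infinite_universe
    by (intro regularCard_stable) (auto simp: inaccessible_universe_def card_of_card_order_on Field_card_of)
  then show ?thesis
    using assms stable_UNION unfolding small_iff by blast
qed

lemma small_Un: "sml A \<Longrightarrow> sml B \<Longrightarrow> sml (A \<union> B)"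
  using small_UNION[of "UNIV :: bool set" "\<lambda>b. if b then A else B"] small_finite[of "UNIV :: bool set"]
  by (simp add: UNIV_bool Un_commute)

lemma small_Sigma: "sml A \<Longrightarrow> (\<And>a. a \<in> A \<Longrightarrow> sml (B a)) \<Longrightarrow> sml (Sigma A B)"
proof -
  assume *: "sml A" "\<And>a. a \<in> A \<Longrightarrow> sml (B a)"
  have "Sigma A B = (\<Union>a\<in>A. Pair a ` B a)" by auto
  then show ?thesis using * by (simp add: small_UNION small_image)
qed

lemma small_lists: "sml A \<Longrightarrow> sml (lists A)"
proof -
  assume A: "sml A"
  have "sml {xs \<in> lists A. length xs = n}" for n
  proof (induction n)
    case 0
    have "{xs \<in> lists A. length xs = 0} \<subseteq> {[]}" by auto
    then show ?case using small_finite small_subset by blast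
  next
    case (Suc n)
    have "{xs \<in> lists A. length xs = Suc n} \<subseteq> (\<lambda>(x, xs). x # xs) ` (A \<times> {xs \<in> lists A. length xs = n})"
      by (auto simp: length_Suc_conv image_iff)
    then show ?case by (rule small_subset[OF small_image[OF small_Sigma[OF A Suc]]])
  qed
  then have "sml (\<Union>n\<in>(UNIV :: nat set). {xs \<in> lists A. length xs = n})"
    by (intro small_UNION[OF small_countable]) auto
  then show ?thesis by (rule small_subset) auto
qed

lemma small_finite_subsets: "sml A \<Longrightarrow> sml {n. finite n \<and> n \<subseteq> A}"
  by (rule small_subset[OF small_Pow]) auto

lemma small_PiE: "sml A \<Longrightarrow> (\<And>a. a \<in> A \<Longrightarrow> sml (B a)) \<Longrightarrow> sml (Pi\<^sub>E A B)"
proof -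
  assume *: "sml A" "\<And>a. a \<in> A \<Longrightarrow> sml (B a)"
  \<comment> \<open>An extensional function is determined by its graph over \<open>A\<close>, which
    is a subset of \<open>Sigma A B\<close>.\<close>
  have inj: "inj_on (\<lambda>f. (\<lambda>a. (a, f a)) ` A) (Pi\<^sub>E A B)"
  proof (rule inj_onI)
    fix f g assume fg: "f \<in> Pi\<^sub>E A B" "g \<in> Pi\<^sub>E A B" "(\<lambda>a. (a, f a)) ` A = (\<lambda>a. (a, g a)) ` A"
    have "f a = g a" if "a \<in> A" for a
    proof -
      have "(a, f a) \<in> (\<lambda>a. (a, g a)) ` A" using fg(3) that by blast
      then show ?thesis by auto
    qed
    then show "f = g" by (rule PiE_ext[OF fg(1,2)])
  qed
  have "(\<lambda>f. (\<lambda>a. (a, f a)) ` A) ` Pi\<^sub>E A B \<subseteq> Pow (Sigma A B)" by auto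
  then have "sml ((\<lambda>f. (\<lambda>a. (a, f a)) ` A) ` Pi\<^sub>E A B)"
    by (rule small_subset[rotated]) (intro small_Pow small_Sigma *)
  then show ?thesis by (rule small_inj_on[OF _ inj])
qed

text \<open>Yields an element of \<open>'u\<close> outside any small carrier; \<open>star\<close> is
  chosen this way.\<close>

lemma not_small_UNIV: "\<not> sml (UNIV :: 'u set)"
  unfolding small_iff using ordLess_irreflexive by blast

end

section \<open>Dcpos and continuous maps\<close>

lemma dcpoD:
  assumes "is_dcpo P"
  shows dcpo_leq_carr: "(x, y) \<in> leq P \<Longrightarrow> x \<in> carr P \<and> y \<in> carr P"
    and dcpo_refl: "x \<in> carr P \<Longrightarrow> (x, x) \<in> leq P"
    and dcpo_trans: "(x, y) \<in> leq P \<Longrightarrow> (y, z) \<in> leq P \<Longrightarrow> (x, z) \<in> leq P"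
    and dcpo_antisym: "(x, y) \<in> leq P \<Longrightarrow> (y, x) \<in> leq P \<Longrightarrow> x = y"
    and dcpo_ex_join: "directed P D \<Longrightarrow> \<exists>x. is_join P D x"
  using assms unfolding is_dcpo_def partial_order_on_def preorder_on_def refl_on_def
  by (auto dest: transD antisymD)

lemma is_dcpoI:
  assumes "leq P \<subseteq> carr P \<times> carr P" "\<And>x. x \<in> carr P \<Longrightarrow> (x, x) \<in> leq P"
    "\<And>x y z. (x, y) \<in> leq P \<Longrightarrow> (y, z) \<in> leq P \<Longrightarrow> (x, z) \<in> leq P"
    "\<And>x y. (x, y) \<in> leq P \<Longrightarrow> (y, x) \<in> leq P \<Longrightarrow> x = y"
    "\<And>D. directed P D \<Longrightarrow> \<exists>x. is_join P D x"
  shows "is_dcpo P"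
  unfolding is_dcpo_def partial_order_on_def preorder_on_def refl_on_def
  using assms by (auto intro!: transI antisymI)

lemma directedI:
  "D \<subseteq> carr P \<Longrightarrow> D \<noteq> {} \<Longrightarrow>
   (\<And>x y. x \<in> D \<Longrightarrow> y \<in> D \<Longrightarrow> \<exists>z\<in>D. (x, z) \<in> leq P \<and> (y, z) \<in> leq P) \<Longrightarrow> directed P D"
  unfolding directed_def by blast

lemma directedD:
  assumes "directed P D"
  shows directed_carr: "x \<in> D \<Longrightarrow> x \<in> carr P" and directed_nonempty: "D \<noteq> {}"
    and directed_ub: "x \<in> D \<Longrightarrow> y \<in> D \<Longrightarrow> \<exists>z\<in>D. (x, z) \<in> leq P \<and> (y, z) \<in> leq P"
  using assms unfolding directed_def by blast+

lemma is_joinI: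
  "x \<in> carr P \<Longrightarrow> (\<And>d. d \<in> D \<Longrightarrow> (d, x) \<in> leq P) \<Longrightarrow>
   (\<And>y. y \<in> carr P \<Longrightarrow> (\<And>d. d \<in> D \<Longrightarrow> (d, y) \<in> leq P) \<Longrightarrow> (x, y) \<in> leq P) \<Longrightarrow> is_join P D x"
  unfolding is_join_def by blast

lemma is_joinD:
  assumes "is_join P D x"
  shows is_join_carr: "x \<in> carr P" and is_join_ub: "d \<in> D \<Longrightarrow> (d, x) \<in> leq P"
    and is_join_least: "y \<in> carr P \<Longrightarrow> (\<And>d. d \<in> D \<Longrightarrow> (d, y) \<in> leq P) \<Longrightarrow> (x, y) \<in> leq P"
  using assms unfolding is_join_def by blast+

lemma is_join_unique: "is_dcpo P \<Longrightarrow> is_join P D x \<Longrightarrow> is_join P D y \<Longrightarrow> x = y"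
  unfolding is_join_def by (meson dcpo_antisym)

lemma join_eq: "is_dcpo P \<Longrightarrow> is_join P D x \<Longrightarrow> join P D = x"
  unfolding join_def using is_join_unique by (metis the_equality)

lemma is_join_join: "is_dcpo P \<Longrightarrow> directed P D \<Longrightarrow> is_join P D (join P D)"
  using dcpo_ex_join join_eq by metis

lemma is_join_greatest: "is_dcpo P \<Longrightarrow> x \<in> D \<Longrightarrow> (\<And>d. d \<in> D \<Longrightarrow> (d, x) \<in> leq P) \<Longrightarrow> is_join P D x"
  by (intro is_joinI) (auto dest: dcpo_leq_carr)

lemma continuous_carr: "continuous P Q f \<Longrightarrow> x \<in> carr P \<Longrightarrow> f x \<in> carr Q"
  unfolding continuous_def by blast

lemma continuous_join: "continuous P Q f \<Longrightarrow> directed P D \<Longrightarrow> is_join P D x \<Longrightarrow> is_join Q (f ` D) (f x)"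
  unfolding continuous_def by blast

lemma continuous_mono:
  assumes "continuous P Q f" "is_dcpo P" "(x, y) \<in> leq P"
  shows "(f x, f y) \<in> leq Q"
proof -
  have "x \<in> carr P" "y \<in> carr P" using assms dcpo_leq_carr by metis+
  then have "directed P {x, y}" "is_join P {x, y} y"
    using assms by (auto intro!: directedI is_joinI dest: dcpo_refl)
  then have "is_join Q (f ` {x, y}) (f y)" using assms continuous_join by metis
  then show ?thesis by (simp add: is_join_def)
qed

lemma directed_image:
  assumes "directed P D" "\<And>x. x \<in> D \<Longrightarrow> f x \<in> carr Q"
    "\<And>x y. x \<in> D \<Longrightarrow> y \<in> D \<Longrightarrow> (x, y) \<in> leq P \<Longrightarrow> (f x, f y) \<in> leq Q"
  shows "directed Q (f ` D)"
  using assms unfolding directed_def by (simp add: image_subset_iff) blast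

lemma continuous_directed: "continuous P Q f \<Longrightarrow> is_dcpo P \<Longrightarrow> directed P D \<Longrightarrow> directed Q (f ` D)"
  by (rule directed_image) (auto dest: directed_carr continuous_carr continuous_mono)

text \<open>A monotone map sends a join to an upper bound of the image, so only the comparison with
  an arbitrary upper bound \<open>q\<close> is left.\<close>

lemma continuousI:
  assumes "\<And>x. x \<in> carr P \<Longrightarrow> f x \<in> carr Q"
    "\<And>x y. (x, y) \<in> leq P \<Longrightarrow> (f x, f y) \<in> leq Q"
    "\<And>D x q. directed P D \<Longrightarrow> is_join P D x \<Longrightarrow> q \<in> carr Q \<Longrightarrow> (\<And>d. d \<in> D \<Longrightarrow> (f d, q) \<in> leq Q) \<Longrightarrow> (f x, q) \<in> leq Q"
  shows "continuous P Q f"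
  unfolding continuous_def
proof (intro conjI allI impI)
  show "f \<in> carr P \<rightarrow> carr Q" using assms(1) by blast
  fix D x assume D: "directed P D" "is_join P D x"
  show "is_join Q (f ` D) (f x)"
    using D assms by (intro is_joinI) (auto dest: is_join_carr is_join_ub)
qed

lemma continuous_cong:
  assumes "continuous P Q f" "\<And>x. x \<in> carr P \<Longrightarrow> f x = g x"
  shows "continuous P Q g"
  unfolding continuous_def
proof (intro conjI allI impI)
  show "g \<in> carr P \<rightarrow> carr Q" using assms continuous_carr by fastforce
  fix D x assume D: "directed P D" "is_join P D x"
  have "g ` D = f ` D" using D assms(2) by (metis directed_carr image_cong)
  then show "is_join Q (g ` D) (g x)"
    using assms D by (metis continuous_join is_join_carr)
qed

lemma continuous_comp:
  "continuous P Q f \<Longrightarrow> continuous Q R g \<Longrightarrow> is_dcpo P \<Longrightarrow> continuous P R (\<lambda>x. g (f x))"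
  unfolding continuous_def
proof (intro conjI allI impI; elim conjE)
  fix D x
  assume f: "f \<in> carr P \<rightarrow> carr Q" "\<forall>D x. directed P D \<longrightarrow> is_join P D x \<longrightarrow> is_join Q (f ` D) (f x)"
    and g: "g \<in> carr Q \<rightarrow> carr R" "\<forall>D x. directed Q D \<longrightarrow> is_join Q D x \<longrightarrow> is_join R (g ` D) (g x)"
    and P: "is_dcpo P"
    and D: "directed P D" "is_join P D x"
  have "continuous P Q f" using f by (simp add: continuous_def)
  then have "directed Q (f ` D)" using continuous_directed P D by metis
  then have "is_join R (g ` f ` D) (g (f x))" using f g D by blast
  then show "is_join R ((\<lambda>x. g (f x)) ` D) (g (f x))" by (simp add: image_image)
qed auto

lemma continuous_ident: "continuous P P (\<lambda>x. x)"
  unfolding continuous_def by simp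

lemma continuous_const: "is_dcpo Q \<Longrightarrow> q \<in> carr Q \<Longrightarrow> continuous P Q (\<lambda>x. q)"
  by (intro continuousI) (auto intro: dcpo_refl dest: directed_nonempty)

section \<open>Sub-dcpos and closure under directed joins\<close>

definition dclosed :: "'a dcpo \<Rightarrow> 'a set \<Rightarrow> bool" where
  "dclosed P C \<longleftrightarrow> (\<forall>D x. directed P D \<longrightarrow> D \<subseteq> C \<longrightarrow> is_join P D x \<longrightarrow> x \<in> C)"

lemma dclosedD: "dclosed P C \<Longrightarrow> directed P D \<Longrightarrow> D \<subseteq> C \<Longrightarrow> is_join P D x \<Longrightarrow> x \<in> C"
  unfolding dclosed_def by blast

definition sub_dcpo :: "'a dcpo \<Rightarrow> 'a set \<Rightarrow> 'a dcpo" where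
  "sub_dcpo P C = \<lparr>carr = C, leq = leq P \<inter> C \<times> C\<rparr>"

lemma carr_sub_dcpo [simp]: "carr (sub_dcpo P C) = C"
  by (simp add: sub_dcpo_def)

lemma leq_sub_dcpo [simp]: "(x, y) \<in> leq (sub_dcpo P C) \<longleftrightarrow> (x, y) \<in> leq P \<and> x \<in> C \<and> y \<in> C"
  by (auto simp: sub_dcpo_def)

lemma directed_sub_dcpo:
  "C \<subseteq> carr P \<Longrightarrow> directed (sub_dcpo P C) D \<longleftrightarrow> directed P D \<and> D \<subseteq> C"
  unfolding directed_def by (auto; blast)

text \<open>The ambient join exists, lies in \<open>C\<close> by closedness and is therefore also a
  join inside; antisymmetry identifies it with any join found inside.\<close>

lemma is_join_sub_dcpo:
  assumes "is_dcpo P" "dclosed P C" "C \<subseteq> carr P" "directed P D" "D \<subseteq> C"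
  shows "is_join (sub_dcpo P C) D x \<longleftrightarrow> is_join P D x"
proof -
  have imp: "is_join (sub_dcpo P C) D x" if "is_join P D x" for x
  proof -
    have "x \<in> C" using dclosedD assms that by metis
    then show ?thesis using that assms by (intro is_joinI) (auto dest: is_joinD)
  qed
  have "is_join (sub_dcpo P C) D (join P D)" using imp is_join_join assms by blast
  then show ?thesis
  proof (intro iffI imp)
    assume x: "is_join (sub_dcpo P C) D x"
    have "(x, join P D) \<in> leq P" "(join P D, x) \<in> leq P"
      using x \<open>is_join (sub_dcpo P C) D (join P D)\<close> unfolding is_join_def by auto
    then have "x = join P D" using assms(1) dcpo_antisym by metis
    then show "is_join P D x" using is_join_join assms by blast
  qed
qed

lemma is_dcpo_sub_dcpo:
  assumes "is_dcpo P" "dclosed P C" "C \<subseteq> carr P"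
  shows "is_dcpo (sub_dcpo P C)"
proof (rule is_dcpoI)
  show "leq (sub_dcpo P C) \<subseteq> carr (sub_dcpo P C) \<times> carr (sub_dcpo P C)" by auto
  show "(x, x) \<in> leq (sub_dcpo P C)" if "x \<in> carr (sub_dcpo P C)" for x
    using that assms(3) dcpo_refl[OF assms(1)] by auto
  show "(x, z) \<in> leq (sub_dcpo P C)" if "(x, y) \<in> leq (sub_dcpo P C)" "(y, z) \<in> leq (sub_dcpo P C)" for x y z
    using that dcpo_trans[OF assms(1), of x y z] by simp
  show "x = y" if "(x, y) \<in> leq (sub_dcpo P C)" "(y, x) \<in> leq (sub_dcpo P C)" for x y
    using that dcpo_antisym[OF assms(1)] by simp
  show "\<exists>x. is_join (sub_dcpo P C) D x" if "directed (sub_dcpo P C) D" for D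
    using that assms by (metis dcpo_ex_join directed_sub_dcpo is_join_sub_dcpo)
qed

lemma continuous_into_sub_dcpo:
  assumes "is_dcpo P" "is_dcpo Q" "dclosed Q C" "C \<subseteq> carr Q"
    "continuous P Q f" "\<And>x. x \<in> carr P \<Longrightarrow> f x \<in> C"
  shows "continuous P (sub_dcpo Q C) f"
  unfolding continuous_def
proof (intro conjI allI impI)
  show "f \<in> carr P \<rightarrow> carr (sub_dcpo Q C)" using assms by simp
  fix D x assume D: "directed P D" "is_join P D x"
  have "f ` D \<subseteq> C" using assms D directed_carr by fastforce
  moreover have "directed Q (f ` D)" using continuous_directed assms D by metis
  ultimately show "is_join (sub_dcpo Q C) (f ` D) (f x)"
    using assms D continuous_join is_join_sub_dcpo by metis
qed

lemma continuous_from_sub_dcpo: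
  assumes "is_dcpo P" "dclosed P C" "C \<subseteq> carr P" "continuous P Q f"
  shows "continuous (sub_dcpo P C) Q f"
  unfolding continuous_def
proof (intro conjI allI impI)
  show "f \<in> carr (sub_dcpo P C) \<rightarrow> carr Q" using assms continuous_carr by fastforce
  fix D x assume D: "directed (sub_dcpo P C) D" "is_join (sub_dcpo P C) D x"
  then show "is_join Q (f ` D) (f x)"
    using assms by (metis continuous_join directed_sub_dcpo is_join_sub_dcpo)
qed

text \<open>A single round of adding directed joins need not give a closed set; the inductive
  definition iterates it transfinitely and supplies the induction behind the density
  arguments.\<close>

inductive_set dcl :: "'a dcpo \<Rightarrow> 'a set \<Rightarrow> 'a set" for P :: "'a dcpo" and Y :: "'a set" where
  base: "y \<in> Y \<Longrightarrow> y \<in> dcl P Y"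
| join: "directed P D \<Longrightarrow> (\<And>d. d \<in> D \<Longrightarrow> d \<in> dcl P Y) \<Longrightarrow> is_join P D x \<Longrightarrow> x \<in> dcl P Y"

lemma dclosed_dcl: "dclosed P (dcl P Y)"
  unfolding dclosed_def by (blast intro: dcl.join)

lemma dcl_subset_carr: "Y \<subseteq> carr P \<Longrightarrow> dcl P Y \<subseteq> carr P"
proof
  fix x assume "x \<in> dcl P Y" "Y \<subseteq> carr P"
  then show "x \<in> carr P" by (induction rule: dcl.induct) (auto dest: is_join_carr)
qed

lemma dcl_least: "Y \<subseteq> C \<Longrightarrow> dclosed P C \<Longrightarrow> dcl P Y \<subseteq> C"
proof
  fix x assume "x \<in> dcl P Y" "Y \<subseteq> C" "dclosed P C"
  then show "x \<in> C" by (induction rule: dcl.induct) (auto dest: dclosedD)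
qed

lemma dcl_nonempty: "x \<in> dcl P Y \<Longrightarrow> Y \<noteq> {}"
  by (induction rule: dcl.induct) (auto dest: directed_nonempty)

text \<open>This and the next two lemmas produce the closed sets fed to \<open>dcl_least\<close>: a
  property of one of these forms that holds on \<open>Y\<close> holds on
  \<open>dcl P Y\<close>.\<close>

lemma dclosed_preimage:
  assumes "continuous P Q f" "is_dcpo P" "dclosed Q C"
  shows "dclosed P {x \<in> carr P. f x \<in> C}"
  unfolding dclosed_def
proof (intro allI impI)
  fix D x assume D: "directed P D" "D \<subseteq> {x \<in> carr P. f x \<in> C}" "is_join P D x"
  have "f ` D \<subseteq> C" using D(2) by auto
  then have "f x \<in> C"
    using dclosedD[OF assms(3) continuous_directed[OF assms(1,2) D(1)]] continuous_join[OF assms(1) D(1,3)]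
    by simp
  then show "x \<in> {x \<in> carr P. f x \<in> C}" using is_join_carr[OF D(3)] by simp
qed

lemma dclosed_equalizer:
  assumes "is_dcpo Q" "continuous P Q f" "continuous P Q g"
  shows "dclosed P {x \<in> carr P. f x = g x}"
  unfolding dclosed_def
proof (intro allI impI)
  fix D x assume D: "directed P D" "D \<subseteq> {x \<in> carr P. f x = g x}" "is_join P D x"
  have "f ` D = g ` D" using D(2) by (intro image_cong) auto
  then have "f x = g x"
    using continuous_join[OF assms(2) D(1,3)] continuous_join[OF assms(3) D(1,3)] is_join_unique[OF assms(1)]
    by simp
  then show "x \<in> {x \<in> carr P. f x = g x}" using is_join_carr[OF D(3)] by simp
qed

lemma dclosed_le:
  assumes "is_dcpo P" "is_dcpo Q" "continuous P Q f" "continuous P Q g"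
  shows "dclosed P {x \<in> carr P. (f x, g x) \<in> leq Q}"
  unfolding dclosed_def
proof (intro allI impI)
  fix D x assume D: "directed P D" "D \<subseteq> {x \<in> carr P. (f x, g x) \<in> leq Q}" "is_join P D x"
  have "(f d, g x) \<in> leq Q" if "d \<in> D" for d
  proof -
    have "(f d, g d) \<in> leq Q" using that D(2) by auto
    moreover have "(g d, g x) \<in> leq Q"
      by (rule continuous_mono[OF assms(4,1) is_join_ub[OF D(3) that]])
    ultimately show ?thesis by (rule dcpo_trans[OF assms(2)])
  qed
  then have "(f x, g x) \<in> leq Q"
    using continuous_join[OF assms(3) D(1,3)] continuous_carr[OF assms(4) is_join_carr[OF D(3)]]
    using is_join_least[of Q "f ` D" "f x" "g x"] \<open>\<And>d. d \<in> D \<Longrightarrow> (f d, g x) \<in> leq Q\<close> by blast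
  then show "x \<in> {x \<in> carr P. (f x, g x) \<in> leq Q}" using is_join_carr[OF D(3)] by simp
qed

text \<open>A point of the closure of \<open>Y\<close> is determined by the traces on \<open>Y\<close> of the Scott-closed sets
  containing it.\<close>

lemma (in universe) small_dcl:
  assumes P: "is_dcpo P" and Y: "Y \<subseteq> carr P" "sml Y"
  shows "sml (dcl P Y)"
proof -
  \<comment> \<open>These are the Scott-closed sets: closed under directed joins and downward
    closed.\<close>
  define closed where "closed L \<longleftrightarrow> dclosed P L \<and> (\<forall>x y. (x, y) \<in> leq P \<longrightarrow> y \<in> L \<longrightarrow> x \<in> L)" for L
  define tr where "tr x = {L \<inter> Y | L. closed L \<and> x \<in> L}" for x
  have down_closed: "closed {z. (z, y) \<in> leq P}" for y
    unfolding closed_def dclosed_def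
  proof (intro conjI allI impI)
    fix D x assume "directed P D" "D \<subseteq> {z. (z, y) \<in> leq P}" "is_join P D x"
    moreover then obtain d where "d \<in> D" "(d, y) \<in> leq P" using directed_nonempty by blast
    ultimately show "x \<in> {z. (z, y) \<in> leq P}"
      using dcpo_leq_carr[OF P] is_join_least[of P D x y] by auto
  next
    fix x y' assume "(x, y') \<in> leq P" "y' \<in> {z. (z, y) \<in> leq P}"
    then show "x \<in> {z. (z, y) \<in> leq P}" using dcpo_trans[OF P, of x y' y] by simp
  qed
  have le: "(x, y) \<in> leq P" if xy: "x \<in> dcl P Y" "y \<in> dcl P Y" "tr x = tr y" for x y
  proof -
    have "y \<in> carr P" using xy dcl_subset_carr Y by blast
    then have "{z. (z, y) \<in> leq P} \<inter> Y \<in> tr y"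
      unfolding tr_def using down_closed dcpo_refl[OF P] by blast
    then have "\<exists>L. {z. (z, y) \<in> leq P} \<inter> Y = L \<inter> Y \<and> closed L \<and> x \<in> L"
      unfolding xy(3)[symmetric] by (simp add: tr_def)
    then obtain L where L: "closed L" "x \<in> L" "L \<inter> Y = {z. (z, y) \<in> leq P} \<inter> Y"
      by metis
    \<comment> \<open>To be applied to \<open>z = x\<close>. \<open>L\<close> contains the same
      generators as the down-set of \<open>y\<close>; being downward closed, it contains the members
      of a directed set whose join it contains, and the induction hypothesis puts these below
      \<open>y\<close>.\<close>
    have "z \<in> L \<longrightarrow> (z, y) \<in> leq P" if "z \<in> dcl P Y" for z
      using that
    proof (induction rule: dcl.induct)
      case (base z) then show ?case using L(3) by blast
    next
      case (join D z)
      show ?case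
      proof
        assume "z \<in> L"
        then have "d \<in> L" if "d \<in> D" for d
          using L(1) is_join_ub[OF join.hyps(3) that] unfolding closed_def by blast
        then show "(z, y) \<in> leq P" using join.IH by (intro is_join_least[OF join.hyps(3) \<open>y \<in> carr P\<close>]) blast
      qed
    qed
    then show ?thesis using xy L by blast
  qed
  have "inj_on tr (dcl P Y)"
    using le dcpo_antisym[OF P] by (intro inj_onI) metis
  \<comment> \<open>This bounds the closure by the double power set of \<open>Y\<close>.\<close>
  moreover have "tr ` dcl P Y \<subseteq> Pow (Pow Y)" unfolding tr_def by blast
  ultimately show ?thesis
    by (intro small_inj_on[of tr "dcl P Y"] small_subset[OF small_Pow[OF small_Pow[OF Y(2)]], of "tr ` dcl P Y"])
qed

section \<open>Products and function spaces\<close>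

definition prod_dcpo :: "'i set \<Rightarrow> ('i \<Rightarrow> 'a dcpo) \<Rightarrow> ('i \<Rightarrow> 'a) dcpo" where
  "prod_dcpo I B = (let X = \<Pi>\<^sub>E i\<in>I. carr (B i) in
     \<lparr>carr = X, leq = {(a, b) \<in> X \<times> X. \<forall>i\<in>I. (a i, b i) \<in> leq (B i)}\<rparr>)"

lemma carr_prod_dcpo [simp]: "carr (prod_dcpo I B) = (\<Pi>\<^sub>E i\<in>I. carr (B i))"
  by (simp add: prod_dcpo_def Let_def)

lemma leq_prod_dcpo:
  "(a, b) \<in> leq (prod_dcpo I B) \<longleftrightarrow> a \<in> (\<Pi>\<^sub>E i\<in>I. carr (B i)) \<and> b \<in> (\<Pi>\<^sub>E i\<in>I. carr (B i)) \<and>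
     (\<forall>i\<in>I. (a i, b i) \<in> leq (B i))"
  by (simp add: prod_dcpo_def Let_def)

lemma directed_prod_dcpo: "directed (prod_dcpo I B) D \<Longrightarrow> i \<in> I \<Longrightarrow> directed (B i) ((\<lambda>d. d i) ` D)"
  by (rule directed_image[of "prod_dcpo I B"]) (auto dest!: directed_carr simp: PiE_iff leq_prod_dcpo)

lemma is_join_prod_dcpoI:
  assumes "x \<in> (\<Pi>\<^sub>E i\<in>I. carr (B i))" "D \<subseteq> (\<Pi>\<^sub>E i\<in>I. carr (B i))"
    "\<And>i. i \<in> I \<Longrightarrow> is_join (B i) ((\<lambda>d. d i) ` D) (x i)"
  shows "is_join (prod_dcpo I B) D x"
proof (rule is_joinI)
  show "x \<in> carr (prod_dcpo I B)" using assms by simp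
  show "(d, x) \<in> leq (prod_dcpo I B)" if "d \<in> D" for d
    using that assms is_join_ub[OF assms(3)] by (auto simp: leq_prod_dcpo)
  show "(x, y) \<in> leq (prod_dcpo I B)"
    if "y \<in> carr (prod_dcpo I B)" "\<And>d. d \<in> D \<Longrightarrow> (d, y) \<in> leq (prod_dcpo I B)" for y
  proof -
    have "(x i, y i) \<in> leq (B i)" if "i \<in> I" for i
      by (rule is_join_least[OF assms(3)[OF that]])
        (use that \<open>y \<in> _\<close> \<open>\<And>d. d \<in> D \<Longrightarrow> (d, y) \<in> leq (prod_dcpo I B)\<close> in \<open>auto simp: leq_prod_dcpo\<close>)
    then show ?thesis using that assms(1) by (simp add: leq_prod_dcpo)
  qed
qed

lemma is_dcpo_prod_dcpo:
  assumes B: "\<And>i. i \<in> I \<Longrightarrow> is_dcpo (B i)"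
  shows "is_dcpo (prod_dcpo I B)"
proof (rule is_dcpoI)
  show "leq (prod_dcpo I B) \<subseteq> carr (prod_dcpo I B) \<times> carr (prod_dcpo I B)"
    by (auto simp: leq_prod_dcpo)
  show "(x, x) \<in> leq (prod_dcpo I B)" if "x \<in> carr (prod_dcpo I B)" for x
    using that dcpo_refl[OF B] by (auto simp: leq_prod_dcpo)
  show "(x, z) \<in> leq (prod_dcpo I B)" if "(x, y) \<in> leq (prod_dcpo I B)" "(y, z) \<in> leq (prod_dcpo I B)" for x y z
    using that dcpo_trans[OF B] unfolding leq_prod_dcpo by blast
  show "x = y" if "(x, y) \<in> leq (prod_dcpo I B)" "(y, x) \<in> leq (prod_dcpo I B)" for x y
  proof (rule PiE_ext)
    show "x \<in> (\<Pi>\<^sub>E i\<in>I. carr (B i))" "y \<in> (\<Pi>\<^sub>E i\<in>I. carr (B i))"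
      using that by (simp_all add: leq_prod_dcpo)
    show "x i = y i" if "i \<in> I" for i
      using that \<open>(x, y) \<in> _\<close> \<open>(y, x) \<in> _\<close> by (intro dcpo_antisym[OF B]) (auto simp: leq_prod_dcpo)
  qed
  fix D assume D: "directed (prod_dcpo I B) D"
  let ?x = "\<lambda>i\<in>I. join (B i) ((\<lambda>d. d i) ` D)"
  have j: "is_join (B i) ((\<lambda>d. d i) ` D) (?x i)" if "i \<in> I" for i
    using is_join_join[OF B directed_prod_dcpo[OF D]] that by simp
  have "?x \<in> (\<Pi>\<^sub>E i\<in>I. carr (B i))"
    using is_join_carr[OF j] by auto
  moreover have "D \<subseteq> (\<Pi>\<^sub>E i\<in>I. carr (B i))" using D by (simp add: directed_def)
  ultimately show "\<exists>x. is_join (prod_dcpo I B) D x" using j is_join_prod_dcpoI by blast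
qed

lemma is_join_prod_dcpo:
  assumes B: "\<And>i. i \<in> I \<Longrightarrow> is_dcpo (B i)" and D: "directed (prod_dcpo I B) D"
  shows "is_join (prod_dcpo I B) D x \<longleftrightarrow>
    x \<in> (\<Pi>\<^sub>E i\<in>I. carr (B i)) \<and> (\<forall>i\<in>I. is_join (B i) ((\<lambda>d. d i) ` D) (x i))" (is "?L \<longleftrightarrow> ?R")
proof
  have sub: "D \<subseteq> (\<Pi>\<^sub>E i\<in>I. carr (B i))" using D by (simp add: directed_def)
  show ?L if ?R using that is_join_prod_dcpoI sub by blast
  let ?y = "\<lambda>i\<in>I. join (B i) ((\<lambda>d. d i) ` D)"
  have j: "is_join (B i) ((\<lambda>d. d i) ` D) (?y i)" if "i \<in> I" for i
    using is_join_join[OF B directed_prod_dcpo[OF D]] that by simp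
  have y: "?y \<in> (\<Pi>\<^sub>E i\<in>I. carr (B i))"
    using is_join_carr[OF j] by auto
  have "is_join (prod_dcpo I B) D ?y" by (rule is_join_prod_dcpoI[OF y sub j])
  then have "x = ?y" if ?L
    using that by (intro is_join_unique[OF is_dcpo_prod_dcpo[OF B]])
  then show ?R if ?L
    using that j y by simp
qed

lemma continuous_proj: "(\<And>i. i \<in> I \<Longrightarrow> is_dcpo (B i)) \<Longrightarrow> i \<in> I \<Longrightarrow> continuous (prod_dcpo I B) (B i) (\<lambda>a. a i)"
  unfolding continuous_def by (auto simp: is_join_prod_dcpo)

lemma continuous_into_prod_dcpo:
  assumes "is_dcpo P" "\<And>i. i \<in> I \<Longrightarrow> is_dcpo (B i)"
    and f: "\<And>x. x \<in> carr P \<Longrightarrow> f x \<in> extensional I"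
    "\<And>i. i \<in> I \<Longrightarrow> continuous P (B i) (\<lambda>x. f x i)"
  shows "continuous P (prod_dcpo I B) f"
  unfolding continuous_def
proof (intro conjI allI impI)
  show *: "f \<in> carr P \<rightarrow> carr (prod_dcpo I B)"
    using f continuous_carr[OF f(2)] by (auto simp: PiE_def)
  fix D x assume D: "directed P D" "is_join P D x"
  show "is_join (prod_dcpo I B) (f ` D) (f x)"
  proof (rule is_join_prod_dcpoI)
    show "f x \<in> (\<Pi>\<^sub>E i\<in>I. carr (B i))" "f ` D \<subseteq> (\<Pi>\<^sub>E i\<in>I. carr (B i))"
      using * is_join_carr[OF D(2)] directed_carr[OF D(1)] by auto
    show "is_join (B i) ((\<lambda>d. d i) ` f ` D) (f x i)" if "i \<in> I" for i
      using continuous_join[OF f(2)[OF that] D] by (simp add: image_image)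
  qed
qed

text \<open>The same dcpo as \<open>hom_dcpo\<close>, but with two independent types, so that
  function spaces can be iterated as in \<open>cfun (cfun Y X) P\<close>. As a closed subset of a
  product it has pointwise joins.\<close>

definition cfun :: "'a dcpo \<Rightarrow> 'b dcpo \<Rightarrow> ('a \<Rightarrow> 'b) dcpo" where
  "cfun P Q = sub_dcpo (prod_dcpo (carr P) (\<lambda>_. Q)) {f \<in> carr P \<rightarrow>\<^sub>E carr Q. continuous P Q f}"

lemma carr_cfun: "carr (cfun P Q) = {f \<in> carr P \<rightarrow>\<^sub>E carr Q. continuous P Q f}"
  by (simp add: cfun_def)

lemma cfunD: "f \<in> carr (cfun P Q) \<Longrightarrow> continuous P Q f"
  and cfun_ext: "f \<in> carr (cfun P Q) \<Longrightarrow> f \<in> carr P \<rightarrow>\<^sub>E carr Q"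
  and cfun_carr: "f \<in> carr (cfun P Q) \<Longrightarrow> x \<in> carr P \<Longrightarrow> f x \<in> carr Q"
  by (auto simp: carr_cfun)

lemma cfun_eqI:
  "f \<in> carr (cfun P Q) \<Longrightarrow> g \<in> carr (cfun P R) \<Longrightarrow> (\<And>x. x \<in> carr P \<Longrightarrow> f x = g x) \<Longrightarrow> f = g"
  unfolding carr_cfun by (auto intro: PiE_ext)

lemma restrict_in_cfun: "continuous P Q f \<Longrightarrow> restrict f (carr P) \<in> carr (cfun P Q)"
  by (auto simp: carr_cfun dest: continuous_carr intro: continuous_cong)

lemma leq_cfun:
  "(f, g) \<in> leq (cfun P Q) \<longleftrightarrow> f \<in> carr (cfun P Q) \<and> g \<in> carr (cfun P Q) \<and> (\<forall>x\<in>carr P. (f x, g x) \<in> leq Q)"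
  by (auto simp: cfun_def leq_prod_dcpo)

lemma Hom_DCPO: "Hom DCPO P Q = carr (cfun P Q)"
  by (simp add: DCPO_def carr_cfun)

lemma hom_dcpo_eq: "hom_dcpo P Q = cfun P Q"
proof -
  have "leq (hom_dcpo P Q) = leq (cfun P Q)"
    by (auto simp: hom_dcpo_def leq_cfun Hom_DCPO)
  moreover have "carr (hom_dcpo P Q) = carr (cfun P Q)"
    by (simp add: hom_dcpo_def Hom_DCPO)
  ultimately show ?thesis by simp
qed

text \<open>The join over the directed set \<open>D\<close> of maps and the join over the directed
  set \<open>E\<close> of arguments commute, because both iterated joins have the same upper
  bounds.\<close>

lemma dclosed_cfun:
  assumes "is_dcpo Q"
  shows "dclosed (prod_dcpo (carr P) (\<lambda>_. Q)) (carr (cfun P Q))"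
  unfolding dclosed_def
proof (intro allI impI)
  fix D f
  assume D: "directed (prod_dcpo (carr P) (\<lambda>_. Q)) D" "D \<subseteq> carr (cfun P Q)"
    "is_join (prod_dcpo (carr P) (\<lambda>_. Q)) D f"
  have f: "f \<in> carr P \<rightarrow>\<^sub>E carr Q" using is_join_carr[OF D(3)] by simp
  have j: "is_join Q ((\<lambda>d. d x) ` D) (f x)" if "x \<in> carr P" for x
    using D(3) that is_join_prod_dcpo[OF _ D(1)] assms by auto
  have "is_join Q (f ` E) (f x)" if E: "directed P E" "is_join P E x" for E x
  proof (rule is_joinI)
    have x: "x \<in> carr P" using is_join_carr[OF E(2)] .
    show "f x \<in> carr Q" using f x by auto
    have dj: "is_join Q (d ` E) (d x)" if "d \<in> D" for d
      using D(2) that by (intro continuous_join[OF cfunD E]) auto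
    show "(q, f x) \<in> leq Q" if q: "q \<in> f ` E" for q
    proof -
      obtain e where e: "e \<in> E" "q = f e" using q by blast
      have "(d e, f x) \<in> leq Q" if "d \<in> D" for d
        using is_join_ub[OF dj[OF that], of "d e"] is_join_ub[OF j[OF x], of "d x"] that e
          dcpo_trans[OF assms] by blast
      then show ?thesis
        using is_join_least[OF j[OF directed_carr[OF E(1) e(1)]] \<open>f x \<in> carr Q\<close>] e(2) by blast
    qed
    fix q assume q: "q \<in> carr Q" "\<And>p. p \<in> f ` E \<Longrightarrow> (p, q) \<in> leq Q"
    have "(d e, q) \<in> leq Q" if "d \<in> D" "e \<in> E" for d e
      using is_join_ub[OF j[OF directed_carr[OF E(1) that(2)]], of "d e"] q(2)[of "f e"] that
        dcpo_trans[OF assms] by blast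
    then have "(d x, q) \<in> leq Q" if "d \<in> D" for d
      using is_join_least[OF dj[OF that] q(1)] that by blast
    then show "(f x, q) \<in> leq Q"
      using is_join_least[OF j[OF x] q(1)] by blast
  qed
  then have "continuous P Q f" using f by (auto simp: continuous_def)
  then show "f \<in> carr (cfun P Q)" using f by (simp add: carr_cfun)
qed

lemma is_dcpo_cfun: "is_dcpo Q \<Longrightarrow> is_dcpo (cfun P Q)"
  unfolding cfun_def using dclosed_cfun[of Q P]
  by (intro is_dcpo_sub_dcpo is_dcpo_prod_dcpo) (auto simp: carr_cfun)

lemma directed_cfun_prod: "directed (cfun P Q) D \<longleftrightarrow> directed (prod_dcpo (carr P) (\<lambda>_. Q)) D \<and> D \<subseteq> carr (cfun P Q)"
  unfolding cfun_def by (subst directed_sub_dcpo) auto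

lemma is_join_cfun:
  assumes "is_dcpo Q" "directed (cfun P Q) D"
  shows "is_join (cfun P Q) D f \<longleftrightarrow> f \<in> carr (cfun P Q) \<and> (\<forall>x\<in>carr P. is_join Q ((\<lambda>d. d x) ` D) (f x))"
proof -
  have D: "directed (prod_dcpo (carr P) (\<lambda>_. Q)) D" "D \<subseteq> carr (cfun P Q)"
    using assms(2) by (simp_all add: directed_cfun_prod)
  have "is_join (cfun P Q) D f \<longleftrightarrow> is_join (prod_dcpo (carr P) (\<lambda>_. Q)) D f"
    using assms(1) D dclosed_cfun[of Q P] unfolding cfun_def
    by (intro is_join_sub_dcpo is_dcpo_prod_dcpo) (auto simp: carr_cfun)
  moreover have "f \<in> carr (cfun P Q)" if "is_join (cfun P Q) D f" using that is_join_carr by metis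
  moreover have "is_join (prod_dcpo (carr P) (\<lambda>_. Q)) D f \<longleftrightarrow>
    f \<in> carr P \<rightarrow>\<^sub>E carr Q \<and> (\<forall>x\<in>carr P. is_join Q ((\<lambda>d. d x) ` D) (f x))"
    by (rule is_join_prod_dcpo[OF assms(1) D(1)])
  ultimately show ?thesis
    using cfun_ext[of f P Q] by metis
qed

lemma continuous_eval: "is_dcpo Q \<Longrightarrow> x \<in> carr P \<Longrightarrow> continuous (cfun P Q) Q (\<lambda>f. f x)"
  unfolding continuous_def by (auto simp: is_join_cfun cfun_carr)

lemma continuous_into_cfun:
  assumes "is_dcpo R" "is_dcpo Q"
    and f: "\<And>r. r \<in> carr R \<Longrightarrow> f r \<in> carr (cfun P Q)"
    "\<And>x. x \<in> carr P \<Longrightarrow> continuous R Q (\<lambda>r. f r x)"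
  shows "continuous R (cfun P Q) f"
  unfolding cfun_def
proof (rule continuous_into_sub_dcpo[OF assms(1)])
  have sub: "{f \<in> carr P \<rightarrow>\<^sub>E carr Q. continuous P Q f} = carr (cfun P Q)" by (simp add: carr_cfun)
  show "is_dcpo (prod_dcpo (carr P) (\<lambda>_. Q))" using assms by (intro is_dcpo_prod_dcpo)
  show "dclosed (prod_dcpo (carr P) (\<lambda>_. Q)) {f \<in> carr P \<rightarrow>\<^sub>E carr Q. continuous P Q f}"
    unfolding sub using assms by (intro dclosed_cfun)
  show "{f \<in> carr P \<rightarrow>\<^sub>E carr Q. continuous P Q f} \<subseteq> carr (prod_dcpo (carr P) (\<lambda>_. Q))" by auto
  show "continuous R (prod_dcpo (carr P) (\<lambda>_. Q)) f"
    using assms by (intro continuous_into_prod_dcpo) (auto simp: carr_cfun PiE_def)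
  show "f x \<in> {f \<in> carr P \<rightarrow>\<^sub>E carr Q. continuous P Q f}" if "x \<in> carr R" for x
    unfolding sub using f(1) that .
qed

lemma (in universe) small_cfun: "sml (carr P) \<Longrightarrow> sml (carr Q) \<Longrightarrow> sml (carr (cfun P Q))"
  by (rule small_subset[OF small_PiE[of "carr P" "\<lambda>_. carr Q"]]) (auto simp: carr_cfun)

section \<open>Finite powers and separate continuity\<close>

lemma carr_power_dcpo: "carr (power_dcpo P n) = {xs. length xs = n \<and> set xs \<subseteq> carr P}"
  by (simp add: power_dcpo_def Let_def)

lemma leq_power_dcpo:
  "(xs, ys) \<in> leq (power_dcpo P n) \<longleftrightarrow> xs \<in> carr (power_dcpo P n) \<and> ys \<in> carr (power_dcpo P n) \<and>
     (\<forall>i<n. (xs ! i, ys ! i) \<in> leq P)"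
  by (auto simp: power_dcpo_def Let_def list_all2_conv_all_nth)

lemma power_dcpo_nth: "xs \<in> carr (power_dcpo P n) \<Longrightarrow> i < n \<Longrightarrow> xs ! i \<in> carr P"
  by (auto simp: carr_power_dcpo)

lemma directed_power_dcpo: "directed (power_dcpo P n) D \<Longrightarrow> i < n \<Longrightarrow> directed P ((\<lambda>d. d ! i) ` D)"
  by (rule directed_image[of "power_dcpo P n"]) (auto dest: directed_carr simp: leq_power_dcpo power_dcpo_nth)

lemma is_join_power_dcpoI:
  assumes "x \<in> carr (power_dcpo P n)" "D \<subseteq> carr (power_dcpo P n)"
    "\<And>i. i < n \<Longrightarrow> is_join P ((\<lambda>d. d ! i) ` D) (x ! i)"
  shows "is_join (power_dcpo P n) D x"
proof (rule is_joinI)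
  show "(d, x) \<in> leq (power_dcpo P n)" if "d \<in> D" for d
    using that assms is_join_ub[OF assms(3)] by (auto simp: leq_power_dcpo)
  show "(x, y) \<in> leq (power_dcpo P n)"
    if "y \<in> carr (power_dcpo P n)" "\<And>d. d \<in> D \<Longrightarrow> (d, y) \<in> leq (power_dcpo P n)" for y
  proof -
    have "(x ! i, y ! i) \<in> leq P" if "i < n" for i
      by (rule is_join_least[OF assms(3)[OF that]])
        (use that \<open>y \<in> _\<close> \<open>\<And>d. d \<in> D \<Longrightarrow> (d, y) \<in> leq (power_dcpo P n)\<close> in
          \<open>auto simp: leq_power_dcpo power_dcpo_nth\<close>)
    then show ?thesis using that assms(1) by (simp add: leq_power_dcpo)
  qed
qed fact

lemma ex_join_power_dcpo:
  assumes P: "is_dcpo P" and D: "directed (power_dcpo P n) D"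
  obtains x where "is_join (power_dcpo P n) D x" "x \<in> carr (power_dcpo P n)"
    "\<And>i. i < n \<Longrightarrow> is_join P ((\<lambda>d. d ! i) ` D) (x ! i)"
proof -
  let ?x = "map (\<lambda>i. join P ((\<lambda>d. d ! i) ` D)) [0..<n]"
  have j: "is_join P ((\<lambda>d. d ! i) ` D) (?x ! i)" if "i < n" for i
    using is_join_join[OF P directed_power_dcpo[OF D]] that by simp
  have x: "?x \<in> carr (power_dcpo P n)"
    using is_join_carr[OF j] by (auto simp: carr_power_dcpo)
  have "D \<subseteq> carr (power_dcpo P n)" using D by (simp add: directed_def)
  then have "is_join (power_dcpo P n) D ?x" using j x is_join_power_dcpoI by blast
  then show thesis using that j x by blast
qed

lemma is_dcpo_power_dcpo:
  assumes P: "is_dcpo P"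
  shows "is_dcpo (power_dcpo P n)"
proof (rule is_dcpoI)
  show "leq (power_dcpo P n) \<subseteq> carr (power_dcpo P n) \<times> carr (power_dcpo P n)"
    by (auto simp: leq_power_dcpo)
  show "(x, x) \<in> leq (power_dcpo P n)" if "x \<in> carr (power_dcpo P n)" for x
    using that dcpo_refl[OF P] by (auto simp: leq_power_dcpo power_dcpo_nth)
  show "(x, z) \<in> leq (power_dcpo P n)" if "(x, y) \<in> leq (power_dcpo P n)" "(y, z) \<in> leq (power_dcpo P n)" for x y z
    using that dcpo_trans[OF P] unfolding leq_power_dcpo by blast
  show "x = y" if "(x, y) \<in> leq (power_dcpo P n)" "(y, x) \<in> leq (power_dcpo P n)" for x y
    by (rule nth_equalityI) (use that dcpo_antisym[OF P] in \<open>auto simp: leq_power_dcpo carr_power_dcpo\<close>)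
  show "\<exists>x. is_join (power_dcpo P n) D x" if "directed (power_dcpo P n) D" for D
    using ex_join_power_dcpo[OF P that] by blast
qed

lemma is_join_power_dcpo_nth:
  assumes P: "is_dcpo P" and D: "directed (power_dcpo P n) D" and x: "is_join (power_dcpo P n) D x"
    and i: "i < n"
  shows "is_join P ((\<lambda>d. d ! i) ` D) (x ! i)"
proof -
  obtain y where y: "is_join (power_dcpo P n) D y" "\<And>i. i < n \<Longrightarrow> is_join P ((\<lambda>d. d ! i) ` D) (y ! i)"
    using ex_join_power_dcpo[OF P D] by blast
  then have "y = x" using is_join_unique[OF is_dcpo_power_dcpo[OF P]] x by blast
  then show ?thesis using y(2) i by blast
qed

lemma continuous_into_power_dcpo:
  assumes "is_dcpo P" "is_dcpo Q" "\<And>g. g \<in> set gs \<Longrightarrow> continuous P Q g" "length gs = n"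
  shows "continuous P (power_dcpo Q n) (\<lambda>x. map (\<lambda>g. g x) gs)"
  unfolding continuous_def
proof (intro conjI allI impI)
  show *: "(\<lambda>x. map (\<lambda>g. g x) gs) \<in> carr P \<rightarrow> carr (power_dcpo Q n)"
    using assms(3,4) continuous_carr by (fastforce simp: carr_power_dcpo)
  fix D x assume D: "directed P D" "is_join P D x"
  show "is_join (power_dcpo Q n) ((\<lambda>x. map (\<lambda>g. g x) gs) ` D) (map (\<lambda>g. g x) gs)"
  proof (rule is_join_power_dcpoI)
    show "map (\<lambda>g. g x) gs \<in> carr (power_dcpo Q n)"
      "(\<lambda>x. map (\<lambda>g. g x) gs) ` D \<subseteq> carr (power_dcpo Q n)"
      using * is_join_carr[OF D(2)] directed_carr[OF D(1)] by auto
    show "is_join Q ((\<lambda>d. d ! i) ` (\<lambda>x. map (\<lambda>g. g x) gs) ` D) (map (\<lambda>g. g x) gs ! i)" if "i < n" for i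
    proof -
      have "is_join Q (gs ! i ` D) ((gs ! i) x)"
        using assms(3,4) that by (intro continuous_join[OF _ D]) auto
      moreover have "(\<lambda>d. d ! i) ` (\<lambda>x. map (\<lambda>g. g x) gs) ` D = gs ! i ` D"
        using that assms(4) by (auto simp: image_image)
      ultimately show ?thesis using that assms(4) by simp
    qed
  qed
qed

text \<open>The argument list is split as \<open>xs @ x # ys\<close> around the varying entry. For
  \<open>n = 0\<close> the second clause is void and the first one carries the whole
  content.\<close>

definition sepcont :: "'a dcpo \<Rightarrow> 'b dcpo \<Rightarrow> nat \<Rightarrow> ('a list \<Rightarrow> 'b) \<Rightarrow> bool" where
  "sepcont P Q n g \<longleftrightarrow> (\<forall>xs. length xs = n \<longrightarrow> set xs \<subseteq> carr P \<longrightarrow> g xs \<in> carr Q) \<and>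
     (\<forall>xs ys. Suc (length xs + length ys) = n \<longrightarrow> set xs \<subseteq> carr P \<longrightarrow> set ys \<subseteq> carr P \<longrightarrow>
        continuous P Q (\<lambda>x. g (xs @ x # ys)))"

lemma sepcontI:
  "(\<And>xs. length xs = n \<Longrightarrow> set xs \<subseteq> carr P \<Longrightarrow> g xs \<in> carr Q) \<Longrightarrow>
   (\<And>xs ys. Suc (length xs + length ys) = n \<Longrightarrow> set xs \<subseteq> carr P \<Longrightarrow> set ys \<subseteq> carr P \<Longrightarrow>
        continuous P Q (\<lambda>x. g (xs @ x # ys))) \<Longrightarrow> sepcont P Q n g"
  unfolding sepcont_def by blast

lemma sepcontD:
  assumes "sepcont P Q n g"
  shows sepcont_carr: "length xs = n \<Longrightarrow> set xs \<subseteq> carr P \<Longrightarrow> g xs \<in> carr Q"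
    and sepcont_continuous: "Suc (length xs + length ys) = n \<Longrightarrow> set xs \<subseteq> carr P \<Longrightarrow> set ys \<subseteq> carr P \<Longrightarrow>
        continuous P Q (\<lambda>x. g (xs @ x # ys))"
  using assms unfolding sepcont_def by blast+

lemma sepcont_mono_step:
  assumes g: "sepcont P Q n g" and P: "is_dcpo P" and Q: "is_dcpo Q"
    and de: "length d = n" "length e = n" "\<And>i. i < n \<Longrightarrow> (d ! i, e ! i) \<in> leq P"
  shows "(g d, g e) \<in> leq Q"
proof -
  have carrs: "set d \<subseteq> carr P" "set e \<subseteq> carr P"
    using de dcpo_leq_carr[OF P] by (metis in_set_conv_nth subsetI)+
  \<comment> \<open>Hybrid lists: the entries of \<open>d\<close> are replaced by those of
    \<open>e\<close> from the left, one at a time.\<close>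
  have "(g d, g (take j e @ drop j d)) \<in> leq Q" if "j \<le> n" for j
    using that
  proof (induction j)
    case 0
    have "g d \<in> carr Q" using sepcont_carr[OF g de(1) carrs(1)] .
    then show ?case using dcpo_refl[OF Q] by simp
  next
    case (Suc j)
    have eq: "take j e @ drop j d = take j e @ d ! j # drop (Suc j) d"
      "take (Suc j) e @ drop (Suc j) d = take j e @ e ! j # drop (Suc j) d"
      using Suc.prems de by (simp_all add: Cons_nth_drop_Suc take_Suc_conv_app_nth)
    have "set (take j e) \<subseteq> carr P" "set (drop (Suc j) d) \<subseteq> carr P"
      using carrs by (auto dest: in_set_takeD in_set_dropD)
    then have "continuous P Q (\<lambda>x. g (take j e @ x # drop (Suc j) d))"
      using Suc.prems de by (intro sepcont_continuous[OF g]) auto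
    then have "(g (take j e @ drop j d), g (take (Suc j) e @ drop (Suc j) d)) \<in> leq Q"
      unfolding eq using de(3)[of j] Suc.prems P by (intro continuous_mono[where f = "\<lambda>x. g (take j e @ x # drop (Suc j) d)"]) auto
    then show ?case using Suc dcpo_trans[OF Q] by (meson Suc_leD)
  qed
  from this[of n] show ?thesis using de by simp
qed

text \<open>Joint continuity follows by passing to the join in one coordinate after another;
  directedness synchronises the coordinates that have not been treated yet.\<close>

lemma continuous_power_iff:
  assumes P: "is_dcpo P" and Q: "is_dcpo Q"
  shows "continuous (power_dcpo P n) Q g \<longleftrightarrow> sepcont P Q n g"
proof
  assume g: "continuous (power_dcpo P n) Q g"
  show "sepcont P Q n g"
  proof (rule sepcontI)
    show "g xs \<in> carr Q" if "length xs = n" "set xs \<subseteq> carr P" for xs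
      using that continuous_carr[OF g, of xs] by (simp add: carr_power_dcpo)
    fix xs ys assume xy: "Suc (length xs + length ys) = n" "set xs \<subseteq> carr P" "set ys \<subseteq> carr P"
    have "continuous P (power_dcpo P n)
      (\<lambda>x. map (\<lambda>h. h x) (map (\<lambda>a _. a) xs @ (\<lambda>x. x) # map (\<lambda>a _. a) ys))"
      using xy P by (intro continuous_into_power_dcpo) (auto intro: continuous_const continuous_ident)
    then have "continuous P (power_dcpo P n) (\<lambda>x. xs @ x # ys)" by (simp add: comp_def)
    then show "continuous P Q (\<lambda>x. g (xs @ x # ys))" using continuous_comp g P by blast
  qed
next
  assume g: "sepcont P Q n g"
  show "continuous (power_dcpo P n) Q g"
  proof (rule continuousI)
    show "g x \<in> carr Q" if "x \<in> carr (power_dcpo P n)" for x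
      using that sepcont_carr[OF g] by (simp add: carr_power_dcpo)
    show "(g x, g y) \<in> leq Q" if "(x, y) \<in> leq (power_dcpo P n)" for x y
      using that sepcont_mono_step[OF g P Q] by (simp add: leq_power_dcpo carr_power_dcpo)
    fix D x q
    assume D: "directed (power_dcpo P n) D" "is_join (power_dcpo P n) D x"
      and q: "q \<in> carr Q" "\<And>d. d \<in> D \<Longrightarrow> (g d, q) \<in> leq Q"
    have x: "length x = n" "set x \<subseteq> carr P"
      using is_join_carr[OF D(2)] by (simp_all add: carr_power_dcpo)
    have D': "length d = n" "set d \<subseteq> carr P" if "d \<in> D" for d
      using directed_carr[OF D(1) that] by (simp_all add: carr_power_dcpo)
    \<comment> \<open>The first \<open>j\<close> coordinates have been moved to the join
      \<open>x\<close>; the others still come from one member \<open>d\<close>.\<close>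
    have "\<forall>d\<in>D. (g (take j x @ drop j d), q) \<in> leq Q" if "j \<le> n" for j
      using that
    proof (induction j)
      case 0
      then show ?case using q(2) by simp
    next
      case (Suc j)
      show ?case
      proof
        fix d assume d: "d \<in> D"
        have sub: "set (take j x) \<subseteq> carr P" "set (drop (Suc j) d) \<subseteq> carr P"
          using x(2) D'(2)[OF d] by (auto dest: in_set_takeD in_set_dropD)
        then have c: "continuous P Q (\<lambda>z. g (take j x @ z # drop (Suc j) d))"
          using Suc.prems x D'[OF d] by (intro sepcont_continuous[OF g]) auto
        have j: "is_join P ((\<lambda>d. d ! j) ` D) (x ! j)"
          using is_join_power_dcpo_nth[OF P D] Suc.prems by simp
        have dir: "directed P ((\<lambda>d. d ! j) ` D)"
          using directed_power_dcpo[OF D(1)] Suc.prems by simp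
        have "(g (take j x @ e ! j # drop (Suc j) d), q) \<in> leq Q" if e: "e \<in> D" for e
        proof -
          \<comment> \<open>The varying coordinate comes from \<open>e\<close> and the later ones
            from \<open>d\<close>. A common upper bound dominates the mixed list by one whose
            untreated coordinates come from a single member of \<open>D\<close>.\<close>
          obtain e' where e': "e' \<in> D" "(d, e') \<in> leq (power_dcpo P n)" "(e, e') \<in> leq (power_dcpo P n)"
            using directed_ub[OF D(1) d e] by blast
          have le: "(d ! i, e' ! i) \<in> leq P" "(e ! i, e' ! i) \<in> leq P" if "i < n" for i
            using e' that by (simp_all add: leq_power_dcpo)
          have xc: "x ! i \<in> carr P" if "i < n" for i
            using x that by (metis nth_mem subsetD)
          have "((take j x @ e ! j # drop (Suc j) d) ! i, (take j x @ drop j e') ! i) \<in> leq P" if "i < n" for i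
            using that Suc.prems x D'[OF d] D'[OF e] D'[OF e'(1)] le[OF that]
              dcpo_refl[OF P xc[OF that]]
            by (auto simp: nth_append nth_Cons' Suc_diff_Suc)
          then have "(g (take j x @ e ! j # drop (Suc j) d), g (take j x @ drop j e')) \<in> leq Q"
            using Suc.prems x D'[OF d] D'[OF e'(1)] by (intro sepcont_mono_step[OF g P Q]) auto
          moreover have "(g (take j x @ drop j e'), q) \<in> leq Q"
            using Suc e'(1) by simp
          ultimately show ?thesis using dcpo_trans[OF Q] by blast
        qed
        then have "(g (take j x @ x ! j # drop (Suc j) d), q) \<in> leq Q"
          using is_join_least[OF continuous_join[OF c dir j] q(1)] by blast
        then show "(g (take (Suc j) x @ drop (Suc j) d), q) \<in> leq Q"
          using Suc.prems x by (simp add: take_Suc_conv_app_nth)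
      qed
    qed
    from this[of n] show "(g x, q) \<in> leq Q"
      using directed_nonempty[OF D(1)] x D' by fastforce
  qed
qed

text \<open>Closure induction in several arguments: entries are released from \<open>Y\<close> to
  \<open>dcl P Y\<close> one by one, each by \<open>dcl_least\<close> with the other entries
  fixed.\<close>

lemma dcl_lists_induct:
  assumes Y: "Y \<subseteq> carr P"
    and base: "\<And>ys. set ys \<subseteq> Y \<Longrightarrow> length ys = n \<Longrightarrow> R ys"
    and step: "\<And>xs ys. set xs \<subseteq> dcl P Y \<Longrightarrow> set ys \<subseteq> dcl P Y \<Longrightarrow> Suc (length xs + length ys) = n \<Longrightarrow>
      dclosed P {z \<in> carr P. R (xs @ z # ys)}"
    and zs: "set zs \<subseteq> dcl P Y" "length zs = n"
  shows "R zs"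
proof -
  \<comment> \<open>At most the first \<open>j\<close> entries lie outside \<open>Y\<close>.\<close>
  have "\<forall>zs. set zs \<subseteq> dcl P Y \<longrightarrow> length zs = n \<longrightarrow> set (drop j zs) \<subseteq> Y \<longrightarrow> R zs" if "j \<le> n" for j
    using that
  proof (induction j)
    case 0
    then show ?case using base by simp
  next
    case (Suc j)
    show ?case
    proof (intro allI impI)
      fix zs assume zs: "set zs \<subseteq> dcl P Y" "length zs = n" "set (drop (Suc j) zs) \<subseteq> Y"
      have sub: "set (take j zs) \<subseteq> dcl P Y" "set (drop (Suc j) zs) \<subseteq> dcl P Y"
        using zs(1) by (auto dest: in_set_takeD in_set_dropD)
      have "dcl P Y \<subseteq> {z \<in> carr P. R (take j zs @ z # drop (Suc j) zs)}"
      proof (rule dcl_least)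
        show "dclosed P {z \<in> carr P. R (take j zs @ z # drop (Suc j) zs)}"
          using step[OF sub] Suc.prems zs by simp
        have "R (take j zs @ y # drop (Suc j) zs)" if "y \<in> Y" for y
          using Suc.IH[THEN spec, of "take j zs @ y # drop (Suc j) zs"] Suc.prems zs sub that dcl.base[OF that, of P]
          by simp
        then show "Y \<subseteq> {z \<in> carr P. R (take j zs @ z # drop (Suc j) zs)}" using Y by auto
      qed
      moreover have "zs ! j \<in> dcl P Y" using zs Suc.prems by auto
      ultimately have "R (take j zs @ zs ! j # drop (Suc j) zs)" by blast
      then show "R zs" using zs Suc.prems by (simp add: id_take_nth_drop[symmetric])
    qed
  qed
  from this[of n] show ?thesis using zs by simp
qed

lemma eq_on_dcl:
  assumes "is_dcpo Q" "continuous P Q f" "continuous P Q g" "Y \<subseteq> carr P"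
    "\<And>y. y \<in> Y \<Longrightarrow> f y = g y" "z \<in> dcl P Y"
  shows "f z = g z"
  using dcl_least[OF _ dclosed_equalizer[OF assms(1-3)], of Y] assms(4-6) by blast

lemma le_on_dcl:
  assumes "is_dcpo P" "is_dcpo Q" "continuous P Q f" "continuous P Q g" "Y \<subseteq> carr P"
    "\<And>y. y \<in> Y \<Longrightarrow> (f y, g y) \<in> leq Q" "z \<in> dcl P Y"
  shows "(f z, g z) \<in> leq Q"
  using dcl_least[OF _ dclosed_le[OF assms(1-4)], of Y] assms(5-7) by blast

lemma sepcont_eq_on_dcl:
  assumes "is_dcpo Q" "sepcont P Q n f" "sepcont P Q n g" "Y \<subseteq> carr P"
    "\<And>ys. set ys \<subseteq> Y \<Longrightarrow> length ys = n \<Longrightarrow> f ys = g ys" "set zs \<subseteq> dcl P Y" "length zs = n"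
  shows "f zs = g zs"
proof (rule dcl_lists_induct[OF assms(4)])
  note dcl = dcl_subset_carr[OF assms(4)]
  show "dclosed P {z \<in> carr P. f (xs @ z # ys) = g (xs @ z # ys)}"
    if "set xs \<subseteq> dcl P Y" "set ys \<subseteq> dcl P Y" "Suc (length xs + length ys) = n" for xs ys
    using that dcl by (intro dclosed_equalizer[OF assms(1)] sepcont_continuous[OF assms(2)] sepcont_continuous[OF assms(3)]) auto
qed (use assms in auto)

text \<open>Inequalities between continuous maps extend from the generators to their closure, so the
  family is directed in \<open>cfun P Q\<close>, where joins are pointwise. In use, the index
  \<open>d\<close> is the value of one argument of an operation.\<close>

lemma pointwise_limit:
  assumes P: "is_dcpo P" and Q: "is_dcpo Q" and D: "directed R D"
    and F: "\<And>d. d \<in> D \<Longrightarrow> continuous P Q (F d)" and Y: "Y \<subseteq> carr P" "carr P = dcl P Y"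
    and mono: "\<And>d d' y. d \<in> D \<Longrightarrow> d' \<in> D \<Longrightarrow> (d, d') \<in> leq R \<Longrightarrow> y \<in> Y \<Longrightarrow> (F d y, F d' y) \<in> leq Q"
  obtains E where "continuous P Q E" "\<And>z. z \<in> carr P \<Longrightarrow> is_join Q ((\<lambda>d. F d z) ` D) (E z)"
proof -
  let ?G = "\<lambda>d. restrict (F d) (carr P)"
  have "directed (cfun P Q) (?G ` D)"
  proof (rule directed_image[OF D])
    show G: "?G d \<in> carr (cfun P Q)" if "d \<in> D" for d
      using restrict_in_cfun[OF F[OF that]] .
    show "(?G d, ?G d') \<in> leq (cfun P Q)" if "d \<in> D" "d' \<in> D" "(d, d') \<in> leq R" for d d'
      using G that le_on_dcl[OF P Q F F Y(1) mono] Y(2) by (auto simp: leq_cfun)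
  qed
  then obtain E where "E \<in> carr (cfun P Q)" "\<forall>x\<in>carr P. is_join Q ((\<lambda>g. g x) ` ?G ` D) (E x)"
    using dcpo_ex_join[OF is_dcpo_cfun[OF Q]] is_join_cfun[OF Q] by metis
  then show thesis using that[of E] cfunD by (auto simp: image_image cong: image_cong)
qed

text \<open>An operation that is defined on a dense subset and extends continuously in each argument
  separately, the others being dense elements, extends to all arguments simultaneously.\<close>

lemma extend_operation:
  assumes P: "is_dcpo P" and Q: "is_dcpo Q" and b: "b ` I \<subseteq> carr P" "carr P = dcl P (b ` I)"
    and const: "n = 0 \<Longrightarrow> g [] \<in> carr Q"
    and ext: "\<And>ps qs. set ps \<subseteq> I \<Longrightarrow> set qs \<subseteq> I \<Longrightarrow> Suc (length ps + length qs) = n \<Longrightarrow>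
      \<exists>E. continuous P Q E \<and> (\<forall>i\<in>I. E (b i) = g (ps @ i # qs))"
  shows "\<exists>h. sepcont P Q n h \<and> (\<forall>is. set is \<subseteq> I \<longrightarrow> length is = n \<longrightarrow> h (map b is) = g is)"
  using const ext
proof (induction n arbitrary: g)
  case 0
  then show ?case by (intro exI[of _ "\<lambda>_. g []"]) (auto intro: sepcontI)
next
  case (Suc n)
  \<comment> \<open>With a generator \<open>i\<close> as first argument, the induction hypothesis
    extends the operation to the other \<open>n\<close> arguments.\<close>
  have "\<exists>h. sepcont P Q n h \<and> (\<forall>is. set is \<subseteq> I \<longrightarrow> length is = n \<longrightarrow> h (map b is) = g (i # is))" if i: "i \<in> I" for i
  proof (rule Suc.IH[of "\<lambda>is. g (i # is)"])
    show "\<exists>E. continuous P Q E \<and> (\<forall>j\<in>I. E (b j) = g (i # ps @ j # qs))"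
      if "set ps \<subseteq> I" "set qs \<subseteq> I" "Suc (length ps + length qs) = n" for ps qs
      using Suc.prems(2)[of "i # ps" qs] that i by simp
    show "g [i] \<in> carr Q" if n: "n = 0"
    proof -
      obtain E where "continuous P Q E" "\<forall>j\<in>I. E (b j) = g [j]"
        using Suc.prems(2)[of "[]" "[]"] n by auto
      then show ?thesis using continuous_carr b(1) i by (metis image_subset_iff)
    qed
  qed
  then obtain h where h: "\<And>i. i \<in> I \<Longrightarrow> sepcont P Q n (h i)"
    "\<And>i is. i \<in> I \<Longrightarrow> set is \<subseteq> I \<Longrightarrow> length is = n \<Longrightarrow> h i (map b is) = g (i # is)"
    by metis
  have hmono: "(h i (xs @ d # ys), h i (xs @ d' # ys)) \<in> leq Q"
    if "i \<in> I" "(d, d') \<in> leq P" "set xs \<subseteq> carr P" "set ys \<subseteq> carr P" "Suc (length xs + length ys) = n" for i d d' xs ys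
    using continuous_mono[OF sepcont_continuous[OF h(1)] P] that by blast
  have hjoin: "is_join Q ((\<lambda>d. h i (xs @ d # ys)) ` D) (h i (xs @ x # ys))"
    if "i \<in> I" "directed P D" "is_join P D x" "set xs \<subseteq> carr P" "set ys \<subseteq> carr P" "Suc (length xs + length ys) = n" for i D x xs ys
    using continuous_join[OF sepcont_continuous[OF h(1)], of i xs ys D x] that by blast
  \<comment> \<open>Now the first argument is released, for each fixed list \<open>zs\<close> of the
    others. For generators the extension is the assumption; at a directed join in an entry of
    \<open>zs\<close> it is the pointwise limit of the extensions already found.\<close>
  have "\<exists>E. continuous P Q E \<and> (\<forall>i\<in>I. E (b i) = h i zs)" if zs: "set zs \<subseteq> dcl P (b ` I)" "length zs = n" for zs
    using b(1) _ _ zs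
  proof (rule dcl_lists_induct)
    show "\<exists>E. continuous P Q E \<and> (\<forall>i\<in>I. E (b i) = h i ys)" if ys: "set ys \<subseteq> b ` I" "length ys = n" for ys
    proof -
      have "ys \<in> lists (b ` I)" using ys(1) by auto
      then obtain "is" where "is": "set is \<subseteq> I" "ys = map b is"
        unfolding lists_image by auto
      obtain E where "continuous P Q E" "\<forall>i\<in>I. E (b i) = g (i # is)"
        using Suc.prems(2)[of "[]" "is"] ys "is" by auto
      moreover have "h i ys = g (i # is)" if "i \<in> I" for i
        using h(2)[OF that, of "is"] ys "is" by simp
      ultimately show ?thesis by auto
    qed
    fix xs ys assume "set xs \<subseteq> dcl P (b ` I)" "set ys \<subseteq> dcl P (b ` I)" and len: "Suc (length xs + length ys) = n"
    then have sub: "set xs \<subseteq> carr P" "set ys \<subseteq> carr P" using b(2) by simp_all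
    show "dclosed P {z \<in> carr P. \<exists>E. continuous P Q E \<and> (\<forall>i\<in>I. E (b i) = h i (xs @ z # ys))}"
      unfolding dclosed_def
    proof (intro allI impI)
      fix D x assume D: "directed P D" "D \<subseteq> {z \<in> carr P. \<exists>E. continuous P Q E \<and> (\<forall>i\<in>I. E (b i) = h i (xs @ z # ys))}"
        "is_join P D x"
      then have "\<forall>d\<in>D. \<exists>E. continuous P Q E \<and> (\<forall>i\<in>I. E (b i) = h i (xs @ d # ys))" by auto
      then obtain F where F: "\<And>d. d \<in> D \<Longrightarrow> continuous P Q (F d)" "\<And>d i. d \<in> D \<Longrightarrow> i \<in> I \<Longrightarrow> F d (b i) = h i (xs @ d # ys)"
        by metis
      obtain E where E: "continuous P Q E" "\<And>z. z \<in> carr P \<Longrightarrow> is_join Q ((\<lambda>d. F d z) ` D) (E z)"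
        by (rule pointwise_limit[OF P Q D(1) F(1) b]) (use F(2) hmono sub len in auto)
      have "E (b i) = h i (xs @ x # ys)" if i: "i \<in> I" for i
      proof (rule is_join_unique[OF Q])
        show "is_join Q ((\<lambda>d. F d (b i)) ` D) (E (b i))" using E(2) b(1) i by blast
        have "(\<lambda>d. F d (b i)) ` D = (\<lambda>d. h i (xs @ d # ys)) ` D" using F(2) i by (intro image_cong) auto
        then show "is_join Q ((\<lambda>d. F d (b i)) ` D) (h i (xs @ x # ys))"
          using hjoin[OF i D(1,3) sub len] by simp
      qed
      then show "x \<in> {z \<in> carr P. \<exists>E. continuous P Q E \<and> (\<forall>i\<in>I. E (b i) = h i (xs @ z # ys))}"
        using E(1) is_join_carr[OF D(3)] by blast
    qed
  qed
  then obtain E where E: "\<And>zs. set zs \<subseteq> carr P \<Longrightarrow> length zs = n \<Longrightarrow> continuous P Q (E zs)"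
    "\<And>zs i. set zs \<subseteq> carr P \<Longrightarrow> length zs = n \<Longrightarrow> i \<in> I \<Longrightarrow> E zs (b i) = h i zs"
    using b(2) by metis
  let ?h = "\<lambda>zs. E (tl zs) (hd zs)"
  \<comment> \<open>\<open>E\<close> was chosen for each list of arguments separately, so continuity
    in these arguments needs a proof: the pointwise limit along \<open>D\<close> and the value at
    the join agree on the generators, where both are given by \<open>h i\<close>, hence
    everywhere.\<close>
  have cont: "continuous P Q (\<lambda>y. E (xs @ y # ys) z)"
    if z: "z \<in> carr P" and len: "Suc (length xs + length ys) = n" and sub: "set xs \<subseteq> carr P" "set ys \<subseteq> carr P" for z xs ys
    unfolding continuous_def
  proof (intro conjI allI impI)
    show "(\<lambda>y. E (xs @ y # ys) z) \<in> carr P \<rightarrow> carr Q"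
      using len sub z continuous_carr[OF E(1)] by auto
    fix D x assume D: "directed P D" "is_join P D x"
    have x: "x \<in> carr P" using is_join_carr[OF D(2)] .
    note F = E(1)[of "xs @ d # ys" for d]
    obtain F where F: "continuous P Q F" "\<And>z. z \<in> carr P \<Longrightarrow> is_join Q ((\<lambda>d. E (xs @ d # ys) z) ` D) (F z)"
      by (rule pointwise_limit[OF P Q D(1) _ b, of "\<lambda>d. E (xs @ d # ys)"])
        (use E hmono sub len directed_carr[OF D(1)] in auto)
    have "F z = E (xs @ x # ys) z"
    proof (rule eq_on_dcl[OF Q F(1) E(1) b(1)])
      fix y assume "y \<in> b ` I"
      then obtain i where i: "i \<in> I" "y = b i" by blast
      show "F y = E (xs @ x # ys) y"
      proof (rule is_join_unique[OF Q])
        show "is_join Q ((\<lambda>d. E (xs @ d # ys) y) ` D) (F y)" using F(2) i b(1) by blast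
        have "(\<lambda>d. E (xs @ d # ys) y) ` D = (\<lambda>d. h i (xs @ d # ys)) ` D"
          using E(2)[of "xs @ d # ys" for d] i sub len directed_carr[OF D(1)] by (intro image_cong) auto
        moreover have "E (xs @ x # ys) y = h i (xs @ x # ys)" using E(2) i sub len x by auto
        ultimately show "is_join Q ((\<lambda>d. E (xs @ d # ys) y) ` D) (E (xs @ x # ys) y)"
          using hjoin[OF i(1) D sub len] by simp
      qed
    qed (use sub len x z b(2) in auto)
    then show "is_join Q ((\<lambda>y. E (xs @ y # ys) z) ` D) (E (xs @ x # ys) z)" using F(2) z by metis
  qed
  show ?case
  proof (intro exI[of _ ?h] conjI allI impI sepcontI)
    fix zs assume "length zs = Suc n" "set zs \<subseteq> carr P"
    then show "?h zs \<in> carr Q" using continuous_carr[OF E(1)] by (cases zs) auto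
  next
    fix xs ys assume len: "Suc (length xs + length ys) = Suc n" and sub: "set xs \<subseteq> carr P" "set ys \<subseteq> carr P"
    show "continuous P Q (\<lambda>x. ?h (xs @ x # ys))"
    proof (cases xs)
      case Nil
      then show ?thesis using E(1) len sub by simp
    next
      case (Cons z xs')
      then show ?thesis using cont[of z xs' ys] len sub by simp
    qed
  next
    fix "is" assume "is": "set is \<subseteq> I" "length is = Suc n"
    then obtain i js where i: "is = i # js" "i \<in> I" "set js \<subseteq> I" "length js = n"
      by (cases "is") auto
    have "set (map b js) \<subseteq> carr P" using i b(1) by auto
    then show "?h (map b is) = g is"
      using E(2)[of "map b js" i] h(2)[of i js] i by simp
  qed
qed

text \<open>Constructions below live on function types, whereas the objects of \<open>DCPO\<close>
  are dcpos on \<open>'u\<close>; a function \<open>g\<close> that is injective on the carrier moves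
  them there.\<close>

definition transport :: "('a \<Rightarrow> 'b) \<Rightarrow> 'a dcpo \<Rightarrow> 'b dcpo" where
  "transport g Q = \<lparr>carr = g ` carr Q, leq = map_prod g g ` leq Q\<rparr>"

lemma carr_transport [simp]: "carr (transport g Q) = g ` carr Q"
  by (simp add: transport_def)

context
  fixes g :: "'a \<Rightarrow> 'b" and Q :: "'a dcpo"
  assumes Q: "is_dcpo Q" and inj: "inj_on g (carr Q)"
begin

lemma leq_transport: "x \<in> carr Q \<Longrightarrow> y \<in> carr Q \<Longrightarrow> (g x, g y) \<in> leq (transport g Q) \<longleftrightarrow> (x, y) \<in> leq Q"
proof
  assume xy: "x \<in> carr Q" "y \<in> carr Q" "(g x, g y) \<in> leq (transport g Q)"
  then obtain x' y' where "(x', y') \<in> leq Q" "g x = g x'" "g y = g y'"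
    by (auto simp: transport_def)
  then show "(x, y) \<in> leq Q"
    using xy inj dcpo_leq_carr[OF Q, of x' y'] by (metis inj_onD)
qed (auto simp: transport_def)

lemma is_join_transport:
  assumes "D \<subseteq> carr Q" "x \<in> carr Q"
  shows "is_join (transport g Q) (g ` D) (g x) \<longleftrightarrow> is_join Q D x"
proof -
  have "(\<forall>d\<in>D. (g d, g y) \<in> leq (transport g Q)) \<longleftrightarrow> (\<forall>d\<in>D. (d, y) \<in> leq Q)" if "y \<in> carr Q" for y
    using assms(1) that leq_transport by blast
  then show ?thesis using assms by (simp add: is_join_def leq_transport)
qed

lemma directed_transport:
  assumes "D \<subseteq> carr Q"
  shows "directed (transport g Q) (g ` D) \<longleftrightarrow> directed Q D"
proof -
  have "(\<exists>z\<in>D. (g x, g z) \<in> leq (transport g Q) \<and> (g y, g z) \<in> leq (transport g Q)) \<longleftrightarrow>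
    (\<exists>z\<in>D. (x, z) \<in> leq Q \<and> (y, z) \<in> leq Q)" if "x \<in> D" "y \<in> D" for x y
    using assms that by (intro bex_cong) (auto simp: leq_transport subset_iff)
  then show ?thesis using assms by (simp add: directed_def image_mono)
qed

lemma transport_subset: "D \<subseteq> carr (transport g Q) \<Longrightarrow> \<exists>E. E \<subseteq> carr Q \<and> D = g ` E"
  by (metis carr_transport subset_image_iff)

lemma is_dcpo_transport: "is_dcpo (transport g Q)"
proof (rule is_dcpoI)
  show "leq (transport g Q) \<subseteq> carr (transport g Q) \<times> carr (transport g Q)"
    using dcpo_leq_carr[OF Q] by (auto simp: transport_def)
  show "(x, x) \<in> leq (transport g Q)" if "x \<in> carr (transport g Q)" for x
    using that dcpo_refl[OF Q] by (auto simp: leq_transport)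
  show "(x, z) \<in> leq (transport g Q)" if xyz: "(x, y) \<in> leq (transport g Q)" "(y, z) \<in> leq (transport g Q)" for x y z
  proof -
    obtain a b b' c where *: "(a, b) \<in> leq Q" "(b', c) \<in> leq Q" "x = g a" "y = g b" "y = g b'" "z = g c"
      using xyz by (auto simp: transport_def)
    then have "b = b'" using inj dcpo_leq_carr[OF Q] by (metis inj_onD)
    then have "(a, c) \<in> leq Q" using * dcpo_trans[OF Q] by blast
    then show ?thesis using * by (auto simp: transport_def)
  qed
  show "x = y" if xy: "(x, y) \<in> leq (transport g Q)" "(y, x) \<in> leq (transport g Q)" for x y
  proof -
    obtain a b where ab: "(a, b) \<in> leq Q" "x = g a" "y = g b"
      using xy by (auto simp: transport_def)
    then have "(b, a) \<in> leq Q" using xy dcpo_leq_carr[OF Q ab(1)] leq_transport by simp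
    then show ?thesis using ab dcpo_antisym[OF Q] by blast
  qed
  show "\<exists>x. is_join (transport g Q) D x" if D: "directed (transport g Q) D" for D
  proof -
    obtain E where E: "E \<subseteq> carr Q" "D = g ` E"
      using transport_subset D by (metis directed_def)
    then obtain x where "is_join Q E x" using dcpo_ex_join[OF Q] directed_transport D by blast
    then show ?thesis using E is_join_transport is_join_carr by metis
  qed
qed

lemma continuous_transport: "continuous Q (transport g Q) g"
  unfolding continuous_def
proof (intro conjI allI impI)
  fix D x assume D: "directed Q D" "is_join Q D x"
  then have "D \<subseteq> carr Q" "x \<in> carr Q" by (auto simp: directed_def is_join_def)
  then show "is_join (transport g Q) (g ` D) (g x)" using is_join_transport D(2) by blast
qed auto

lemma continuous_inv_transport: "continuous (transport g Q) Q (inv_into (carr Q) g)"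
  unfolding continuous_def
proof (intro conjI allI impI)
  show "inv_into (carr Q) g \<in> carr (transport g Q) \<rightarrow> carr Q" by (auto intro: inv_into_into)
  fix D x assume D: "directed (transport g Q) D" "is_join (transport g Q) D x"
  obtain E where E: "E \<subseteq> carr Q" "D = g ` E" using transport_subset D(1) by (metis directed_def)
  obtain y where y: "y \<in> carr Q" "x = g y" using is_join_carr[OF D(2)] by auto
  have "inv_into (carr Q) g ` D = E"
    unfolding E(2) image_image using E(1) inj by (force simp: subset_iff image_iff)
  then show "is_join Q (inv_into (carr Q) g ` D) (inv_into (carr Q) g x)"
    using D(2) E y is_join_transport inj by simp
qed

end

section \<open>Algebras and free algebras\<close>

lemma Obj_DCPO: "P \<in> Obj DCPO \<longleftrightarrow> is_dcpo P \<and> small TYPE('u) (carr P)" for P :: "'u dcpo"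
  by (simp add: DCPO_def)

lemma is_dcpo_Obj: "P \<in> Obj DCPO \<Longrightarrow> is_dcpo P"
  by (simp add: Obj_DCPO)

lemma Comp_DCPO: "Comp DCPO P Q R g f = compose (carr P) g f"
  by (simp add: DCPO_def)

lemma Ide_DCPO: "Ide DCPO P = (\<lambda>x\<in>carr P. x)"
  by (simp add: DCPO_def)

lemma compose_in_cfun:
  "f \<in> carr (cfun P Q) \<Longrightarrow> g \<in> carr (cfun Q R) \<Longrightarrow> is_dcpo P \<Longrightarrow> compose (carr P) g f \<in> carr (cfun P R)"
  unfolding compose_def by (intro restrict_in_cfun continuous_comp[OF cfunD cfunD])

lemma ident_in_cfun: "(\<lambda>x\<in>carr P. x) \<in> carr (cfun P P)"
  by (intro restrict_in_cfun continuous_ident)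

lemma compose_ident_cfun [simp]:
  "f \<in> carr (cfun P Q) \<Longrightarrow> compose (carr P) f (\<lambda>x\<in>carr P. x) = f"
  "f \<in> carr (cfun P Q) \<Longrightarrow> compose (carr P) (\<lambda>x\<in>carr Q. x) f = f"
  by (auto simp: compose_def carr_cfun PiE_iff extensional_def fun_eq_iff)

lemma compose_assoc_cfun:
  "f \<in> carr (cfun P Q) \<Longrightarrow> compose (carr P) h (compose (carr P) g f) = compose (carr P) (compose (carr Q) h g) f"
  by (auto simp: compose_def fun_eq_iff cfun_carr)

lemma compose_apply [simp]: "x \<in> A \<Longrightarrow> compose A g f x = g (f x)"
  by (simp add: compose_def)

lemma is_algebraD:
  assumes "is_algebra S A"
  shows algebra_Obj: "und A \<in> Obj DCPO"
    and algebra_dcpo: "is_dcpo (und A)"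
    and algebra_sepcont: "s \<in> S n \<Longrightarrow> sepcont (und A) (und A) n (opn A s)"
    and algebra_continuous: "s \<in> S n \<Longrightarrow> continuous (power_dcpo (und A) n) (und A) (opn A s)"
    and algebra_undefined: "\<not> (s \<in> S (length xs) \<and> set xs \<subseteq> carr (und A)) \<Longrightarrow> opn A s xs = undefined"
    and algebra_closed: "s \<in> S (length xs) \<Longrightarrow> set xs \<subseteq> carr (und A) \<Longrightarrow> opn A s xs \<in> carr (und A)"
proof -
  show *: "und A \<in> Obj DCPO"
    and "\<not> (s \<in> S (length xs) \<and> set xs \<subseteq> carr (und A)) \<Longrightarrow> opn A s xs = undefined"
    using assms by (auto simp: is_algebra_def)
  show d: "is_dcpo (und A)" using * by (simp add: Obj_DCPO)
  show c: "s \<in> S n \<Longrightarrow> continuous (power_dcpo (und A) n) (und A) (opn A s)" for s n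
    using assms by (auto simp: is_algebra_def)
  then show sc: "s \<in> S n \<Longrightarrow> sepcont (und A) (und A) n (opn A s)" for s n
    using continuous_power_iff[OF d d] by blast
  show "s \<in> S (length xs) \<Longrightarrow> set xs \<subseteq> carr (und A) \<Longrightarrow> opn A s xs \<in> carr (und A)"
    using sc sepcont_carr by blast
qed

lemma is_algebraI:
  assumes "und A \<in> Obj DCPO" "\<And>n s. s \<in> S n \<Longrightarrow> sepcont (und A) (und A) n (opn A s)"
    "\<And>s xs. \<not> (s \<in> S (length xs) \<and> set xs \<subseteq> carr (und A)) \<Longrightarrow> opn A s xs = undefined"
  shows "is_algebra S A"
  unfolding is_algebra_def using assms continuous_power_iff[of "und A" "und A"] by (simp add: Obj_DCPO)

abbreviation alg_hom :: "'u signature \<Rightarrow> 'u algebra \<Rightarrow> 'u algebra \<Rightarrow> ('u \<Rightarrow> 'u) set" where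
  "alg_hom S A B \<equiv> Hom (Alg S) A B"

lemma Obj_Alg: "Obj (Alg S) = {A. is_algebra S A}"
  by (simp add: Alg_def)

lemma alg_hom_iff:
  "h \<in> alg_hom S A B \<longleftrightarrow> h \<in> carr (cfun (und A) (und B)) \<and>
     (\<forall>s xs. s \<in> S (length xs) \<longrightarrow> set xs \<subseteq> carr (und A) \<longrightarrow> h (opn A s xs) = opn B s (map h xs))"
  by (auto simp: Alg_def Hom_DCPO carr_power_dcpo)

lemma alg_homI:
  "h \<in> carr (cfun (und A) (und B)) \<Longrightarrow>
   (\<And>s xs. s \<in> S (length xs) \<Longrightarrow> set xs \<subseteq> carr (und A) \<Longrightarrow> h (opn A s xs) = opn B s (map h xs)) \<Longrightarrow>
   h \<in> alg_hom S A B"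
  by (simp add: alg_hom_iff)

lemma alg_homD:
  assumes "h \<in> alg_hom S A B"
  shows alg_hom_cfun: "h \<in> carr (cfun (und A) (und B))"
    and alg_hom_op: "s \<in> S (length xs) \<Longrightarrow> set xs \<subseteq> carr (und A) \<Longrightarrow> h (opn A s xs) = opn B s (map h xs)"
    and alg_hom_carr: "x \<in> carr (und A) \<Longrightarrow> h x \<in> carr (und B)"
    and alg_hom_continuous: "continuous (und A) (und B) h"
  using assms by (auto simp: alg_hom_iff dest: cfun_carr cfunD)

lemma alg_hom_ident: "is_algebra S A \<Longrightarrow> (\<lambda>x\<in>carr (und A). x) \<in> alg_hom S A A"
  by (intro alg_homI ident_in_cfun) (auto simp: algebra_closed map_idI subset_iff intro!: arg_cong[where f = "opn A s" for s])

lemma alg_hom_compose: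
  assumes "is_algebra S A" "f \<in> alg_hom S A B" "g \<in> alg_hom S B C"
  shows "compose (carr (und A)) g f \<in> alg_hom S A C"
proof (rule alg_homI)
  show "compose (carr (und A)) g f \<in> carr (cfun (und A) (und C))"
    using assms by (intro compose_in_cfun[of f _ "und B"]) (auto dest: alg_hom_cfun algebra_dcpo)
  fix s xs assume s: "s \<in> S (length xs)" "set xs \<subseteq> carr (und A)"
  have "set (map f xs) \<subseteq> carr (und B)" using s alg_hom_carr[OF assms(2)] by auto
  then have m: "g (f (opn A s xs)) = opn C s (map g (map f xs))"
    using alg_hom_op[OF assms(2) s] alg_hom_op[OF assms(3), of s "map f xs"] s(1) by simp
  have m': "map g (map f xs) = map (compose (carr (und A)) g f) xs"
    using s(2) by auto
  show "compose (carr (und A)) g f (opn A s xs) = opn C s (map (compose (carr (und A)) g f) xs)"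
    using algebra_closed[OF assms(1) s] m[unfolded m'] by simp
qed

lemma Comp_Alg: "Comp (Alg S) A B C g f = compose (carr (und A)) g f"
  by (simp add: Alg_def Comp_DCPO)

lemma Ide_Alg: "Ide (Alg S) A = (\<lambda>x\<in>carr (und A). x)"
  by (simp add: Alg_def Ide_DCPO)

text \<open>Algebras are defined over \<open>'u\<close> only; operations constructed on another
  type, such as a closure inside a power, are conjugated by a coding \<open>g\<close> with inverse
  \<open>k\<close>. The two formulas for \<open>opn\<close> serve calculations starting from either
  side.\<close>

lemma (in universe) transport_algebra:
  fixes Q :: "'z dcpo" and S :: "'u signature" and op :: "'u \<Rightarrow> 'z list \<Rightarrow> 'z"
  assumes Q: "is_dcpo Q" and small: "sml (carr Q)"
    and op: "\<And>n s. s \<in> S n \<Longrightarrow> sepcont Q Q n (op s)"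
  shows "\<exists>(A :: 'u algebra) g k. is_algebra S A \<and> continuous Q (und A) g \<and> continuous (und A) Q k \<and>
    (\<forall>x\<in>carr Q. k (g x) = x) \<and> (\<forall>x\<in>carr (und A). g (k x) = x) \<and>
    (\<forall>s xs. s \<in> S (length xs) \<longrightarrow> set xs \<subseteq> carr Q \<longrightarrow> opn A s (map g xs) = g (op s xs)) \<and>
    (\<forall>s xs. s \<in> S (length xs) \<longrightarrow> set xs \<subseteq> carr (und A) \<longrightarrow> opn A s xs = g (op s (map k xs)))"
proof -
  obtain g :: "'z \<Rightarrow> 'u" where g: "inj_on g (carr Q)" using small_embedding[OF small] .
  define k where "k = inv_into (carr Q) g"
  define A where "A = \<lparr>und = transport g Q, opn = (\<lambda>s xs. if s \<in> S (length xs) \<and> set xs \<subseteq> g ` carr Q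
    then g (op s (map k xs)) else undefined)\<rparr>"
  have kg: "k (g x) = x" if "x \<in> carr Q" for x using that g by (simp add: k_def)
  have cg: "continuous Q (transport g Q) g" by (rule continuous_transport[OF Q g])
  have ck: "continuous (transport g Q) Q k" unfolding k_def by (rule continuous_inv_transport[OF Q g])
  have dT: "is_dcpo (transport g Q)" by (rule is_dcpo_transport[OF Q g])
  have kc: "k x \<in> carr Q" if "x \<in> g ` carr Q" for x using that kg by auto
  have alg: "is_algebra S A"
  proof (rule is_algebraI)
    show "und A \<in> Obj DCPO"
      using dT small_image[OF small] by (simp add: A_def Obj_DCPO small_TYPE)
    fix n s assume s: "s \<in> S n"
    show "sepcont (und A) (und A) n (opn A s)"
    proof (rule sepcontI)
      fix xs assume xs: "length xs = n" "set xs \<subseteq> carr (und A)"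
      then have "op s (map k xs) \<in> carr Q" using s kc by (intro sepcont_carr[OF op[OF s]]) (auto simp: A_def)
      then show "opn A s xs \<in> carr (und A)" using xs s by (simp add: A_def)
    next
      fix xs ys assume xy: "Suc (length xs + length ys) = n" "set xs \<subseteq> carr (und A)" "set ys \<subseteq> carr (und A)"
      have "continuous Q Q (\<lambda>x. op s (map k xs @ x # map k ys))"
        using xy kc by (intro sepcont_continuous[OF op[OF s]]) (auto simp: A_def)
      then have "continuous (transport g Q) (transport g Q) (\<lambda>x. g (op s (map k xs @ k x # map k ys)))"
        by (rule continuous_comp[OF continuous_comp[OF ck _ dT] cg dT])
      then have "continuous (und A) (und A) (\<lambda>x. g (op s (map k xs @ k x # map k ys)))" by (simp add: A_def)
      then show "continuous (und A) (und A) (\<lambda>x. opn A s (xs @ x # ys))"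
        by (rule continuous_cong) (use xy s in \<open>auto simp: A_def\<close>)
    qed
  qed (auto simp: A_def)
  show ?thesis
  proof (intro exI[of _ A] exI[of _ g] exI[of _ k] conjI alg allI impI ballI)
    show "opn A s (map g xs) = g (op s xs)" if "s \<in> S (length xs)" "set xs \<subseteq> carr Q" for s xs
    proof -
      have "map (k \<circ> g) xs = xs" using that kg by (intro map_idI) auto
      then show ?thesis using that by (auto simp: A_def)
    qed
  qed (use cg ck kg in \<open>auto simp: A_def\<close>)
qed

section \<open>Interpretation of extended terms and satisfaction\<close>

lemma trm_val_carr:
  assumes "is_algebra S A" "f \<in> UNIV \<rightarrow> carr (und A)" "t \<in> trms S"
  shows "trm_val A f t \<in> carr (und A)"
  using assms(3)
proof (induction rule: trms.induct)
  case (Op s ts)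
  then show ?case by (auto intro!: algebra_closed[OF assms(1)])
qed (use assms in auto)

lemma trm_val_hom:
  assumes "is_algebra S A" "h \<in> alg_hom S A B" "f \<in> UNIV \<rightarrow> carr (und A)" "t \<in> trms S"
  shows "trm_val B (h \<circ> f) t = h (trm_val A f t)"
  using assms(4)
proof (induction rule: trms.induct)
  case (Op s ts)
  have "h (opn A s (map (trm_val A f) ts)) = opn B s (map h (map (trm_val A f) ts))"
    using Op trm_val_carr[OF assms(1,3)] by (intro alg_hom_op[OF assms(2)]) auto
  moreover have "map (trm_val B (h \<circ> f)) ts = map h (map (trm_val A f) ts)"
    using Op.IH by (simp add: comp_def)
  ultimately show ?case by (simp only: trm_val.simps)
qed simp

lemma trm_val_cong: "(\<And>v. v \<in> trm_vars t \<Longrightarrow> f v = g v) \<Longrightarrow> trm_val A f t = trm_val A g t"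
proof (induction t)
  case (Op s ts)
  then have "map (trm_val A f) ts = map (trm_val A g) ts" by auto
  then show ?case by (simp only: trm_val.simps)
qed simp

lemma trm_val_continuous:
  assumes A: "is_algebra S A" and f: "f \<in> UNIV \<rightarrow> carr (und A)" and t: "t \<in> trms S"
  shows "continuous (und A) (und A) (\<lambda>x. trm_val A (f(v := x)) t)"
  using t
proof (induction rule: trms.induct)
  case (Var w)
  note algebra_dcpo[OF A]
  then show ?case using f by (cases "w = v") (auto intro: continuous_ident continuous_const)
next
  case (Op s ts)
  have "continuous (und A) (power_dcpo (und A) (length ts))
    (\<lambda>x. map (\<lambda>g. g x) (map (\<lambda>t x. trm_val A (f(v := x)) t) ts))"
    using Op by (intro continuous_into_power_dcpo algebra_dcpo[OF A]) (auto simp: fun_upd_def)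
  then have "continuous (und A) (und A)
    (\<lambda>x. opn A s (map (\<lambda>g. g x) (map (\<lambda>t x. trm_val A (f(v := x)) t) ts)))"
    using continuous_comp algebra_continuous[OF A] Op algebra_dcpo[OF A] by blast
  then show ?case by (simp add: comp_def fun_upd_def)
qed

lemma finite_trm_vars: "finite (trm_vars t)"
  by (induction t) auto

lemma finite_ext_vars: "t \<in> ext_trms S \<Longrightarrow> finite (ext_vars t)"
  by (induction rule: ext_trms.induct) (auto simp: finite_trm_vars)

lemma below_iff: "i \<in> below \<alpha> \<longleftrightarrow> i \<noteq> \<alpha> \<and> (i, \<alpha>) \<in> |UNIV|"
  by (simp add: below_def underS_def)

lemma below_trans: "i \<in> below j \<Longrightarrow> j \<in> below \<alpha> \<Longrightarrow> i \<in> below \<alpha>"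
  using card_of_Well_order[of UNIV]
  unfolding below_iff well_order_on_def linear_order_on_def partial_order_on_def preorder_on_def
  by (metis antisymD transD)

lemma below_linear: "i = j \<or> i \<in> below j \<or> j \<in> below i"
  using card_of_Well_order[of UNIV]
  unfolding below_iff well_order_on_def linear_order_on_def total_on_def by (metis Field_card_of UNIV_I)

lemma directed_chain:
  assumes P: "is_dcpo P" and ne: "below \<alpha> \<noteq> {}" and v: "\<And>i. i \<in> below \<alpha> \<Longrightarrow> v i \<in> carr P"
    and mono: "\<And>i j. j \<in> below \<alpha> \<Longrightarrow> i \<in> below j \<Longrightarrow> (v i, v j) \<in> leq P"
  shows "directed P (v ` below \<alpha>)"
proof (rule directedI)
  fix x y assume "x \<in> v ` below \<alpha>" "y \<in> v ` below \<alpha>"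
  then obtain i j where ij: "i \<in> below \<alpha>" "x = v i" "j \<in> below \<alpha>" "y = v j" by auto
  have "(x, x) \<in> leq P" "(y, y) \<in> leq P" using ij v dcpo_refl[OF P] by auto
  then show "\<exists>z\<in>v ` below \<alpha>. (x, z) \<in> leq P \<and> (y, z) \<in> leq P"
    using below_linear[of i j] ij mono by blast
qed (use ne v in auto)

lemma ext_val_Join_iff:
  "ext_val A f (Join \<alpha> t) \<noteq> None \<longleftrightarrow> (\<forall>i\<in>below \<alpha>. ext_val A f (t i) \<noteq> None) \<and>
     (\<forall>j\<in>below \<alpha>. \<forall>i\<in>below j. (the (ext_val A f (t i)), the (ext_val A f (t j))) \<in> leq (und A))"
  by simp

lemma ext_val_carr:
  assumes A: "is_algebra S A" and f: "f \<in> UNIV \<rightarrow> carr (und A)" and t: "t \<in> ext_trms S"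
  shows "ext_val A f t \<noteq> None \<Longrightarrow> the (ext_val A f t) \<in> carr (und A)"
  using t
proof (induction rule: ext_trms.induct)
  case (Trm t)
  then show ?case using trm_val_carr[OF A f] by simp
next
  case (Join \<alpha> t)
  note def = Join.prems[unfolded ext_val_Join_iff]
  have "directed (und A) ((\<lambda>i. the (ext_val A f (t i))) ` below \<alpha>)"
    using Join def by (intro directed_chain algebra_dcpo[OF A]) auto
  then show ?case
    using def is_join_carr[OF is_join_join[OF algebra_dcpo[OF A]]] by simp
qed

lemma ext_val_Join:
  assumes A: "is_algebra S A" and f: "f \<in> UNIV \<rightarrow> carr (und A)" and t: "Join \<alpha> t \<in> ext_trms S"
    and def: "ext_val A f (Join \<alpha> t) \<noteq> None"
  shows "directed (und A) ((\<lambda>i. the (ext_val A f (t i))) ` below \<alpha>)"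
    and "is_join (und A) ((\<lambda>i. the (ext_val A f (t i))) ` below \<alpha>) (the (ext_val A f (Join \<alpha> t)))"
proof -
  have t': "below \<alpha> \<noteq> {}" "\<And>k. k \<in> below \<alpha> \<Longrightarrow> t k \<in> ext_trms S"
    using t by (auto elim: ext_trms.cases)
  note def' = def[unfolded ext_val_Join_iff]
  show d: "directed (und A) ((\<lambda>i. the (ext_val A f (t i))) ` below \<alpha>)"
    using t' def' by (intro directed_chain algebra_dcpo[OF A] ext_val_carr[OF A f]) auto
  show "is_join (und A) ((\<lambda>i. the (ext_val A f (t i))) ` below \<alpha>) (the (ext_val A f (Join \<alpha> t)))"
    using is_join_join[OF algebra_dcpo[OF A] d] def' by simp
qed

lemma ext_val_cong: "(\<And>v. v \<in> ext_vars t \<Longrightarrow> f v = g v) \<Longrightarrow> ext_val A f t = ext_val A g t"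
proof (induction t)
  case (Trm t)
  then show ?case using trm_val_cong[of t f g] by simp
next
  case (Join \<alpha> t)
  have eq: "ext_val A f (t i) = ext_val A g (t i)" if "i \<in> below \<alpha>" for i
    using Join that by auto
  have eq': "ext_val A f (t i) = ext_val A g (t i)" if "i \<in> below j" "j \<in> below \<alpha>" for i j
    by (rule eq[OF below_trans[OF that]])
  have "(\<lambda>i. the (ext_val A f (t i))) ` below \<alpha> = (\<lambda>i. the (ext_val A g (t i))) ` below \<alpha>"
    using eq by (intro image_cong) auto
  moreover have "(\<forall>i\<in>below \<alpha>. ext_val A f (t i) \<noteq> None) \<longleftrightarrow> (\<forall>i\<in>below \<alpha>. ext_val A g (t i) \<noteq> None)"
    using eq by (intro ball_cong) auto
  moreover have "(\<forall>j\<in>below \<alpha>. \<forall>i\<in>below j. (the (ext_val A f (t i)), the (ext_val A f (t j))) \<in> leq (und A)) \<longleftrightarrow>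
     (\<forall>j\<in>below \<alpha>. \<forall>i\<in>below j. (the (ext_val A g (t i)), the (ext_val A g (t j))) \<in> leq (und A))"
    using eq eq' by (intro ball_cong) auto
  ultimately show ?case by (simp only: ext_val.simps)
qed

text \<open>Homomorphisms are monotone, so they preserve definedness of a formal join, and
  continuous, so they preserve its value. The passage back from the target to the source is
  \<open>ext_val_reflect\<close>.\<close>

lemma ext_val_hom:
  assumes A: "is_algebra S A" and B: "is_algebra S B" and h: "h \<in> alg_hom S A B"
    and f: "f \<in> UNIV \<rightarrow> carr (und A)" and t: "t \<in> ext_trms S"
  shows "ext_val A f t \<noteq> None \<Longrightarrow> ext_val B (h \<circ> f) t = Some (h (the (ext_val A f t)))"
  using t
proof (induction rule: ext_trms.induct)
  case (Trm t)
  then show ?case using trm_val_hom[OF A h f] by (simp add: comp_def)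
next
  case (Join \<alpha> t)
  have J: "Join \<alpha> t \<in> ext_trms S" using Join by (intro ext_trms.Join) auto
  note def = Join.prems[unfolded ext_val_Join_iff]
  note j = ext_val_Join[OF A f J Join.prems]
  have eq: "ext_val B (h \<circ> f) (t i) = Some (h (the (ext_val A f (t i))))" if "i \<in> below \<alpha>" for i
    using Join that def by blast
  have eq': "ext_val B (h \<circ> f) (t i) = Some (h (the (ext_val A f (t i))))" if "i \<in> below j" "j \<in> below \<alpha>" for i j
    by (rule eq[OF below_trans[OF that]])
  have mono: "(h x, h y) \<in> leq (und B)" if "(x, y) \<in> leq (und A)" for x y
    using continuous_mono[OF alg_hom_continuous[OF h] algebra_dcpo[OF A] that] .
  have "ext_val B (h \<circ> f) (Join \<alpha> t) \<noteq> None"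
    unfolding ext_val_Join_iff using eq eq' def mono by simp
  then have "is_join (und B) ((\<lambda>i. the (ext_val B (h \<circ> f) (t i))) ` below \<alpha>) (the (ext_val B (h \<circ> f) (Join \<alpha> t)))"
    using f alg_hom_carr[OF h] by (intro ext_val_Join[OF B _ J]) (simp_all add: Pi_iff)
  moreover have "(\<lambda>i. the (ext_val B (h \<circ> f) (t i))) ` below \<alpha> = h ` (\<lambda>i. the (ext_val A f (t i))) ` below \<alpha>"
    unfolding image_image using eq by (intro image_cong) auto
  moreover have "is_join (und B) (h ` (\<lambda>i. the (ext_val A f (t i))) ` below \<alpha>) (h (the (ext_val A f (Join \<alpha> t))))"
    by (rule continuous_join[OF alg_hom_continuous[OF h] j])
  ultimately have "the (ext_val B (h \<circ> f) (Join \<alpha> t)) = h (the (ext_val A f (Join \<alpha> t)))"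
    using is_join_unique[OF algebra_dcpo[OF B]] by metis
  then show ?case using \<open>ext_val B (h \<circ> f) (Join \<alpha> t) \<noteq> None\<close> by (metis option.collapse)
qed

text \<open>The only cause of undefinedness is a failing inequality between two values; if it fails
  in \<open>A\<close>, it fails in some \<open>B i\<close>, because the family \<open>h\<close>
  jointly reflects the order.\<close>

lemma ext_val_reflect:
  assumes A: "is_algebra S A" and B: "\<And>i. i \<in> I \<Longrightarrow> is_algebra S (B i)"
    and h: "\<And>i. i \<in> I \<Longrightarrow> h i \<in> alg_hom S A (B i)"
    and reflect: "\<And>x y. x \<in> carr (und A) \<Longrightarrow> y \<in> carr (und A) \<Longrightarrow>
      (\<And>i. i \<in> I \<Longrightarrow> (h i x, h i y) \<in> leq (und (B i))) \<Longrightarrow> (x, y) \<in> leq (und A)"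
    and f: "f \<in> UNIV \<rightarrow> carr (und A)" and t: "t \<in> ext_trms S"
  shows "(\<And>i. i \<in> I \<Longrightarrow> ext_val (B i) (h i \<circ> f) t \<noteq> None) \<Longrightarrow> ext_val A f t \<noteq> None"
  using t
proof (induction rule: ext_trms.induct)
  case (Trm t)
  then show ?case by simp
next
  case (Join \<alpha> t)
  have def: "ext_val A f (t k) \<noteq> None" if "k \<in> below \<alpha>" for k
    using Join.IH[OF that] Join.prems that unfolding ext_val_Join_iff by blast
  have "(the (ext_val A f (t i)), the (ext_val A f (t j))) \<in> leq (und A)"
    if ij: "j \<in> below \<alpha>" "i \<in> below j" for i j
  proof (rule reflect)
    have i: "i \<in> below \<alpha>" by (rule below_trans[OF ij(2,1)])
    show "the (ext_val A f (t i)) \<in> carr (und A)" "the (ext_val A f (t j)) \<in> carr (und A)"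
      using def i ij Join.hyps by (auto intro!: ext_val_carr[OF A f])
    fix m assume m: "m \<in> I"
    have "ext_val (B m) (h m \<circ> f) (t l) = Some (h m (the (ext_val A f (t l))))" if "l \<in> below \<alpha>" for l
      using ext_val_hom[OF A B[OF m] h[OF m] f] Join.hyps def that by blast
    then show "(h m (the (ext_val A f (t i))), h m (the (ext_val A f (t j)))) \<in> leq (und (B m))"
      using Join.prems[OF m] i ij unfolding ext_val_Join_iff by fastforce
  qed
  then show ?case unfolding ext_val_Join_iff using def by blast
qed

text \<open>Covers subalgebras, through a single order embedding, and subalgebras of products,
  through the family of projections.\<close>

lemma satisfies_reflect:
  assumes A: "is_algebra S A" and B: "\<And>i. i \<in> I \<Longrightarrow> is_algebra S (B i)"
    and h: "\<And>i. i \<in> I \<Longrightarrow> h i \<in> alg_hom S A (B i)"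
    and reflect: "\<And>x y. x \<in> carr (und A) \<Longrightarrow> y \<in> carr (und A) \<Longrightarrow>
      (\<And>i. i \<in> I \<Longrightarrow> (h i x, h i y) \<in> leq (und (B i))) \<Longrightarrow> (x, y) \<in> leq (und A)"
    and e: "e \<in> ext_trms S \<times> ext_trms S" and sat: "\<And>i. i \<in> I \<Longrightarrow> satisfies (B i) e"
  shows "satisfies A e"
  unfolding satisfies_def
proof (intro ballI conjI)
  fix f :: "nat \<Rightarrow> _" assume f: "f \<in> UNIV \<rightarrow> carr (und A)"
  have e': "fst e \<in> ext_trms S" "snd e \<in> ext_trms S" using e by auto
  have hf: "h i \<circ> f \<in> UNIV \<rightarrow> carr (und (B i))" if "i \<in> I" for i
    using f alg_hom_carr[OF h[OF that]] by (simp add: Pi_iff)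
  have satB: "ext_val (B i) (h i \<circ> f) (fst e) \<noteq> None" "ext_val (B i) (h i \<circ> f) (snd e) \<noteq> None"
    "ext_val (B i) (h i \<circ> f) (fst e) = ext_val (B i) (h i \<circ> f) (snd e)" if "i \<in> I" for i
    using sat[OF that] hf[OF that] unfolding satisfies_def by blast+
  have def: "ext_val A f t \<noteq> None"
    if t: "t \<in> ext_trms S" "\<And>i. i \<in> I \<Longrightarrow> ext_val (B i) (h i \<circ> f) t \<noteq> None" for t
  proof (rule ext_val_reflect[where I = I and B = B and h = h, OF A])
    show "(x, y) \<in> leq (und A)" if "x \<in> carr (und A)" "y \<in> carr (und A)"
      "\<And>i. i \<in> I \<Longrightarrow> (h i x, h i y) \<in> leq (und (B i))" for x y
      using reflect that by blast
  qed (fact B h f t)+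
  show def: "ext_val A f (fst e) \<noteq> None" "ext_val A f (snd e) \<noteq> None"
    using def e' satB by blast+
  note carrs = ext_val_carr[OF A f e'(1) def(1)] ext_val_carr[OF A f e'(2) def(2)]
  have eq: "h i (the (ext_val A f (fst e))) = h i (the (ext_val A f (snd e)))" if "i \<in> I" for i
    using ext_val_hom[OF A B[OF that] h[OF that] f e'(1) def(1)]
      ext_val_hom[OF A B[OF that] h[OF that] f e'(2) def(2)] satB(3)[OF that] by simp
  have refl: "(h i x, h i x) \<in> leq (und (B i))" if "i \<in> I" "x \<in> carr (und A)" for i x
    using dcpo_refl[OF algebra_dcpo[OF B[OF that(1)]] alg_hom_carr[OF h[OF that(1)] that(2)]] .
  have "the (ext_val A f (fst e)) = the (ext_val A f (snd e))"
    using carrs eq refl by (intro dcpo_antisym[OF algebra_dcpo[OF A]] reflect) metis+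
  then show "ext_val A f (fst e) = ext_val A f (snd e)" using def by (metis option.expand)
qed

text \<open>A section \<open>s\<close> of underlying sets suffices: it lifts assignments to
  \<open>A\<close>, where both sides are defined and equal, and \<open>h\<close> carries the values
  back.\<close>

lemma satisfies_retract:
  assumes A: "is_algebra S A" and B: "is_algebra S B" and h: "h \<in> alg_hom S A B"
    and s: "\<And>x. x \<in> carr (und B) \<Longrightarrow> s x \<in> carr (und A) \<and> h (s x) = x"
    and e: "e \<in> ext_trms S \<times> ext_trms S" and sat: "satisfies A e"
  shows "satisfies B e"
  unfolding satisfies_def
proof
  fix f :: "nat \<Rightarrow> _" assume f: "f \<in> UNIV \<rightarrow> carr (und B)"
  have sf: "s \<circ> f \<in> UNIV \<rightarrow> carr (und A)" using f s by (simp add: Pi_iff)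
  have hsf: "h \<circ> (s \<circ> f) = f" using f s by (simp add: Pi_iff fun_eq_iff)
  have e': "fst e \<in> ext_trms S" "snd e \<in> ext_trms S" using e by auto
  have "ext_val A (s \<circ> f) (fst e) \<noteq> None" "ext_val A (s \<circ> f) (snd e) \<noteq> None"
    "ext_val A (s \<circ> f) (fst e) = ext_val A (s \<circ> f) (snd e)"
    using sat sf unfolding satisfies_def by blast+
  then show "ext_val B f (fst e) \<noteq> None \<and> ext_val B f (snd e) \<noteq> None \<and> ext_val B f (fst e) = ext_val B f (snd e)"
    using ext_val_hom[OF A B h sf e'(1)] ext_val_hom[OF A B h sf e'(2)] hsf by simp
qed

lemma ext_val_mono:
  assumes A: "is_algebra S A" and f: "f \<in> UNIV \<rightarrow> carr (und A)" and xy: "(x, y) \<in> leq (und A)"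
    and t: "t \<in> ext_trms S"
  shows "ext_val A (f(v := x)) t \<noteq> None \<Longrightarrow> ext_val A (f(v := y)) t \<noteq> None \<Longrightarrow>
    (the (ext_val A (f(v := x)) t), the (ext_val A (f(v := y)) t)) \<in> leq (und A)"
  using t
proof (induction rule: ext_trms.induct)
  case (Trm t)
  then show ?case
    using continuous_mono[OF trm_val_continuous[OF A f] algebra_dcpo[OF A] xy] by (simp add: fun_upd_def)
next
  case (Join \<alpha> t)
  have J: "Join \<alpha> t \<in> ext_trms S" using Join by (intro ext_trms.Join) auto
  have fx: "f(v := x) \<in> UNIV \<rightarrow> carr (und A)" "f(v := y) \<in> UNIV \<rightarrow> carr (und A)"
    using f dcpo_leq_carr[OF algebra_dcpo[OF A] xy] by auto
  note jx = ext_val_Join(2)[OF A fx(1) J Join.prems(1)]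
  note jy = ext_val_Join(2)[OF A fx(2) J Join.prems(2)]
  show ?case
  proof (rule is_join_least[OF jx is_join_carr[OF jy]])
    fix d assume "d \<in> (\<lambda>i. the (ext_val A (f(v := x)) (t i))) ` below \<alpha>"
    then obtain i where i: "i \<in> below \<alpha>" "d = the (ext_val A (f(v := x)) (t i))" by blast
    have "(d, the (ext_val A (f(v := y)) (t i))) \<in> leq (und A)"
      using Join.IH[OF i(1)] Join.prems i unfolding ext_val_Join_iff by blast
    moreover have "(the (ext_val A (f(v := y)) (t i)), the (ext_val A (f(v := y)) (Join \<alpha> t))) \<in> leq (und A)"
      by (rule is_join_ub[OF jy]) (use i in blast)
    ultimately show "(d, the (ext_val A (f(v := y)) (Join \<alpha> t))) \<in> leq (und A)"
      using dcpo_trans[OF algebra_dcpo[OF A]] by blast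
  qed
qed

text \<open>The inequalities that make a formal join defined persist at a directed join of
  arguments, since both sides are joins of their values along \<open>D\<close>. The join over
  \<open>below \<alpha>\<close> then commutes with the join over \<open>D\<close>.\<close>

lemma ext_val_limit:
  assumes A: "is_algebra S A" and f: "f \<in> UNIV \<rightarrow> carr (und A)"
    and D: "directed (und A) D" "is_join (und A) D x" and t: "t \<in> ext_trms S"
  shows "(\<And>d. d \<in> D \<Longrightarrow> ext_val A (f(v := d)) t \<noteq> None) \<Longrightarrow>
    ext_val A (f(v := x)) t \<noteq> None \<and>
    is_join (und A) ((\<lambda>d. the (ext_val A (f(v := d)) t)) ` D) (the (ext_val A (f(v := x)) t))"
  using t
proof (induction rule: ext_trms.induct)
  case (Trm t)
  then show ?case
    using continuous_join[OF trm_val_continuous[OF A f] D] by (simp add: fun_upd_def)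
next
  case (Join \<alpha> t)
  note dA = algebra_dcpo[OF A]
  have J: "Join \<alpha> t \<in> ext_trms S" using Join by (intro ext_trms.Join) auto
  have fx: "f(v := x) \<in> UNIV \<rightarrow> carr (und A)" "\<And>d. d \<in> D \<Longrightarrow> f(v := d) \<in> UNIV \<rightarrow> carr (und A)"
    using f is_join_carr[OF D(2)] directed_carr[OF D(1)] by auto
  define val where "val y i = the (ext_val A (f(v := y)) (t i))" for y i
  have defd: "ext_val A (f(v := d)) (t i) \<noteq> None" if "d \<in> D" "i \<in> below \<alpha>" for d i
    using Join.prems[OF that(1)] that(2) unfolding ext_val_Join_iff by blast
  have IH: "ext_val A (f(v := x)) (t i) \<noteq> None" "is_join (und A) ((\<lambda>d. val d i) ` D) (val x i)"
    if "i \<in> below \<alpha>" for i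
    using Join.IH[OF that] defd that unfolding val_def by blast+
  have "(val x i, val x j) \<in> leq (und A)" if ij: "j \<in> below \<alpha>" "i \<in> below j" for i j
  proof (rule is_join_least[OF IH(2)])
    show "i \<in> below \<alpha>" by (rule below_trans[OF ij(2,1)])
    show "val x j \<in> carr (und A)" using is_join_carr[OF IH(2)[OF ij(1)]] .
    fix p assume "p \<in> (\<lambda>d. val d i) ` D"
    then obtain d where d: "d \<in> D" "p = val d i" by blast
    have "(val d i, val d j) \<in> leq (und A)"
      using Join.prems[OF d(1)] ij unfolding ext_val_Join_iff val_def by blast
    then show "(p, val x j) \<in> leq (und A)"
      using d is_join_ub[OF IH(2)[OF ij(1)], of "val d j"] dcpo_trans[OF dA] by blast
  qed
  then have defx: "ext_val A (f(v := x)) (Join \<alpha> t) \<noteq> None"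
    unfolding ext_val_Join_iff using IH(1) by (simp add: val_def)
  have jx: "is_join (und A) (val x ` below \<alpha>) (the (ext_val A (f(v := x)) (Join \<alpha> t)))"
    using ext_val_Join(2)[OF A fx(1) J defx] unfolding val_def .
  have jd: "is_join (und A) (val d ` below \<alpha>) (the (ext_val A (f(v := d)) (Join \<alpha> t)))" if "d \<in> D" for d
    using ext_val_Join(2)[OF A fx(2)[OF that] J Join.prems[OF that]] unfolding val_def .
  have "is_join (und A) ((\<lambda>d. the (ext_val A (f(v := d)) (Join \<alpha> t))) ` D) (the (ext_val A (f(v := x)) (Join \<alpha> t)))"
  proof (rule is_joinI)
    show "the (ext_val A (f(v := x)) (Join \<alpha> t)) \<in> carr (und A)" using is_join_carr[OF jx] .
    show "(p, the (ext_val A (f(v := x)) (Join \<alpha> t))) \<in> leq (und A)"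
      if p: "p \<in> (\<lambda>d. the (ext_val A (f(v := d)) (Join \<alpha> t))) ` D" for p
    proof -
      obtain d where d: "d \<in> D" "p = the (ext_val A (f(v := d)) (Join \<alpha> t))" using p by blast
      show ?thesis unfolding d(2)
        by (rule ext_val_mono[OF A f is_join_ub[OF D(2) d(1)] J Join.prems[OF d(1)] defx])
    qed
    fix q assume q: "q \<in> carr (und A)" "\<And>p. p \<in> (\<lambda>d. the (ext_val A (f(v := d)) (Join \<alpha> t))) ` D \<Longrightarrow> (p, q) \<in> leq (und A)"
    have vq: "(val d i, q) \<in> leq (und A)" if d: "d \<in> D" and i: "i \<in> below \<alpha>" for d i
    proof (rule dcpo_trans[OF dA])
      show "(val d i, the (ext_val A (f(v := d)) (Join \<alpha> t))) \<in> leq (und A)"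
        using is_join_ub[OF jd[OF d], of "val d i"] i by blast
      show "(the (ext_val A (f(v := d)) (Join \<alpha> t)), q) \<in> leq (und A)" by (rule q(2)) (use d in blast)
    qed
    have "(val x i, q) \<in> leq (und A)" if i: "i \<in> below \<alpha>" for i
      by (rule is_join_least[OF IH(2)[OF i] q(1)]) (use vq i in blast)
    then show "(the (ext_val A (f(v := x)) (Join \<alpha> t)), q) \<in> leq (und A)"
      by (intro is_join_least[OF jx q(1)]) blast
  qed
  then show ?case using defx by blast
qed

text \<open>An extended term has finitely many variables, so they can be released from
  \<open>Y\<close> one after another; each release is a closure induction by
  \<open>ext_val_limit\<close>. Here \<open>Y\<close> generates by directed joins alone, without
  operations.\<close>

lemma satisfies_dcl:
  assumes A: "is_algebra S A" and e: "e \<in> ext_trms S \<times> ext_trms S"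
    and Y: "Y \<subseteq> carr (und A)" "carr (und A) = dcl (und A) Y"
    and sat: "\<And>f. f \<in> UNIV \<rightarrow> Y \<Longrightarrow> ext_val A f (fst e) \<noteq> None \<and> ext_val A f (snd e) \<noteq> None \<and>
      ext_val A f (fst e) = ext_val A f (snd e)"
  shows "satisfies A e"
proof -
  define good where "good f \<longleftrightarrow> ext_val A f (fst e) \<noteq> None \<and> ext_val A f (snd e) \<noteq> None \<and>
      ext_val A f (fst e) = ext_val A f (snd e)" for f
  define vars where "vars = ext_vars (fst e) \<union> ext_vars (snd e)"
  have e': "fst e \<in> ext_trms S" "snd e \<in> ext_trms S" using e by auto
  have fin: "finite vars" using finite_ext_vars[OF e'(1)] finite_ext_vars[OF e'(2)] by (simp add: vars_def)
  have cong: "good f \<longleftrightarrow> good g" if fg: "\<And>v. v \<in> vars \<Longrightarrow> f v = g v" for f g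
  proof -
    have "ext_val A f (fst e) = ext_val A g (fst e)" "ext_val A f (snd e) = ext_val A g (snd e)"
      using fg by (auto intro!: ext_val_cong simp: vars_def)
    then show ?thesis by (simp add: good_def)
  qed
  \<comment> \<open>\<open>W\<close> is the set of variables that have been released from
    \<open>Y\<close>.\<close>
  have "\<forall>f \<in> UNIV \<rightarrow> carr (und A). (\<forall>v\<in>vars - W. f v \<in> Y) \<longrightarrow> good f" if "finite W" for W
    using that
  proof (induction W)
    case empty
    show ?case
    proof (intro ballI impI)
      fix f :: "nat \<Rightarrow> _" assume f: "f \<in> UNIV \<rightarrow> carr (und A)" "\<forall>v\<in>vars - {}. f v \<in> Y"
      \<comment> \<open>Variables outside \<open>vars\<close> may have values outside
        \<open>Y\<close>; they are reset to some \<open>y\<close> in \<open>Y\<close>, which exists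
        because the closure of the empty set is empty.\<close>
      have "Y \<noteq> {}" using f(1) Y(2) dcl_nonempty by (metis PiE UNIV_I)
      then obtain y where "y \<in> Y" by blast
      then have "good (\<lambda>v. if v \<in> vars then f v else y)"
        using sat[of "\<lambda>v. if v \<in> vars then f v else y"] f(2) unfolding good_def by auto
      then show "good f" using cong[of f "\<lambda>v. if v \<in> vars then f v else y"] by simp
    qed
  next
    case (insert w W)
    show ?case
    proof (intro ballI impI)
      fix f :: "nat \<Rightarrow> _" assume f: "f \<in> UNIV \<rightarrow> carr (und A)" "\<forall>v\<in>vars - insert w W. f v \<in> Y"
      have "dcl (und A) Y \<subseteq> {x \<in> carr (und A). good (f(w := x))}"
      proof (rule dcl_least)
        show "Y \<subseteq> {x \<in> carr (und A). good (f(w := x))}"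
        proof
          fix x assume x: "x \<in> Y"
          have "f(w := x) \<in> UNIV \<rightarrow> carr (und A)" "\<forall>v\<in>vars - W. (f(w := x)) v \<in> Y"
            using f x subsetD[OF Y(1)] by (auto simp: Pi_iff)
          then have "good (f(w := x))" using insert.IH by blast
          then show "x \<in> {x \<in> carr (und A). good (f(w := x))}" using x Y(1) by blast
        qed
        show "dclosed (und A) {x \<in> carr (und A). good (f(w := x))}"
          unfolding dclosed_def
        proof (intro allI impI)
          fix D x assume D: "directed (und A) D" "D \<subseteq> {x \<in> carr (und A). good (f(w := x))}" "is_join (und A) D x"
          have g: "ext_val A (f(w := d)) (fst e) \<noteq> None" "ext_val A (f(w := d)) (snd e) \<noteq> None"
            "ext_val A (f(w := d)) (fst e) = ext_val A (f(w := d)) (snd e)" if "d \<in> D" for d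
            using D(2) that unfolding good_def by auto
          note l = ext_val_limit[OF A f(1) D(1,3) e'(1) g(1)] ext_val_limit[OF A f(1) D(1,3) e'(2) g(2)]
          have "(\<lambda>d. the (ext_val A (f(w := d)) (fst e))) ` D = (\<lambda>d. the (ext_val A (f(w := d)) (snd e))) ` D"
            using g(3) by (intro image_cong) auto
          then have "the (ext_val A (f(w := x)) (fst e)) = the (ext_val A (f(w := x)) (snd e))"
            using l is_join_unique[OF algebra_dcpo[OF A]] by metis
          then have "good (f(w := x))" unfolding good_def using l by (metis option.expand)
          then show "x \<in> {x \<in> carr (und A). good (f(w := x))}" using is_join_carr[OF D(3)] by simp
        qed
      qed
      moreover have "f w \<in> dcl (und A) Y" using f(1) Y(2) by auto
      ultimately have "good (f(w := f w))" by blast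
      then show "good f" by simp
    qed
  qed
  from this[OF fin] show ?thesis unfolding satisfies_def good_def by simp
qed

section \<open>Models, subalgebras and existence of free algebras\<close>

definition models :: "'u signature \<Rightarrow> ('u ext_trm \<times> 'u ext_trm) set \<Rightarrow> 'u algebra set" where
  "models S E = {A. is_algebra S A \<and> (\<forall>e\<in>E. satisfies A e)}"

lemma models_algebra: "A \<in> models S E \<Longrightarrow> is_algebra S A"
  by (simp add: models_def)

text \<open>A directed join formed inside the closure is the ambient one, so the inductive
  generation can be replayed inside; this gives density of \<open>Y\<close> in the new dcpo.\<close>

lemma dcl_sub_dcpo:
  assumes "is_dcpo P" "Y \<subseteq> carr P"
  shows "dcl (sub_dcpo P (dcl P Y)) Y = dcl P Y"
proof
  note sub = dcl_subset_carr[OF assms(2)]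
  show "dcl (sub_dcpo P (dcl P Y)) Y \<subseteq> dcl P Y"
    using dcl_subset_carr[of Y "sub_dcpo P (dcl P Y)"] by (auto intro: dcl.base)
  show "dcl P Y \<subseteq> dcl (sub_dcpo P (dcl P Y)) Y"
  proof
    fix x assume "x \<in> dcl P Y"
    then show "x \<in> dcl (sub_dcpo P (dcl P Y)) Y"
    proof (induction rule: dcl.induct)
      case (join D x)
      have "D \<subseteq> dcl P Y" using join.hyps(2) by blast
      then have "directed (sub_dcpo P (dcl P Y)) D" "is_join (sub_dcpo P (dcl P Y)) D x"
        using join.hyps(1,3) directed_sub_dcpo[OF sub] is_join_sub_dcpo[OF assms(1) dclosed_dcl sub] by blast+
      then show ?case using join.IH dcl.join by metis
    qed (rule dcl.base)
  qed
qed

lemma sepcont_sub_dcpo: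
  assumes P: "is_dcpo P" and C: "dclosed P C" "C \<subseteq> carr P" and g: "sepcont P P n g"
    and closed: "\<And>xs. length xs = n \<Longrightarrow> set xs \<subseteq> C \<Longrightarrow> g xs \<in> C"
  shows "sepcont (sub_dcpo P C) (sub_dcpo P C) n g"
proof (rule sepcontI)
  fix xs ys assume *: "Suc (length xs + length ys) = n" "set xs \<subseteq> carr (sub_dcpo P C)" "set ys \<subseteq> carr (sub_dcpo P C)"
  then have "continuous P P (\<lambda>x. g (xs @ x # ys))"
    using C(2) by (intro sepcont_continuous[OF g]) auto
  then show "continuous (sub_dcpo P C) (sub_dcpo P C) (\<lambda>x. g (xs @ x # ys))"
    using * closed
    by (intro continuous_into_sub_dcpo is_dcpo_sub_dcpo continuous_from_sub_dcpo P C) auto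
qed (use closed in auto)

lemma continuous_compose_left:
  assumes "g \<in> carr (cfun Q R)" "is_dcpo P" "is_dcpo Q" "is_dcpo R"
  shows "continuous (cfun P Q) (cfun P R) (\<lambda>f. compose (carr P) g f)"
proof (rule continuous_into_cfun[OF is_dcpo_cfun])
  show "continuous (cfun P Q) R (\<lambda>f. compose (carr P) g f x)" if "x \<in> carr P" for x
    using that assms continuous_comp[OF continuous_eval cfunD is_dcpo_cfun, of Q x P g R] by simp
qed (use assms in \<open>auto intro: compose_in_cfun\<close>)

lemma continuous_compose_right:
  assumes "f \<in> carr (cfun P Q)" "is_dcpo P" "is_dcpo Q" "is_dcpo R"
  shows "continuous (cfun Q R) (cfun P R) (\<lambda>g. compose (carr P) g f)"
proof (rule continuous_into_cfun[OF is_dcpo_cfun])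
  show "continuous (cfun Q R) R (\<lambda>g. compose (carr P) g f x)" if "x \<in> carr P" for x
    using that assms continuous_eval[of R "f x" Q] cfun_carr[of f P Q x] by simp
qed (use assms in \<open>auto intro: compose_in_cfun\<close>)

text \<open>Homomorphisms are extensional functions, so uniqueness is equality of HOL
  functions.\<close>

definition is_free ::
    "'u signature \<Rightarrow> ('u ext_trm \<times> 'u ext_trm) set \<Rightarrow> 'u dcpo \<Rightarrow> 'u algebra \<Rightarrow> ('u \<Rightarrow> 'u) \<Rightarrow> bool" where
  "is_free S E X A \<eta> \<longleftrightarrow> A \<in> models S E \<and> \<eta> \<in> carr (cfun X (und A)) \<and>
     (\<forall>B\<in>models S E. \<forall>f\<in>carr (cfun X (und B)). \<exists>!h. h \<in> alg_hom S A B \<and> (\<forall>x\<in>carr X. h (\<eta> x) = f x))"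

locale variety = universe U for U :: "'u itself" +
  fixes S :: "'u signature" and E :: "('u ext_trm \<times> 'u ext_trm) set"
  assumes signature: "is_signature S" and equations: "E \<subseteq> ext_trms S \<times> ext_trms S"
begin

lemma models_reflect:
  assumes "is_algebra S A" "\<And>i. i \<in> I \<Longrightarrow> B i \<in> models S E"
    "\<And>i. i \<in> I \<Longrightarrow> h i \<in> alg_hom S A (B i)"
    "\<And>x y. x \<in> carr (und A) \<Longrightarrow> y \<in> carr (und A) \<Longrightarrow>
      (\<And>i. i \<in> I \<Longrightarrow> (h i x, h i y) \<in> leq (und (B i))) \<Longrightarrow> (x, y) \<in> leq (und A)"
  shows "A \<in> models S E"
proof -
  have "satisfies A e" if e: "e \<in> E" for e
  proof (rule satisfies_reflect[where I = I and B = B and h = h, OF assms(1)])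
    show "is_algebra S (B i)" "satisfies (B i) e" if "i \<in> I" for i
      using assms(2)[OF that] e by (auto simp: models_def)
    show "e \<in> ext_trms S \<times> ext_trms S" using e equations by blast
  qed (fact assms(3,4))+
  then show ?thesis using assms(1) by (simp add: models_def)
qed

lemma models_Obj: "A \<in> models S E \<Longrightarrow> und A \<in> Obj DCPO"
  by (rule algebra_Obj[OF models_algebra])

lemma models_dcpo: "A \<in> models S E \<Longrightarrow> is_dcpo (und A)"
  by (rule algebra_dcpo[OF models_algebra])

text \<open>The inclusion is an order embedding, so equations, definedness included, are inherited
  by \<open>models_reflect\<close> with a one-element family.\<close>

lemma subalgebra:
  assumes A: "A \<in> models S E" and C: "C \<subseteq> carr (und A)" "dclosed (und A) C"
    and closed: "\<And>s xs. s \<in> S (length xs) \<Longrightarrow> set xs \<subseteq> C \<Longrightarrow> opn A s xs \<in> C"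
  obtains B where "B \<in> models S E" "und B = sub_dcpo (und A) C" "(\<lambda>x\<in>C. x) \<in> alg_hom S B A"
proof -
  define B where "B = \<lparr>und = sub_dcpo (und A) C,
    opn = (\<lambda>s xs. if s \<in> S (length xs) \<and> set xs \<subseteq> C then opn A s xs else undefined)\<rparr>"
  note dA = models_dcpo[OF A] and alg = models_algebra[OF A]
  have B: "is_algebra S B"
  proof (rule is_algebraI)
    have "small TYPE('u) C"
      using models_Obj[OF A] small_subset[OF _ C(1)] by (simp add: Obj_DCPO small_TYPE)
    then show "und B \<in> Obj DCPO"
      using is_dcpo_sub_dcpo[OF dA C(2,1)] by (simp add: B_def Obj_DCPO)
    fix n s assume s: "s \<in> S n"
    have sc: "sepcont (und B) (und B) n (opn A s)"
      using closed s unfolding B_def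
      by simp (intro sepcont_sub_dcpo dA C algebra_sepcont[OF alg]; simp)
    have eq: "opn B s xs = opn A s xs" if "length xs = n" "set xs \<subseteq> carr (und B)" for xs
      using that s by (simp add: B_def)
    show "sepcont (und B) (und B) n (opn B s)"
    proof (rule sepcontI)
      show "opn B s xs \<in> carr (und B)" if "length xs = n" "set xs \<subseteq> carr (und B)" for xs
        using sepcont_carr[OF sc that] eq[OF that] by simp
      show "continuous (und B) (und B) (\<lambda>x. opn B s (xs @ x # ys))"
        if *: "Suc (length xs + length ys) = n" "set xs \<subseteq> carr (und B)" "set ys \<subseteq> carr (und B)" for xs ys
        by (rule continuous_cong[OF sepcont_continuous[OF sc *]], rule eq[symmetric]) (use * in auto)
    qed
  qed (auto simp: B_def)
  have "(\<lambda>x\<in>C. x) \<in> alg_hom S B A"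
  proof (rule alg_homI)
    have "continuous (sub_dcpo (und A) C) (und A) (\<lambda>x. x)"
      by (rule continuous_from_sub_dcpo[OF dA C(2,1) continuous_ident])
    then show "(\<lambda>x\<in>C. x) \<in> carr (cfun (und B) (und A))"
      using restrict_in_cfun by (fastforce simp: B_def)
    fix s xs assume s: "s \<in> S (length xs)" "set xs \<subseteq> carr (und B)"
    then have "map (\<lambda>x\<in>C. x) xs = xs" by (intro map_idI) (auto simp: B_def)
    then show "(\<lambda>x\<in>C. x) (opn B s xs) = opn A s (map (\<lambda>x\<in>C. x) xs)"
      using s closed by (simp add: B_def)
  qed
  moreover have "B \<in> models S E"
    by (rule models_reflect[where I = "{()}" and B = "\<lambda>_. A" and h = "\<lambda>_. \<lambda>x\<in>C. x", OF B])
      (use A \<open>(\<lambda>x\<in>C. x) \<in> alg_hom S B A\<close> in \<open>auto simp: B_def\<close>)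
  ultimately show thesis using that by (simp add: B_def)
qed

text \<open>The free algebra is generated by \<open>X\<close> inside the product of all algebras under \<open>X\<close>;
  the product is large but the generated subalgebra is small.\<close>

lemma ex_free:
  assumes X: "X \<in> Obj DCPO"
  shows "\<exists>A \<eta>. is_free S E X A \<eta>"
proof -
  have dX: "is_dcpo X" and sX: "sml (carr X)" using X by (simp_all add: Obj_DCPO small_TYPE)
  define I where "I = {(A, f). A \<in> models S E \<and> f \<in> carr (cfun X (und A))}"
  have I: "fst i \<in> models S E" "snd i \<in> carr (cfun X (und (fst i)))" "is_dcpo (und (fst i))" if "i \<in> I" for i
    using that models_dcpo by (auto simp: I_def)
  define P where "P = prod_dcpo I (\<lambda>i. und (fst i))"
  have dP: "is_dcpo P" unfolding P_def using I by (intro is_dcpo_prod_dcpo)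
  have proj: "continuous P (und (fst i)) (\<lambda>a. a i)" if "i \<in> I" for i
    unfolding P_def using I that by (intro continuous_proj)
  define op where "op s xs = (\<lambda>i\<in>I. opn (fst i) s (map (\<lambda>a. a i) xs))" for s and xs :: "('u algebra \<times> ('u \<Rightarrow> 'u) \<Rightarrow> 'u) list"
  have op: "sepcont P P n (op s)" if s: "s \<in> S n" for n s
  proof (rule sepcontI)
    fix xs assume xs: "length xs = n" "set xs \<subseteq> carr P"
    have "opn (fst i) s (map (\<lambda>a. a i) xs) \<in> carr (und (fst i))" if "i \<in> I" for i
      using xs s continuous_carr[OF proj[OF that]]
      by (intro algebra_closed[OF models_algebra[OF I(1)[OF that]]]) auto
    then show "op s xs \<in> carr P" by (simp add: op_def P_def)
  next
    fix xs ys assume xy: "Suc (length xs + length ys) = n" "set xs \<subseteq> carr P" "set ys \<subseteq> carr P"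
    show "continuous P P (\<lambda>x. op s (xs @ x # ys))"
      unfolding P_def
    proof (rule continuous_into_prod_dcpo)
      fix i assume i: "i \<in> I"
      have "continuous (und (fst i)) (und (fst i)) (\<lambda>x. opn (fst i) s (map (\<lambda>a. a i) xs @ x # map (\<lambda>a. a i) ys))"
        using xy s continuous_carr[OF proj[OF i]]
        by (intro sepcont_continuous[OF algebra_sepcont[OF models_algebra[OF I(1)[OF i]]]]) auto
      then show "continuous (prod_dcpo I (\<lambda>i. und (fst i))) (und (fst i)) (\<lambda>x. op s (xs @ x # ys) i)"
        using continuous_comp[OF proj[OF i] _ dP] i by (simp add: op_def P_def)
    qed (use I dP in \<open>auto simp: op_def P_def\<close>)
  qed
  define xh where "xh x = (\<lambda>i\<in>I. snd i x)" for x
  have xh: "continuous X P xh"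
    unfolding P_def using cfunD[OF I(2)] by (intro continuous_into_prod_dcpo dX I(3)) (auto simp: xh_def)
  \<comment> \<open>Finite stages of closing the image of \<open>X\<close> under the operations. As
    these are finitary, the union \<open>Y\<close> is closed under them, and it is small because
    every stage is.\<close>
  define Yn where "Yn = rec_nat (xh ` carr X) (\<lambda>_ Y. Y \<union> {op s xs | s xs. s \<in> S (length xs) \<and> set xs \<subseteq> Y})"
  have Yn: "Yn 0 = xh ` carr X" "Yn (Suc k) = Yn k \<union> {op s xs | s xs. s \<in> S (length xs) \<and> set xs \<subseteq> Yn k}" for k
    by (simp_all add: Yn_def)
  define Y where "Y = (\<Union>k. Yn k)"
  have sS: "sml (\<Union>n. S n)"
    using signature by (intro small_UNION[OF small_countable]) (auto simp: is_signature_def small_TYPE)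
  have "sml (Yn k)" for k
  proof (induction k)
    case 0
    show ?case unfolding Yn using small_image[OF sX] .
  next
    case (Suc k)
    have "{op s xs | s xs. s \<in> S (length xs) \<and> set xs \<subseteq> Yn k} \<subseteq> (\<lambda>(s, xs). op s xs) ` ((\<Union>n. S n) \<times> lists (Yn k))"
      by auto
    then show ?case unfolding Yn(2)
      by (intro small_Un Suc) (rule small_subset[OF small_image[OF small_Sigma[OF sS small_lists[OF Suc]]]])
  qed
  then have sY: "sml Y" unfolding Y_def by (intro small_UNION[OF small_countable]) auto
  have "Yn k \<subseteq> carr P" for k
  proof (induction k)
    case 0
    show ?case unfolding Yn using continuous_carr[OF xh] by blast
  next
    case (Suc k)
    then show ?case unfolding Yn(2) using sepcont_carr[OF op] by auto
  qed
  then have YP: "Y \<subseteq> carr P" by (auto simp: Y_def)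
  have mono: "Yn k \<subseteq> Yn l" if "k \<le> l" for k l
    using that by (rule lift_Suc_mono_le[rotated]) (simp add: Yn)
  have opY: "op s xs \<in> Y" if s: "s \<in> S (length xs)" "set xs \<subseteq> Y" for s xs
  proof -
    have "\<exists>k. set xs \<subseteq> Yn k" using s(2)
    proof (induction xs)
      case (Cons x xs)
      then obtain k l where "set xs \<subseteq> Yn k" "x \<in> Yn l" by (auto simp: Y_def)
      then have "set (x # xs) \<subseteq> Yn (max k l)" using mono[of k "max k l"] mono[of l "max k l"] by auto
      then show ?case by blast
    qed simp
    then obtain k where "set xs \<subseteq> Yn k" by blast
    then have "op s xs \<in> Yn (Suc k)" using s(1) unfolding Yn(2) by blast
    then show ?thesis unfolding Y_def by blast
  qed
  define Z where "Z = dcl P Y"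
  have YZ: "Y \<subseteq> Z" by (auto simp: Z_def intro: dcl.base)
  have ZP: "Z \<subseteq> carr P" unfolding Z_def by (rule dcl_subset_carr[OF YP])
  have Z: "dclosed P Z" unfolding Z_def by (rule dclosed_dcl)
  \<comment> \<open>An operation maps \<open>Y\<close> into itself and is continuous in each
    argument, so it maps the closure into itself.\<close>
  have opZ: "op s xs \<in> Z" if s: "s \<in> S (length xs)" "set xs \<subseteq> Z" for s xs
  proof (rule dcl_lists_induct[where n = "length xs" and Y = Y and P = P, OF YP])
    show "dclosed P {z \<in> carr P. op s (us @ z # vs) \<in> Z}"
      if "set us \<subseteq> dcl P Y" "set vs \<subseteq> dcl P Y" "Suc (length us + length vs) = length xs" for us vs
      using that ZP s(1) by (intro dclosed_preimage[OF _ dP Z] sepcont_continuous[OF op]) (auto simp: Z_def)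
    show "op s ys \<in> Z" if "set ys \<subseteq> Y" "length ys = length xs" for ys
      using opY[of s ys] that s YZ by auto
  qed (use s in \<open>auto simp: Z_def\<close>)
  define Q where "Q = sub_dcpo P Z"
  have dQ: "is_dcpo Q" unfolding Q_def by (rule is_dcpo_sub_dcpo[OF dP Z ZP])
  have sQ: "sml (carr Q)" using small_dcl[OF dP YP sY] by (simp add: Q_def Z_def)
  have opQ: "sepcont Q Q n (op s)" if "s \<in> S n" for n s
    unfolding Q_def using opZ that by (intro sepcont_sub_dcpo dP Z ZP op) auto
  have "\<exists>(A :: 'u algebra) g k. is_algebra S A \<and> continuous Q (und A) g \<and> continuous (und A) Q k \<and>
    (\<forall>x\<in>carr Q. k (g x) = x) \<and> (\<forall>x\<in>carr (und A). g (k x) = x) \<and>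
    (\<forall>s xs. s \<in> S (length xs) \<longrightarrow> set xs \<subseteq> carr Q \<longrightarrow> opn A s (map g xs) = g (op s xs)) \<and>
    (\<forall>s xs. s \<in> S (length xs) \<longrightarrow> set xs \<subseteq> carr (und A) \<longrightarrow> opn A s xs = g (op s (map k xs)))"
    by (rule transport_algebra[OF dQ sQ opQ])
  then obtain A g k where A0: "is_algebra S A" "continuous Q (und A) g" "continuous (und A) Q k"
    "\<forall>x\<in>carr Q. k (g x) = x" "\<forall>x\<in>carr (und A). g (k x) = x"
    "\<forall>s xs. s \<in> S (length xs) \<longrightarrow> set xs \<subseteq> carr Q \<longrightarrow> opn A s (map g xs) = g (op s xs)"
    "\<forall>s xs. s \<in> S (length xs) \<longrightarrow> set xs \<subseteq> carr (und A) \<longrightarrow> opn A s xs = g (op s (map k xs))"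
    by (elim exE conjE)
  note A = A0[rule_format]
  note dA = algebra_dcpo[OF A(1)]
  have kZ: "k a \<in> Z" if "a \<in> carr (und A)" for a
    using continuous_carr[OF A(3) that] by (simp add: Q_def)
  \<comment> \<open>The projections of the generated algebra: \<open>h (B, f)\<close> is the
    homomorphism extending \<open>f\<close>, and jointly the projections reflect the order, which is
    pointwise.\<close>
  define h where "h i = (\<lambda>a\<in>carr (und A). k a i)" for i
  have projQ: "continuous Q (und (fst i)) (\<lambda>a. a i)" if "i \<in> I" for i
    unfolding Q_def by (rule continuous_from_sub_dcpo[OF dP Z ZP proj[OF that]])
  have h: "h i \<in> alg_hom S A (fst i)" if i: "i \<in> I" for i
  proof (rule alg_homI)
    show "h i \<in> carr (cfun (und A) (und (fst i)))"
      unfolding h_def by (intro restrict_in_cfun continuous_comp[OF A(3) projQ[OF i] dA])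
    fix s xs assume s: "s \<in> S (length xs)" "set xs \<subseteq> carr (und A)"
    have kxs: "set (map k xs) \<subseteq> Z" using s kZ by auto
    have "h i (opn A s xs) = k (g (op s (map k xs))) i"
      using algebra_closed[OF A(1) s] A(7)[OF s] by (simp add: h_def)
    also have "\<dots> = op s (map k xs) i"
      using A(4) opZ[of s "map k xs"] kxs s by (simp add: Q_def)
    also have "\<dots> = opn (fst i) s (map (\<lambda>a. k a i) xs)" using i by (simp add: op_def comp_def)
    also have "map (\<lambda>a. k a i) xs = map (h i) xs" using s by (auto simp: h_def)
    finally show "h i (opn A s xs) = opn (fst i) s (map (h i) xs)" .
  qed
  have model: "A \<in> models S E"
  proof (rule models_reflect[where I = I and B = fst and h = h, OF A(1)])
    fix x y assume xy: "x \<in> carr (und A)" "y \<in> carr (und A)" "\<And>i. i \<in> I \<Longrightarrow> (h i x, h i y) \<in> leq (und (fst i))"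
    have "k x \<in> carr P" "k y \<in> carr P" using xy kZ ZP by blast+
    then have "(k x, k y) \<in> leq P"
      using xy by (simp add: P_def leq_prod_dcpo h_def)
    then have "(k x, k y) \<in> leq Q" using kZ xy by (simp add: Q_def)
    then have "(g (k x), g (k y)) \<in> leq (und A)" by (rule continuous_mono[OF A(2) dQ])
    then show "(x, y) \<in> leq (und A)" using A(5) xy by simp
  qed (use I h in auto)
  have xhY: "xh x \<in> Y" if "x \<in> carr X" for x
    using that unfolding Y_def using Yn(1) by blast
  define \<eta> where "\<eta> = (\<lambda>x\<in>carr X. g (xh x))"
  have xhQ: "continuous X Q xh"
    unfolding Q_def using xhY YZ by (intro continuous_into_sub_dcpo dX dP Z ZP xh) auto
  have \<eta>: "\<eta> \<in> carr (cfun X (und A))"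
    unfolding \<eta>_def by (intro restrict_in_cfun continuous_comp[OF xhQ A(2) dX])
  have "\<exists>!m. m \<in> alg_hom S A B \<and> (\<forall>x\<in>carr X. m (\<eta> x) = f x)"
    if B: "B \<in> models S E" and f: "f \<in> carr (cfun X (und B))" for B f
  proof (rule ex1I)
    have i: "(B, f) \<in> I" using B f by (simp add: I_def)
    have "h (B, f) (\<eta> x) = f x" if x: "x \<in> carr X" for x
    proof -
      have "xh x \<in> carr Q" using xhQ x continuous_carr by metis
      moreover have "\<eta> x \<in> carr (und A)" by (rule cfun_carr[OF \<eta> x])
      ultimately show ?thesis using i x A(4) by (simp add: h_def \<eta>_def xh_def)
    qed
    then show "h (B, f) \<in> alg_hom S A B \<and> (\<forall>x\<in>carr X. h (B, f) (\<eta> x) = f x)"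
      using h[OF i] by simp
    fix m assume m: "m \<in> alg_hom S A B \<and> (\<forall>x\<in>carr X. m (\<eta> x) = f x)"
    let ?n = "h (B, f)"
    have n: "?n \<in> alg_hom S A B" using h[OF i] by simp
    have YQ: "Y \<subseteq> carr Q" using YZ by (simp add: Q_def)
    \<comment> \<open>Uniqueness follows the generation: agreement on \<open>X\<close> passes to
      every stage, hence to \<open>Y\<close>, and by continuity to the closure.\<close>
    have "\<forall>y\<in>Yn j. m (g y) = ?n (g y)" for j
    proof (induction j)
      case 0
      have "m (g (xh x)) = ?n (g (xh x))" if "x \<in> carr X" for x
        using m \<open>\<And>x. x \<in> carr X \<Longrightarrow> h (B, f) (\<eta> x) = f x\<close>[OF that] that by (simp add: \<eta>_def)
      then show ?case by (auto simp: Yn)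
    next
      case (Suc j)
      have "m (g (op s xs)) = ?n (g (op s xs))" if s: "s \<in> S (length xs)" "set xs \<subseteq> Yn j" for s xs
      proof -
        have xs: "set xs \<subseteq> carr Q" using s(2) YQ by (auto simp: Y_def)
        then have gxs: "set (map g xs) \<subseteq> carr (und A)" using continuous_carr[OF A(2)] by auto
        have "m (g (op s xs)) = opn B s (map m (map g xs))"
          using alg_hom_op[of m S A B s "map g xs"] m gxs s A(6)[OF s(1) xs] by simp
        also have "map m (map g xs) = map ?n (map g xs)" using Suc s(2) by auto
        also have "opn B s (map ?n (map g xs)) = ?n (g (op s xs))"
          using alg_hom_op[OF n, of s "map g xs"] gxs s A(6)[OF s(1) xs] by simp
        finally show ?thesis .
      qed
      then show ?case using Suc unfolding Yn(2) by blast
    qed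
    then have onY: "m (g y) = ?n (g y)" if "y \<in> Y" for y using that by (auto simp: Y_def)
    have "m (g z) = ?n (g z)" if "z \<in> dcl Q Y" for z
    proof (rule eq_on_dcl[OF models_dcpo[OF B] _ _ YQ onY that])
      show "continuous Q (und B) (\<lambda>z. m (g z))"
        by (rule continuous_comp[OF A(2) alg_hom_continuous dQ]) (use m in blast)
      show "continuous Q (und B) (\<lambda>z. ?n (g z))"
        by (rule continuous_comp[OF A(2) alg_hom_continuous[OF n] dQ])
    qed
    then have "m (g z) = ?n (g z)" if "z \<in> Z" for z
      using that dcl_sub_dcpo[OF dP YP] by (simp add: Q_def Z_def)
    then have "m a = ?n a" if "a \<in> carr (und A)" for a
      using kZ[OF that] A(5)[OF that] by metis
    then show "m = ?n"
      using m n by (intro cfun_eqI[of m "und A" "und B" _ "und B"]) (auto dest: alg_hom_cfun)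
  qed
  then have "is_free S E X A \<eta>" unfolding is_free_def using model \<eta> by blast
  then show ?thesis by blast
qed

end

text \<open>The choice of free algebras is a parameter, so that the results apply to an arbitrary
  left adjoint and also to a given monad whose values are shown to be free.\<close>

locale free_algebras = variety U S E for U :: "'u itself" and S E +
  fixes T :: "'u dcpo \<Rightarrow> 'u algebra" and eta :: "'u dcpo \<Rightarrow> 'u \<Rightarrow> 'u"
  assumes free: "X \<in> Obj DCPO \<Longrightarrow> is_free S E X (T X) (eta X)"
begin

abbreviation TO :: "'u dcpo \<Rightarrow> 'u dcpo" where "TO X \<equiv> und (T X)"

definition ext :: "'u dcpo \<Rightarrow> 'u algebra \<Rightarrow> ('u \<Rightarrow> 'u) \<Rightarrow> 'u \<Rightarrow> 'u" where
  "ext X B f = (THE h. h \<in> alg_hom S (T X) B \<and> (\<forall>x\<in>carr X. h (eta X x) = f x))"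

definition TA :: "'u dcpo \<Rightarrow> 'u dcpo \<Rightarrow> ('u \<Rightarrow> 'u) \<Rightarrow> 'u \<Rightarrow> 'u" where
  "TA X Y f = ext X (T Y) (compose (carr X) (eta Y) f)"

definition mu :: "'u dcpo \<Rightarrow> 'u \<Rightarrow> 'u" where
  "mu X = ext (TO X) (T X) (\<lambda>x\<in>carr (TO X). x)"

lemma T_models: "X \<in> Obj DCPO \<Longrightarrow> T X \<in> models S E"
  and eta_cfun: "X \<in> Obj DCPO \<Longrightarrow> eta X \<in> carr (cfun X (TO X))"
  using free unfolding is_free_def by blast+

lemma T_algebra: "X \<in> Obj DCPO \<Longrightarrow> is_algebra S (T X)"
  using T_models models_algebra by blast

lemma TO_Obj: "X \<in> Obj DCPO \<Longrightarrow> TO X \<in> Obj DCPO"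
  using T_models models_Obj by blast

lemma TO_dcpo: "X \<in> Obj DCPO \<Longrightarrow> is_dcpo (TO X)"
  using TO_Obj is_dcpo_Obj by blast

lemma eta_carr: "X \<in> Obj DCPO \<Longrightarrow> x \<in> carr X \<Longrightarrow> eta X x \<in> carr (TO X)"
  using eta_cfun cfun_carr by metis

lemma ext:
  assumes "X \<in> Obj DCPO" "B \<in> models S E" "f \<in> carr (cfun X (und B))"
  shows ext_hom: "ext X B f \<in> alg_hom S (T X) B"
    and ext_eta: "x \<in> carr X \<Longrightarrow> ext X B f (eta X x) = f x"
proof -
  have "\<exists>!h. h \<in> alg_hom S (T X) B \<and> (\<forall>x\<in>carr X. h (eta X x) = f x)"
    using free[OF assms(1)] assms unfolding is_free_def by blast
  from theI'[OF this] show "ext X B f \<in> alg_hom S (T X) B" "x \<in> carr X \<Longrightarrow> ext X B f (eta X x) = f x"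
    unfolding ext_def by blast+
qed

lemma hom_eqI:
  assumes "X \<in> Obj DCPO" "B \<in> models S E" "h \<in> alg_hom S (T X) B" "h' \<in> alg_hom S (T X) B"
    "\<And>x. x \<in> carr X \<Longrightarrow> h (eta X x) = h' (eta X x)"
  shows "h = h'"
proof -
  let ?f = "compose (carr X) h' (eta X)"
  have "?f \<in> carr (cfun X (und B))"
    using assms by (intro compose_in_cfun[of _ _ "TO X"] eta_cfun alg_hom_cfun is_dcpo_Obj)
  then have "\<exists>!h. h \<in> alg_hom S (T X) B \<and> (\<forall>x\<in>carr X. h (eta X x) = ?f x)"
    using free[OF assms(1)] assms(2) unfolding is_free_def by blast
  moreover have "\<forall>x\<in>carr X. h (eta X x) = ?f x" "\<forall>x\<in>carr X. h' (eta X x) = ?f x"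
    using assms(5) by auto
  ultimately show ?thesis using assms(3,4) by blast
qed

lemma ext_unique:
  assumes "X \<in> Obj DCPO" "B \<in> models S E" "h \<in> alg_hom S (T X) B"
    "f \<in> carr (cfun X (und B))" "\<And>x. x \<in> carr X \<Longrightarrow> h (eta X x) = f x"
  shows "h = ext X B f"
  using assms by (intro hom_eqI[OF assms(1-3)] ext_hom) (auto simp: ext_eta)

text \<open>The extension of \<open>eta X\<close> into the subalgebra on \<open>C\<close>, followed
  by the inclusion, fixes the generators and hence is the identity.\<close>

lemma T_induct:
  assumes X: "X \<in> Obj DCPO" and C: "C \<subseteq> carr (TO X)" "dclosed (TO X) C"
    and eta: "\<And>x. x \<in> carr X \<Longrightarrow> eta X x \<in> C"
    and closed: "\<And>s xs. s \<in> S (length xs) \<Longrightarrow> set xs \<subseteq> C \<Longrightarrow> opn (T X) s xs \<in> C"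
  shows "C = carr (TO X)"
proof -
  obtain B where B: "B \<in> models S E" "und B = sub_dcpo (TO X) C" "(\<lambda>x\<in>C. x) \<in> alg_hom S B (T X)"
    using subalgebra[OF T_models[OF X] C closed] .
  have "continuous X (sub_dcpo (TO X) C) (eta X)"
    using eta by (intro continuous_into_sub_dcpo is_dcpo_Obj[OF X] TO_dcpo[OF X] C cfunD[OF eta_cfun[OF X]]) auto
  then have eB: "eta X \<in> carr (cfun X (und B))"
    using eta_cfun[OF X] eta by (auto simp: carr_cfun B(2) PiE_iff)
  have "compose (carr (TO X)) (\<lambda>x\<in>C. x) (ext X B (eta X)) = (\<lambda>x\<in>carr (TO X). x)"
  proof (rule hom_eqI[OF X T_models[OF X]])
    show "compose (carr (TO X)) (\<lambda>x\<in>C. x) (ext X B (eta X)) \<in> alg_hom S (T X) (T X)"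
      by (rule alg_hom_compose[OF T_algebra[OF X] ext_hom[OF X B(1) eB] B(3)])
    show "(\<lambda>x\<in>carr (TO X). x) \<in> alg_hom S (T X) (T X)" by (rule alg_hom_ident[OF T_algebra[OF X]])
  qed (use ext_eta[OF X B(1) eB] eta eta_carr[OF X] in auto)
  then have "x \<in> C" if x: "x \<in> carr (TO X)" for x
    using x alg_hom_carr[OF ext_hom[OF X B(1) eB] x] by (auto simp: B(2) compose_def fun_eq_iff split: if_splits)
  then show ?thesis using C(1) by blast
qed

text \<open>The points \<open>z\<close> at which \<open>ext X B f z\<close> depends continuously on
  \<open>f\<close> form a subalgebra containing the generators, so \<open>T_induct\<close> applies.
  This is the source of the local continuity of the free-algebra monad.\<close>

lemma continuous_ext:
  assumes X: "X \<in> Obj DCPO" and B: "B \<in> models S E"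
  shows "continuous (cfun X (und B)) (cfun (TO X) (und B)) (ext X B)"
proof (rule continuous_into_cfun)
  note dB = models_dcpo[OF B] and dX = is_dcpo_Obj[OF X]
  note dc = is_dcpo_cfun[OF dB, of X]
  show "is_dcpo (cfun X (und B))" "is_dcpo (und B)" by fact+
  show "ext X B f \<in> carr (cfun (TO X) (und B))" if "f \<in> carr (cfun X (und B))" for f
    by (rule alg_hom_cfun[OF ext_hom[OF X B that]])
  fix z assume z: "z \<in> carr (TO X)"
  have ext_c: "continuous (TO X) (und B) (ext X B f)" if "f \<in> carr (cfun X (und B))" for f
    by (rule alg_hom_continuous[OF ext_hom[OF X B that]])
  have "{z \<in> carr (TO X). continuous (cfun X (und B)) (und B) (\<lambda>f. ext X B f z)} = carr (TO X)"
  proof (rule T_induct[OF X])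
    show "dclosed (TO X) {z \<in> carr (TO X). continuous (cfun X (und B)) (und B) (\<lambda>f. ext X B f z)}"
      unfolding dclosed_def
    proof (intro allI impI)
      fix D z assume D: "directed (TO X) D"
        "D \<subseteq> {z \<in> carr (TO X). continuous (cfun X (und B)) (und B) (\<lambda>f. ext X B f z)}" "is_join (TO X) D z"
      have j: "is_join (und B) (ext X B f ` D) (ext X B f z)" if "f \<in> carr (cfun X (und B))" for f
        by (rule continuous_join[OF ext_c[OF that] D(1,3)])
      have Dc: "continuous (cfun X (und B)) (und B) (\<lambda>f. ext X B f d)" if "d \<in> D" for d
        using D(2) that by blast
      \<comment> \<open>The value at \<open>z\<close> is the join of the values at the members of
        \<open>D\<close>, and joins over \<open>D\<close> and over directed sets of maps
        commute.\<close>
      have "continuous (cfun X (und B)) (und B) (\<lambda>f. ext X B f z)"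
      proof (rule continuousI)
        show "ext X B f z \<in> carr (und B)" if "f \<in> carr (cfun X (und B))" for f
          using is_join_carr[OF j[OF that]] .
        show "(ext X B f z, ext X B f' z) \<in> leq (und B)" if ff: "(f, f') \<in> leq (cfun X (und B))" for f f'
        proof (rule is_join_least[OF j])
          show "f \<in> carr (cfun X (und B))" using dcpo_leq_carr[OF dc ff] by blast
          have fc': "f' \<in> carr (cfun X (und B))" using dcpo_leq_carr[OF dc ff] by blast
          show "ext X B f' z \<in> carr (und B)" using is_join_carr[OF j[OF fc']] .
          fix p assume "p \<in> ext X B f ` D"
          then obtain d where d: "d \<in> D" "p = ext X B f d" by blast
          have "(ext X B f d, ext X B f' d) \<in> leq (und B)"
            by (rule continuous_mono[OF Dc[OF d(1)] dc ff])
          moreover have "(ext X B f' d, ext X B f' z) \<in> leq (und B)"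
            by (rule is_join_ub[OF j[OF fc']]) (use d in blast)
          ultimately show "(p, ext X B f' z) \<in> leq (und B)" using d dcpo_trans[OF dB] by blast
        qed
        fix F f q assume F: "directed (cfun X (und B)) F" "is_join (cfun X (und B)) F f" and q: "q \<in> carr (und B)"
          "\<And>g. g \<in> F \<Longrightarrow> (ext X B g z, q) \<in> leq (und B)"
        show "(ext X B f z, q) \<in> leq (und B)"
        proof (rule is_join_least[OF j[OF is_join_carr[OF F(2)]] q(1)])
          fix p assume "p \<in> ext X B f ` D"
          then obtain d where d: "d \<in> D" "p = ext X B f d" by blast
          have "(ext X B f d, q) \<in> leq (und B)"
          proof (rule is_join_least[OF continuous_join[OF Dc[OF d(1)] F] q(1)])
            fix p assume "p \<in> (\<lambda>f. ext X B f d) ` F"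
            then obtain g where g: "g \<in> F" "p = ext X B g d" by blast
            have "(ext X B g d, ext X B g z) \<in> leq (und B)"
              by (rule is_join_ub[OF j[OF directed_carr[OF F(1) g(1)]]]) (use d in blast)
            then show "(p, q) \<in> leq (und B)" using g q(2)[OF g(1)] dcpo_trans[OF dB] by blast
          qed
          then show "(p, q) \<in> leq (und B)" using d by simp
        qed
      qed
      then show "z \<in> {z \<in> carr (TO X). continuous (cfun X (und B)) (und B) (\<lambda>f. ext X B f z)}"
        using is_join_carr[OF D(3)] by blast
    qed
    show "eta X x \<in> {z \<in> carr (TO X). continuous (cfun X (und B)) (und B) (\<lambda>f. ext X B f z)}"
      if x: "x \<in> carr X" for x
    proof -
      have "continuous (cfun X (und B)) (und B) (\<lambda>f. ext X B f (eta X x))"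
        by (rule continuous_cong[OF continuous_eval[OF dB x]]) (simp add: ext_eta[OF X B _ x])
      then show ?thesis using eta_carr[OF X x] by simp
    qed
    show "opn (T X) s xs \<in> {z \<in> carr (TO X). continuous (cfun X (und B)) (und B) (\<lambda>f. ext X B f z)}"
      if s: "s \<in> S (length xs)" and xs: "set xs \<subseteq> {z \<in> carr (TO X). continuous (cfun X (und B)) (und B) (\<lambda>f. ext X B f z)}" for s xs
    proof -
      have xs': "set xs \<subseteq> carr (TO X)" using xs by blast
      have "continuous (cfun X (und B)) (power_dcpo (und B) (length xs))
        (\<lambda>f. map (\<lambda>g. g f) (map (\<lambda>z f. ext X B f z) xs))"
        using xs by (intro continuous_into_power_dcpo dc dB) auto
      then have "continuous (cfun X (und B)) (und B) (\<lambda>f. opn B s (map (\<lambda>g. g f) (map (\<lambda>z f. ext X B f z) xs)))"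
        by (rule continuous_comp[OF _ algebra_continuous[OF models_algebra[OF B] s] dc])
      then have "continuous (cfun X (und B)) (und B) (\<lambda>f. ext X B f (opn (T X) s xs))"
        by (rule continuous_cong) (simp add: alg_hom_op[OF ext_hom[OF X B] s xs'] comp_def)
      then show ?thesis using algebra_closed[OF T_algebra[OF X] s xs'] by simp
    qed
  qed blast
  then show "continuous (cfun X (und B)) (und B) (\<lambda>f. ext X B f z)" using z by blast
qed

end

section \<open>The free-algebra monad\<close>

context free_algebras
begin

lemma compose_eta: "X \<in> Obj DCPO \<Longrightarrow> Y \<in> Obj DCPO \<Longrightarrow> f \<in> carr (cfun X Y) \<Longrightarrow>
    compose (carr X) (eta Y) f \<in> carr (cfun X (TO Y))"
  by (intro compose_in_cfun[of _ _ Y] eta_cfun is_dcpo_Obj)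

lemma TA_hom: "X \<in> Obj DCPO \<Longrightarrow> Y \<in> Obj DCPO \<Longrightarrow> f \<in> carr (cfun X Y) \<Longrightarrow> TA X Y f \<in> alg_hom S (T X) (T Y)"
  unfolding TA_def by (intro ext_hom T_models compose_eta)

lemma TA_cfun: "X \<in> Obj DCPO \<Longrightarrow> Y \<in> Obj DCPO \<Longrightarrow> f \<in> carr (cfun X Y) \<Longrightarrow> TA X Y f \<in> carr (cfun (TO X) (TO Y))"
  by (rule alg_hom_cfun[OF TA_hom])

lemma TA_carr: "X \<in> Obj DCPO \<Longrightarrow> Y \<in> Obj DCPO \<Longrightarrow> f \<in> carr (cfun X Y) \<Longrightarrow> z \<in> carr (TO X) \<Longrightarrow> TA X Y f z \<in> carr (TO Y)"
  by (rule alg_hom_carr[OF TA_hom])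

lemma TA_eta: "X \<in> Obj DCPO \<Longrightarrow> Y \<in> Obj DCPO \<Longrightarrow> f \<in> carr (cfun X Y) \<Longrightarrow> x \<in> carr X \<Longrightarrow>
    TA X Y f (eta X x) = eta Y (f x)"
  unfolding TA_def by (simp add: ext_eta[OF _ T_models compose_eta])

lemma compose_TA:
  assumes "X \<in> Obj DCPO" "Y \<in> Obj DCPO" "Z \<in> Obj DCPO" "f \<in> carr (cfun X Y)" "g \<in> carr (cfun Y Z)"
  shows "compose (carr (TO X)) (TA Y Z g) (TA X Y f) = TA X Z (compose (carr X) g f)"
proof (rule hom_eqI[OF assms(1) T_models[OF assms(3)]])
  have gf: "compose (carr X) g f \<in> carr (cfun X Z)"
    using assms by (intro compose_in_cfun[of _ _ Y] is_dcpo_Obj)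
  show "compose (carr (TO X)) (TA Y Z g) (TA X Y f) \<in> alg_hom S (T X) (T Z)"
    using assms by (intro alg_hom_compose[of S _ _ "T Y"] T_algebra TA_hom)
  show "TA X Z (compose (carr X) g f) \<in> alg_hom S (T X) (T Z)"
    using assms gf by (intro TA_hom)
  show "compose (carr (TO X)) (TA Y Z g) (TA X Y f) (eta X x) = TA X Z (compose (carr X) g f) (eta X x)"
    if x: "x \<in> carr X" for x
    using x assms gf by (simp add: eta_carr TA_eta cfun_carr)
qed

lemma TA_TA:
  assumes "X \<in> Obj DCPO" "Y \<in> Obj DCPO" "Z \<in> Obj DCPO" "f \<in> carr (cfun X Y)" "g \<in> carr (cfun Y Z)" "z \<in> carr (TO X)"
  shows "TA Y Z g (TA X Y f z) = TA X Z (compose (carr X) g f) z"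
  using compose_TA[OF assms(1-5)] assms(6) by (metis compose_apply)

lemma TA_ident: "X \<in> Obj DCPO \<Longrightarrow> TA X X (\<lambda>x\<in>carr X. x) = (\<lambda>z\<in>carr (TO X). z)"
  by (rule hom_eqI[OF _ T_models])
    (auto intro!: TA_hom alg_hom_ident T_algebra ident_in_cfun simp: TA_eta[OF _ _ ident_in_cfun] eta_carr)

lemma continuous_TA:
  assumes "X \<in> Obj DCPO" "Y \<in> Obj DCPO"
  shows "continuous (cfun X Y) (cfun (TO X) (TO Y)) (TA X Y)"
  unfolding TA_def
  using assms by (intro continuous_comp[OF continuous_compose_left continuous_ext] eta_cfun is_dcpo_Obj TO_Obj T_models is_dcpo_cfun)

lemma mu_hom: "X \<in> Obj DCPO \<Longrightarrow> mu X \<in> alg_hom S (T (TO X)) (T X)"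
  unfolding mu_def by (intro ext_hom TO_Obj T_models ident_in_cfun)

lemma mu_eta: "X \<in> Obj DCPO \<Longrightarrow> z \<in> carr (TO X) \<Longrightarrow> mu X (eta (TO X) z) = z"
  unfolding mu_def by (simp add: ext_eta[OF TO_Obj T_models ident_in_cfun])

lemma mu_carr: "X \<in> Obj DCPO \<Longrightarrow> z \<in> carr (TO (TO X)) \<Longrightarrow> mu X z \<in> carr (TO X)"
  by (rule alg_hom_carr[OF mu_hom])

lemma mu_natural:
  assumes X: "X \<in> Obj DCPO" and Y: "Y \<in> Obj DCPO" and f: "f \<in> carr (cfun X Y)"
  shows "compose (carr (TO (TO X))) (mu Y) (TA (TO X) (TO Y) (TA X Y f)) = compose (carr (TO (TO X))) (TA X Y f) (mu X)"
proof (rule hom_eqI[OF TO_Obj[OF X] T_models[OF Y]])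
  note TX = TO_Obj[OF X] and TY = TO_Obj[OF Y]
  note Tf = TA_cfun[OF X Y f]
  show "compose (carr (TO (TO X))) (mu Y) (TA (TO X) (TO Y) (TA X Y f)) \<in> alg_hom S (T (TO X)) (T Y)"
    by (rule alg_hom_compose[OF T_algebra[OF TX] TA_hom[OF TX TY Tf] mu_hom[OF Y]])
  show "compose (carr (TO (TO X))) (TA X Y f) (mu X) \<in> alg_hom S (T (TO X)) (T Y)"
    by (rule alg_hom_compose[OF T_algebra[OF TX] mu_hom[OF X] TA_hom[OF X Y f]])
qed (use assms in \<open>simp add: eta_carr TO_Obj TA_eta TA_cfun mu_eta TA_carr\<close>)

lemma mu_unit:
  assumes X: "X \<in> Obj DCPO"
  shows "compose (carr (TO X)) (mu X) (TA X (TO X) (eta X)) = (\<lambda>z\<in>carr (TO X). z)"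
proof (rule hom_eqI[OF X T_models[OF X]])
  note TX = TO_Obj[OF X]
  show "compose (carr (TO X)) (mu X) (TA X (TO X) (eta X)) \<in> alg_hom S (T X) (T X)"
    by (rule alg_hom_compose[OF T_algebra[OF X] TA_hom[OF X TX eta_cfun[OF X]] mu_hom[OF X]])
qed (use assms in \<open>simp_all add: eta_carr TO_Obj TA_eta eta_cfun mu_eta alg_hom_ident T_algebra\<close>)

text \<open>Both sides are homomorphisms on a free algebra that agree on generators. Taking
  \<open>a = mu X\<close> gives associativity of the monad; taking the structure map of a model
  gives its Eilenberg--Moore law.\<close>

lemma mu_assoc:
  assumes X: "X \<in> Obj DCPO" and A: "A \<in> models S E" and a: "a \<in> alg_hom S (T (und A)) A"
    "\<And>x. x \<in> carr (und A) \<Longrightarrow> a (eta (und A) x) = x"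
  shows "compose (carr (TO (TO (und A)))) a (mu (und A)) = compose (carr (TO (TO (und A)))) a (TA (TO (und A)) (und A) a)"
proof -
  note X = models_Obj[OF A] and TX = TO_Obj[OF models_Obj[OF A]]
  show ?thesis
  proof (rule hom_eqI[OF TX A])
    show "compose (carr (TO (TO (und A)))) a (mu (und A)) \<in> alg_hom S (T (TO (und A))) A"
      by (rule alg_hom_compose[OF T_algebra[OF TX] mu_hom[OF X] a(1)])
    show "compose (carr (TO (TO (und A)))) a (TA (TO (und A)) (und A) a) \<in> alg_hom S (T (TO (und A))) A"
      by (rule alg_hom_compose[OF T_algebra[OF TX] TA_hom[OF TX X alg_hom_cfun[OF a(1)]] a(1)])
    show "compose (carr (TO (TO (und A)))) a (mu (und A)) (eta (TO (und A)) z) =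
        compose (carr (TO (TO (und A)))) a (TA (TO (und A)) (und A) a) (eta (TO (und A)) z)"
      if "z \<in> carr (TO (und A))" for z
      using that X TX a(2) alg_hom_carr[OF a(1)]
      by (simp add: eta_carr mu_eta TA_eta alg_hom_cfun[OF a(1)])
  qed
qed

text \<open>Values of the functor outside \<open>DCPO\<close> and on functions that are not
  morphisms stay open, as functors are total HOL functions; unit and multiplication are extensional,
  as natural transformations are.\<close>

definition is_free_monad :: "'u dcpo_monad \<Rightarrow> bool" where
  "is_free_monad M \<longleftrightarrow> unit M \<in> extensional (Obj DCPO) \<and> mult M \<in> extensional (Obj DCPO) \<and>
     (\<forall>X\<in>Obj DCPO. FObj (Fun M) X = TO X \<and> unit M X = eta X \<and> mult M X = mu X \<and>
       (\<forall>Y\<in>Obj DCPO. \<forall>f\<in>carr (cfun X Y). FArr (Fun M) X Y f = TA X Y f))"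

lemma is_free_monadD:
  assumes "is_free_monad M" "X \<in> Obj DCPO"
  shows "FObj (Fun M) X = TO X" "unit M X = eta X" "mult M X = mu X"
    "Y \<in> Obj DCPO \<Longrightarrow> f \<in> carr (cfun X Y) \<Longrightarrow> FArr (Fun M) X Y f = TA X Y f"
  using assms unfolding is_free_monad_def by blast+

lemma enriched_free_monad:
  assumes M: "is_free_monad M"
  shows "enriched_monad M"
proof -
  note M' = is_free_monadD[OF M]
  have is_fun: "is_functor DCPO DCPO (Fun M)"
    unfolding is_functor_def Hom_DCPO Ide_DCPO Comp_DCPO
    by (auto simp: M' TO_Obj ident_in_cfun TA_ident compose_TA intro!: TA_cfun)
      (simp add: M' compose_TA compose_in_cfun[OF _ _ is_dcpo_Obj])
  have "continuous (cfun X Y) (cfun (FObj (Fun M) X) (FObj (Fun M) Y)) (FArr (Fun M) X Y)"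
    if "X \<in> Obj DCPO" "Y \<in> Obj DCPO" for X Y
    using that by (simp add: M') (rule continuous_cong[OF continuous_TA[OF that]], simp add: M')
  then have "enriched_endofunctor (Fun M)"
    using is_fun by (simp add: enriched_endofunctor_def hom_dcpo_eq)
  moreover have "nat_trans DCPO DCPO id_functor (Fun M) (unit M)"
    unfolding nat_trans_def Hom_DCPO Comp_DCPO id_functor_def
    using M by (auto simp: M' is_free_monad_def PiE_iff eta_cfun compose_def TA_eta fun_eq_iff)
  moreover have "nat_trans DCPO DCPO (Fun M \<odot> Fun M) (Fun M) (mult M)"
    unfolding nat_trans_def Hom_DCPO Comp_DCPO comp_functor_def
    using M by (auto simp: M' is_free_monad_def PiE_iff TO_Obj TA_cfun mu_natural alg_hom_cfun[OF mu_hom])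
  moreover have "compose (carr (TO X)) (mu X) (eta (TO X)) = (\<lambda>x\<in>carr (TO X). x)" if "X \<in> Obj DCPO" for X
    using that by (auto simp: compose_def mu_eta fun_eq_iff)
  moreover have "compose (carr (TO (TO (TO X)))) (mu X) (mu (TO X)) = compose (carr (TO (TO (TO X)))) (mu X) (TA (TO (TO X)) (TO X) (mu X))"
    if "X \<in> Obj DCPO" for X
    using that by (intro mu_assoc mu_hom T_models mu_eta)
  ultimately show ?thesis
    unfolding enriched_monad_def is_monad_def
    using is_fun by (simp add: M' TO_Obj eta_cfun mu_unit Comp_DCPO Ide_DCPO Let_def alg_hom_cfun[OF mu_hom])
qed

end

section \<open>Adjunctions and free algebras\<close>

definition variety_of :: "'u signature \<Rightarrow> ('u ext_trm \<times> 'u ext_trm) set \<Rightarrow> 'u alg_category" where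
  "variety_of S E = full_subcategory (Alg S) (models S E)"

lemma variety_of_eq: "full_subcategory (Alg S) {A \<in> Obj (Alg S). \<forall>e\<in>E. satisfies A e} = variety_of S E"
  by (simp add: variety_of_def models_def Obj_Alg)

lemma variety_of_simps [simp]:
  "Obj (variety_of S E) = models S E" "Hom (variety_of S E) A B = alg_hom S A B"
  "Ide (variety_of S E) A = (\<lambda>x\<in>carr (und A). x)"
  "Comp (variety_of S E) A B C g f = compose (carr (und A)) g f"
  using Comp_Alg[of S A B C g f] Ide_Alg[of S A]
  by (simp_all add: variety_of_def full_subcategory_def)

lemma forget_simps [simp]: "FObj forget A = und A" "FArr forget A B h = h"
  by (simp_all add: forget_def)

lemma comp_functor_simps [simp]:
  "FObj (G \<odot> F) X = FObj G (FObj F X)"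
  "FArr (G \<odot> F) X Y f = FArr G (FObj F X) (FObj F Y) (FArr F X Y f)"
  by (simp_all add: comp_functor_def)

lemma id_functor_simps [simp]: "FObj id_functor X = X" "FArr id_functor X Y f = f"
  by (simp_all add: id_functor_def)

text \<open>The extension of \<open>f\<close> is the counit at \<open>B\<close> after the image of
  \<open>f\<close> under the left adjoint. The counit at a free algebra extends the identity, so it
  is \<open>mu\<close>, which makes the induced monad the free monad for this choice of free
  algebras.\<close>

lemma (in variety) adjunction_free_algebras:
  assumes adj: "adjunction DCPO (variety_of S E) F forget \<eta> \<epsilon>"
  shows "free_algebras S E (FObj F) \<eta>"
    and "free_algebras.is_free_monad S (FObj F) \<eta> (induced_monad DCPO F forget \<eta> \<epsilon>)"
proof -
  have F: "\<And>X. X \<in> Obj DCPO \<Longrightarrow> FObj F X \<in> models S E"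
    "\<And>X Y f. X \<in> Obj DCPO \<Longrightarrow> Y \<in> Obj DCPO \<Longrightarrow> f \<in> carr (cfun X Y) \<Longrightarrow> FArr F X Y f \<in> alg_hom S (FObj F X) (FObj F Y)"
    "\<And>X Y Z f g. X \<in> Obj DCPO \<Longrightarrow> Y \<in> Obj DCPO \<Longrightarrow> Z \<in> Obj DCPO \<Longrightarrow> f \<in> carr (cfun X Y) \<Longrightarrow> g \<in> carr (cfun Y Z) \<Longrightarrow>
      FArr F X Z (compose (carr X) g f) = compose (carr (und (FObj F X))) (FArr F Y Z g) (FArr F X Y f)"
    using adj unfolding adjunction_def is_functor_def Hom_DCPO Comp_DCPO by auto
  have \<eta>: "\<eta> \<in> extensional (Obj DCPO)" "\<And>X. X \<in> Obj DCPO \<Longrightarrow> \<eta> X \<in> carr (cfun X (und (FObj F X)))"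
    "\<And>X Y f. X \<in> Obj DCPO \<Longrightarrow> Y \<in> Obj DCPO \<Longrightarrow> f \<in> carr (cfun X Y) \<Longrightarrow>
      compose (carr X) (\<eta> Y) f = compose (carr X) (FArr F X Y f) (\<eta> X)"
    using adj unfolding adjunction_def nat_trans_def Hom_DCPO Comp_DCPO by (auto simp: PiE_iff)
  have \<epsilon>: "\<And>A. A \<in> models S E \<Longrightarrow> \<epsilon> A \<in> alg_hom S (FObj F (und A)) A"
    "\<And>A B f. A \<in> models S E \<Longrightarrow> B \<in> models S E \<Longrightarrow> f \<in> alg_hom S A B \<Longrightarrow>
      compose (carr (und (FObj F (und A)))) (\<epsilon> B) (FArr F (und A) (und B) f) = compose (carr (und (FObj F (und A)))) f (\<epsilon> A)"
    using adj unfolding adjunction_def nat_trans_def by (auto simp: PiE_iff)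
  have tri: "\<And>X. X \<in> Obj DCPO \<Longrightarrow>
      compose (carr (und (FObj F X))) (\<epsilon> (FObj F X)) (FArr F X (und (FObj F X)) (\<eta> X)) = (\<lambda>x\<in>carr (und (FObj F X)). x)"
    "\<And>A. A \<in> models S E \<Longrightarrow> compose (carr (und A)) (\<epsilon> A) (\<eta> (und A)) = (\<lambda>x\<in>carr (und A). x)"
    using adj unfolding adjunction_def Let_def Comp_DCPO by (auto simp: Ide_DCPO)
  have \<epsilon>\<eta>: "\<epsilon> A (\<eta> (und A) x) = x" if "A \<in> models S E" "x \<in> carr (und A)" for A x
    using fun_cong[OF tri(2)[OF that(1)], of x] that(2) by simp
  have F\<eta>: "FArr F X Y f (\<eta> X x) = \<eta> Y (f x)"
    if "X \<in> Obj DCPO" "Y \<in> Obj DCPO" "f \<in> carr (cfun X Y)" "x \<in> carr X" for X Y f x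
    using fun_cong[OF \<eta>(3)[OF that(1-3)], of x] that(4) by simp
  \<comment> \<open>The first triangle identity inserts the unit and the counit in front of
    \<open>h\<close>, naturality of the counit moves \<open>h\<close> under the left adjoint, and
    functoriality merges it with the unit into \<open>f\<close>.\<close>
  have uni: "h = compose (carr (und (FObj F X))) (\<epsilon> B) (FArr F X (und B) f)"
    if X: "X \<in> Obj DCPO" and B: "B \<in> models S E" and f: "f \<in> carr (cfun X (und B))"
      and h: "h \<in> alg_hom S (FObj F X) B" "\<And>x. x \<in> carr X \<Longrightarrow> h (\<eta> X x) = f x" for X B f h
  proof (rule cfun_eqI[OF alg_hom_cfun[OF h(1)]])
    note FX = F(1)[OF X] and OX = models_Obj[OF F(1)[OF X]] and OB = models_Obj[OF B]
    have hX: "h \<in> carr (cfun (und (FObj F X)) (und B))" by (rule alg_hom_cfun[OF h(1)])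
    have f_eq: "f = compose (carr X) h (\<eta> X)"
      by (rule cfun_eqI[OF f compose_in_cfun[OF \<eta>(2)[OF X] hX is_dcpo_Obj[OF X]]]) (simp add: h(2))
    show "compose (carr (und (FObj F X))) (\<epsilon> B) (FArr F X (und B) f) \<in> carr (cfun (und (FObj F X)) (und B))"
      by (rule alg_hom_cfun[OF alg_hom_compose[OF models_algebra[OF FX] F(2)[OF X OB f] \<epsilon>(1)[OF B]]])
    fix z assume z: "z \<in> carr (und (FObj F X))"
    have F\<eta>z: "FArr F X (und (FObj F X)) (\<eta> X) z \<in> carr (und (FObj F (und (FObj F X))))"
      using alg_hom_carr[OF F(2)[OF X OX \<eta>(2)[OF X]] z] .
    have "h z = h (\<epsilon> (FObj F X) (FArr F X (und (FObj F X)) (\<eta> X) z))"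
      using fun_cong[OF tri(1)[OF X], of z] z by simp
    also have "\<dots> = \<epsilon> B (FArr F (und (FObj F X)) (und B) h (FArr F X (und (FObj F X)) (\<eta> X) z))"
      using fun_cong[OF \<epsilon>(2)[OF FX B h(1)], of "FArr F X (und (FObj F X)) (\<eta> X) z"] F\<eta>z by simp
    also have "\<dots> = \<epsilon> B (FArr F X (und B) f z)"
      using fun_cong[OF F(3)[OF X OX OB \<eta>(2)[OF X] hX], of z] z by (simp add: f_eq)
    finally show "h z = compose (carr (und (FObj F X))) (\<epsilon> B) (FArr F X (und B) f) z"
      using z by simp
  qed
  have "is_free S E X (FObj F X) (\<eta> X)" if X: "X \<in> Obj DCPO" for X
    unfolding is_free_def
  proof (intro conjI ballI F(1)[OF X] \<eta>(2)[OF X])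
    fix B f assume B: "B \<in> models S E" and f: "f \<in> carr (cfun X (und B))"
    let ?h = "compose (carr (und (FObj F X))) (\<epsilon> B) (FArr F X (und B) f)"
    have "?h \<in> alg_hom S (FObj F X) B"
      by (rule alg_hom_compose[OF models_algebra[OF F(1)[OF X]] F(2)[OF X models_Obj[OF B] f] \<epsilon>(1)[OF B]])
    moreover have "?h (\<eta> X x) = f x" if x: "x \<in> carr X" for x
      using x cfun_carr[OF \<eta>(2)[OF X] x] cfun_carr[OF f x] by (simp add: F\<eta>[OF X models_Obj[OF B] f] \<epsilon>\<eta>[OF B])
    ultimately show "\<exists>!h. h \<in> alg_hom S (FObj F X) B \<and> (\<forall>x\<in>carr X. h (\<eta> X x) = f x)"
      by (intro ex1I[of _ ?h] conjI ballI uni[OF X B f]) (blast | simp)+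
  qed
  then show fa: "free_algebras S E (FObj F) \<eta>" by unfold_locales
  interpret free_algebras U S E "FObj F" \<eta> by (rule fa)
  show "is_free_monad (induced_monad DCPO F forget \<eta> \<epsilon>)"
    unfolding is_free_monad_def
  proof (intro conjI ballI)
    show "unit (induced_monad DCPO F forget \<eta> \<epsilon>) \<in> extensional (Obj DCPO)"
      using \<eta>(1) by (simp add: induced_monad_def)
    show "mult (induced_monad DCPO F forget \<eta> \<epsilon>) \<in> extensional (Obj DCPO)"
      by (simp add: induced_monad_def)
    fix X :: "'u dcpo" assume X: "X \<in> Obj DCPO"
    show "FObj (Fun (induced_monad DCPO F forget \<eta> \<epsilon>)) X = TO X"
      "unit (induced_monad DCPO F forget \<eta> \<epsilon>) X = \<eta> X"
      by (simp_all add: induced_monad_def)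
    have "\<epsilon> (FObj F X) = mu X"
      unfolding mu_def
      by (rule ext_unique[OF TO_Obj[OF X] T_models[OF X] \<epsilon>(1)[OF F(1)[OF X]] ident_in_cfun])
        (simp add: \<epsilon>\<eta>[OF F(1)[OF X]])
    then show "mult (induced_monad DCPO F forget \<eta> \<epsilon>) X = mu X"
      using X by (simp add: induced_monad_def)
    fix Y :: "'u dcpo" and f assume Y: "Y \<in> Obj DCPO" and f: "f \<in> carr (cfun X Y)"
    have "FArr F X Y f = TA X Y f"
      unfolding TA_def
      by (rule ext_unique[OF X T_models[OF Y] F(2)[OF X Y f] compose_eta[OF X Y f]]) (simp add: F\<eta>[OF X Y f])
    then show "FArr (Fun (induced_monad DCPO F forget \<eta> \<epsilon>)) X Y f = TA X Y f"
      by (simp add: induced_monad_def)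
  qed
qed

lemma (in variety) ex_adjunction:
  "\<exists>F \<eta> \<epsilon>. adjunction DCPO (variety_of S E) F forget \<eta> \<epsilon>"
proof -
  have "\<forall>X\<in>Obj DCPO. \<exists>Ae. is_free S E X (fst Ae) (snd Ae)"
    using ex_free by simp
  then obtain Ae where Ae: "\<forall>X\<in>Obj DCPO. is_free S E X (fst (Ae X)) (snd (Ae X))"
    using bchoice[of "Obj DCPO" "\<lambda>X Ae. is_free S E X (fst Ae) (snd Ae)"] by blast
  define T where "T = (\<lambda>X. fst (Ae X))"
  define e where "e = (\<lambda>X. snd (Ae X))"
  interpret free_algebras U S E T e
    by unfold_locales (simp add: Ae T_def e_def)
  let ?F = "\<lparr>FObj = T, FArr = TA\<rparr>"
  let ?\<epsilon> = "\<lambda>A\<in>models S E. ext (und A) A (\<lambda>x\<in>carr (und A). x)"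
  have \<epsilon>: "?\<epsilon> A \<in> alg_hom S (T (und A)) A" "\<And>x. x \<in> carr (und A) \<Longrightarrow> ?\<epsilon> A (e (und A) x) = x"
    if "A \<in> models S E" for A
    using that by (auto simp: ext_hom ext_eta models_Obj ident_in_cfun)
  have "adjunction DCPO (variety_of S E) ?F forget (restrict e (Obj DCPO)) ?\<epsilon>"
    unfolding adjunction_def
  proof (intro conjI ballI)
    show "is_functor DCPO (variety_of S E) ?F"
      unfolding is_functor_def by (auto simp: T_models TA_hom Hom_DCPO Ide_DCPO TA_ident Comp_DCPO compose_TA)
    show "is_functor (variety_of S E) DCPO forget"
      unfolding is_functor_def by (auto simp: models_Obj Hom_DCPO Ide_DCPO Comp_DCPO intro: alg_hom_cfun)
    show "nat_trans DCPO DCPO id_functor (forget \<odot> ?F) (restrict e (Obj DCPO))"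
      unfolding nat_trans_def by (auto simp: eta_cfun Hom_DCPO Comp_DCPO compose_def TA_eta fun_eq_iff)
    show "nat_trans (variety_of S E) (variety_of S E) (?F \<odot> forget) id_functor ?\<epsilon>"
      unfolding nat_trans_def
    proof (intro conjI ballI)
      show "?\<epsilon> \<in> (\<Pi>\<^sub>E A\<in>Obj (variety_of S E). Hom (variety_of S E) (FObj (?F \<odot> forget) A) (FObj id_functor A))"
        using \<epsilon>(1) by auto
      fix A B f assume A: "A \<in> Obj (variety_of S E)" and B: "B \<in> Obj (variety_of S E)" and f: "f \<in> Hom (variety_of S E) A B"
      have "compose (carr (TO (und A))) (?\<epsilon> B) (TA (und A) (und B) f) = compose (carr (TO (und A))) f (?\<epsilon> A)"
      proof (rule hom_eqI[OF models_Obj])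
        show "A \<in> models S E" "B \<in> models S E" using A B by simp_all
        have f': "f \<in> alg_hom S A B" "f \<in> carr (cfun (und A) (und B))" using f by (simp_all add: alg_hom_cfun)
        note OA = models_Obj[OF \<open>A \<in> models S E\<close>] and OB = models_Obj[OF \<open>B \<in> models S E\<close>]
        show "compose (carr (TO (und A))) (?\<epsilon> B) (TA (und A) (und B) f) \<in> alg_hom S (T (und A)) B"
          by (rule alg_hom_compose[OF T_algebra[OF OA] TA_hom[OF OA OB f'(2)] \<epsilon>(1)[OF \<open>B \<in> models S E\<close>]])
        show "compose (carr (TO (und A))) f (?\<epsilon> A) \<in> alg_hom S (T (und A)) B"
          by (rule alg_hom_compose[OF T_algebra[OF OA] \<epsilon>(1)[OF \<open>A \<in> models S E\<close>] f'(1)])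
        fix x assume x: "x \<in> carr (und A)"
        have "compose (carr (TO (und A))) (?\<epsilon> B) (TA (und A) (und B) f) (e (und A) x) = ?\<epsilon> B (e (und B) (f x))"
          using x OA OB f' by (simp add: eta_carr TA_eta)
        also have "\<dots> = f x" by (rule \<epsilon>(2)[OF \<open>B \<in> models S E\<close> cfun_carr[OF f'(2) x]])
        also have "\<dots> = compose (carr (TO (und A))) f (?\<epsilon> A) (e (und A) x)"
          using x \<epsilon>(2)[OF \<open>A \<in> models S E\<close> x] by (simp only: compose_apply[OF eta_carr[OF OA x]])
        finally show "compose (carr (TO (und A))) (?\<epsilon> B) (TA (und A) (und B) f) (e (und A) x) =
          compose (carr (TO (und A))) f (?\<epsilon> A) (e (und A) x)" .
      qed
      then show "Comp (variety_of S E) (FObj (?F \<odot> forget) A) (FObj (?F \<odot> forget) B) (FObj id_functor B) (?\<epsilon> B) (FArr (?F \<odot> forget) A B f) =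
        Comp (variety_of S E) (FObj (?F \<odot> forget) A) (FObj id_functor A) (FObj id_functor B) (FArr id_functor A B f) (?\<epsilon> A)"
        by simp
    qed
    show "let FX = FObj ?F X; UFX = FObj forget FX; FUFX = FObj ?F UFX
        in Comp (variety_of S E) FX FUFX FX (?\<epsilon> FX) (FArr ?F X UFX (restrict e (Obj DCPO) X)) = Ide (variety_of S E) FX"
      if "X \<in> Obj DCPO" for X
      using mu_unit[OF that] that by (simp add: Let_def T_models mu_def)
    show "let UA = FObj forget A; FUA = FObj ?F UA; UFUA = FObj forget FUA
        in Comp DCPO UA UFUA UA (FArr forget FUA A (?\<epsilon> A)) (restrict e (Obj DCPO) UA) = Ide DCPO UA"
      if "A \<in> Obj (variety_of S E)" for A
      using that \<epsilon>(2)[of A] models_Obj[of A] by (simp add: Let_def Comp_DCPO Ide_DCPO compose_def fun_eq_iff)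
  qed
  then show ?thesis by blast
qed

section \<open>Finite discrete dcpos and basic elements\<close>

abbreviation disc :: "'u set \<Rightarrow> 'u dcpo" where "disc n \<equiv> FObj discrete n"

abbreviation incl :: "'u set \<Rightarrow> 'u \<Rightarrow> 'u" where "incl n \<equiv> (\<lambda>v\<in>n. v)"

lemma carr_disc [simp]: "carr (disc n) = n"
  by (simp add: discrete_def)

lemma leq_disc: "(x, y) \<in> leq (disc n) \<longleftrightarrow> x \<in> n \<and> x = y"
  by (auto simp: discrete_def)

lemma is_dcpo_disc: "is_dcpo (disc n)"
proof (rule is_dcpoI)
  show "\<exists>x. is_join (disc n) D x" if "directed (disc n) D" for D
  proof -
    obtain x where x: "x \<in> D" using directed_nonempty[OF \<open>directed (disc n) D\<close>] by blast
    have "y = x" if "y \<in> D" for y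
      using directed_ub[OF \<open>directed (disc n) D\<close> that x] by (auto simp: leq_disc)
    then have "D = {x}" using x by blast
    moreover have "x \<in> n" using directed_carr[OF that x] by simp
    ultimately show ?thesis by (intro exI[of _ x]) (simp add: is_join_def leq_disc)
  qed
qed (auto simp: leq_disc)

lemma (in universe) disc_Obj: "finite n \<Longrightarrow> disc (n :: 'u set) \<in> Obj DCPO"
  by (simp add: Obj_DCPO is_dcpo_disc small_TYPE small_finite)

lemma continuous_disc: "is_dcpo P \<Longrightarrow> f \<in> n \<rightarrow> carr P \<Longrightarrow> continuous (disc n) P f"
proof (rule continuousI)
  fix D x q
  assume "directed (disc n) D" "is_join (disc n) D x" "\<And>d. d \<in> D \<Longrightarrow> (f d, q) \<in> leq P"
  moreover from this have "x \<in> D"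
    using directed_nonempty is_join_ub by (metis equals0I leq_disc)
  ultimately show "(f x, q) \<in> leq P" by blast
qed (auto simp: leq_disc Pi_iff dcpo_refl)

lemma cfun_disc: "is_dcpo P \<Longrightarrow> carr (cfun (disc n) P) = n \<rightarrow>\<^sub>E carr P"
  by (auto simp: carr_cfun intro: continuous_disc)

lemma incl_cfun: "is_dcpo P \<Longrightarrow> n \<subseteq> carr P \<Longrightarrow> incl n \<in> carr (cfun (disc n) P)"
  by (auto simp: cfun_disc)

lemma sepcont_cong:
  assumes "sepcont P Q n f" "\<And>xs. length xs = n \<Longrightarrow> set xs \<subseteq> carr P \<Longrightarrow> f xs = g xs"
  shows "sepcont P Q n g"
proof (rule sepcontI)
  show "g xs \<in> carr Q" if "length xs = n" "set xs \<subseteq> carr P" for xs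
    using sepcont_carr[OF assms(1) that] assms(2)[OF that] by simp
  show "continuous P Q (\<lambda>x. g (xs @ x # ys))"
    if *: "Suc (length xs + length ys) = n" "set xs \<subseteq> carr P" "set ys \<subseteq> carr P" for xs ys
    by (rule continuous_cong[OF sepcont_continuous[OF assms(1) *]], rule assms(2)) (use * in auto)
qed

context free_algebras
begin

text \<open>Elements that come from the free algebra on a finite subset of \<open>X\<close>, whose
  members serve as the variables.\<close>

definition basics :: "'u dcpo \<Rightarrow> 'u set" where
  "basics X = {TA (disc n) X (incl n) t | n t. finite n \<and> n \<subseteq> carr X \<and> t \<in> carr (TO (disc n))}"

lemma basics_carr: "X \<in> Obj DCPO \<Longrightarrow> basics X \<subseteq> carr (TO X)"
  unfolding basics_def by (auto intro!: TA_carr disc_Obj incl_cfun is_dcpo_Obj)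

text \<open>The transition maps that bring basic elements to a common finite set.\<close>

definition J :: "'u set \<Rightarrow> 'u set \<Rightarrow> 'u \<Rightarrow> 'u" where
  "J n m = TA (disc n) (disc m) (incl n)"

lemma J:
  assumes "finite m" "n \<subseteq> m"
  shows J_hom: "J n m \<in> alg_hom S (T (disc n)) (T (disc m))"
    and J_eta: "v \<in> n \<Longrightarrow> J n m (eta (disc n) v) = eta (disc m) v"
    and J_carr: "t \<in> carr (TO (disc n)) \<Longrightarrow> J n m t \<in> carr (TO (disc m))"
    and TA_J: "X \<in> Obj DCPO \<Longrightarrow> f \<in> carr (cfun (disc m) X) \<Longrightarrow> t \<in> carr (TO (disc n)) \<Longrightarrow>
      TA (disc m) X f (J n m t) = TA (disc n) X (restrict f n) t"
proof -
  have n: "disc n \<in> Obj DCPO" "disc m \<in> Obj DCPO"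
    using assms finite_subset by (auto intro!: disc_Obj)
  have i: "incl n \<in> carr (cfun (disc n) (disc m))" using assms(2) by (intro incl_cfun is_dcpo_disc) simp
  show hom: "J n m \<in> alg_hom S (T (disc n)) (T (disc m))" unfolding J_def using n i by (intro TA_hom)
  show "v \<in> n \<Longrightarrow> J n m (eta (disc n) v) = eta (disc m) v"
    unfolding J_def using n i by (simp add: TA_eta)
  show "t \<in> carr (TO (disc n)) \<Longrightarrow> J n m t \<in> carr (TO (disc m))" using alg_hom_carr[OF hom] .
  assume "X \<in> Obj DCPO" "f \<in> carr (cfun (disc m) X)" "t \<in> carr (TO (disc n))"
  moreover have "compose n f (incl n) = restrict f n" by (auto simp: compose_def)
  ultimately show "TA (disc m) X f (J n m t) = TA (disc n) X (restrict f n) t"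
    unfolding J_def using n i by (subst TA_TA) auto
qed

lemma J_J: "finite l \<Longrightarrow> n \<subseteq> m \<Longrightarrow> m \<subseteq> l \<Longrightarrow> t \<in> carr (TO (disc n)) \<Longrightarrow> J m l (J n m t) = J n l t"
proof -
  assume a: "finite l" "n \<subseteq> m" "m \<subseteq> l" "t \<in> carr (TO (disc n))"
  have "TA (disc m) (disc l) (incl m) (J n m t) = TA (disc n) (disc l) (restrict (incl m) n) t"
    using a finite_subset[of m l] by (intro TA_J disc_Obj incl_cfun is_dcpo_disc) auto
  moreover have "restrict (incl m) n = incl n" using a(2) by (simp add: restrict_restrict Int_absorb1)
  ultimately show ?thesis by (simp add: J_def)
qed

lemma J_same: "finite n \<Longrightarrow> t \<in> carr (TO (disc n)) \<Longrightarrow> J n n t = t"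
  using TA_ident[OF disc_Obj, of n] by (simp add: J_def)

text \<open>Finitely many basic elements come from one finite subset, by the maps \<open>J\<close>,
  so basic elements are closed under the operations. As they contain the generators, their closure
  is a subalgebra to which \<open>T_induct\<close> applies.\<close>

lemma basics_dense:
  assumes X: "X \<in> Obj DCPO"
  shows "carr (TO X) = dcl (TO X) (basics X)"
proof -
  note bc = basics_carr[OF X]
  have dX: "is_dcpo X" using is_dcpo_Obj[OF X] .
  have "dcl (TO X) (basics X) = carr (TO X)"
  proof (rule T_induct[OF X dcl_subset_carr[OF bc] dclosed_dcl])
    fix x assume x: "x \<in> carr X"
    have "eta X x = TA (disc {x}) X (incl {x}) (eta (disc {x}) x)"
      using x by (simp add: TA_eta[OF disc_Obj X incl_cfun[OF dX]])
    moreover have "eta (disc {x}) x \<in> carr (TO (disc {x}))" by (intro eta_carr disc_Obj) auto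
    ultimately have "eta X x \<in> basics X"
      unfolding basics_def using x by (intro CollectI exI[of _ "{x}"] exI[of _ "eta (disc {x}) x"]) simp
    then show "eta X x \<in> dcl (TO X) (basics X)" by (rule dcl.base)
  next
    fix s xs assume s: "s \<in> S (length xs)" and xs: "set xs \<subseteq> dcl (TO X) (basics X)"
    note op = algebra_sepcont[OF T_algebra[OF X] s]
    show "opn (T X) s xs \<in> dcl (TO X) (basics X)"
    proof (rule dcl_lists_induct[OF bc _ _ xs refl])
      show "dclosed (TO X) {z \<in> carr (TO X). opn (T X) s (us @ z # vs) \<in> dcl (TO X) (basics X)}"
        if "set us \<subseteq> dcl (TO X) (basics X)" "set vs \<subseteq> dcl (TO X) (basics X)"
          "Suc (length us + length vs) = length xs" for us vs
        using that dcl_subset_carr[OF bc]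
        by (intro dclosed_preimage[OF _ TO_dcpo[OF X] dclosed_dcl] sepcont_continuous[OF op]) auto
      fix ys assume ys: "set ys \<subseteq> basics X" "length ys = length xs"
      have "\<exists>n ts. finite n \<and> n \<subseteq> carr X \<and> set ts \<subseteq> carr (TO (disc n)) \<and> ys = map (TA (disc n) X (incl n)) ts"
        using ys(1)
      proof (induction ys)
        case Nil
        then show ?case by (intro exI[of _ "{}"] exI[of _ "[]"]) auto
      next
        case (Cons y ys)
        have "set ys \<subseteq> basics X" using Cons.prems by simp
        from Cons.IH[OF this] obtain m ts where m: "finite m" "m \<subseteq> carr X" "set ts \<subseteq> carr (TO (disc m))" "ys = map (TA (disc m) X (incl m)) ts"
          by blast
        obtain n t where n: "finite n" "n \<subseteq> carr X" "t \<in> carr (TO (disc n))" "y = TA (disc n) X (incl n) t"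
          using Cons.prems by (auto simp: basics_def)
        have r: "restrict (incl (n \<union> m)) n = incl n" "restrict (incl (n \<union> m)) m = incl m" by auto
        have i: "incl (n \<union> m) \<in> carr (cfun (disc (n \<union> m)) X)" using n m by (intro incl_cfun[OF dX]) auto
        have "y = TA (disc (n \<union> m)) X (incl (n \<union> m)) (J n (n \<union> m) t)"
          using TA_J[of "n \<union> m" n X "incl (n \<union> m)" t] n m i X by (simp add: r)
        moreover have "TA (disc m) X (incl m) u = TA (disc (n \<union> m)) X (incl (n \<union> m)) (J m (n \<union> m) u)"
          if "u \<in> set ts" for u
          using TA_J[of "n \<union> m" m X "incl (n \<union> m)" u] n m i X that by (auto simp: r)
        then have "ys = map (TA (disc (n \<union> m)) X (incl (n \<union> m))) (map (J m (n \<union> m)) ts)"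
          unfolding m(4) by simp
        ultimately have "y # ys = map (TA (disc (n \<union> m)) X (incl (n \<union> m))) (J n (n \<union> m) t # map (J m (n \<union> m)) ts)"
          by (simp only: list.map)
        moreover have "set (J n (n \<union> m) t # map (J m (n \<union> m)) ts) \<subseteq> carr (TO (disc (n \<union> m)))"
          using n m J_carr[of "n \<union> m"] by auto
        moreover have "finite (n \<union> m)" "n \<union> m \<subseteq> carr X" using n m by auto
        ultimately show ?case
          by (intro exI[of _ "n \<union> m"] exI[of _ "J n (n \<union> m) t # map (J m (n \<union> m)) ts"] conjI)
      qed
      then obtain n ts where n: "finite n" "n \<subseteq> carr X" "set ts \<subseteq> carr (TO (disc n))" "ys = map (TA (disc n) X (incl n)) ts"
        by blast
      note dn = disc_Obj[OF n(1)]
      have l: "length ts = length xs" using n(4) ys(2) by simp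
      have "opn (T X) s ys = TA (disc n) X (incl n) (opn (T (disc n)) s ts)"
        unfolding n(4) using s n l
        by (subst alg_hom_op[OF TA_hom[OF dn X incl_cfun[OF dX n(2)]]]) simp_all
      moreover have "opn (T (disc n)) s ts \<in> carr (TO (disc n))"
        using s n(3) l by (intro algebra_closed[OF T_algebra[OF dn]]) auto
      ultimately have "opn (T X) s ys \<in> basics X" unfolding basics_def using n by blast
      then show "opn (T X) s ys \<in> dcl (TO X) (basics X)" by (rule dcl.base)
    qed
  qed
  then show ?thesis by simp
qed

end

section \<open>The free-algebra monad is strongly finitary\<close>

text \<open>A cocone with vertex \<open>P\<close> over the diagram for the left Kan extension at
  \<open>X\<close>: \<open>phi n\<close> is defined on pairs from \<open>[n, X]\<close> and the free
  algebra on \<open>n\<close>, continuous in each entry and dinatural in \<open>n\<close>. The aim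
  is its factorisation through the free algebra on \<open>X\<close>, the lemma
  \<open>extension\<close>.\<close>

locale cocone = free_algebras U S E T eta for U :: "'u itself" and S E T eta +
  fixes X P :: "'u dcpo" and phi :: "'u set \<Rightarrow> ('u \<Rightarrow> 'u) \<Rightarrow> 'u \<Rightarrow> 'u"
  assumes X: "X \<in> Obj DCPO" and P: "P \<in> Obj DCPO"
    and phi_fst: "finite n \<Longrightarrow> t \<in> carr (TO (disc n)) \<Longrightarrow> continuous (cfun (disc n) X) P (\<lambda>x. phi n x t)"
    and phi_snd: "finite n \<Longrightarrow> x \<in> n \<rightarrow>\<^sub>E carr X \<Longrightarrow> continuous (TO (disc n)) P (phi n x)"
    and phi_natural: "finite n \<Longrightarrow> finite m \<Longrightarrow> f \<in> n \<rightarrow>\<^sub>E m \<Longrightarrow> x \<in> m \<rightarrow>\<^sub>E carr X \<Longrightarrow> t \<in> carr (TO (disc n)) \<Longrightarrow>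
      phi m x (TA (disc n) (disc m) f t) = phi n (compose n x f) t"
begin

lemma dX: "is_dcpo X" and dP: "is_dcpo P"
  using X P is_dcpo_Obj by blast+

definition fins :: "'u set set" where "fins = {n. finite n \<and> n \<subseteq> carr X}"

lemma fins_Un: "n \<in> fins \<Longrightarrow> m \<in> fins \<Longrightarrow> n \<union> m \<in> fins"
  and fins_insert: "n \<in> fins \<Longrightarrow> x \<in> carr X \<Longrightarrow> insert x n \<in> fins"
  and fins_empty: "{} \<in> fins" and fins_finite: "n \<in> fins \<Longrightarrow> finite n" and fins_sub: "n \<in> fins \<Longrightarrow> n \<subseteq> carr X"
  by (auto simp: fins_def)

text \<open>A placeholder for a generator that is to vary continuously; lying outside
  \<open>carr X\<close>, it cannot clash with the elements of a finite subset.\<close>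

definition star :: 'u where "star = (SOME v. v \<notin> carr X)"

lemma star: "star \<notin> carr X"
proof -
  have "carr X \<noteq> UNIV" using X not_small_UNIV by (auto simp: Obj_DCPO small_TYPE)
  then have "\<exists>v. v \<notin> carr X" by blast
  then show ?thesis unfolding star_def by (rule someI_ex)
qed

text \<open>Substitutes \<open>x\<close> for the placeholder. The element \<open>x\<close> may
  already belong to \<open>k\<close>, in which case two variables are identified.\<close>

definition w :: "'u set \<Rightarrow> 'u \<Rightarrow> 'u \<Rightarrow> 'u" where
  "w k x = (\<lambda>v\<in>insert star k. if v = star then x else v)"

lemma w: "w k x \<in> insert star k \<rightarrow>\<^sub>E insert x k"
  by (auto simp: w_def)

text \<open>The target varies with \<open>x\<close>, so continuity in \<open>x\<close> can only be
  stated after an observation into the fixed dcpo \<open>P\<close>, as in the last clause of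
  \<open>obs\<close>.\<close>

definition W :: "'u set \<Rightarrow> 'u \<Rightarrow> 'u \<Rightarrow> 'u" where
  "W k x = TA (disc (insert star k)) (disc (insert x k)) (w k x)"

lemma W_hom: "finite k \<Longrightarrow> W k x \<in> alg_hom S (T (disc (insert star k))) (T (disc (insert x k)))"
  unfolding W_def using w by (intro TA_hom disc_Obj) (auto simp: cfun_disc is_dcpo_disc)

text \<open>The cocones with vertex \<open>P\<close> separate the points of the colimit to be constructed; it is
  obtained as the closure of the basic elements in the power of \<open>P\<close> indexed by all of them.\<close>

definition obs :: "('u set \<Rightarrow> 'u \<Rightarrow> 'u) set" where
  "obs = {q. (\<forall>n\<in>fins. continuous (TO (disc n)) P (q n)) \<and>
     (\<forall>m\<in>fins. \<forall>n. n \<subseteq> m \<longrightarrow> (\<forall>t\<in>carr (TO (disc n)). q m (J n m t) = q n t)) \<and>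
     (\<forall>k\<in>fins. \<forall>u\<in>carr (TO (disc (insert star k))). continuous X P (\<lambda>x. q (insert x k) (W k x u)))}"

lemma obsD:
  assumes "q \<in> obs"
  shows obs_continuous: "n \<in> fins \<Longrightarrow> continuous (TO (disc n)) P (q n)"
    and obs_J: "m \<in> fins \<Longrightarrow> n \<subseteq> m \<Longrightarrow> t \<in> carr (TO (disc n)) \<Longrightarrow> q m (J n m t) = q n t"
    and obs_W: "k \<in> fins \<Longrightarrow> u \<in> carr (TO (disc (insert star k))) \<Longrightarrow> continuous X P (\<lambda>x. q (insert x k) (W k x u))"
  using assms by (auto simp: obs_def)

definition Idx :: "('u set \<times> 'u) set" where "Idx = Sigma fins (\<lambda>n. carr (TO (disc n)))"

lemma Idx_D: "i \<in> Idx \<Longrightarrow> fst i \<in> fins \<and> snd i \<in> carr (TO (disc (fst i)))"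
  by (auto simp: Idx_def)

lemma Idx_Union: "set is \<subseteq> Idx \<Longrightarrow> \<Union> (fst ` set is) \<in> fins"
proof -
  assume "set is \<subseteq> Idx"
  then have "finite (fst i) \<and> fst i \<subseteq> carr X" if "i \<in> set is" for i
    using Idx_D[OF subsetD[OF _ that]] fins_finite fins_sub by blast
  then show ?thesis by (auto simp: fins_def)
qed

lemma J_Idx:
  assumes "set is \<subseteq> Idx" "finite N" "\<Union> (fst ` set is) \<subseteq> N"
  shows "set (map (\<lambda>i. J (fst i) N (snd i)) is) \<subseteq> carr (TO (disc N))"
proof -
  have "J (fst i) N (snd i) \<in> carr (TO (disc N))" if "i \<in> set is" for i
    using Idx_D[OF subsetD[OF assms(1) that]] assms(3) that by (intro J_carr[OF assms(2)]) auto
  then show ?thesis by auto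
qed

text \<open>The point of the power of \<open>P\<close> that records the results of all observations
  on one basic element.\<close>

definition b :: "'u set \<times> 'u \<Rightarrow> ('u set \<Rightarrow> 'u \<Rightarrow> 'u) \<Rightarrow> 'u" where
  "b i = (\<lambda>q\<in>obs. q (fst i) (snd i))"

definition PP :: "(('u set \<Rightarrow> 'u \<Rightarrow> 'u) \<Rightarrow> 'u) dcpo" where "PP = prod_dcpo obs (\<lambda>_. P)"

definition Z :: "(('u set \<Rightarrow> 'u \<Rightarrow> 'u) \<Rightarrow> 'u) dcpo" where "Z = sub_dcpo PP (dcl PP (b ` Idx))"

lemma fins_Obj: "n \<in> fins \<Longrightarrow> disc n \<in> Obj DCPO"
  by (intro disc_Obj fins_finite)

lemma b_carr: "b ` Idx \<subseteq> carr PP"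
  using continuous_carr[OF obs_continuous] by (auto simp: b_def PP_def Idx_def)

lemma dPP: "is_dcpo PP"
  unfolding PP_def by (intro is_dcpo_prod_dcpo dP)

lemma carr_Z: "carr Z = dcl PP (b ` Idx)"
  by (simp add: Z_def)

lemma Z_sub: "carr Z \<subseteq> carr PP"
  unfolding carr_Z by (rule dcl_subset_carr[OF b_carr])

lemma dclosed_Z: "dclosed PP (carr Z)"
  unfolding carr_Z by (rule dclosed_dcl)

lemma Z_eq: "Z = sub_dcpo PP (carr Z)"
  by (simp add: Z_def)

lemma dZ: "is_dcpo Z"
  using is_dcpo_sub_dcpo[OF dPP dclosed_Z Z_sub] by (simp flip: Z_eq)

lemma Z_dense: "carr Z = dcl Z (b ` Idx)"
  using dcl_sub_dcpo[OF dPP b_carr] by (simp add: Z_def)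

lemma b_Z: "i \<in> Idx \<Longrightarrow> b i \<in> carr Z"
  unfolding carr_Z by (intro dcl.base) simp

lemma small_Z: "sml (carr Z)"
proof -
  have "sml fins" unfolding fins_def using X by (intro small_finite_subsets) (simp add: Obj_DCPO small_TYPE)
  moreover have "sml (carr (TO (disc n)))" if "n \<in> fins" for n
    using TO_Obj[OF fins_Obj[OF that]] by (simp add: Obj_DCPO small_TYPE)
  ultimately have "sml Idx" unfolding Idx_def by (rule small_Sigma)
  then show ?thesis unfolding carr_Z by (intro small_dcl dPP b_carr small_image)
qed

lemma b_J:
  assumes "m \<in> fins" "n \<subseteq> m" "t \<in> carr (TO (disc n))"
  shows "b (m, J n m t) = b (n, t)"
  using obs_J[OF _ assms] by (auto simp: b_def)

text \<open>The operation on representatives, carried out over the union of the finite sets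
  involved; by \<open>gop_eq\<close> any larger finite subset of \<open>X\<close> gives the same
  point.\<close>

definition gop :: "'u \<Rightarrow> ('u set \<times> 'u) list \<Rightarrow> ('u set \<Rightarrow> 'u \<Rightarrow> 'u) \<Rightarrow> 'u" where
  "gop s is = (let N = \<Union> (fst ` set is) in b (N, opn (T (disc N)) s (map (\<lambda>i. J (fst i) N (snd i)) is)))"

lemma gop_eq:
  assumes "set is \<subseteq> Idx" "s \<in> S (length is)" "M \<in> fins" "\<Union> (fst ` set is) \<subseteq> M"
  shows "gop s is = b (M, opn (T (disc M)) s (map (\<lambda>i. J (fst i) M (snd i)) is))"
proof -
  let ?N = "\<Union> (fst ` set is)"
  have fM: "finite M" and fN: "finite ?N" using assms(3,4) fins_finite finite_subset by blast+
  have i: "fst i \<subseteq> ?N" "snd i \<in> carr (TO (disc (fst i)))" if "i \<in> set is" for i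
    using that assms(1) by (auto simp: Idx_def)
  let ?ts = "map (\<lambda>i. J (fst i) ?N (snd i)) is"
  have ts: "set ?ts \<subseteq> carr (TO (disc ?N))" using i J_carr[OF fN] by auto
  have op: "opn (T (disc ?N)) s ?ts \<in> carr (TO (disc ?N))"
    using ts assms(2) by (intro algebra_closed[OF T_algebra[OF disc_Obj[OF fN]]]) simp_all
  have "gop s is = b (M, J ?N M (opn (T (disc ?N)) s ?ts))"
    unfolding gop_def Let_def by (rule b_J[OF assms(3,4) op, symmetric])
  also have "J ?N M (opn (T (disc ?N)) s ?ts) = opn (T (disc M)) s (map (J ?N M) ?ts)"
    by (rule alg_hom_op[OF J_hom[OF fM assms(4)] _ ts]) (simp add: assms(2))
  also have "map (J ?N M) ?ts = map (\<lambda>i. J (fst i) M (snd i)) is"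
    using J_J[OF fM _ assms(4)] i by simp
  finally show ?thesis .
qed

lemma gop_Z:
  assumes "set is \<subseteq> Idx" "s \<in> S (length is)"
  shows "gop s is \<in> b ` Idx"
proof -
  let ?N = "\<Union> (fst ` set is)"
  have N: "?N \<in> fins" by (rule Idx_Union[OF assms(1)])
  have "set (map (\<lambda>i. J (fst i) ?N (snd i)) is) \<subseteq> carr (TO (disc ?N))"
    by (rule J_Idx[OF assms(1) fins_finite[OF N] order_refl])
  then have "opn (T (disc ?N)) s (map (\<lambda>i. J (fst i) ?N (snd i)) is) \<in> carr (TO (disc ?N))"
    using assms(2) by (intro algebra_closed[OF T_algebra[OF fins_Obj[OF N]]]) simp_all
  then show ?thesis unfolding gop_def Let_def using N by (auto simp: Idx_def)
qed

text \<open>Observes the result of plugging \<open>t\<close> into the operation \<open>s\<close>,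
  next to the fixed arguments \<open>us\<close> and \<open>vs\<close> taken over
  \<open>N\<close>.\<close>

definition shift :: "'u \<Rightarrow> 'u set \<Rightarrow> 'u list \<Rightarrow> 'u list \<Rightarrow> ('u set \<Rightarrow> 'u \<Rightarrow> 'u) \<Rightarrow> 'u set \<Rightarrow> 'u \<Rightarrow> 'u" where
  "shift s N us vs q = (\<lambda>n t. q (n \<union> N)
     (opn (T (disc (n \<union> N))) s (map (J N (n \<union> N)) us @ J n (n \<union> N) t # map (J N (n \<union> N)) vs)))"

text \<open>Stability of the observations under translations is what lets the operations act on
  \<open>Z\<close>: a point is moved by reading it at translated observations. The clause about the
  placeholder holds because the operation can be performed while \<open>star\<close> is still in
  place, and \<open>x\<close> substituted afterwards.\<close>

lemma shift_obs:
  assumes q: "q \<in> obs" and N: "N \<in> fins" and us: "set us \<subseteq> carr (TO (disc N))" and vs: "set vs \<subseteq> carr (TO (disc N))"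
    and s: "s \<in> S (Suc (length us + length vs))"
  shows "shift s N us vs q \<in> obs"
  unfolding obs_def
proof (intro CollectI conjI ballI allI impI)
  fix n assume n: "n \<in> fins"
  note nN = fins_Un[OF n N] and f = fins_finite[OF fins_Un[OF n N]]
  have "continuous (TO (disc (n \<union> N))) (TO (disc (n \<union> N)))
    (\<lambda>t. opn (T (disc (n \<union> N))) s (map (J N (n \<union> N)) us @ t # map (J N (n \<union> N)) vs))"
    using us vs J_carr[OF f, of N] by (intro sepcont_continuous[OF algebra_sepcont[OF T_algebra[OF disc_Obj[OF f]] s]]) auto
  then show "continuous (TO (disc n)) P (shift s N us vs q n)"
    unfolding shift_def
    using alg_hom_continuous[OF J_hom[OF f, of n]] obs_continuous[OF q nN] TO_dcpo[OF fins_Obj[OF n]]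
    by (intro continuous_comp[of "TO (disc n)" "TO (disc (n \<union> N))" _ P "q (n \<union> N)"]
        continuous_comp[of "TO (disc n)" "TO (disc (n \<union> N))" "J n (n \<union> N)"
          "TO (disc (n \<union> N))" "\<lambda>t. opn (T (disc (n \<union> N))) s (map (J N (n \<union> N)) us @ t # map (J N (n \<union> N)) vs)"]) auto
next
  fix m n t assume m: "m \<in> fins" "n \<subseteq> m" and t: "t \<in> carr (TO (disc n))"
  have n: "n \<in> fins" using m by (auto simp: fins_def intro: finite_subset)
  have mN: "m \<union> N \<in> fins" using fins_Un m N by blast
  note f = fins_finite[OF mN]
  let ?ts = "map (J N (n \<union> N)) us @ J n (n \<union> N) t # map (J N (n \<union> N)) vs"
  have ts: "set ?ts \<subseteq> carr (TO (disc (n \<union> N)))"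
    using us vs t J_carr[OF fins_finite[OF fins_Un[OF n N]]] by auto
  have "J (n \<union> N) (m \<union> N) (opn (T (disc (n \<union> N))) s ?ts) = opn (T (disc (m \<union> N))) s (map (J (n \<union> N) (m \<union> N)) ?ts)"
    using ts m(2) s by (intro alg_hom_op[OF J_hom[OF f]]) auto
  also have "map (J (n \<union> N) (m \<union> N)) ?ts = map (J N (m \<union> N)) us @ J n (m \<union> N) t # map (J N (m \<union> N)) vs"
    using J_J[OF f] us vs t m(2) by (auto simp: subset_iff)
  also have "J n (m \<union> N) t = J m (m \<union> N) (J n m t)"
    using J_J[OF f m(2)] t by simp
  finally show "shift s N us vs q m (J n m t) = shift s N us vs q n t"
    unfolding shift_def using obs_J[OF q mN, of "n \<union> N" "opn (T (disc (n \<union> N))) s ?ts"] m(2) ts s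
      algebra_closed[OF T_algebra[OF fins_Obj[OF fins_Un[OF n N]]], of s ?ts] by auto
next
  fix k u assume k: "k \<in> fins" and u: "u \<in> carr (TO (disc (insert star k)))"
  let ?K = "k \<union> N"
  have K: "?K \<in> fins" using k N fins_Un by blast
  have fK: "finite (insert star ?K)" using fins_finite[OF K] by simp
  \<comment> \<open>The operation performed over \<open>?K\<close> with the placeholder adjoined;
    the homomorphism \<open>W ?K x\<close> then substitutes \<open>x\<close> inside all
    arguments.\<close>
  let ?u = "opn (T (disc (insert star ?K))) s
    (map (J N (insert star ?K)) us @ J (insert star k) (insert star ?K) u # map (J N (insert star ?K)) vs)"
  have args: "set (map (J N (insert star ?K)) us @ J (insert star k) (insert star ?K) u # map (J N (insert star ?K)) vs)
      \<subseteq> carr (TO (disc (insert star ?K)))"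
    using us vs u J_carr[OF fK, of N] J_carr[OF fK, of "insert star k"] by auto
  have u': "?u \<in> carr (TO (disc (insert star ?K)))"
    using args s by (intro algebra_closed[OF T_algebra[OF disc_Obj[OF fK]]]) auto
  have "shift s N us vs q (insert x k) (W k x u) = q (insert x ?K) (W ?K x ?u)" if x: "x \<in> carr X" for x
  proof -
    have wK: "w ?K x \<in> carr (cfun (disc (insert star ?K)) (disc (insert x ?K)))"
      using w by (simp add: cfun_disc is_dcpo_disc)
    have fx: "finite (insert x ?K)" using fK by simp
    have "W ?K x ?u = opn (T (disc (insert x ?K))) s
      (map (W ?K x) (map (J N (insert star ?K)) us @ J (insert star k) (insert star ?K) u # map (J N (insert star ?K)) vs))"
      using args s fins_finite[OF K] by (intro alg_hom_op[OF W_hom]) auto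
    moreover have "W ?K x (J N (insert star ?K) t) = J N (insert x ?K) t" if "t \<in> carr (TO (disc N))" for t
    proof -
      \<comment> \<open>\<open>star\<close> is not in \<open>carr X\<close>, hence not in
        \<open>N\<close>, so the fixed arguments are unaffected by the substitution.\<close>
      have "restrict (w ?K x) N = incl N"
        using star fins_sub[OF N] unfolding w_def restrict_def fun_eq_iff by auto
      then show ?thesis unfolding W_def using that fK fx wK by (subst TA_J) (auto intro!: disc_Obj simp: J_def)
    qed
    moreover have "W ?K x (J (insert star k) (insert star ?K) u) = J (insert x k) (insert x ?K) (W k x u)"
    proof -
      have "W ?K x (J (insert star k) (insert star ?K) u) = TA (disc (insert star k)) (disc (insert x ?K)) (restrict (w ?K x) (insert star k)) u"
        unfolding W_def using u fK fx wK by (intro TA_J disc_Obj) auto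
      also have "restrict (w ?K x) (insert star k) = compose (insert star k) (incl (insert x k)) (w k x)"
        by (auto simp: w_def compose_def)
      also have "TA (disc (insert star k)) (disc (insert x ?K)) \<dots> u = J (insert x k) (insert x ?K) (W k x u)"
        unfolding W_def J_def using u fK fx w[of k x]
        by (subst TA_TA) (auto intro!: disc_Obj incl_cfun is_dcpo_disc simp: cfun_disc is_dcpo_disc)
      finally show ?thesis .
    qed
    ultimately have "W ?K x ?u = opn (T (disc (insert x ?K))) s
      (map (J N (insert x ?K)) us @ J (insert x k) (insert x ?K) (W k x u) # map (J N (insert x ?K)) vs)"
      using us vs by (auto simp: subset_iff comp_def intro!: arg_cong[where f = "opn (T (disc (insert x ?K))) s"])
    then show ?thesis unfolding shift_def by simp
  qed
  then show "continuous X P (\<lambda>x. shift s N us vs q (insert x k) (W k x u))"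
    using continuous_cong[OF obs_W[OF q K u']] by simp
qed

lemma gop_extends:
  assumes ps: "set ps \<subseteq> Idx" and qs: "set qs \<subseteq> Idx" and s: "s \<in> S (Suc (length ps + length qs))"
  shows "\<exists>E. continuous Z Z E \<and> (\<forall>i\<in>Idx. E (b i) = gop s (ps @ i # qs))"
proof -
  let ?N = "\<Union> (fst ` set (ps @ qs))"
  have N: "?N \<in> fins" using ps qs by (intro Idx_Union) simp
  let ?us = "map (\<lambda>i. J (fst i) ?N (snd i)) ps" and ?vs = "map (\<lambda>i. J (fst i) ?N (snd i)) qs"
  have uv: "set ?us \<subseteq> carr (TO (disc ?N))" "set ?vs \<subseteq> carr (TO (disc ?N))"
    by (rule J_Idx[OF ps fins_finite[OF N]], force, rule J_Idx[OF qs fins_finite[OF N]], force)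
  \<comment> \<open>Precomposition with the translation of observations: each coordinate of the
    result is a coordinate of the argument, so continuity reduces to that of projections.\<close>
  define R :: "(('u set \<Rightarrow> 'u \<Rightarrow> 'u) \<Rightarrow> 'u) \<Rightarrow> ('u set \<Rightarrow> 'u \<Rightarrow> 'u) \<Rightarrow> 'u" where "R = (\<lambda>z. \<lambda>q\<in>obs. z (shift s ?N ?us ?vs q))"
  have sh: "shift s ?N ?us ?vs q \<in> obs" if "q \<in> obs" for q
    using s by (intro shift_obs[OF that N uv]) simp
  have R: "continuous PP PP R"
    unfolding PP_def R_def using sh
    by (intro continuous_into_prod_dcpo is_dcpo_prod_dcpo dP) (auto intro: continuous_proj dP)
  have Rb: "R (b i) = gop s (ps @ i # qs)" if i: "i \<in> Idx" for i
  proof -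
    obtain n t where nt: "i = (n, t)" "n \<in> fins" "t \<in> carr (TO (disc n))" using i by (auto simp: Idx_def)
    let ?M = "n \<union> ?N"
    have M: "?M \<in> fins" using fins_Un nt(2) N by blast
    have JJ: "J ?N ?M (J (fst j) ?N (snd j)) = J (fst j) ?M (snd j)" if "j \<in> set ps \<union> set qs" for j
      using that ps qs by (intro J_J[OF fins_finite[OF M]]) (auto simp: Idx_def)
    have "gop s (ps @ i # qs) = b (?M, opn (T (disc ?M)) s (map (\<lambda>i. J (fst i) ?M (snd i)) (ps @ i # qs)))"
      using ps qs i s nt by (intro gop_eq[OF _ _ M]) auto
    also have "map (\<lambda>i. J (fst i) ?M (snd i)) (ps @ i # qs) = map (J ?N ?M) ?us @ J n ?M t # map (J ?N ?M) ?vs"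
      using JJ nt(1) by simp
    finally show ?thesis using sh nt(1) by (auto simp: R_def b_def shift_def)
  qed
  \<comment> \<open>Basic points go to basic points, and \<open>carr Z\<close> is closed under
    directed joins.\<close>
  have RZ: "R z \<in> carr Z" if "z \<in> carr Z" for z
  proof -
    have "dcl PP (b ` Idx) \<subseteq> {z \<in> carr PP. R z \<in> carr Z}"
    proof (rule dcl_least[OF _ dclosed_preimage[OF R dPP dclosed_Z]])
      have "R (b i) \<in> carr Z" if "i \<in> Idx" for i
        using Rb[OF that] gop_Z[of "ps @ i # qs" s] ps qs s that b_Z by auto
      then show "b ` Idx \<subseteq> {z \<in> carr PP. R z \<in> carr Z}" using b_carr by auto
    qed
    then show ?thesis using that carr_Z by blast
  qed
  have "continuous Z Z R"
    by (subst (2) Z_eq, rule continuous_into_sub_dcpo[OF dZ dPP dclosed_Z Z_sub _ RZ],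
      subst Z_eq, rule continuous_from_sub_dcpo[OF dPP dclosed_Z Z_sub R])
  then show ?thesis using Rb by blast
qed

text \<open>\<open>gop_extends\<close> supplies the extension in one argument;
  \<open>extend_operation\<close> combines these into all arguments at once.\<close>

lemma ex_op: "\<exists>op. \<forall>n. \<forall>s\<in>S n. sepcont Z Z n (op s) \<and> (\<forall>is. set is \<subseteq> Idx \<longrightarrow> length is = n \<longrightarrow> op s (map b is) = gop s is)"
proof -
  have "\<forall>n s. \<exists>h. s \<in> S n \<longrightarrow> sepcont Z Z n h \<and> (\<forall>is. set is \<subseteq> Idx \<longrightarrow> length is = n \<longrightarrow> h (map b is) = gop s is)"
  proof (intro allI)
    fix n s
    show "\<exists>h. s \<in> S n \<longrightarrow> sepcont Z Z n h \<and> (\<forall>is. set is \<subseteq> Idx \<longrightarrow> length is = n \<longrightarrow> h (map b is) = gop s is)"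
    proof (cases "s \<in> S n")
      case True
      have "\<exists>h. sepcont Z Z n h \<and> (\<forall>is. set is \<subseteq> Idx \<longrightarrow> length is = n \<longrightarrow> h (map b is) = gop s is)"
      proof (rule extend_operation[OF dZ dZ _ Z_dense])
        show "b ` Idx \<subseteq> carr Z" using b_Z by blast
        show "gop s [] \<in> carr Z" if "n = 0" using gop_Z[of "[]" s] True that b_Z by auto
      qed (use gop_extends True in auto)
      then show ?thesis by blast
    qed simp
  qed
  then obtain h where h: "\<And>n s. s \<in> S n \<Longrightarrow> sepcont Z Z n (h n s)"
    "\<And>n s is. s \<in> S n \<Longrightarrow> set is \<subseteq> Idx \<Longrightarrow> length is = n \<Longrightarrow> h n s (map b is) = gop s is"
    by metis
  \<comment> \<open>Symbols may be shared between arities, so the arity is read off the length of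
    the argument list.\<close>
  show ?thesis
    by (intro exI[of _ "\<lambda>s xs. h (length xs) s xs"] allI ballI conjI impI)
      (auto intro: sepcont_cong[OF h(1)] simp: h(2))
qed

text \<open>Taken at inclusions of finite subsets, the given cocone is itself a coordinate of the
  power; reading off this coordinate yields the factorisation. Continuity of \<open>phi\<close> in
  its first argument becomes the clause about the placeholder.\<close>

lemma q0_obs: "(\<lambda>n. phi n (incl n)) \<in> obs"
  unfolding obs_def
proof (intro CollectI conjI ballI allI impI)
  fix n assume n: "n \<in> fins"
  then show "continuous (TO (disc n)) P (phi n (incl n))"
    by (intro phi_snd) (auto simp: fins_def)
next
  fix m n t assume m: "m \<in> fins" "n \<subseteq> m" and t: "t \<in> carr (TO (disc n))"
  have "phi m (incl m) (TA (disc n) (disc m) (incl n) t) = phi n (compose n (incl m) (incl n)) t"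
    using m t by (intro phi_natural) (auto simp: fins_def intro: finite_subset)
  moreover have "compose n (incl m) (incl n) = incl n" using m(2) by (auto simp: compose_def fun_eq_iff)
  ultimately show "phi m (incl m) (J n m t) = phi n (incl n) t" by (simp add: J_def)
next
  fix k u assume k: "k \<in> fins" and u: "u \<in> carr (TO (disc (insert star k)))"
  have fk: "finite (insert star k)" using k by (simp add: fins_def)
  have wx: "w k x \<in> carr (cfun (disc (insert star k)) X)" if "x \<in> carr X" for x
    using that k by (auto simp: cfun_disc[OF dX] w_def fins_def)
  have "continuous X (cfun (disc (insert star k)) X) (w k)"
  proof (rule continuous_into_cfun[OF dX dX wx])
    show "continuous X X (\<lambda>x. w k x v)" if "v \<in> carr (disc (insert star k))" for v
      using that fins_sub[OF k] dX by (cases "v = star") (auto simp: w_def intro: continuous_ident continuous_const)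
  qed
  then have "continuous X P (\<lambda>x. phi (insert star k) (w k x) u)"
    by (rule continuous_comp[OF _ phi_fst[OF fk u] dX])
  moreover have "phi (insert star k) (w k x) u = phi (insert x k) (incl (insert x k)) (W k x u)" if "x \<in> carr X" for x
  proof -
    have "phi (insert x k) (incl (insert x k)) (W k x u) = phi (insert star k) (compose (insert star k) (incl (insert x k)) (w k x)) u"
      unfolding W_def using that k fk u w fins_sub[OF k] by (intro phi_natural) auto
    also have "compose (insert star k) (incl (insert x k)) (w k x) = w k x"
      by (auto simp: compose_def w_def)
    finally show ?thesis by (rule sym)
  qed
  ultimately show "continuous X P (\<lambda>x. phi (insert x k) (incl (insert x k)) (W k x u))"
    by (rule continuous_cong)
qed

text \<open>Once \<open>Z\<close> is known to be a model, singletons give a continuous map of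
  \<open>X\<close> into it. Its homomorphic extension, followed by the coordinate of the given
  cocone, is the required map.\<close>

lemma extension: "\<exists>h\<in>carr (cfun (TO X) P). \<forall>n x t. finite n \<longrightarrow> x \<in> n \<rightarrow>\<^sub>E carr X \<longrightarrow> t \<in> carr (TO (disc n)) \<longrightarrow>
    h (TA (disc n) X x t) = phi n x t"
proof -
  obtain op where op: "\<And>n s. s \<in> S n \<Longrightarrow> sepcont Z Z n (op s)"
    "\<And>n s is. s \<in> S n \<Longrightarrow> set is \<subseteq> Idx \<Longrightarrow> length is = n \<Longrightarrow> op s (map b is) = gop s is"
    using ex_op by blast
  have "\<exists>(A :: 'u algebra) g k. is_algebra S A \<and> continuous Z (und A) g \<and> continuous (und A) Z k \<and>
    (\<forall>x\<in>carr Z. k (g x) = x) \<and> (\<forall>x\<in>carr (und A). g (k x) = x) \<and>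
    (\<forall>s xs. s \<in> S (length xs) \<longrightarrow> set xs \<subseteq> carr Z \<longrightarrow> opn A s (map g xs) = g (op s xs)) \<and>
    (\<forall>s xs. s \<in> S (length xs) \<longrightarrow> set xs \<subseteq> carr (und A) \<longrightarrow> opn A s xs = g (op s (map k xs)))"
    by (rule transport_algebra[OF dZ small_Z op(1)])
  then obtain A g k where A0: "is_algebra S A" "continuous Z (und A) g" "continuous (und A) Z k"
    "\<forall>x\<in>carr Z. k (g x) = x" "\<forall>x\<in>carr (und A). g (k x) = x"
    "\<forall>s xs. s \<in> S (length xs) \<longrightarrow> set xs \<subseteq> carr Z \<longrightarrow> opn A s (map g xs) = g (op s xs)"
    by (elim exE conjE)
  note A = A0[rule_format]
  have gb: "g (b i) \<in> carr (und A)" if "i \<in> Idx" for i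
    by (rule continuous_carr[OF A(2) b_Z[OF that]])
  \<comment> \<open>The homomorphisms from the free algebras on finite subsets into the candidate
    colimit.\<close>
  define r where "r n = (\<lambda>t\<in>carr (TO (disc n)). g (b (n, t)))" for n
  have r: "r n \<in> alg_hom S (T (disc n)) A" if n: "n \<in> fins" for n
  proof (rule alg_homI)
    have "continuous (TO (disc n)) PP (\<lambda>t. b (n, t))"
      unfolding PP_def using obs_continuous n
      by (intro continuous_into_prod_dcpo TO_dcpo fins_Obj dP) (auto simp: b_def)
    then have "continuous (TO (disc n)) Z (\<lambda>t. b (n, t))"
      using n b_Z by (subst Z_eq, intro continuous_into_sub_dcpo TO_dcpo fins_Obj dPP dclosed_Z Z_sub) (auto simp: Idx_def)
    then show "r n \<in> carr (cfun (TO (disc n)) (und A))"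
      unfolding r_def by (intro restrict_in_cfun continuous_comp[OF _ A(2)] TO_dcpo fins_Obj n)
    fix s ts assume s: "s \<in> S (length ts)" "set ts \<subseteq> carr (TO (disc n))"
    let ?is = "map (Pair n) ts"
    have "is": "set ?is \<subseteq> Idx" using s n by (auto simp: Idx_def)
    have sub: "set (map b ?is) \<subseteq> carr Z" using "is" b_Z by auto
    have "map (r n) ts = map g (map b ?is)"
      using s(2) by (auto simp: r_def)
    then have "opn A s (map (r n) ts) = opn A s (map g (map b ?is))"
      by (rule arg_cong)
    also have "\<dots> = g (op s (map b ?is))" using s by (intro A(6) sub) simp
    also have "op s (map b ?is) = gop s ?is" using s "is" by (intro op(2)) auto
    also have "gop s ?is = b (n, opn (T (disc n)) s (map (\<lambda>i. J (fst i) n (snd i)) ?is))"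
      using s "is" by (intro gop_eq n) auto
    also have "map (\<lambda>i. J (fst i) n (snd i)) ?is = ts"
      using s(2) J_same[OF fins_finite[OF n]] by (auto intro!: map_idI)
    also have "g (b (n, opn (T (disc n)) s ts)) = r n (opn (T (disc n)) s ts)"
      using algebra_closed[OF T_algebra[OF fins_Obj[OF n]] s] by (simp add: r_def)
    finally show "r n (opn (T (disc n)) s ts) = opn A s (map (r n) ts)" by (rule sym)
  qed
  have rJ: "r m (J n m t) = g (b (n, t))" if "m \<in> fins" "n \<subseteq> m" "t \<in> carr (TO (disc n))" for m n t
    using that by (simp add: r_def b_J J_carr fins_finite)
  have dense: "carr (und A) = dcl (und A) (g ` b ` Idx)"
  proof
    have "dcl Z (b ` Idx) \<subseteq> {z \<in> carr Z. g z \<in> dcl (und A) (g ` b ` Idx)}"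
      using b_Z by (intro dcl_least dclosed_preimage[OF A(2) dZ dclosed_dcl]) (auto intro: dcl.base)
    then have "g (k a) \<in> dcl (und A) (g ` b ` Idx)" if "a \<in> carr (und A)" for a
      using continuous_carr[OF A(3) that] Z_dense by blast
    then show "carr (und A) \<subseteq> dcl (und A) (g ` b ` Idx)" using A(5) by auto
    show "dcl (und A) (g ` b ` Idx) \<subseteq> carr (und A)" using gb by (intro dcl_subset_carr) auto
  qed
  \<comment> \<open>By \<open>satisfies_dcl\<close> only assignments to basic points matter. As
    finitely many variables occur, such an assignment lifts along one \<open>r n\<close> to a free
    algebra, where the equation holds.\<close>
  have "satisfies A e" if e: "e \<in> E" for e
  proof (rule satisfies_dcl[OF A(1) _ _ dense])
    show e': "e \<in> ext_trms S \<times> ext_trms S" using e equations by blast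
    show "g ` b ` Idx \<subseteq> carr (und A)" using gb by auto
    fix f :: "nat \<Rightarrow> 'u" assume f: "f \<in> UNIV \<rightarrow> g ` b ` Idx"
    then have "\<forall>v. \<exists>i. i \<in> Idx \<and> f v = g (b i)" by blast
    then obtain i where i: "\<And>v. i v \<in> Idx" "\<And>v. f v = g (b (i v))" by metis
    define vars where "vars = ext_vars (fst e) \<union> ext_vars (snd e)"
    have fin: "finite vars" using e' finite_ext_vars by (auto simp: vars_def)
    \<comment> \<open>Adjoining \<open>0\<close> provides a value over \<open>n\<close> that
      \<open>f'\<close> assigns to the variables outside \<open>vars\<close>.\<close>
    define n where "n = (\<Union>v\<in>insert 0 vars. fst (i v))"
    have "fst (i v) \<in> fins" for v using Idx_D[OF i(1)] by blast
    then have n: "n \<in> fins" using fin by (auto simp: n_def fins_def)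
    define f' where "f' v = (let v' = if v \<in> vars then v else 0 in J (fst (i v')) n (snd (i v')))" for v
    have sub: "fst (i v) \<subseteq> n" if "v \<in> insert 0 vars" for v using that by (auto simp: n_def)
    have snd_i: "snd (i v) \<in> carr (TO (disc (fst (i v))))" for v using i(1)[of v] by (auto simp: Idx_def)
    have f': "f' \<in> UNIV \<rightarrow> carr (TO (disc n))"
      using sub snd_i J_carr[OF fins_finite[OF n]] by (auto simp: f'_def Let_def)
    have rf': "(r n \<circ> f') v = f v" if "v \<in> vars" for v
      using that sub[of v] snd_i[of v] i(2)[of v] rJ[OF n] by (simp add: f'_def)
    have sat: "satisfies (T (disc n)) e" using T_models[OF fins_Obj[OF n]] e by (simp add: models_def)
    have val: "ext_val A f u = Some (r n (the (ext_val (T (disc n)) f' u)))"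
      if u: "u = fst e \<or> u = snd e" for u
    proof -
      have "u \<in> ext_trms S" "ext_val (T (disc n)) f' u \<noteq> None"
        using u e' sat f' unfolding satisfies_def by auto
      then have "ext_val A (r n \<circ> f') u = Some (r n (the (ext_val (T (disc n)) f' u)))"
        by (intro ext_val_hom[OF T_algebra[OF fins_Obj[OF n]] A(1) r[OF n] f'])
      moreover have "ext_val A (r n \<circ> f') u = ext_val A f u"
        using u rf' by (intro ext_val_cong) (auto simp: vars_def)
      ultimately show ?thesis by simp
    qed
    moreover have "ext_val (T (disc n)) f' (fst e) = ext_val (T (disc n)) f' (snd e)"
      using sat f' unfolding satisfies_def by blast
    ultimately show "ext_val A f (fst e) \<noteq> None \<and> ext_val A f (snd e) \<noteq> None \<and> ext_val A f (fst e) = ext_val A f (snd e)"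
      by simp
  qed
  then have model: "A \<in> models S E" using A(1) by (simp add: models_def)
  define xi where "xi = (\<lambda>x\<in>carr X. g (b ({x}, eta (disc {x}) x)))"
  have single: "{x} \<in> fins" "({x}, eta (disc {x}) x) \<in> Idx" if "x \<in> carr X" for x
    using that eta_carr[OF disc_Obj, of "{x}" x] by (auto simp: fins_def Idx_def)
  have xi: "xi \<in> carr (cfun X (und A))"
  proof -
    \<comment> \<open>Continuity in \<open>x\<close> is the placeholder clause of \<open>obs\<close>
      for \<open>k = {}\<close> and the generator \<open>star\<close>.\<close>
    have "continuous X PP (\<lambda>x. b ({x}, eta (disc {x}) x))"
      unfolding PP_def
    proof (rule continuous_into_prod_dcpo[OF dX dP])
      fix q assume q: "q \<in> obs"
      have "eta (disc {star}) star \<in> carr (TO (disc {star}))" by (intro eta_carr disc_Obj) auto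
      then have "continuous X P (\<lambda>x. q {x} (W {} x (eta (disc {star}) star)))"
        using obs_W[OF q fins_empty] by simp
      moreover have "W {} x (eta (disc {star}) star) = eta (disc {x}) x" for x
        unfolding W_def using w[of "{}" x]
        by (subst TA_eta) (auto intro!: disc_Obj simp: cfun_disc is_dcpo_disc w_def)
      ultimately show "continuous X P (\<lambda>x. b ({x}, eta (disc {x}) x) q)" using q by (simp add: b_def)
    qed (simp add: b_def)
    then have "continuous X Z (\<lambda>x. b ({x}, eta (disc {x}) x))"
      using single b_Z by (subst Z_eq, intro continuous_into_sub_dcpo dX dPP dclosed_Z Z_sub) auto
    then show ?thesis unfolding xi_def by (intro restrict_in_cfun continuous_comp[OF _ A(2) dX])
  qed
  define m where "m = ext X A xi"
  have m: "m \<in> alg_hom S (T X) A" "\<And>x. x \<in> carr X \<Longrightarrow> m (eta X x) = xi x"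
    unfolding m_def using ext_hom[OF X model xi] ext_eta[OF X model xi] by auto
  \<comment> \<open>Both sides are homomorphisms on the free algebra on \<open>n\<close>; on a
    generator both reduce to the point given by a singleton.\<close>
  have m_r: "m (TA (disc n) X (incl n) t) = r n t" if n: "n \<in> fins" and t: "t \<in> carr (TO (disc n))" for n t
  proof -
    note dn = fins_Obj[OF n] and i = incl_cfun[OF dX fins_sub[OF n]]
    have "compose (carr (TO (disc n))) m (TA (disc n) X (incl n)) = r n"
    proof (rule hom_eqI[OF dn model alg_hom_compose[OF T_algebra[OF dn] TA_hom[OF dn X i] m(1)] r[OF n]])
      fix v assume "v \<in> carr (disc n)"
      then have v: "v \<in> n" by simp
      then have vX: "v \<in> carr X" using fins_sub[OF n] by blast
      have "r n (eta (disc n) v) = r n (J {v} n (eta (disc {v}) v))"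
        using v J_eta[OF fins_finite[OF n], of "{v}" v] by simp
      also have "\<dots> = g (b ({v}, eta (disc {v}) v))"
        using v single[OF vX] by (intro rJ[OF n]) (auto simp: Idx_def)
      finally show "compose (carr (TO (disc n))) m (TA (disc n) X (incl n)) (eta (disc n) v) = r n (eta (disc n) v)"
        using v vX eta_carr[OF dn, of v] m(2)[OF vX] by (simp add: TA_eta[OF dn X i] xi_def)
    qed
    then show ?thesis using t by (metis compose_apply)
  qed
  let ?q = "\<lambda>n. phi n (incl n)"
  define h where "h = (\<lambda>z\<in>carr (TO X). k (m z) ?q)"
  have "continuous Z P (\<lambda>z. z ?q)"
    by (subst Z_eq, rule continuous_from_sub_dcpo[OF dPP dclosed_Z Z_sub], unfold PP_def,
      rule continuous_proj) (simp_all add: dP q0_obs)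
  then have "h \<in> carr (cfun (TO X) P)"
    unfolding h_def
    by (intro restrict_in_cfun continuous_comp[OF continuous_comp[OF alg_hom_continuous[OF m(1)] A(3)]] TO_dcpo X)
  moreover have "h (TA (disc n) X x t) = phi n x t"
    if n: "finite n" and x: "x \<in> n \<rightarrow>\<^sub>E carr X" and t: "t \<in> carr (TO (disc n))" for n x t
  proof -
    \<comment> \<open>A general \<open>x\<close> factors through its image, a finite subset of
      \<open>X\<close>; dinaturality of \<open>phi\<close> along this factorisation reduces the
      claim to an inclusion.\<close>
    have xn: "x ` n \<in> fins" using n x by (auto simp: fins_def)
    have x': "x \<in> n \<rightarrow>\<^sub>E x ` n" using x by auto
    note dxn = fins_Obj[OF xn] and i = incl_cfun[OF dX fins_sub[OF xn]]
    have xc: "x \<in> carr (cfun (disc n) (disc (x ` n)))" using x' by (simp add: cfun_disc is_dcpo_disc)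
    let ?t = "TA (disc n) (disc (x ` n)) x t"
    have t': "?t \<in> carr (TO (disc (x ` n)))" by (rule TA_carr[OF disc_Obj[OF n] dxn xc t])
    have comp: "compose n (incl (x ` n)) x = x" using x by (auto simp: compose_def PiE_iff extensional_def fun_eq_iff)
    have eq: "TA (disc n) X x t = TA (disc (x ` n)) X (incl (x ` n)) ?t"
      using TA_TA[OF disc_Obj[OF n] dxn X xc i t] comp by simp
    have "h (TA (disc n) X x t) = k (r (x ` n) ?t) ?q"
      unfolding eq using m_r[OF xn t'] TA_carr[OF dxn X i t'] by (simp add: h_def)
    also have "\<dots> = phi (x ` n) (incl (x ` n)) ?t"
      using t' xn A(4)[OF b_Z, of "(x ` n, ?t)"] q0_obs by (simp add: r_def Idx_def b_def)
    also have "\<dots> = phi n x t"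
      using phi_natural[OF n fins_finite[OF xn] x' _ t, of "incl (x ` n)"] fins_sub[OF xn] comp by auto
    finally show ?thesis .
  qed
  ultimately show ?thesis by blast
qed

end

lemma enriched_endofunctorD:
  assumes "enriched_endofunctor G" "X \<in> Obj DCPO" "Y \<in> Obj DCPO"
  shows endo_Obj: "FObj G X \<in> Obj DCPO"
    and endo_cfun: "f \<in> carr (cfun X Y) \<Longrightarrow> FArr G X Y f \<in> carr (cfun (FObj G X) (FObj G Y))"
    and endo_ident: "FArr G X X (\<lambda>x\<in>carr X. x) = (\<lambda>x\<in>carr (FObj G X). x)"
    and endo_compose: "Z \<in> Obj DCPO \<Longrightarrow> f \<in> carr (cfun X Y) \<Longrightarrow> g \<in> carr (cfun Y Z) \<Longrightarrow>
      FArr G X Z (compose (carr X) g f) = compose (carr (FObj G X)) (FArr G Y Z g) (FArr G X Y f)"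
    and endo_continuous: "continuous (cfun X Y) (cfun (FObj G X) (FObj G Y)) (FArr G X Y)"
proof -
  have G: "is_functor DCPO DCPO G" using assms(1) by (simp add: enriched_endofunctor_def)
  show "FObj G X \<in> Obj DCPO"
    "f \<in> carr (cfun X Y) \<Longrightarrow> FArr G X Y f \<in> carr (cfun (FObj G X) (FObj G Y))"
    "FArr G X X (\<lambda>x\<in>carr X. x) = (\<lambda>x\<in>carr (FObj G X). x)"
    using G assms(2,3) unfolding is_functor_def Hom_DCPO Ide_DCPO by blast+
  show "Z \<in> Obj DCPO \<Longrightarrow> f \<in> carr (cfun X Y) \<Longrightarrow> g \<in> carr (cfun Y Z) \<Longrightarrow>
      FArr G X Z (compose (carr X) g f) = compose (carr (FObj G X)) (FArr G Y Z g) (FArr G X Y f)"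
    using G assms(2,3) unfolding is_functor_def Hom_DCPO Comp_DCPO by blast
  show "continuous (cfun X Y) (cfun (FObj G X) (FObj G Y)) (FArr G X Y)"
    using assms by (simp add: enriched_endofunctor_def hom_dcpo_eq)
qed

lemma nat_trans_DCPO:
  "nat_trans DCPO DCPO F G \<tau> \<longleftrightarrow> \<tau> \<in> extensional (Obj DCPO) \<and>
     (\<forall>X\<in>Obj DCPO. \<tau> X \<in> carr (cfun (FObj F X) (FObj G X))) \<and>
     (\<forall>X\<in>Obj DCPO. \<forall>Y\<in>Obj DCPO. \<forall>f\<in>carr (cfun X Y).
        compose (carr (FObj F X)) (\<tau> Y) (FArr F X Y f) = compose (carr (FObj F X)) (FArr G X Y f) (\<tau> X))"
  unfolding nat_trans_def Hom_DCPO Comp_DCPO by (auto simp: PiE_iff)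

lemma FArr_discrete [simp]: "FArr discrete X Y f = f"
  by (simp add: discrete_def)

lemma nat_trans_FinSet:
  "nat_trans FinSet DCPO (F \<odot> discrete) (G \<odot> discrete) \<sigma> \<longleftrightarrow> \<sigma> \<in> extensional {n. finite n} \<and>
     (\<forall>n. finite n \<longrightarrow> \<sigma> n \<in> carr (cfun (FObj F (disc n)) (FObj G (disc n)))) \<and>
     (\<forall>n m f. finite n \<longrightarrow> finite m \<longrightarrow> f \<in> n \<rightarrow>\<^sub>E m \<longrightarrow>
        compose (carr (FObj F (disc n))) (\<sigma> m) (FArr F (disc n) (disc m) f) =
        compose (carr (FObj F (disc n))) (FArr G (disc n) (disc m) f) (\<sigma> n))"
  unfolding nat_trans_def Hom_DCPO Comp_DCPO by (auto simp: PiE_iff FinSet_def Ball_def)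

section \<open>Strong finitarity and Eilenberg--Moore algebras\<close>

context free_algebras
begin

text \<open>Existence is \<open>extension\<close> at each \<open>X\<close>, applied to the cocone
  with vertex \<open>G X\<close> made from \<sigma>; naturality and uniqueness are checked on the
  basic elements, which are dense.\<close>

lemma strongly_finitary_free_monad:
  assumes M: "is_free_monad M"
  shows "strongly_finitary (Fun M)"
  unfolding strongly_finitary_def
proof (intro conjI allI impI; (elim conjE)?)
  note M' = is_free_monadD[OF M]
  show "enriched_endofunctor (Fun M)" using enriched_free_monad[OF M] by (simp add: enriched_monad_def)
  fix G \<sigma> assume G: "enriched_endofunctor G" and \<sigma>: "nat_trans FinSet DCPO (Fun M \<odot> discrete) (G \<odot> discrete) \<sigma>"
  note GO = endo_Obj[OF G] and GA = endo_cfun[OF G] and Gc = endo_compose[OF G]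
  have GG: "FArr G Y Z g (FArr G X Y f y) = FArr G X Z (compose (carr X) g f) y"
    if "X \<in> Obj DCPO" "Y \<in> Obj DCPO" "Z \<in> Obj DCPO" "f \<in> carr (cfun X Y)" "g \<in> carr (cfun Y Z)" "y \<in> carr (FObj G X)"
    for X Y Z f g y
    using Gc[OF that(1-5)] that(6) by simp
  have \<sigma>c: "\<sigma> n \<in> carr (cfun (TO (disc n)) (FObj G (disc n)))" if "finite n" for n
    using \<sigma> that unfolding M'(1)[OF disc_Obj[OF that], symmetric] by (simp add: nat_trans_FinSet)
  have \<sigma>n: "\<sigma> m (TA (disc n) (disc m) f t) = FArr G (disc n) (disc m) f (\<sigma> n t)"
    if nm: "finite n" "finite m" "f \<in> n \<rightarrow>\<^sub>E m" "t \<in> carr (TO (disc n))" for n m f t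
  proof -
    have fc: "f \<in> carr (cfun (disc n) (disc m))" using nm by (simp add: cfun_disc is_dcpo_disc)
    have "compose (carr (TO (disc n))) (\<sigma> m) (TA (disc n) (disc m) f) =
      compose (carr (TO (disc n))) (FArr G (disc n) (disc m) f) (\<sigma> n)"
      using \<sigma> nm unfolding M'(1)[OF disc_Obj[OF nm(1)], symmetric] M'(4)[OF disc_Obj[OF nm(1)] disc_Obj[OF nm(2)] fc, symmetric]
      by (simp add: nat_trans_FinSet)
    from fun_cong[OF this, of t] nm(4) show ?thesis by simp
  qed
  have "\<exists>h\<in>carr (cfun (TO X) (FObj G X)). \<forall>n x t. finite n \<longrightarrow> x \<in> n \<rightarrow>\<^sub>E carr X \<longrightarrow> t \<in> carr (TO (disc n)) \<longrightarrow>
    h (TA (disc n) X x t) = FArr G (disc n) X x (\<sigma> n t)" if X: "X \<in> Obj DCPO" for X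
  proof -
    note dX = is_dcpo_Obj[OF X] and dGX = is_dcpo_Obj[OF GO[OF X X]]
    \<comment> \<open>Local continuity of \<open>G\<close> gives continuity in \<open>x\<close>, and
      naturality of \<sigma> gives dinaturality.\<close>
    interpret cocone U S E T eta X "FObj G X" "\<lambda>n x t. FArr G (disc n) X x (\<sigma> n t)"
    proof (unfold_locales, fact X, fact GO[OF X X])
      fix n :: "'u set" and t assume n: "finite n" and t: "t \<in> carr (TO (disc n))"
      note dn = disc_Obj[OF n]
      have "\<sigma> n t \<in> carr (FObj G (disc n))" by (rule cfun_carr[OF \<sigma>c[OF n] t])
      then show "continuous (cfun (disc n) X) (FObj G X) (\<lambda>x. FArr G (disc n) X x (\<sigma> n t))"
        using dX dGX by (intro continuous_comp[OF endo_continuous[OF G dn X] continuous_eval] is_dcpo_cfun)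
    next
      fix n :: "'u set" and x assume n: "finite n" and x: "x \<in> n \<rightarrow>\<^sub>E carr X"
      note dn = disc_Obj[OF n]
      have "x \<in> carr (cfun (disc n) X)" using x by (simp add: cfun_disc[OF dX])
      then show "continuous (TO (disc n)) (FObj G X) (\<lambda>t. FArr G (disc n) X x (\<sigma> n t))"
        using TO_dcpo[OF dn] by (intro continuous_comp[OF cfunD[OF \<sigma>c[OF n]] cfunD[OF GA[OF dn X]]])
    next
      fix n m :: "'u set" and f x t
      assume *: "finite n" "finite m" "f \<in> n \<rightarrow>\<^sub>E m" "x \<in> m \<rightarrow>\<^sub>E carr X" "t \<in> carr (TO (disc n))"
      then show "FArr G (disc m) X x (\<sigma> m (TA (disc n) (disc m) f t)) = FArr G (disc n) X (compose n x f) (\<sigma> n t)"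
        using cfun_carr[OF \<sigma>c[OF *(1)] *(5)] disc_Obj X
        by (simp add: \<sigma>n) (subst GG, auto simp: cfun_disc is_dcpo_disc dX)
    qed
    show ?thesis by (rule extension)
  qed
  then have "\<forall>X\<in>Obj DCPO. \<exists>h. h \<in> carr (cfun (TO X) (FObj G X)) \<and> (\<forall>n x t. finite n \<longrightarrow>
    x \<in> n \<rightarrow>\<^sub>E carr X \<longrightarrow> t \<in> carr (TO (disc n)) \<longrightarrow> h (TA (disc n) X x t) = FArr G (disc n) X x (\<sigma> n t))"
    unfolding Bex_def by blast
  from bchoice[OF this] obtain h where h0: "\<forall>X\<in>Obj DCPO. h X \<in> carr (cfun (TO X) (FObj G X)) \<and> (\<forall>n x t. finite n \<longrightarrow>
    x \<in> n \<rightarrow>\<^sub>E carr X \<longrightarrow> t \<in> carr (TO (disc n)) \<longrightarrow> h X (TA (disc n) X x t) = FArr G (disc n) X x (\<sigma> n t))" ..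
  have h: "h X \<in> carr (cfun (TO X) (FObj G X))"
    "finite n \<Longrightarrow> x \<in> n \<rightarrow>\<^sub>E carr X \<Longrightarrow> t \<in> carr (TO (disc n)) \<Longrightarrow>
      h X (TA (disc n) X x t) = FArr G (disc n) X x (\<sigma> n t)" if "X \<in> Obj DCPO" for X n x t
    using h0[rule_format, OF that] by simp_all
  define \<tau> where "\<tau> = restrict h (Obj DCPO)"
  have eq_basics: "f = g" if X: "X \<in> Obj DCPO" and P: "is_dcpo P" and f: "f \<in> carr (cfun (TO X) P)" and g: "g \<in> carr (cfun (TO X) P)"
    and eq: "\<And>n t. finite n \<Longrightarrow> n \<subseteq> carr X \<Longrightarrow> t \<in> carr (TO (disc n)) \<Longrightarrow> f (TA (disc n) X (incl n) t) = g (TA (disc n) X (incl n) t)"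
    for X P f g
  proof (rule cfun_eqI[OF f g])
    fix z assume "z \<in> carr (TO X)"
    then have "z \<in> dcl (TO X) (basics X)" by (simp only: basics_dense[OF X, symmetric])
    then show "f z = g z"
      by (rule eq_on_dcl[OF P cfunD[OF f] cfunD[OF g] basics_carr[OF X], rotated]) (use eq in \<open>auto simp: basics_def\<close>)
  qed
  have nat: "nat_trans DCPO DCPO (Fun M) G \<tau>"
    unfolding nat_trans_DCPO
  proof (intro conjI ballI)
    show "\<tau> \<in> extensional (Obj DCPO)" by (simp add: \<tau>_def)
    show "\<tau> X \<in> carr (cfun (FObj (Fun M) X) (FObj G X))" if "X \<in> Obj DCPO" for X
      using that h(1) M'(1) by (simp add: \<tau>_def)
    fix X Y :: "'u dcpo" and f assume X: "X \<in> Obj DCPO" and Y: "Y \<in> Obj DCPO" and f: "f \<in> carr (cfun X Y)"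
    have "compose (carr (TO X)) (h Y) (TA X Y f) = compose (carr (TO X)) (FArr G X Y f) (h X)"
    proof (rule eq_basics[OF X is_dcpo_Obj[OF GO[OF Y Y]]])
      show "compose (carr (TO X)) (h Y) (TA X Y f) \<in> carr (cfun (TO X) (FObj G Y))"
        by (rule compose_in_cfun[OF TA_cfun[OF X Y f] h(1)[OF Y] TO_dcpo[OF X]])
      show "compose (carr (TO X)) (FArr G X Y f) (h X) \<in> carr (cfun (TO X) (FObj G Y))"
        by (rule compose_in_cfun[OF h(1)[OF X] GA[OF X Y f] TO_dcpo[OF X]])
      fix n t assume n: "finite n" "n \<subseteq> carr X" and t: "t \<in> carr (TO (disc n))"
      note dn = disc_Obj[OF n(1)] and i = incl_cfun[OF is_dcpo_Obj[OF X] n(2)]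
      have iE: "incl n \<in> n \<rightarrow>\<^sub>E carr X" using n(2) by auto
      have fi: "compose n f (incl n) \<in> n \<rightarrow>\<^sub>E carr Y" using cfun_ext[OF f] n(2) by (auto simp: compose_def)
      have "compose (carr (TO X)) (h Y) (TA X Y f) (TA (disc n) X (incl n) t) = h Y (TA (disc n) Y (compose n f (incl n)) t)"
        using TA_carr[OF dn X i t] TA_TA[OF dn X Y i f t] by simp
      also have "\<dots> = FArr G (disc n) Y (compose n f (incl n)) (\<sigma> n t)" by (rule h(2)[OF Y n(1) fi t])
      also have "\<dots> = FArr G X Y f (FArr G (disc n) X (incl n) (\<sigma> n t))"
        using GG[OF dn X Y i f cfun_carr[OF \<sigma>c[OF n(1)] t]] by simp
      also have "\<dots> = FArr G X Y f (h X (TA (disc n) X (incl n) t))" using h(2)[OF X n(1) iE t] by simp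
      finally show "compose (carr (TO X)) (h Y) (TA X Y f) (TA (disc n) X (incl n) t) =
        compose (carr (TO X)) (FArr G X Y f) (h X) (TA (disc n) X (incl n) t)"
        by (simp only: compose_apply[OF TA_carr[OF dn X i t]])
    qed
    then show "compose (carr (FObj (Fun M) X)) (\<tau> Y) (FArr (Fun M) X Y f) = compose (carr (FObj (Fun M) X)) (FArr G X Y f) (\<tau> X)"
      using X Y f M' by (simp add: \<tau>_def)
  qed
  have on_disc: "\<tau> (disc n) = \<sigma> n" if n: "finite n" for n
  proof (rule cfun_eqI)
    note dn = disc_Obj[OF n]
    show "\<tau> (disc n) \<in> carr (cfun (TO (disc n)) (FObj G (disc n)))" using dn h(1) by (simp add: \<tau>_def)
    show "\<sigma> n \<in> carr (cfun (TO (disc n)) (FObj G (disc n)))" by (rule \<sigma>c[OF n])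
    fix t assume t: "t \<in> carr (TO (disc n))"
    have "h (disc n) (TA (disc n) (disc n) (incl n) t) = FArr G (disc n) (disc n) (incl n) (\<sigma> n t)"
      using n t by (intro h(2)[OF dn]) auto
    then show "\<tau> (disc n) t = \<sigma> n t"
      using TA_ident[OF dn] endo_ident[OF G dn dn] dn t cfun_carr[OF \<sigma>c[OF n] t] by (simp add: \<tau>_def)
  qed
  show "\<exists>!\<tau>. nat_trans DCPO DCPO (Fun M) G \<tau> \<and> (\<forall>X\<in>Obj FinSet. \<tau> (FObj discrete X) = \<sigma> X)"
  proof (rule ex1I[of _ \<tau>])
    show "nat_trans DCPO DCPO (Fun M) G \<tau> \<and> (\<forall>X\<in>Obj FinSet. \<tau> (FObj discrete X) = \<sigma> X)"
      using nat on_disc by (simp add: FinSet_def)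
    fix \<tau>' assume "nat_trans DCPO DCPO (Fun M) G \<tau>' \<and> (\<forall>X\<in>Obj FinSet. \<tau>' (FObj discrete X) = \<sigma> X)"
    then have \<tau>': "nat_trans DCPO DCPO (Fun M) G \<tau>'" "\<And>n. finite n \<Longrightarrow> \<tau>' (disc n) = \<sigma> n" by (simp_all add: FinSet_def)
    have basic: "\<rho> X (TA (disc n) X (incl n) t) = FArr G (disc n) X (incl n) (\<rho> (disc n) t)"
      if "nat_trans DCPO DCPO (Fun M) G \<rho>" and X: "X \<in> Obj DCPO" and n: "finite n" "n \<subseteq> carr X" and t: "t \<in> carr (TO (disc n))"
      for \<rho> X n t
    proof -
      note dn = disc_Obj[OF n(1)] and i = incl_cfun[OF is_dcpo_Obj[OF X] n(2)]
      have "compose (carr (TO (disc n))) (\<rho> X) (TA (disc n) X (incl n)) = compose (carr (TO (disc n))) (FArr G (disc n) X (incl n)) (\<rho> (disc n))"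
        using that(1) dn X i M'(1,4)[OF dn] unfolding nat_trans_DCPO by metis
      from fun_cong[OF this, of t] t show ?thesis by (simp only: compose_apply)
    qed
    show "\<tau>' = \<tau>"
    proof (rule extensionalityI)
      show "\<tau>' \<in> extensional (Obj DCPO)" "\<tau> \<in> extensional (Obj DCPO)" using \<tau>'(1) nat by (simp_all add: nat_trans_DCPO)
      fix X :: "'u dcpo" assume X: "X \<in> Obj DCPO"
      show "\<tau>' X = \<tau> X"
      proof (rule eq_basics[OF X is_dcpo_Obj[OF GO[OF X X]]])
        show "\<tau>' X \<in> carr (cfun (TO X) (FObj G X))" "\<tau> X \<in> carr (cfun (TO X) (FObj G X))"
          using \<tau>'(1) nat X unfolding M'(1)[OF X, symmetric] by (simp_all add: nat_trans_DCPO)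
        show "\<tau>' X (TA (disc n) X (incl n) t) = \<tau> X (TA (disc n) X (incl n) t)"
          if n: "finite n" "n \<subseteq> carr X" and t: "t \<in> carr (TO (disc n))" for n t
          using basic[OF \<tau>'(1) X n t] basic[OF nat X n t] \<tau>'(2)[OF n(1)] on_disc[OF n(1)] by simp
      qed
    qed
  qed
qed

text \<open>The algebra that an Eilenberg--Moore structure map \<open>a\<close> induces: perform the
  operation formally on generators, then evaluate by \<open>a\<close>. Elsewhere the value is
  \<open>undefined\<close>, as \<open>is_algebra\<close> demands.\<close>

definition EM :: "'u dcpo \<Rightarrow> ('u \<Rightarrow> 'u) \<Rightarrow> 'u algebra" where
  "EM X a = \<lparr>und = X, opn = (\<lambda>s xs. if s \<in> S (length xs) \<and> set xs \<subseteq> carr X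
     then a (opn (T X) s (map (eta X) xs)) else undefined)\<rparr>"

lemma und_EM [simp]: "und (EM X a) = X"
  by (simp add: EM_def)

context
  fixes X a
  assumes X: "X \<in> Obj DCPO" and a: "a \<in> carr (cfun (TO X) X)"
    and a_eta: "\<And>x. x \<in> carr X \<Longrightarrow> a (eta X x) = x"
    and a_mu: "\<And>z. z \<in> carr (TO (TO X)) \<Longrightarrow> a (mu X z) = a (TA (TO X) X a z)"
begin

text \<open>Every element of the free algebra on \<open>X\<close> is \<open>mu X\<close> of a
  generator of the free algebra on \<open>TO X\<close>; there the law \<open>a_mu\<close> lets
  \<open>a\<close> be applied inside the operation.\<close>

lemma EM_hom: "a \<in> alg_hom S (T X) (EM X a)"
proof (rule alg_homI)
  show "a \<in> carr (cfun (TO X) (und (EM X a)))" using a by simp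
  fix s zs assume s: "s \<in> S (length zs)" "set zs \<subseteq> carr (TO X)"
  note TX = TO_Obj[OF X]
  have e: "set (map (eta (TO X)) zs) \<subseteq> carr (TO (TO X))" using s(2) eta_carr[OF TX] by auto
  have "map (mu X) (map (eta (TO X)) zs) = zs" using s(2) mu_eta[OF X] by (auto intro!: map_idI)
  then have "a (opn (T X) s zs) = a (mu X (opn (T (TO X)) s (map (eta (TO X)) zs)))"
    using alg_hom_op[OF mu_hom[OF X] _ e] s(1) by simp
  also have "\<dots> = a (TA (TO X) X a (opn (T (TO X)) s (map (eta (TO X)) zs)))"
    using s e by (intro a_mu algebra_closed[OF T_algebra[OF TX]]) auto
  also have "\<dots> = a (opn (T X) s (map (TA (TO X) X a) (map (eta (TO X)) zs)))"
    using alg_hom_op[OF TA_hom[OF TX X a] _ e, of s] s(1) by simp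
  also have "map (TA (TO X) X a) (map (eta (TO X)) zs) = map (eta X) (map a zs)"
    using s(2) TA_eta[OF TX X a] by auto
  also have "a (opn (T X) s (map (eta X) (map a zs))) = opn (EM X a) s (map a zs)"
    using s cfun_carr[OF a] by (auto simp: EM_def)
  finally show "a (opn (T X) s zs) = opn (EM X a) s (map a zs)" .
qed

text \<open>\<open>a\<close> is a homomorphism from the free algebra and \<open>eta X\<close> is a
  section of it, so the equations descend by \<open>satisfies_retract\<close>.\<close>

lemma EM_models: "EM X a \<in> models S E"
proof -
  have "is_algebra S (EM X a)"
  proof (rule is_algebraI)
    show "und (EM X a) \<in> Obj DCPO" using X by simp
    fix n s assume s: "s \<in> S n"
    have op: "opn (EM X a) s xs = a (opn (T X) s (map (eta X) xs))" if "length xs = n" "set xs \<subseteq> carr X" for xs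
      using that s by (simp add: EM_def)
    show "sepcont (und (EM X a)) (und (EM X a)) n (opn (EM X a) s)"
      unfolding und_EM
    proof (rule sepcontI)
      fix xs assume xs: "length xs = n" "set xs \<subseteq> carr X"
      then show "opn (EM X a) s xs \<in> carr X"
        unfolding op[OF xs] using s eta_carr[OF X]
        by (intro cfun_carr[OF a] algebra_closed[OF T_algebra[OF X]]) auto
    next
      fix xs ys assume xy: "Suc (length xs + length ys) = n" "set xs \<subseteq> carr X" "set ys \<subseteq> carr X"
      have "continuous (TO X) (TO X) (\<lambda>z. opn (T X) s (map (eta X) xs @ z # map (eta X) ys))"
        using xy eta_carr[OF X] by (intro sepcont_continuous[OF algebra_sepcont[OF T_algebra[OF X] s]]) auto
      then have "continuous X X (\<lambda>x. a (opn (T X) s (map (eta X) xs @ eta X x # map (eta X) ys)))"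
        by (rule continuous_comp[OF continuous_comp[OF cfunD[OF eta_cfun[OF X]] _ is_dcpo_Obj[OF X]] cfunD[OF a] is_dcpo_Obj[OF X]])
      then show "continuous X X (\<lambda>x. opn (EM X a) s (xs @ x # ys))"
        by (rule continuous_cong) (use xy in \<open>simp add: op\<close>)
    qed
  qed (auto simp: EM_def)
  moreover have "satisfies (EM X a) e" if e: "e \<in> E" for e
  proof (rule satisfies_retract[OF T_algebra[OF X] calculation EM_hom])
    show "eta X x \<in> carr (TO X) \<and> a (eta X x) = x" if "x \<in> carr (und (EM X a))" for x
      using that a_eta eta_carr[OF X] by simp
    show "e \<in> ext_trms S \<times> ext_trms S" "satisfies (T X) e"
      using e equations T_models[OF X] by (auto simp: models_def)
  qed
  ultimately show ?thesis by (simp add: models_def)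
qed

end

text \<open>The Eilenberg--Moore structure map of a model: evaluation of formal elements over its
  own carrier.\<close>

definition str :: "'u algebra \<Rightarrow> 'u \<Rightarrow> 'u" where
  "str A = ext (und A) A (\<lambda>x\<in>carr (und A). x)"

lemma str:
  assumes A: "A \<in> models S E"
  shows str_hom: "str A \<in> alg_hom S (T (und A)) A"
    and str_eta: "x \<in> carr (und A) \<Longrightarrow> str A (eta (und A) x) = x"
    and str_unique: "h \<in> alg_hom S (T (und A)) A \<Longrightarrow> (\<And>x. x \<in> carr (und A) \<Longrightarrow> h (eta (und A) x) = x) \<Longrightarrow> h = str A"
proof -
  note O = models_Obj[OF A]
  show *: "str A \<in> alg_hom S (T (und A)) A" unfolding str_def using A O by (intro ext_hom ident_in_cfun)
  show **: "x \<in> carr (und A) \<Longrightarrow> str A (eta (und A) x) = x" for x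
    unfolding str_def using A O by (simp add: ext_eta ident_in_cfun)
  show "h \<in> alg_hom S (T (und A)) A \<Longrightarrow> (\<And>x. x \<in> carr (und A) \<Longrightarrow> h (eta (und A) x) = x) \<Longrightarrow> h = str A"
    by (rule hom_eqI[OF O A _ *]) (simp_all add: **)
qed

lemma str_natural:
  assumes A: "A \<in> models S E" and B: "B \<in> models S E" and f: "f \<in> alg_hom S A B" and z: "z \<in> carr (TO (und A))"
  shows "str B (TA (und A) (und B) f z) = f (str A z)"
proof -
  note O = models_Obj[OF A] models_Obj[OF B]
  have "compose (carr (TO (und A))) (str B) (TA (und A) (und B) f) = compose (carr (TO (und A))) f (str A)"
  proof (rule hom_eqI[OF O(1) B])
    show "compose (carr (TO (und A))) (str B) (TA (und A) (und B) f) \<in> alg_hom S (T (und A)) B"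
      by (rule alg_hom_compose[OF T_algebra[OF O(1)] TA_hom[OF O alg_hom_cfun[OF f]] str_hom[OF B]])
    show "compose (carr (TO (und A))) f (str A) \<in> alg_hom S (T (und A)) B"
      by (rule alg_hom_compose[OF T_algebra[OF O(1)] str_hom[OF A] f])
  qed (use O alg_hom_carr[OF f] in \<open>simp add: eta_carr TA_eta alg_hom_cfun[OF f] str_eta A B\<close>)
  from fun_cong[OF this, of z] z show ?thesis by simp
qed

text \<open>Evaluating an operation formed on generators returns the operation of the model, and
  outside the domain both are \<open>undefined\<close>; hence equality and not only
  isomorphism.\<close>

lemma EM_str:
  assumes A: "A \<in> models S E"
  shows "EM (und A) (str A) = A"
proof -
  note O = models_Obj[OF A] and alg = models_algebra[OF A]
  have "opn (EM (und A) (str A)) s xs = opn A s xs" for s xs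
  proof (cases "s \<in> S (length xs) \<and> set xs \<subseteq> carr (und A)")
    case True
    then have "set (map (eta (und A)) xs) \<subseteq> carr (TO (und A))" using eta_carr[OF O] by auto
    then have "str A (opn (T (und A)) s (map (eta (und A)) xs)) = opn A s (map (str A) (map (eta (und A)) xs))"
      using True by (intro alg_hom_op[OF str_hom[OF A]]) auto
    also have "map (str A) (map (eta (und A)) xs) = xs" using True str_eta[OF A] by (auto intro!: map_idI)
    finally show ?thesis using True by (simp add: EM_def)
  next
    case False
    then show ?thesis using algebra_undefined[OF alg False] by (auto simp: EM_def)
  qed
  then have "opn (EM (und A) (str A)) = opn A" by blast
  then show ?thesis by (simp add: und_EM)
qed

end

section \<open>Monad morphisms and concrete functors\<close>

locale two_varieties =
  V: free_algebras U S E T eta + W: free_algebras U S' E' T' eta'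
  for U :: "'u itself" and S E T eta S' E' T' eta' +
  fixes M N :: "'u dcpo_monad"
  assumes M: "V.is_free_monad M" and N: "W.is_free_monad N"
begin

lemma monad_morphism_iff:
  "monad_morphism DCPO M N \<tau> \<longleftrightarrow> \<tau> \<in> extensional (Obj DCPO) \<and>
    (\<forall>X\<in>Obj DCPO. \<tau> X \<in> carr (cfun (V.TO X) (W.TO X)) \<and> (\<forall>x\<in>carr X. \<tau> X (eta X x) = eta' X x) \<and>
      (\<forall>z\<in>carr (V.TO (V.TO X)). \<tau> X (V.mu X z) = W.mu X (\<tau> (W.TO X) (V.TA (V.TO X) (W.TO X) (\<tau> X) z))) \<and>
      (\<forall>Y\<in>Obj DCPO. \<forall>f\<in>carr (cfun X Y). \<forall>z\<in>carr (V.TO X). \<tau> Y (V.TA X Y f z) = W.TA X Y f (\<tau> X z)))"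
  (is "?L \<longleftrightarrow> ?R")
proof -
  note M' = V.is_free_monadD[OF M] and N' = W.is_free_monadD[OF N]
  have eq: "compose A g f = compose A g' f' \<longleftrightarrow> (\<forall>z\<in>A. g (f z) = g' (f' z))" for A :: "'u set" and g g' f f' :: "'u \<Rightarrow> 'u"
    by (auto simp: compose_def fun_eq_iff)
  have unit: "compose (carr X) (\<tau> X) (eta X) = eta' X \<longleftrightarrow> (\<forall>x\<in>carr X. \<tau> X (eta X x) = eta' X x)" if "X \<in> Obj DCPO" for X
    using cfun_ext[OF W.eta_cfun[OF that]] by (auto simp: compose_def fun_eq_iff PiE_iff extensional_def)
  have comp3: "compose A g (compose A h f) = compose A (\<lambda>z. g (h z)) f" for A :: "'u set" and f g h :: "'u \<Rightarrow> 'u"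
    by (auto simp: compose_def)
  show ?thesis
  proof
    assume L: ?L
    have nt: "nat_trans DCPO DCPO (Fun M) (Fun N) \<tau>" using L by (simp add: monad_morphism_def)
    have \<tau>: "\<tau> X \<in> carr (cfun (V.TO X) (W.TO X))" if "X \<in> Obj DCPO" for X
      using nt that by (simp add: nat_trans_DCPO M' N')
    have "compose (carr (V.TO X)) (\<tau> Y) (V.TA X Y f) = compose (carr (V.TO X)) (W.TA X Y f) (\<tau> X)"
      if "X \<in> Obj DCPO" "Y \<in> Obj DCPO" "f \<in> carr (cfun X Y)" for X Y f
      using nt that by (simp add: nat_trans_DCPO M' N')
    moreover have "compose (carr X) (\<tau> X) (eta X) = eta' X \<and>
      compose (carr (V.TO (V.TO X))) (\<tau> X) (V.mu X) = compose (carr (V.TO (V.TO X))) (W.mu X)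
        (compose (carr (V.TO (V.TO X))) (\<tau> (W.TO X)) (V.TA (V.TO X) (W.TO X) (\<tau> X)))" if "X \<in> Obj DCPO" for X
      using L that \<tau> by (simp add: monad_morphism_def Let_def M' N' Comp_DCPO V.TO_Obj W.TO_Obj)
    ultimately show ?R
      using nt \<tau> by (simp add: eq unit comp3 nat_trans_DCPO)
  next
    assume R: ?R
    then have "nat_trans DCPO DCPO (Fun M) (Fun N) \<tau>"
      by (simp add: nat_trans_DCPO M' N' eq)
    then show ?L
      using R by (simp add: monad_morphism_def Let_def M' N' Comp_DCPO V.TO_Obj W.TO_Obj eq unit comp3)
  qed
qed

text \<open>The direction is reversed: \<open>J\<close> turns the free algebras of the second
  variety into models of the first, and the component at \<open>X\<close> is the homomorphic
  extension of \<open>eta' X\<close>. The laws hold because homomorphisms on free algebras are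
  compared on generators.\<close>

lemma monad_morphism_of_functor:
  assumes J: "\<And>B. B \<in> models S' E' \<Longrightarrow> J B \<in> models S E" "\<And>B. B \<in> models S' E' \<Longrightarrow> und (J B) = und B"
    "\<And>A B f. A \<in> models S' E' \<Longrightarrow> B \<in> models S' E' \<Longrightarrow> f \<in> alg_hom S' A B \<Longrightarrow> f \<in> alg_hom S (J A) (J B)"
  shows "monad_morphism DCPO M N (\<lambda>X\<in>Obj DCPO. V.ext X (J (T' X)) (eta' X))"
proof -
  define \<sigma> where "\<sigma> X = V.ext X (J (T' X)) (eta' X)" for X
  have JT: "J (T' X) \<in> models S E" "und (J (T' X)) = W.TO X" if "X \<in> Obj DCPO" for X
    using J W.T_models that by auto
  have \<sigma>: "\<sigma> X \<in> alg_hom S (T X) (J (T' X))" "\<And>x. x \<in> carr X \<Longrightarrow> \<sigma> X (eta X x) = eta' X x" if "X \<in> Obj DCPO" for X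
    unfolding \<sigma>_def using that JT[OF that] W.eta_cfun[OF that] by (auto intro: V.ext_hom simp: V.ext_eta)
  have \<sigma>c: "\<sigma> X \<in> carr (cfun (V.TO X) (W.TO X))" if "X \<in> Obj DCPO" for X
    using alg_hom_cfun[OF \<sigma>(1)[OF that]] JT(2)[OF that] by simp
  have nat: "\<sigma> Y (V.TA X Y f z) = W.TA X Y f (\<sigma> X z)"
    if X: "X \<in> Obj DCPO" and Y: "Y \<in> Obj DCPO" and f: "f \<in> carr (cfun X Y)" and z: "z \<in> carr (V.TO X)" for X Y f z
  proof -
    have "compose (carr (V.TO X)) (\<sigma> Y) (V.TA X Y f) = compose (carr (V.TO X)) (W.TA X Y f) (\<sigma> X)"
    proof (rule V.hom_eqI[OF X JT(1)[OF Y]])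
      show "compose (carr (V.TO X)) (\<sigma> Y) (V.TA X Y f) \<in> alg_hom S (T X) (J (T' Y))"
        by (rule alg_hom_compose[OF V.T_algebra[OF X] V.TA_hom[OF X Y f] \<sigma>(1)[OF Y]])
      show "compose (carr (V.TO X)) (W.TA X Y f) (\<sigma> X) \<in> alg_hom S (T X) (J (T' Y))"
        by (rule alg_hom_compose[OF V.T_algebra[OF X] \<sigma>(1)[OF X] J(3)[OF W.T_models[OF X] W.T_models[OF Y] W.TA_hom[OF X Y f]]])
    qed (use X Y f in \<open>simp add: V.eta_carr V.TA_eta W.TA_eta \<sigma>(2) cfun_carr\<close>)
    from fun_cong[OF this, of z] z show ?thesis by simp
  qed
  have mul: "\<sigma> X (V.mu X z) = W.mu X (\<sigma> (W.TO X) (V.TA (V.TO X) (W.TO X) (\<sigma> X) z))"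
    if X: "X \<in> Obj DCPO" and z: "z \<in> carr (V.TO (V.TO X))" for X z
  proof -
    note VX = V.TO_Obj[OF X] and WX = W.TO_Obj[OF X]
    have "compose (carr (V.TO (V.TO X))) (\<sigma> X) (V.mu X) = compose (carr (V.TO (V.TO X))) (compose (carr (V.TO (W.TO X))) (W.mu X) (\<sigma> (W.TO X))) (V.TA (V.TO X) (W.TO X) (\<sigma> X))"
    proof (rule V.hom_eqI[OF VX JT(1)[OF X]])
      show "compose (carr (V.TO (V.TO X))) (\<sigma> X) (V.mu X) \<in> alg_hom S (T (V.TO X)) (J (T' X))"
        by (rule alg_hom_compose[OF V.T_algebra[OF VX] V.mu_hom[OF X] \<sigma>(1)[OF X]])
      show "compose (carr (V.TO (V.TO X))) (compose (carr (V.TO (W.TO X))) (W.mu X) (\<sigma> (W.TO X))) (V.TA (V.TO X) (W.TO X) (\<sigma> X)) \<in> alg_hom S (T (V.TO X)) (J (T' X))"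
        by (rule alg_hom_compose[OF V.T_algebra[OF VX] V.TA_hom[OF VX WX \<sigma>c[OF X]]
          alg_hom_compose[OF V.T_algebra[OF WX] \<sigma>(1)[OF WX] J(3)[OF W.T_models[OF WX] W.T_models[OF X] W.mu_hom[OF X]]]])
    qed (use X VX WX cfun_carr[OF \<sigma>c[OF X]] in \<open>simp add: V.eta_carr V.mu_eta V.TA_eta \<sigma>c \<sigma>(2) W.mu_eta\<close>)
    from fun_cong[OF this, of z] z V.TA_carr[OF VX WX \<sigma>c[OF X] z] show ?thesis by simp
  qed
  show ?thesis
    unfolding monad_morphism_iff \<sigma>_def[symmetric]
    using \<sigma>c \<sigma>(2) nat mul V.TO_Obj W.TO_Obj by simp
qed

text \<open>Restriction along a monad morphism. The multiplication law for \<open>b\<close> combines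
  that of \<tau>, that of the structure map of \<open>B\<close>, and naturality of \<tau> at this
  structure map.\<close>

lemma functor_of_monad_morphism:
  assumes \<tau>: "monad_morphism DCPO M N \<tau>" and B: "B \<in> models S' E'"
  defines "b \<equiv> compose (carr (V.TO (und B))) (W.str B) (\<tau> (und B))"
  shows "V.EM (und B) b \<in> models S E" "V.str (V.EM (und B) b) = b"
proof -
  let ?X = "und B"
  have X: "?X \<in> Obj DCPO" using W.models_Obj[OF B] .
  note VX = V.TO_Obj[OF X] and WX = W.TO_Obj[OF X]
  have t: "\<tau> Y \<in> carr (cfun (V.TO Y) (W.TO Y))" "x \<in> carr Y \<Longrightarrow> \<tau> Y (eta Y x) = eta' Y x"
    "z \<in> carr (V.TO (V.TO Y)) \<Longrightarrow> \<tau> Y (V.mu Y z) = W.mu Y (\<tau> (W.TO Y) (V.TA (V.TO Y) (W.TO Y) (\<tau> Y) z))"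
    "Z \<in> Obj DCPO \<Longrightarrow> f \<in> carr (cfun Y Z) \<Longrightarrow> u \<in> carr (V.TO Y) \<Longrightarrow> \<tau> Z (V.TA Y Z f u) = W.TA Y Z f (\<tau> Y u)"
    if "Y \<in> Obj DCPO" for Y Z x z f u
    using \<tau> that unfolding monad_morphism_iff by blast+
  have strc: "W.str B \<in> carr (cfun (W.TO ?X) ?X)" by (rule alg_hom_cfun[OF W.str_hom[OF B]])
  have b: "b \<in> carr (cfun (V.TO ?X) ?X)"
    unfolding b_def by (rule compose_in_cfun[OF t(1)[OF X] strc V.TO_dcpo[OF X]])
  have b_eta: "b (eta ?X x) = x" if "x \<in> carr ?X" for x
    using that X by (simp add: b_def V.eta_carr t(2) W.str_eta[OF B])
  have b_mu: "b (V.mu ?X z) = b (V.TA (V.TO ?X) ?X b z)" if z: "z \<in> carr (V.TO (V.TO ?X))" for z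
  proof -
    let ?y = "V.TA (V.TO ?X) (W.TO ?X) (\<tau> ?X) z"
    have y: "?y \<in> carr (V.TO (W.TO ?X))" by (rule V.TA_carr[OF VX WX t(1)[OF X] z])
    have ty: "\<tau> (W.TO ?X) ?y \<in> carr (W.TO (W.TO ?X))" by (rule cfun_carr[OF t(1)[OF WX] y])
    have "b (V.mu ?X z) = W.str B (W.mu ?X (\<tau> (W.TO ?X) ?y))"
      using z V.mu_carr[OF X z] by (simp add: b_def t(3)[OF X])
    also have "\<dots> = W.str B (W.TA (W.TO ?X) ?X (W.str B) (\<tau> (W.TO ?X) ?y))"
      using fun_cong[OF W.mu_assoc[OF X B W.str_hom[OF B] W.str_eta[OF B]], of "\<tau> (W.TO ?X) ?y"] ty by simp
    also have "W.TA (W.TO ?X) ?X (W.str B) (\<tau> (W.TO ?X) ?y) = \<tau> ?X (V.TA (W.TO ?X) ?X (W.str B) ?y)"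
      using t(4)[OF WX X strc y] by simp
    also have "V.TA (W.TO ?X) ?X (W.str B) ?y = V.TA (V.TO ?X) ?X b z"
      unfolding b_def by (rule V.TA_TA[OF VX WX X t(1)[OF X] strc z])
    finally show ?thesis
      using V.TA_carr[OF VX X b z] by (simp add: b_def)
  qed
  show EM: "V.EM ?X b \<in> models S E" by (rule V.EM_models[OF X b b_eta b_mu])
  show "V.str (V.EM ?X b) = b"
    using V.str_unique[OF EM, of b] V.EM_hom[OF X b b_eta b_mu] b_eta by simp
qed

end

section \<open>Joins of well-ordered chains\<close>

text \<open>Well-orderedness is phrased through least elements of nonempty subsets; totality is the
  case of two-element subsets.\<close>

definition wchain :: "'a dcpo \<Rightarrow> 'a set \<Rightarrow> bool" where
  "wchain P C \<longleftrightarrow> C \<subseteq> carr P \<and> C \<noteq> {} \<and> (\<forall>A\<subseteq>C. A \<noteq> {} \<longrightarrow> (\<exists>m\<in>A. \<forall>a\<in>A. (m, a) \<in> leq P))"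

lemma wchain_total: "wchain P C \<Longrightarrow> x \<in> C \<Longrightarrow> y \<in> C \<Longrightarrow> (x, y) \<in> leq P \<or> (y, x) \<in> leq P"
proof -
  assume "wchain P C" "x \<in> C" "y \<in> C"
  then have "\<exists>m\<in>{x, y}. \<forall>a\<in>{x, y}. (m, a) \<in> leq P"
    unfolding wchain_def by (metis empty_subsetI insert_not_empty insert_subset)
  then show ?thesis by auto
qed

lemma wchain_directed:
  assumes "is_dcpo P" "wchain P C"
  shows "directed P C"
proof (rule directedI)
  show "C \<subseteq> carr P" "C \<noteq> {}" using assms(2) by (simp_all add: wchain_def)
  fix x y assume xy: "x \<in> C" "y \<in> C"
  then have "(x, x) \<in> leq P" "(y, y) \<in> leq P"
    using assms dcpo_refl[OF assms(1)] by (auto simp: wchain_def)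
  then show "\<exists>z\<in>C. (x, z) \<in> leq P \<and> (y, z) \<in> leq P"
    using wchain_total[OF assms(2) xy] xy by blast
qed

lemma wchain_pair: "is_dcpo P \<Longrightarrow> (x, y) \<in> leq P \<Longrightarrow> wchain P {x, y}"
proof -
  assume P: "is_dcpo P" "(x, y) \<in> leq P"
  have refl: "(x, x) \<in> leq P" "(y, y) \<in> leq P" and sub: "{x, y} \<subseteq> carr P"
    using P dcpo_leq_carr[OF P] dcpo_refl[OF P(1)] by auto
  have "\<exists>m\<in>A. \<forall>a\<in>A. (m, a) \<in> leq P" if "A \<subseteq> {x, y}" "A \<noteq> {}" for A
  proof (cases "x \<in> A")
    case True
    then show ?thesis using that P(2) refl by (intro bexI[of _ x]) auto
  next
    case False
    then have "A = {y}" using that by auto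
    then show ?thesis using refl by simp
  qed
  then show ?thesis using sub by (simp add: wchain_def)
qed

text \<open>Since \<open>g\<close> may identify indices, the least element of \<open>A\<close> is
  taken at a minimal index among those mapped into \<open>A\<close>.\<close>

lemma wchain_image:
  assumes P: "is_dcpo P" and wf: "wf R" and I: "I \<noteq> {}" and g: "\<And>i. i \<in> I \<Longrightarrow> g i \<in> carr P"
    and total: "\<And>i j. i \<in> I \<Longrightarrow> j \<in> I \<Longrightarrow> i = j \<or> (i, j) \<in> R \<or> (j, i) \<in> R"
    and mono: "\<And>i j. i \<in> I \<Longrightarrow> j \<in> I \<Longrightarrow> (i, j) \<in> R \<Longrightarrow> (g i, g j) \<in> leq P"
  shows "wchain P (g ` I)"
  unfolding wchain_def
proof (intro conjI allI impI)
  show "g ` I \<subseteq> carr P" "g ` I \<noteq> {}" using g I by auto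
  fix A assume A: "A \<subseteq> g ` I" "A \<noteq> {}"
  then obtain i where "i \<in> {i \<in> I. g i \<in> A}" by blast
  from wf[unfolded wf_eq_minimal, rule_format, OF this]
  obtain z where z: "z \<in> {i \<in> I. g i \<in> A}" "\<forall>y. (y, z) \<in> R \<longrightarrow> y \<notin> {i \<in> I. g i \<in> A}" ..
  have "(g z, a) \<in> leq P" if a: "a \<in> A" for a
  proof -
    obtain j where j: "j \<in> I" "a = g j" using A(1) a by blast
    then have "z = j \<or> (z, j) \<in> R" using total[of z j] z a by blast
    then show ?thesis using j mono[of z j] z(1) dcpo_refl[OF P g] by auto
  qed
  then show "\<exists>m\<in>A. \<forall>a\<in>A. (m, a) \<in> leq P" using z(1) by blast
qed

text \<open>Countably many rounds suffice for a binary function, so closing up does not exceed an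
  infinite cardinal bound on \<open>A\<close>. With \<open>u\<close> choosing upper bounds, the
  closed sets are directed.\<close>

definition clo :: "('a \<Rightarrow> 'a \<Rightarrow> 'a) \<Rightarrow> 'a set \<Rightarrow> 'a set" where
  "clo u A = (\<Union>n. ((\<lambda>B. B \<union> case_prod u ` (B \<times> B)) ^^ n) A)"

lemma clo_base: "A \<subseteq> clo u A"
  unfolding clo_def by (rule subset_trans[OF _ UN_upper[of 0]]) auto

lemma clo_step:
  assumes "x \<in> clo u A" "y \<in> clo u A"
  shows "u x y \<in> clo u A"
proof -
  let ?F = "\<lambda>B. B \<union> case_prod u ` (B \<times> B)"
  have mono: "(?F ^^ k) A \<subseteq> (?F ^^ l) A" if "k \<le> l" for k l
    using that by (rule lift_Suc_mono_le[rotated]) auto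
  obtain k l where "x \<in> (?F ^^ k) A" "y \<in> (?F ^^ l) A" using assms by (auto simp: clo_def)
  then have "x \<in> (?F ^^ max k l) A" "y \<in> (?F ^^ max k l) A"
    using mono[of k "max k l"] mono[of l "max k l"] by auto
  then have "u x y \<in> (?F ^^ Suc (max k l)) A" by auto
  then show ?thesis unfolding clo_def by blast
qed

lemma clo_mono: "A \<subseteq> B \<Longrightarrow> clo u A \<subseteq> clo u B"
proof -
  let ?F = "\<lambda>B. B \<union> case_prod u ` (B \<times> B)"
  assume AB: "A \<subseteq> B"
  have "(?F ^^ n) A \<subseteq> (?F ^^ n) B" for n
  proof (induction n)
    case (Suc n)
    then show ?case unfolding funpow.simps comp_def by (intro Un_mono image_mono Sigma_mono)
  qed (use AB in simp)
  then show ?thesis unfolding clo_def by blast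
qed

lemma clo_least: "A \<subseteq> C \<Longrightarrow> (\<And>x y. x \<in> C \<Longrightarrow> y \<in> C \<Longrightarrow> u x y \<in> C) \<Longrightarrow> clo u A \<subseteq> C"
proof -
  let ?F = "\<lambda>B. B \<union> case_prod u ` (B \<times> B)"
  assume C: "A \<subseteq> C" "\<And>x y. x \<in> C \<Longrightarrow> y \<in> C \<Longrightarrow> u x y \<in> C"
  have "(?F ^^ n) A \<subseteq> C" for n
  proof (induction n)
    case (Suc n)
    then have "case_prod u ` ((?F ^^ n) A \<times> (?F ^^ n) A) \<subseteq> C" using C(2) by auto
    then show ?case using Suc by simp
  qed (use C in simp)
  then show ?thesis unfolding clo_def by blast
qed

lemma card_of_finite_le: "finite A \<Longrightarrow> infinite B \<Longrightarrow> |A| \<le>o |B|"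
  by (intro ordLess_imp_ordLeq finite_ordLess_infinite) (simp_all add: card_of_well_order_on Field_card_of)

lemma card_of_Un_le:
  assumes "infinite B" "|X| \<le>o |B|" "|Y| \<le>o |B|"
  shows "|X \<union> Y| \<le>o |B|"
proof -
  have "|\<Union>i\<in>{True, False}. if i then X else Y| \<le>o |B|"
    using assms by (intro card_of_UNION_ordLeq_infinite card_of_finite_le) auto
  then show ?thesis by (simp add: Un_commute)
qed

lemma card_of_clo:
  assumes B: "infinite B" and A: "|A| \<le>o |B|"
  shows "|clo u A| \<le>o |B|"
proof -
  let ?F = "\<lambda>B. B \<union> case_prod u ` (B \<times> B)"
  have "|(?F ^^ n) A| \<le>o |B|" for n
  proof (induction n)
    case (Suc n)
    have "|(?F ^^ n) A \<times> (?F ^^ n) A| \<le>o |B|"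
      using Suc by (intro card_of_Sigma_ordLeq_infinite[OF B]) auto
    then have "|case_prod u ` ((?F ^^ n) A \<times> (?F ^^ n) A)| \<le>o |B|"
      using card_of_image ordLeq_transitive by blast
    then show ?case using card_of_Un_le[OF B Suc] by simp
  qed (use A in simp)
  moreover have "|UNIV :: nat set| \<le>o |B|" using B infinite_iff_card_of_nat by blast
  ultimately show ?thesis
    unfolding clo_def by (intro card_of_UNION_ordLeq_infinite[OF B]) auto
qed

text \<open>Iwamura's lemma: an uncountable directed set is the union of a well-ordered chain of
  directed sets of smaller cardinality; countable ones contain a cofinal sequence.\<close>

lemma wchain_closed_dclosed:
  assumes P: "is_dcpo P"
    and chains: "\<And>C x. wchain P C \<Longrightarrow> C \<subseteq> W \<Longrightarrow> is_join P C x \<Longrightarrow> x \<in> W"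
  shows "dclosed P W"
proof -
  have "\<forall>x. directed P D \<longrightarrow> D \<subseteq> W \<longrightarrow> is_join P D x \<longrightarrow> x \<in> W" for D
  \<comment> \<open>Induction on the cardinality of \<open>D\<close>, with \<open>W\<close>
    fixed.\<close>
  proof (induction D rule: wf_induct_rule[OF wf_inv_image[OF wf_ordLess, of card_of]])
    case (1 D)
    show ?case
    proof (intro allI impI)
      fix x assume D: "directed P D" "D \<subseteq> W" "is_join P D x"
      have "\<forall>a b. \<exists>c. a \<in> D \<longrightarrow> b \<in> D \<longrightarrow> c \<in> D \<and> (a, c) \<in> leq P \<and> (b, c) \<in> leq P"
        using directed_ub[OF D(1)] by blast
      then obtain u where u: "\<And>a b. a \<in> D \<Longrightarrow> b \<in> D \<Longrightarrow> u a b \<in> D \<and> (a, u a b) \<in> leq P \<and> (b, u a b) \<in> leq P"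
        by metis
      note tr = dcpo_trans[OF P] and rf = dcpo_refl[OF P]
      show "x \<in> W"
      proof (cases "countable D")
        case True
        define d where "d = from_nat_into D"
        have d: "d n \<in> D" for n using from_nat_into[OF directed_nonempty[OF D(1)]] by (simp add: d_def)
        have d_surj: "\<exists>n. d n = y" if "y \<in> D" for y using from_nat_into_surj[OF True that] by (simp add: d_def)
        \<comment> \<open>A cofinal increasing sequence: each term lies above its predecessor and
          above the next element of the enumeration.\<close>
        define e where "e = rec_nat (d 0) (\<lambda>n y. u y (d (Suc n)))"
        have e: "e 0 = d 0" "e (Suc n) = u (e n) (d (Suc n))" for n by (simp_all add: e_def)
        have eD: "e n \<in> D" for n by (induction n) (simp_all add: e d u)
        have step: "(e n, e (Suc n)) \<in> leq P" for n using u[OF eD d] by (simp add: e)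
        have mono: "(e i, e (i + k)) \<in> leq P" for i k
          by (induction k) (use rf[OF directed_carr[OF D(1) eD]] step tr in auto)
        have de: "(d n, e n) \<in> leq P" for n
          by (cases n) (use u[OF eD d] rf[OF directed_carr[OF D(1) d]] in \<open>simp_all add: e\<close>)
        have "wchain P (range e)"
        proof (rule wchain_image[OF P wf_less_than])
          show "(e i, e j) \<in> leq P" if "(i, j) \<in> less_than" for i j using mono[of i "j - i"] that by simp
        qed (use directed_carr[OF D(1) eD] in auto)
        moreover have "is_join P (range e) x"
        proof (rule is_joinI)
          fix y assume y: "y \<in> carr P" "\<And>z. z \<in> range e \<Longrightarrow> (z, y) \<in> leq P"
          show "(x, y) \<in> leq P"
          proof (rule is_join_least[OF D(3) y(1)])
            fix z assume "z \<in> D"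
            then obtain n where "d n = z" using d_surj by blast
            then show "(z, y) \<in> leq P" using de[of n] y(2)[of "e n"] tr by blast
          qed
        qed (use is_join_carr[OF D(3)] is_join_ub[OF D(3)] eD in auto)
        ultimately show ?thesis using chains D(2) eD by blast
      next
        case False
        let ?r = "|D|"
        have card: "Card_order ?r" by (rule card_of_Card_order)
        have lin: "linear_order_on D ?r" and wfr: "wf (?r - Id)"
          using card_of_well_order_on[of D] by (simp_all add: well_order_on_def)
        have total: "i = j \<or> (i, j) \<in> ?r - Id \<or> (j, i) \<in> ?r - Id" if "i \<in> D" "j \<in> D" for i j
          using lin that unfolding linear_order_on_def total_on_def by blast
        have trr: "trans ?r" and rfr: "refl_on D ?r" and subr: "?r \<subseteq> D \<times> D"
          using lin by (auto simp: linear_order_on_def partial_order_on_def preorder_on_def)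
        \<comment> \<open>An initial segment of the cardinal well-order of \<open>D\<close>, closed
          under the chosen upper bounds: directed, increasing in \<open>d\<close>, and containing
          \<open>d\<close>.\<close>
        define G where "G d = clo u {i. (i, d) \<in> ?r}" for d
        have dG: "d \<in> G d" if "d \<in> D" for d
          using clo_base[of "{i. (i, d) \<in> ?r}" u] rfr that by (auto simp: G_def refl_on_def)
        have GD: "G d \<subseteq> D" for d
          unfolding G_def using subr u by (intro clo_least) auto
        have Gmono: "G i \<subseteq> G j" if "(i, j) \<in> ?r" for i j
          unfolding G_def using trr that by (intro clo_mono) (auto dest: transD)
        have dirG: "directed P (G d)" if "d \<in> D" for d
        proof (rule directedI)
          show "G d \<subseteq> carr P" using GD D(1) by (auto simp: directed_def)
          show "G d \<noteq> {}" using dG[OF that] by blast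
          fix a b assume ab: "a \<in> G d" "b \<in> G d"
          then have "u a b \<in> G d" unfolding G_def by (rule clo_step)
          then show "\<exists>z\<in>G d. (a, z) \<in> leq P \<and> (b, z) \<in> leq P" using u[of a b] ab GD by blast
        qed
        have cardG: "|G d| <o |D|" if d: "d \<in> D" for d
        proof -
          have under: "{i. (i, d) \<in> ?r} \<subseteq> insert d (underS ?r d)" by (auto simp: underS_def)
          have u_less: "|underS ?r d| <o |D|" using card_of_underS[OF card] d by (simp add: Field_card_of)
          show ?thesis
          \<comment> \<open>The closure of a finite segment is at most countable, and
            \<open>D\<close> is uncountable. The closure of an infinite segment is no larger than
            the segment, whose cardinality is less than that of \<open>D\<close>.\<close>
          proof (cases "finite (underS ?r d)")
            case True
            have "finite {i. (i, d) \<in> ?r}" using under True finite_subset by blast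
            then have "|{i. (i, d) \<in> ?r}| \<le>o |UNIV :: nat set|"
              by (intro card_of_finite_le) auto
            then have "|G d| \<le>o |UNIV :: nat set|" unfolding G_def by (intro card_of_clo) auto
            moreover have "|UNIV :: nat set| <o |D|"
            proof -
              have "\<not> |D| \<le>o |UNIV :: nat set|"
                using False unfolding countable_def card_of_ordLeq[symmetric] by blast
              then show ?thesis using not_ordLeq_iff_ordLess[OF card_of_Well_order card_of_Well_order] by blast
            qed
            ultimately show ?thesis by (rule ordLeq_ordLess_trans)
          next
            case False
            have "|insert d (underS ?r d)| \<le>o |underS ?r d|"
              using card_of_Un_le[OF False card_of_finite_le[OF _ False, of "{d}"] card_of_mono1[OF order_refl]]
              by simp
            then have "|{i. (i, d) \<in> ?r}| \<le>o |underS ?r d|"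
              using card_of_mono1[OF under] ordLeq_transitive by blast
            then have "|G d| \<le>o |underS ?r d|" unfolding G_def by (rule card_of_clo[OF False])
            then show ?thesis using u_less by (rule ordLeq_ordLess_trans)
          qed
        qed
        define j where "j d = join P (G d)" for d
        have j: "is_join P (G d) (j d)" if "d \<in> D" for d
          unfolding j_def by (rule is_join_join[OF P dirG[OF that]])
        \<comment> \<open>The induction hypothesis for the directed set \<open>G d\<close>, which is
          smaller than \<open>D\<close>.\<close>
        have jW: "j d \<in> W" if "d \<in> D" for d
          using 1[of "G d"] cardG[OF that] dirG[OF that] j[OF that] GD D(2) by (auto simp: inv_image_def)
        have jmono: "(j a, j b) \<in> leq P" if "a \<in> D" "b \<in> D" "(a, b) \<in> ?r" for a b
          using is_join_least[OF j[OF that(1)] is_join_carr[OF j[OF that(2)]]]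
            is_join_ub[OF j[OF that(2)]] Gmono[OF that(3)] by blast
        have "wchain P (j ` D)"
          by (rule wchain_image[OF P wfr directed_nonempty[OF D(1)] is_join_carr[OF j] total])
            (use jmono in auto)
        moreover have "is_join P (j ` D) x"
        proof (rule is_joinI)
          show "x \<in> carr P" by (rule is_join_carr[OF D(3)])
          show "(p, x) \<in> leq P" if p: "p \<in> j ` D" for p
          proof -
            obtain d where d: "d \<in> D" "p = j d" using p by blast
            show ?thesis unfolding d(2)
              by (rule is_join_least[OF j[OF d(1)] is_join_carr[OF D(3)]]) (use GD is_join_ub[OF D(3)] in blast)
          qed
          fix y assume y: "y \<in> carr P" "\<And>p. p \<in> j ` D \<Longrightarrow> (p, y) \<in> leq P"
          show "(x, y) \<in> leq P"
          proof (rule is_join_least[OF D(3) y(1)])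
            fix d assume d: "d \<in> D"
            show "(d, y) \<in> leq P" using is_join_ub[OF j[OF d] dG[OF d]] y(2)[of "j d"] d tr by blast
          qed
        qed
        ultimately show ?thesis using chains jW by blast
      qed
    qed
  qed
  then show ?thesis unfolding dclosed_def by blast
qed

text \<open>Two comparable points form a well-ordered chain, which gives monotonicity. The points
  that \<open>f\<close> sends below a bound \<open>q\<close> are closed under joins of well-ordered
  chains, hence under directed joins.\<close>

lemma continuous_wchains:
  assumes P: "is_dcpo P" and Q: "is_dcpo Q" and f: "\<And>x. x \<in> carr P \<Longrightarrow> f x \<in> carr Q"
    and chains: "\<And>C x. wchain P C \<Longrightarrow> is_join P C x \<Longrightarrow> is_join Q (f ` C) (f x)"
  shows "continuous P Q f"
proof (rule continuousI[OF f])
  show mono: "(f x, f y) \<in> leq Q" if xy: "(x, y) \<in> leq P" for x y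
  proof -
    have "is_join P {x, y} y"
      using xy dcpo_leq_carr[OF P xy] dcpo_refl[OF P] by (intro is_join_greatest[OF P]) auto
    from is_join_ub[OF chains[OF wchain_pair[OF P xy] this], of "f x"] show ?thesis by simp
  qed
  fix D x q assume D: "directed P D" "is_join P D x" and q: "q \<in> carr Q" "\<And>d. d \<in> D \<Longrightarrow> (f d, q) \<in> leq Q"
  let ?W = "{p \<in> carr P. (f p, q) \<in> leq Q}"
  have "dclosed P ?W"
  proof (rule wchain_closed_dclosed[OF P])
    show "a \<in> ?W" if C: "wchain P C" "C \<subseteq> ?W" "is_join P C a" for C a
      using is_join_least[OF chains[OF C(1,3)] q(1)] C(2) is_join_carr[OF C(3)] by auto
  qed
  then have "x \<in> ?W"
    by (rule dclosedD[OF _ D(1) _ D(2)]) (use q(2) directed_carr[OF D(1)] in auto)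
  then show "(f x, q) \<in> leq Q" by simp
qed

text \<open>A small chain is a well-order shorter than that of \<open>'u\<close>, hence isomorphic
  to a proper initial segment, which is some \<open>below \<alpha>\<close>. This is what allows a
  formal join to range over it.\<close>

lemma (in universe) wchain_enumeration:
  assumes P: "is_dcpo P" and C: "wchain P C" and small: "sml C"
  shows "\<exists>\<alpha> :: 'u. \<exists>t. t ` below \<alpha> = C \<and> (\<forall>j\<in>below \<alpha>. \<forall>i\<in>below j. (t i, t j) \<in> leq P)"
proof -
  define r where "r = leq P \<inter> C \<times> C"
  have sub: "C \<subseteq> carr P" using C by (simp add: wchain_def)
  have Field: "Field r = C" using sub dcpo_refl[OF P] by (auto simp: r_def Field_def)
  have wr: "Well_order r"
    unfolding well_order_on_def linear_order_on_def partial_order_on_def preorder_on_def Field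
  proof (intro conjI)
    show "r \<subseteq> C \<times> C" by (auto simp: r_def)
    show "refl_on C r" using sub dcpo_refl[OF P] by (auto simp: refl_on_def r_def)
    show "trans r" using dcpo_trans[OF P] by (auto simp: trans_def r_def)
    show "antisym r" using dcpo_antisym[OF P] by (auto simp: antisym_def r_def)
    show "total_on C r" using wchain_total[OF C] by (auto simp: total_on_def r_def)
    show "wf (r - Id)"
    proof (rule wfI_min)
      fix x Q assume x: "(x :: 'a) \<in> Q"
      show "\<exists>z\<in>Q. \<forall>y. (y, z) \<in> r - Id \<longrightarrow> y \<notin> Q"
      proof (cases "Q \<inter> C = {}")
        case True
        then show ?thesis using x by (auto simp: r_def)
      next
        case False
        have "\<forall>A\<subseteq>C. A \<noteq> {} \<longrightarrow> (\<exists>m\<in>A. \<forall>a\<in>A. (m, a) \<in> leq P)"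
          using C by (simp add: wchain_def)
        from this[rule_format, of "Q \<inter> C"] False
        obtain m where m: "m \<in> Q \<inter> C" "\<forall>a\<in>Q \<inter> C. (m, a) \<in> leq P"
          by blast
        then show ?thesis using dcpo_antisym[OF P] by (intro bexI[of _ m]) (auto simp: r_def)
      qed
    qed
  qed
  have "\<not> |UNIV :: 'u set| \<le>o r"
  proof
    assume "|UNIV :: 'u set| \<le>o r"
    then have "|Field |UNIV :: 'u set| | \<le>o |Field r|" by (rule card_of_mono2)
    then have "|UNIV :: 'u set| \<le>o |C|" by (simp add: Field Field_card_of)
    then show False using small not_ordLess_ordLeq unfolding small_iff by blast
  qed
  then have "r <o |UNIV :: 'u set|"
    by (rule not_ordLeq_iff_ordLess[OF wr card_of_Well_order, THEN iffD1])
  then have "\<exists>\<alpha>\<in>Field |UNIV :: 'u set|. r =o Restr |UNIV| (underS |UNIV| \<alpha>)"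
    by (rule ordLess_iff_ordIso_Restr[OF card_of_Well_order wr, THEN iffD1])
  then obtain \<alpha> :: 'u where \<alpha>: "r =o Restr |UNIV| (underS |UNIV| \<alpha>)" by blast
  have "Field (Restr |UNIV| (underS |UNIV| \<alpha>)) = below \<alpha>"
    using card_of_Well_order[of "UNIV :: 'u set"]
    by (subst Refl_Field_Restr2) (auto simp: below_def order_on_defs Field_card_of)
  then obtain f where "bij_betw f (Field r) (below \<alpha>)"
    "\<forall>a\<in>Field r. \<forall>b\<in>Field r. (a, b) \<in> r \<longleftrightarrow> (f a, f b) \<in> Restr |UNIV| (below \<alpha>)"
    using \<alpha> unfolding ordIso_def iso_iff2 below_def by auto
  then have f: "bij_betw f C (below \<alpha>)"
    "\<And>a b. a \<in> C \<Longrightarrow> b \<in> C \<Longrightarrow> (a, b) \<in> r \<longleftrightarrow> (f a, f b) \<in> Restr |UNIV| (below \<alpha>)"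
    unfolding Field by blast+
  let ?t = "inv_into C f"
  have t: "bij_betw ?t (below \<alpha>) C" using bij_betw_inv_into[OF f(1)] .
  have "(?t i, ?t j) \<in> leq P" if ij: "j \<in> below \<alpha>" "i \<in> below j" for i j
  proof -
    have i: "i \<in> below \<alpha>" using below_trans[OF ij(2,1)] .
    have "f (?t i) = i" "f (?t j) = j" using bij_betw_inv_into_right[OF f(1)] i ij(1) by auto
    moreover have "?t i \<in> C" "?t j \<in> C" using t i ij(1) by (auto simp: bij_betw_def)
    ultimately have "(?t i, ?t j) \<in> r"
      using f(2)[of "?t i" "?t j"] i ij by (simp add: below_iff)
    then show ?thesis by (simp add: r_def)
  qed
  then show ?thesis using t by (intro exI[of _ \<alpha>] exI[of _ ?t]) (simp add: bij_betw_def)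
qed

section \<open>The clone of a strongly finitary monad\<close>

text \<open>The functor \<open>Y \<mapsto> [[Y, X], P]\<close>: by the enriched Yoneda lemma, natural transformations into it
  from a functor \<open>F\<close> are the same as morphisms \<open>F X \<rightarrow> P\<close>.\<close>

locale double_power = universe U for U :: "'u itself" +
  fixes X P :: "'u dcpo"
  assumes X: "X \<in> Obj DCPO" and P: "P \<in> Obj DCPO"
begin

abbreviation K :: "'u dcpo \<Rightarrow> (('u \<Rightarrow> 'u) \<Rightarrow> 'u) dcpo" where "K Y \<equiv> cfun (cfun Y X) P"

text \<open>An arbitrary coding of the small function space in \<open>'u\<close>, because an
  endofunctor has to take values in dcpos over \<open>'u\<close>.\<close>

definition enc :: "'u dcpo \<Rightarrow> (('u \<Rightarrow> 'u) \<Rightarrow> 'u) \<Rightarrow> 'u" where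
  "enc Y = (SOME g. inj_on g (carr (K Y)))"

definition dec :: "'u dcpo \<Rightarrow> 'u \<Rightarrow> ('u \<Rightarrow> 'u) \<Rightarrow> 'u" where
  "dec Y = inv_into (carr (K Y)) (enc Y)"

definition GO :: "'u dcpo \<Rightarrow> 'u dcpo" where "GO Y = transport (enc Y) (K Y)"

text \<open>Precomposition with \<open>f\<close> is applied to the argument of \<open>k\<close>, so
  the action is covariant in \<open>f\<close>.\<close>

definition pull :: "'u dcpo \<Rightarrow> 'u dcpo \<Rightarrow> ('u \<Rightarrow> 'u) \<Rightarrow> (('u \<Rightarrow> 'u) \<Rightarrow> 'u) \<Rightarrow> ('u \<Rightarrow> 'u) \<Rightarrow> 'u" where
  "pull Y Z f k = (\<lambda>y\<in>carr (cfun Z X). k (compose (carr Y) y f))"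

definition G :: "'u dcpo_functor" where
  "G = \<lparr>FObj = GO, FArr = (\<lambda>Y Z f. \<lambda>z\<in>carr (GO Y). enc Z (pull Y Z f (dec Y z)))\<rparr>"

lemma dX: "is_dcpo X" and dP: "is_dcpo P"
  using X P is_dcpo_Obj by blast+

lemma dK: "is_dcpo (K Y)"
  by (intro is_dcpo_cfun dP)

context
  fixes Y :: "'u dcpo"
  assumes Y: "Y \<in> Obj DCPO"
begin

lemma small_K: "sml (carr (K Y))"
  using X P Y by (intro small_cfun) (simp_all add: Obj_DCPO small_TYPE)

lemma inj_enc: "inj_on (enc Y) (carr (K Y))"
proof -
  obtain g :: "(('u \<Rightarrow> 'u) \<Rightarrow> 'u) \<Rightarrow> 'u" where "inj_on g (carr (K Y))" using small_embedding[OF small_K] .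
  then show ?thesis unfolding enc_def by (rule someI[where P = "\<lambda>g. inj_on g (carr (K Y))"])
qed

lemma dec_enc: "k \<in> carr (K Y) \<Longrightarrow> dec Y (enc Y k) = k"
  by (simp add: dec_def inj_enc)

lemma enc_dec: "z \<in> carr (GO Y) \<Longrightarrow> enc Y (dec Y z) = z"
  by (simp add: dec_def GO_def f_inv_into_f)

lemma enc_continuous: "continuous (K Y) (GO Y) (enc Y)"
  unfolding GO_def by (rule continuous_transport[OF dK inj_enc])

lemma dec_continuous: "continuous (GO Y) (K Y) (dec Y)"
  unfolding GO_def dec_def by (rule continuous_inv_transport[OF dK inj_enc])

lemma GO_Obj: "GO Y \<in> Obj DCPO"
  using is_dcpo_transport[OF dK inj_enc] small_image[OF small_K] by (simp add: GO_def Obj_DCPO small_TYPE)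

lemma dGO: "is_dcpo (GO Y)"
  using GO_Obj is_dcpo_Obj by blast

lemma enc_carr: "k \<in> carr (K Y) \<Longrightarrow> enc Y k \<in> carr (GO Y)"
  by (rule continuous_carr[OF enc_continuous])

lemma dec_carr: "z \<in> carr (GO Y) \<Longrightarrow> dec Y z \<in> carr (K Y)"
  by (rule continuous_carr[OF dec_continuous])

end

lemma pull_K:
  assumes "Y \<in> Obj DCPO" "Z \<in> Obj DCPO" "f \<in> carr (cfun Y Z)" "k \<in> carr (K Y)"
  shows "pull Y Z f k \<in> carr (K Z)"
  unfolding pull_def using assms X dX
  by (intro restrict_in_cfun continuous_comp[OF continuous_compose_right cfunD] is_dcpo_cfun is_dcpo_Obj)

lemma pull_continuous:
  assumes "Y \<in> Obj DCPO" "Z \<in> Obj DCPO" "f \<in> carr (cfun Y Z)"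
  shows "continuous (K Y) (K Z) (pull Y Z f)"
proof (rule continuous_into_cfun[OF dK dP pull_K[OF assms]])
  fix y assume y: "y \<in> carr (cfun Z X)"
  have "compose (carr Y) y f \<in> carr (cfun Y X)"
    using y assms by (intro compose_in_cfun[of f Y Z] is_dcpo_Obj)
  then show "continuous (K Y) P (\<lambda>k. pull Y Z f k y)"
    using y continuous_eval[OF dP] by (simp add: pull_def)
qed

text \<open>This gives the local continuity of \<open>G\<close>, which the universal property of the
  Kan extension requires of its target.\<close>

lemma pull_continuous_fst:
  assumes "Y \<in> Obj DCPO" "Z \<in> Obj DCPO" "k \<in> carr (K Y)"
  shows "continuous (cfun Y Z) (K Z) (\<lambda>f. pull Y Z f k)"
proof (rule continuous_into_cfun[OF is_dcpo_cfun[OF is_dcpo_Obj[OF assms(2)]] dP pull_K[OF assms(1,2) _ assms(3)]])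
  fix y assume y: "y \<in> carr (cfun Z X)"
  then have "continuous (cfun Y Z) P (\<lambda>f. k (compose (carr Y) y f))"
    using assms X dX by (intro continuous_comp[OF continuous_compose_left cfunD] is_dcpo_cfun is_dcpo_Obj)
  then show "continuous (cfun Y Z) P (\<lambda>f. pull Y Z f k y)" using y by (simp add: pull_def)
qed

lemma FArr_G: "z \<in> carr (GO Y) \<Longrightarrow> FArr G Y Z f z = enc Z (pull Y Z f (dec Y z))"
  by (simp add: G_def)

lemma FObj_G [simp]: "FObj G Y = GO Y"
  by (simp add: G_def)

lemma FArr_G_cfun:
  assumes "Y \<in> Obj DCPO" "Z \<in> Obj DCPO" "f \<in> carr (cfun Y Z)"
  shows "FArr G Y Z f \<in> carr (cfun (GO Y) (GO Z))"
proof -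
  have "continuous (GO Y) (GO Z) (\<lambda>z. enc Z (pull Y Z f (dec Y z)))"
    using assms dGO
    by (intro continuous_comp[OF continuous_comp[OF dec_continuous pull_continuous] enc_continuous])
  then show ?thesis unfolding G_def by (simp add: restrict_in_cfun)
qed

lemma enriched_G: "enriched_endofunctor G"
  unfolding enriched_endofunctor_def is_functor_def Hom_DCPO Comp_DCPO Ide_DCPO hom_dcpo_eq
proof (intro conjI ballI)
  fix Y :: "'u dcpo" assume Y: "Y \<in> Obj DCPO"
  show "FObj G Y \<in> Obj DCPO" using GO_Obj[OF Y] by simp
  have "pull Y Y (\<lambda>x\<in>carr Y. x) k = k" if "k \<in> carr (K Y)" for k
  proof (rule cfun_eqI[OF pull_K[OF Y Y ident_in_cfun that] that])
    show "pull Y Y (\<lambda>x\<in>carr Y. x) k y = k y" if "y \<in> carr (cfun Y X)" for y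
      using that by (simp add: pull_def)
  qed
  then show "FArr G Y Y (\<lambda>x\<in>carr Y. x) = (\<lambda>x\<in>carr (FObj G Y). x)"
    using dec_carr[OF Y] enc_dec[OF Y] by (auto simp: G_def)
next
  fix Y Z :: "'u dcpo" assume Y: "Y \<in> Obj DCPO" and Z: "Z \<in> Obj DCPO"
  show "FArr G Y Z \<in> carr (cfun Y Z) \<rightarrow> carr (cfun (FObj G Y) (FObj G Z))"
    using FArr_G_cfun[OF Y Z] by simp
  show "continuous (cfun Y Z) (cfun (FObj G Y) (FObj G Z)) (FArr G Y Z)"
    unfolding FObj_G
  proof (rule continuous_into_cfun[OF is_dcpo_cfun[OF is_dcpo_Obj[OF Z]] dGO[OF Z] FArr_G_cfun[OF Y Z]])
    fix z assume z: "z \<in> carr (GO Y)"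
    have "continuous (cfun Y Z) (GO Z) (\<lambda>f. enc Z (pull Y Z f (dec Y z)))"
      using is_dcpo_Obj[OF Z] dec_carr[OF Y z]
      by (intro continuous_comp[OF pull_continuous_fst[OF Y Z] enc_continuous[OF Z]] is_dcpo_cfun)
    then show "continuous (cfun Y Z) (GO Z) (\<lambda>f. FArr G Y Z f z)" using z by (simp add: FArr_G)
  qed
next
  fix Y Z W :: "'u dcpo" and f g
  assume Y: "Y \<in> Obj DCPO" and Z: "Z \<in> Obj DCPO" and W: "W \<in> Obj DCPO"
    and f: "f \<in> carr (cfun Y Z)" and g: "g \<in> carr (cfun Z W)"
  have gf: "compose (carr Y) g f \<in> carr (cfun Y W)" by (rule compose_in_cfun[OF f g is_dcpo_Obj[OF Y]])
  have "pull Y W (compose (carr Y) g f) k = pull Z W g (pull Y Z f k)" if k: "k \<in> carr (K Y)" for k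
  proof (rule cfun_eqI[OF pull_K[OF Y W gf k] pull_K[OF Z W g pull_K[OF Y Z f k]]])
    fix y assume y: "y \<in> carr (cfun W X)"
    have "compose (carr Z) y g \<in> carr (cfun Z X)" by (rule compose_in_cfun[OF g y is_dcpo_Obj[OF Z]])
    then show "pull Y W (compose (carr Y) g f) k y = pull Z W g (pull Y Z f k) y"
      using y compose_assoc_cfun[OF f, of y g] by (simp add: pull_def)
  qed
  note pull_pull = this
  show "FArr G Y W (compose (carr Y) g f) = compose (carr (FObj G Y)) (FArr G Z W g) (FArr G Y Z f)"
    unfolding FObj_G
  proof (rule cfun_eqI[OF FArr_G_cfun[OF Y W gf] compose_in_cfun[OF FArr_G_cfun[OF Y Z f] FArr_G_cfun[OF Z W g] dGO[OF Y]]])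
    fix z assume z: "z \<in> carr (GO Y)"
    note k = dec_carr[OF Y z] and pk = pull_K[OF Y Z f dec_carr[OF Y z]]
    show "FArr G Y W (compose (carr Y) g f) z = compose (carr (GO Y)) (FArr G Z W g) (FArr G Y Z f) z"
      using z pull_pull[OF k] enc_carr[OF Z pk] dec_enc[OF Z pk] by (simp add: FArr_G)
  qed
qed

end

section \<open>Cocones on the values of a strongly finitary monad\<close>

locale sf_monad = universe U for U :: "'u itself" +
  fixes M :: "'u dcpo_monad"
  assumes sf: "M \<in> sf_monads"
begin

abbreviation MO :: "'u dcpo \<Rightarrow> 'u dcpo" where "MO \<equiv> FObj (Fun M)"
abbreviation MA :: "'u dcpo \<Rightarrow> 'u dcpo \<Rightarrow> ('u \<Rightarrow> 'u) \<Rightarrow> 'u \<Rightarrow> 'u" where "MA \<equiv> FArr (Fun M)"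
abbreviation un :: "'u dcpo \<Rightarrow> 'u \<Rightarrow> 'u" where "un \<equiv> unit M"
abbreviation mm :: "'u dcpo \<Rightarrow> 'u \<Rightarrow> 'u" where "mm \<equiv> mult M"

lemma is_monad: "is_monad DCPO M" and endo: "enriched_endofunctor (Fun M)"
  and strongly_finitary: "strongly_finitary (Fun M)"
  using sf by (auto simp: sf_monads_def enriched_monad_def)

lemma MO_Obj: "X \<in> Obj DCPO \<Longrightarrow> MO X \<in> Obj DCPO"
  by (rule endo_Obj[OF endo])

lemma MO_dcpo: "X \<in> Obj DCPO \<Longrightarrow> is_dcpo (MO X)"
  by (rule is_dcpo_Obj[OF MO_Obj])

lemma MA_cfun: "X \<in> Obj DCPO \<Longrightarrow> Y \<in> Obj DCPO \<Longrightarrow> f \<in> carr (cfun X Y) \<Longrightarrow> MA X Y f \<in> carr (cfun (MO X) (MO Y))"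
  by (rule endo_cfun[OF endo])

lemma MA_carr: "X \<in> Obj DCPO \<Longrightarrow> Y \<in> Obj DCPO \<Longrightarrow> f \<in> carr (cfun X Y) \<Longrightarrow> z \<in> carr (MO X) \<Longrightarrow> MA X Y f z \<in> carr (MO Y)"
  by (rule cfun_carr[OF MA_cfun])

lemma MA_MA: "X \<in> Obj DCPO \<Longrightarrow> Y \<in> Obj DCPO \<Longrightarrow> Z \<in> Obj DCPO \<Longrightarrow> f \<in> carr (cfun X Y) \<Longrightarrow> g \<in> carr (cfun Y Z) \<Longrightarrow>
    z \<in> carr (MO X) \<Longrightarrow> MA Y Z g (MA X Y f z) = MA X Z (compose (carr X) g f) z"
  using endo_compose[OF endo, of X Y Z f g] by simp

lemma MA_ident: "X \<in> Obj DCPO \<Longrightarrow> z \<in> carr (MO X) \<Longrightarrow> MA X X (\<lambda>x\<in>carr X. x) z = z"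
  using endo_ident[OF endo, of X X] by simp

lemma monad_laws:
  assumes X: "X \<in> Obj DCPO"
  shows un_cfun: "un X \<in> carr (cfun X (MO X))"
    and un_natural: "Y \<in> Obj DCPO \<Longrightarrow> f \<in> carr (cfun X Y) \<Longrightarrow> x \<in> carr X \<Longrightarrow> MA X Y f (un X x) = un Y (f x)"
    and mm_cfun: "mm X \<in> carr (cfun (MO (MO X)) (MO X))"
    and mm_natural: "Y \<in> Obj DCPO \<Longrightarrow> f \<in> carr (cfun X Y) \<Longrightarrow> z \<in> carr (MO (MO X)) \<Longrightarrow>
      mm Y (MA (MO X) (MO Y) (MA X Y f) z) = MA X Y f (mm X z)"
    and mm_un: "z \<in> carr (MO X) \<Longrightarrow> mm X (un (MO X) z) = z"
    and mm_MA_un: "z \<in> carr (MO X) \<Longrightarrow> mm X (MA X (MO X) (un X) z) = z"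
    and mm_mm: "z \<in> carr (MO (MO (MO X))) \<Longrightarrow> mm X (mm (MO X) z) = mm X (MA (MO (MO X)) (MO X) (mm X) z)"
proof -
  have n1: "nat_trans DCPO DCPO id_functor (Fun M) un" and n2: "nat_trans DCPO DCPO (Fun M \<odot> Fun M) (Fun M) mm"
    using is_monad by (simp_all add: is_monad_def)
  show "un X \<in> carr (cfun X (MO X))" using n1 X by (simp add: nat_trans_DCPO)
  show "mm X \<in> carr (cfun (MO (MO X)) (MO X))" using n2 X by (simp add: nat_trans_DCPO)
  show "MA X Y f (un X x) = un Y (f x)" if "Y \<in> Obj DCPO" "f \<in> carr (cfun X Y)" "x \<in> carr X" for Y f x
  proof -
    have "compose (carr X) (un Y) f = compose (carr X) (MA X Y f) (un X)"
      using n1 X that by (simp add: nat_trans_DCPO)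
    from fun_cong[OF this, of x] that(3) show ?thesis by simp
  qed
  show "mm Y (MA (MO X) (MO Y) (MA X Y f) z) = MA X Y f (mm X z)"
    if "Y \<in> Obj DCPO" "f \<in> carr (cfun X Y)" "z \<in> carr (MO (MO X))" for Y f z
  proof -
    have "compose (carr (MO (MO X))) (mm Y) (MA (MO X) (MO Y) (MA X Y f)) = compose (carr (MO (MO X))) (MA X Y f) (mm X)"
      using n2 X that by (simp add: nat_trans_DCPO)
    from fun_cong[OF this, of z] that(3) show ?thesis by simp
  qed
  have L: "compose (carr (MO X)) (mm X) (un (MO X)) = (\<lambda>x\<in>carr (MO X). x)"
    "compose (carr (MO X)) (mm X) (MA X (MO X) (un X)) = (\<lambda>x\<in>carr (MO X). x)"
    "compose (carr (MO (MO (MO X)))) (mm X) (mm (MO X)) = compose (carr (MO (MO (MO X)))) (mm X) (MA (MO (MO X)) (MO X) (mm X))"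
    using is_monad X by (simp_all add: is_monad_def Let_def Comp_DCPO Ide_DCPO)
  show "mm X (un (MO X) z) = z" "mm X (MA X (MO X) (un X) z) = z" if "z \<in> carr (MO X)" for z
    using fun_cong[OF L(1), of z] fun_cong[OF L(2), of z] that by simp_all
  show "mm X (mm (MO X) z) = mm X (MA (MO (MO X)) (MO X) (mm X) z)" if "z \<in> carr (MO (MO (MO X)))" for z
    using fun_cong[OF L(3), of z] that by simp
qed

lemma un_carr: "X \<in> Obj DCPO \<Longrightarrow> x \<in> carr X \<Longrightarrow> un X x \<in> carr (MO X)"
  by (rule cfun_carr[OF un_cfun])

lemma mm_carr: "X \<in> Obj DCPO \<Longrightarrow> z \<in> carr (MO (MO X)) \<Longrightarrow> mm X z \<in> carr (MO X)"
  by (rule cfun_carr[OF mm_cfun])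

text \<open>Existence in the Kan extension property for the double power functor: at
  \<open>n\<close> the transformation sends \<open>t\<close> to the function taking \<open>x\<close>
  to \<open>phi n x t\<close>. Evaluating the extended transformation at \<open>X\<close> and at the
  identity of \<open>X\<close> gives the map.\<close>

lemma extend_cocone:
  fixes X P :: "'u dcpo" and phi :: "'u set \<Rightarrow> ('u \<Rightarrow> 'u) \<Rightarrow> 'u \<Rightarrow> 'u"
  assumes X: "X \<in> Obj DCPO" and P: "P \<in> Obj DCPO"
    and phi_fst: "\<And>n t. finite n \<Longrightarrow> t \<in> carr (MO (disc n)) \<Longrightarrow> continuous (cfun (disc n) X) P (\<lambda>x. phi n x t)"
    and phi_snd: "\<And>n x. finite n \<Longrightarrow> x \<in> n \<rightarrow>\<^sub>E carr X \<Longrightarrow> continuous (MO (disc n)) P (phi n x)"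
    and phi_natural: "\<And>n m f x t. finite n \<Longrightarrow> finite m \<Longrightarrow> f \<in> n \<rightarrow>\<^sub>E m \<Longrightarrow> x \<in> m \<rightarrow>\<^sub>E carr X \<Longrightarrow> t \<in> carr (MO (disc n)) \<Longrightarrow>
      phi m x (MA (disc n) (disc m) f t) = phi n (compose n x f) t"
  shows "\<exists>h\<in>carr (cfun (MO X) P). \<forall>n x t. finite n \<longrightarrow> x \<in> n \<rightarrow>\<^sub>E carr X \<longrightarrow> t \<in> carr (MO (disc n)) \<longrightarrow>
    h (MA (disc n) X x t) = phi n x t"
proof -
  interpret double_power U X P by unfold_locales (fact X P)+
  define \<sigma> where "\<sigma> = (\<lambda>n\<in>{n. finite n}. \<lambda>t\<in>carr (MO (disc n)). enc (disc n) (\<lambda>x\<in>carr (cfun (disc n) X). phi n x t))"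
  have kk: "(\<lambda>x\<in>carr (cfun (disc n) X). phi n x t) \<in> carr (K (disc n))"
    if "finite n" "t \<in> carr (MO (disc n))" for n t
    by (rule restrict_in_cfun[OF phi_fst[OF that]])
  have \<sigma>: "nat_trans FinSet DCPO (Fun M \<odot> discrete) (G \<odot> discrete) \<sigma>"
    unfolding nat_trans_FinSet
  proof (intro conjI allI impI)
    show "\<sigma> \<in> extensional {n. finite n}" by (simp add: \<sigma>_def)
    fix n :: "'u set" assume n: "finite n"
    note dn = disc_Obj[OF n]
    have "continuous (MO (disc n)) (K (disc n)) (\<lambda>t. \<lambda>x\<in>carr (cfun (disc n) X). phi n x t)"
    proof (rule continuous_into_cfun[OF MO_dcpo[OF dn] dP kk[OF n]])
      fix x assume x: "x \<in> carr (cfun (disc n) X)"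
      then show "continuous (MO (disc n)) P (\<lambda>t. (\<lambda>x\<in>carr (cfun (disc n) X). phi n x t) x)"
        using phi_snd[OF n, of x] by (simp add: cfun_disc[OF dX])
    qed
    then have "continuous (MO (disc n)) (GO (disc n)) (\<lambda>t. enc (disc n) (\<lambda>x\<in>carr (cfun (disc n) X). phi n x t))"
      by (rule continuous_comp[OF _ enc_continuous[OF dn] MO_dcpo[OF dn]])
    then show "\<sigma> n \<in> carr (cfun (MO (disc n)) (FObj G (disc n)))"
      using n by (simp add: \<sigma>_def restrict_in_cfun)
    fix m :: "'u set" and f assume m: "finite m" and f: "f \<in> n \<rightarrow>\<^sub>E m"
    note dm = disc_Obj[OF m]
    have fc: "f \<in> carr (cfun (disc n) (disc m))" using f by (simp add: cfun_disc is_dcpo_disc)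
    have "\<sigma> m (MA (disc n) (disc m) f t) = FArr G (disc n) (disc m) f (\<sigma> n t)" if t: "t \<in> carr (MO (disc n))" for t
    proof -
      have "(\<lambda>x\<in>carr (cfun (disc m) X). phi m x (MA (disc n) (disc m) f t)) =
        pull (disc n) (disc m) f (\<lambda>x\<in>carr (cfun (disc n) X). phi n x t)"
        unfolding pull_def
      proof (rule restrict_ext)
        fix x assume x: "x \<in> carr (cfun (disc m) X)"
        then have "compose n x f \<in> carr (cfun (disc n) X)"
          using compose_in_cfun[OF fc x is_dcpo_disc] by simp
        then show "phi m x (MA (disc n) (disc m) f t) = (\<lambda>x\<in>carr (cfun (disc n) X). phi n x t) (compose (carr (disc n)) x f)"
          using phi_natural[OF n m f _ t, of x] x by (simp add: cfun_disc[OF dX])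
      qed
      then show ?thesis
        using n m t MA_carr[OF dn dm fc t] enc_carr[OF dn kk[OF n t]] dec_enc[OF dn kk[OF n t]]
        by (simp add: \<sigma>_def FArr_G)
    qed
    then show "compose (carr (MO (disc n))) (\<sigma> m) (MA (disc n) (disc m) f) =
        compose (carr (MO (disc n))) (FArr G (disc n) (disc m) f) (\<sigma> n)"
      by (auto simp: compose_def)
  qed
  then obtain \<tau> where \<tau>: "nat_trans DCPO DCPO (Fun M) G \<tau>" "\<forall>n\<in>Obj FinSet. \<tau> (disc n) = \<sigma> n"
    using strongly_finitary enriched_G unfolding strongly_finitary_def by blast
  let ?id = "\<lambda>x\<in>carr X. x"
  have \<tau>c: "\<tau> X \<in> carr (cfun (MO X) (GO X))" using \<tau>(1) X by (simp add: nat_trans_DCPO)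
  let ?h = "\<lambda>z\<in>carr (MO X). dec X (\<tau> X z) ?id"
  have "?h \<in> carr (cfun (MO X) P)"
    by (rule restrict_in_cfun[OF continuous_comp[OF continuous_comp[OF cfunD[OF \<tau>c] dec_continuous[OF X] MO_dcpo[OF X]]
      continuous_eval[OF dP ident_in_cfun] MO_dcpo[OF X]]])
  moreover have "?h (MA (disc n) X x t) = phi n x t"
    if n: "finite n" and x: "x \<in> n \<rightarrow>\<^sub>E carr X" and t: "t \<in> carr (MO (disc n))" for n x t
  proof -
    note dn = disc_Obj[OF n]
    have xc: "x \<in> carr (cfun (disc n) X)" using x by (simp add: cfun_disc[OF dX])
    have "compose (carr (MO (disc n))) (\<tau> X) (MA (disc n) X x) = compose (carr (MO (disc n))) (FArr G (disc n) X x) (\<tau> (disc n))"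
      using \<tau>(1) dn X xc unfolding nat_trans_DCPO by blast
    from fun_cong[OF this, of t] have "\<tau> X (MA (disc n) X x t) = FArr G (disc n) X x (\<sigma> n t)"
      using t \<tau>(2) n by (simp add: FinSet_def)
    also have "\<dots> = enc X (pull (disc n) X x (\<lambda>x\<in>carr (cfun (disc n) X). phi n x t))"
      using n t enc_carr[OF dn kk[OF n t]] dec_enc[OF dn kk[OF n t]] by (simp add: FArr_G \<sigma>_def)
    finally have "dec X (\<tau> X (MA (disc n) X x t)) = pull (disc n) X x (\<lambda>x\<in>carr (cfun (disc n) X). phi n x t)"
      using dec_enc[OF X pull_K[OF dn X xc kk[OF n t]]] by simp
    moreover have "compose n ?id x = x" using compose_ident_cfun(2)[OF xc] by simp
    ultimately show ?thesis
      using MA_carr[OF dn X xc t] xc ident_in_cfun[of X] by (simp add: pull_def)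
  qed
  ultimately show ?thesis by blast
qed

text \<open>Uniqueness in the Kan extension property: \<open>h\<close> induces the transformation
  that takes \<open>m\<close> in \<open>M Y\<close> to the function sending \<open>y\<close> to
  \<open>h\<close> of \<open>MA Y X y m\<close>. The assumption makes the transformations of
  \<open>h\<close> and \<open>h'\<close> agree on finite discrete dcpos, hence everywhere, and
  evaluation at the identity recovers both maps.\<close>

lemma eq_from_cocone:
  fixes X P :: "'u dcpo"
  assumes X: "X \<in> Obj DCPO" and P: "P \<in> Obj DCPO"
    and h: "h \<in> carr (cfun (MO X) P)" and h': "h' \<in> carr (cfun (MO X) P)"
    and eq: "\<And>n x t. finite n \<Longrightarrow> x \<in> n \<rightarrow>\<^sub>E carr X \<Longrightarrow> t \<in> carr (MO (disc n)) \<Longrightarrow>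
      h (MA (disc n) X x t) = h' (MA (disc n) X x t)"
  shows "h = h'"
proof -
  interpret double_power U X P by unfold_locales (fact X P)+
  define k where "k h Y m = (\<lambda>y\<in>carr (cfun Y X). h (MA Y X y m))" for h :: "'u \<Rightarrow> 'u" and Y m
  define \<tau> where "\<tau> h = (\<lambda>Y\<in>Obj DCPO. \<lambda>m\<in>carr (MO Y). enc Y (k h Y m))" for h
  have kK: "k h Y m \<in> carr (K Y)" if h: "h \<in> carr (cfun (MO X) P)" and Y: "Y \<in> Obj DCPO" and m: "m \<in> carr (MO Y)" for h Y m
    unfolding k_def
    by (rule restrict_in_cfun[OF continuous_comp[OF continuous_comp[OF endo_continuous[OF endo Y X]
      continuous_eval[OF MO_dcpo[OF X] m] is_dcpo_cfun[OF dX]] cfunD[OF h] is_dcpo_cfun[OF dX]]])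
  have nat: "nat_trans DCPO DCPO (Fun M) G (\<tau> h)" if h: "h \<in> carr (cfun (MO X) P)" for h
    unfolding nat_trans_DCPO
  proof (intro conjI ballI)
    show "\<tau> h \<in> extensional (Obj DCPO)" by (simp add: \<tau>_def)
    fix Y :: "'u dcpo" assume Y: "Y \<in> Obj DCPO"
    have "continuous (MO Y) (K Y) (k h Y)"
    proof (rule continuous_into_cfun[OF MO_dcpo[OF Y] dP kK[OF h Y]])
      fix y assume y: "y \<in> carr (cfun Y X)"
      have "continuous (MO Y) P (\<lambda>m. h (MA Y X y m))"
        by (rule continuous_comp[OF cfunD[OF MA_cfun[OF Y X y]] cfunD[OF h] MO_dcpo[OF Y]])
      then show "continuous (MO Y) P (\<lambda>m. k h Y m y)" using y by (simp add: k_def)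
    qed
    then have "continuous (MO Y) (GO Y) (\<lambda>m. enc Y (k h Y m))"
      by (rule continuous_comp[OF _ enc_continuous[OF Y] MO_dcpo[OF Y]])
    then show "\<tau> h Y \<in> carr (cfun (MO Y) (FObj G Y))" using Y by (simp add: \<tau>_def restrict_in_cfun)
    fix Z :: "'u dcpo" and f assume Z: "Z \<in> Obj DCPO" and f: "f \<in> carr (cfun Y Z)"
    have "\<tau> h Z (MA Y Z f m) = FArr G Y Z f (\<tau> h Y m)" if m: "m \<in> carr (MO Y)" for m
    proof -
      have "k h Z (MA Y Z f m) = pull Y Z f (k h Y m)"
        unfolding k_def pull_def
      proof (rule restrict_ext)
        fix y assume y: "y \<in> carr (cfun Z X)"
        then have "compose (carr Y) y f \<in> carr (cfun Y X)"
          using compose_in_cfun[OF f y is_dcpo_Obj[OF Y]] by simp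
        then show "h (MA Z X y (MA Y Z f m)) = (\<lambda>y\<in>carr (cfun Y X). h (MA Y X y m)) (compose (carr Y) y f)"
          using MA_MA[OF Y Z X f y m] by simp
      qed
      then show ?thesis
        using Y Z m MA_carr[OF Y Z f m] enc_carr[OF Y kK[OF h Y m]] dec_enc[OF Y kK[OF h Y m]]
        by (simp add: \<tau>_def FArr_G)
    qed
    then show "compose (carr (MO Y)) (\<tau> h Z) (MA Y Z f) = compose (carr (MO Y)) (FArr G Y Z f) (\<tau> h Y)"
      by (auto simp: compose_def)
  qed
  have on_disc: "\<tau> h (disc n) = \<tau> h' (disc n)" if n: "finite n" for n
  proof -
    have "k h (disc n) t = k h' (disc n) t" if t: "t \<in> carr (MO (disc n))" for t
      unfolding k_def by (rule restrict_ext) (use eq[OF n _ t] in \<open>simp add: cfun_disc[OF dX]\<close>)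
    then have "(\<lambda>m\<in>carr (MO (disc n)). enc (disc n) (k h (disc n) m)) = (\<lambda>m\<in>carr (MO (disc n)). enc (disc n) (k h' (disc n) m))"
      by (intro restrict_ext) simp
    then show ?thesis using disc_Obj[OF n] by (simp add: \<tau>_def)
  qed
  define \<sigma> where "\<sigma> = (\<lambda>n\<in>{n. finite n}. \<tau> h (disc n))"
  have \<sigma>: "nat_trans FinSet DCPO (Fun M \<odot> discrete) (G \<odot> discrete) \<sigma>"
    using nat[OF h] disc_Obj unfolding nat_trans_FinSet nat_trans_DCPO
    by (auto simp: \<sigma>_def cfun_disc is_dcpo_disc)
  have "\<exists>!\<rho>. nat_trans DCPO DCPO (Fun M) G \<rho> \<and> (\<forall>X\<in>Obj FinSet. \<rho> (disc X) = \<sigma> X)"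
    using strongly_finitary enriched_G \<sigma> unfolding strongly_finitary_def by blast
  moreover have "nat_trans DCPO DCPO (Fun M) G (\<tau> h) \<and> (\<forall>X\<in>Obj FinSet. \<tau> h (disc X) = \<sigma> X)"
    using nat[OF h] by (simp add: \<sigma>_def FinSet_def)
  moreover have "nat_trans DCPO DCPO (Fun M) G (\<tau> h') \<and> (\<forall>X\<in>Obj FinSet. \<tau> h' (disc X) = \<sigma> X)"
    using nat[OF h'] on_disc by (simp add: \<sigma>_def FinSet_def)
  ultimately have "\<tau> h = \<tau> h'" by blast
  show ?thesis
  proof (rule cfun_eqI[OF h h'])
    fix m assume m: "m \<in> carr (MO X)"
    have "enc X (k h X m) = enc X (k h' X m)"
      using fun_cong[OF fun_cong[OF \<open>\<tau> h = \<tau> h'\<close>, of X], of m] X m by (simp add: \<tau>_def)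
    then have "k h X m = k h' X m"
      using inj_enc[OF X] kK[OF h X m] kK[OF h' X m] by (auto dest: inj_onD)
    from fun_cong[OF this, of "\<lambda>x\<in>carr X. x"] show "h m = h' m"
      using ident_in_cfun[of X] MA_ident[OF X m] by (simp add: k_def)
  qed
qed

section \<open>Operations applied to lists of generators\<close>

definition num :: "nat \<Rightarrow> 'u" where "num = (SOME e. inj e)"

lemma inj_num: "inj num"
proof -
  obtain e :: "nat \<Rightarrow> 'u" where "inj e" using infinite_countable_subset[OF infinite_universe] by blast
  then show ?thesis unfolding num_def by (rule someI[where P = inj])
qed

definition Nn :: "nat \<Rightarrow> 'u set" where "Nn k = num ` {..<k}"

definition fn :: "'u list \<Rightarrow> 'u \<Rightarrow> 'u" where
  "fn xs = (\<lambda>v\<in>Nn (length xs). xs ! inv num v)"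

abbreviation D :: "nat \<Rightarrow> 'u dcpo" where "D k \<equiv> disc (Nn k)"

lemma finite_Nn [simp]: "finite (Nn k)"
  by (simp add: Nn_def)

lemma D_Obj [simp]: "D k \<in> Obj DCPO"
  by (simp add: disc_Obj)

lemma num_Nn: "i < k \<Longrightarrow> num i \<in> Nn k"
  by (simp add: Nn_def)

lemma fn_num [simp]: "i < length xs \<Longrightarrow> fn xs (num i) = xs ! i"
  using inj_num by (simp add: fn_def num_Nn)

lemma fn_PiE: "set xs \<subseteq> A \<Longrightarrow> fn xs \<in> Nn (length xs) \<rightarrow>\<^sub>E A"
  by (auto simp: fn_def Nn_def inj_num subset_iff)

lemma fn_cfun: "is_dcpo X \<Longrightarrow> set xs \<subseteq> carr X \<Longrightarrow> length xs = k \<Longrightarrow> fn xs \<in> carr (cfun (D k) X)"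
  using fn_PiE[of xs "carr X"] by (auto simp: cfun_disc)

lemma eq_fnI: "g \<in> extensional (Nn (length xs)) \<Longrightarrow> (\<And>i. i < length xs \<Longrightarrow> g (num i) = xs ! i) \<Longrightarrow> g = fn xs"
  by (rule extensionalityI[of _ "Nn (length xs)"]) (auto simp: fn_def Nn_def inj_num)

lemma compose_fn: "length xs = k \<Longrightarrow> compose (Nn k) f (fn xs) = fn (map f xs)"
  by (rule eq_fnI) (auto simp: num_Nn)

lemma continuous_fn:
  assumes X: "is_dcpo X" and "set us \<subseteq> carr X" "set vs \<subseteq> carr X" "k = Suc (length us + length vs)"
  shows "continuous X (cfun (D k) X) (\<lambda>x. fn (us @ x # vs))"
proof (rule continuous_into_cfun[OF X X])
  show "fn (us @ x # vs) \<in> carr (cfun (D k) X)" if "x \<in> carr X" for x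
    using assms that by (intro fn_cfun) auto
  fix v assume "v \<in> carr (D k)"
  then obtain i where i: "v = num i" "i < k" by (auto simp: Nn_def)
  have "continuous X X (\<lambda>x. (us @ x # vs) ! i)"
  proof (cases "i = length us")
    case True
    then show ?thesis by (simp add: continuous_ident)
  next
    case False
    have eq: "(us @ x # vs) ! i = (us @ vs) ! (if i < length us then i else i - 1)" for x
      using False by (auto simp: nth_append nth_Cons' diff_diff_left)
    have "(us @ vs) ! (if i < length us then i else i - 1) \<in> carr X"
    proof -
      have "(if i < length us then i else i - 1) < length (us @ vs)" using i(2) assms(4) False by auto
      then have "(us @ vs) ! (if i < length us then i else i - 1) \<in> set (us @ vs)" by (rule nth_mem)
      then show ?thesis using assms(2,3) by auto
    qed
    then show ?thesis unfolding eq by (rule continuous_const[OF X])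
  qed
  then show "continuous X X (\<lambda>x. fn (us @ x # vs) v)" using i assms(4) by simp
qed

definition Sg :: "nat \<Rightarrow> 'u set" where "Sg k = carr (MO (D k))"

text \<open>The operation \<open>t\<close> applied to the listed generators \<open>ys\<close>,
  repetitions allowed; these are the basic elements of \<open>M X\<close> in list form.\<close>

definition bas :: "'u dcpo \<Rightarrow> 'u list \<Rightarrow> 'u \<Rightarrow> 'u" where
  "bas X ys t = MA (D (length ys)) X (fn ys) t"

lemma bas_carr: "X \<in> Obj DCPO \<Longrightarrow> set ys \<subseteq> carr X \<Longrightarrow> t \<in> Sg (length ys) \<Longrightarrow> bas X ys t \<in> carr (MO X)"
  unfolding bas_def Sg_def by (intro MA_carr fn_cfun is_dcpo_Obj) auto

lemma MA_bas:
  assumes "X \<in> Obj DCPO" "Y \<in> Obj DCPO" "f \<in> carr (cfun X Y)" "set ys \<subseteq> carr X" "t \<in> Sg (length ys)"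
  shows "MA X Y f (bas X ys t) = bas Y (map f ys) t"
  using MA_MA[OF D_Obj assms(1,2) fn_cfun[OF is_dcpo_Obj[OF assms(1)] assms(4) refl] assms(3)] assms(5)
  by (simp add: bas_def Sg_def compose_fn)

lemma bas_MA:
  assumes X: "X \<in> Obj DCPO" and ys: "set ys \<subseteq> carr X" and n: "finite n" and g: "g \<in> n \<rightarrow>\<^sub>E Nn (length ys)" and t: "t \<in> carr (MO (disc n))"
  shows "bas X ys (MA (disc n) (D (length ys)) g t) = MA (disc n) X (compose n (fn ys) g) t"
  unfolding bas_def using fn_cfun[OF is_dcpo_Obj[OF X] ys refl] g
  by (subst MA_MA[OF disc_Obj[OF n] D_Obj X _ _ t]) (simp_all add: cfun_disc is_dcpo_disc)

text \<open>Strong finitarity speaks of all finite subsets of \<open>'u\<close>, whereas operations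
  act on lists; the enumeration \<open>en n\<close> and the renaming \<open>ix n\<close> into a
  standard set \<open>Nn\<close> translate between the two.\<close>

definition en :: "'u set \<Rightarrow> 'u list" where "en n = (SOME xs. distinct xs \<and> set xs = n)"

lemma en: "finite n \<Longrightarrow> distinct (en n)" "finite n \<Longrightarrow> set (en n) = n"
proof -
  assume "finite n"
  then have "\<exists>xs. distinct xs \<and> set xs = n" using finite_distinct_list by blast
  from someI_ex[OF this] show "distinct (en n)" "set (en n) = n" unfolding en_def by blast+
qed

definition ix :: "'u set \<Rightarrow> 'u \<Rightarrow> 'u" where
  "ix n = (\<lambda>v\<in>n. num (inv_into {..<length (en n)} (nth (en n)) v))"

lemma ix:
  assumes "finite n" "v \<in> n"
  obtains i where "i < length (en n)" "ix n v = num i" "en n ! i = v"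
proof -
  have "v \<in> set (en n)" using en(2)[OF assms(1)] assms(2) by simp
  then have "v \<in> nth (en n) ` {..<length (en n)}"
    by (auto simp: set_conv_nth)
  note v = inv_into_into[OF this] f_inv_into_f[OF this]
  show thesis
    by (rule that[of "inv_into {..<length (en n)} (nth (en n)) v"]) (use v assms(2) in \<open>simp_all add: ix_def\<close>)
qed

lemma ix_PiE: "finite n \<Longrightarrow> ix n \<in> n \<rightarrow>\<^sub>E Nn (length (en n))"
proof (rule PiE_I)
  fix v assume n: "finite n" "v \<in> n"
  obtain i where "i < length (en n)" "ix n v = num i" using ix[OF n] by blast
  then show "ix n v \<in> Nn (length (en n))" by (simp add: num_Nn)
qed (simp add: ix_def)

lemma fn_ix: "finite n \<Longrightarrow> v \<in> n \<Longrightarrow> fn (map x (en n)) (ix n v) = x v"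
  using ix[of n v] by (metis fn_num length_map nth_map)

lemma MA_eq_bas:
  assumes X: "X \<in> Obj DCPO" and n: "finite n" and x: "x \<in> n \<rightarrow>\<^sub>E carr X" and t: "t \<in> carr (MO (disc n))"
  shows "MA (disc n) X x t = bas X (map x (en n)) (MA (disc n) (D (length (en n))) (ix n) t)"
    and "set (map x (en n)) \<subseteq> carr X" and "MA (disc n) (D (length (en n))) (ix n) t \<in> Sg (length (map x (en n)))"
proof -
  show s: "set (map x (en n)) \<subseteq> carr X" using x en(2)[OF n] by auto
  have "compose n (fn (map x (en n))) (ix n) = x"
    using x fn_ix[OF n] by (auto simp: compose_def fun_eq_iff PiE_iff extensional_def)
  then show "MA (disc n) X x t = bas X (map x (en n)) (MA (disc n) (D (length (en n))) (ix n) t)"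
    using bas_MA[OF X s n _ t, of "ix n"] ix_PiE[OF n] by simp
  show "MA (disc n) (D (length (en n))) (ix n) t \<in> Sg (length (map x (en n)))"
    unfolding Sg_def using MA_carr[OF disc_Obj[OF n] D_Obj _ t, of "ix n" "length (en n)"] ix_PiE[OF n]
    by (simp add: cfun_disc is_dcpo_disc)
qed

lemma eq_on_bas:
  fixes X P :: "'u dcpo"
  assumes X: "X \<in> Obj DCPO" and P: "P \<in> Obj DCPO"
    and h: "h \<in> carr (cfun (MO X) P)" and h': "h' \<in> carr (cfun (MO X) P)"
    and eq: "\<And>ys t. set ys \<subseteq> carr X \<Longrightarrow> t \<in> Sg (length ys) \<Longrightarrow> h (bas X ys t) = h' (bas X ys t)"
  shows "h = h'"
  by (rule eq_from_cocone[OF X P h h']) (use eq MA_eq_bas[OF X] in simp)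

definition basics :: "'u dcpo \<Rightarrow> 'u set" where
  "basics X = {bas X ys t | ys t. set ys \<subseteq> carr X \<and> t \<in> Sg (length ys)}"

lemma basics_carr: "X \<in> Obj DCPO \<Longrightarrow> basics X \<subseteq> carr (MO X)"
  unfolding basics_def using bas_carr by blast

text \<open>All maps from the values at finite discrete dcpos land in the closure, so
  \<open>extend_cocone\<close> gives a map of \<open>M X\<close> into it. Followed by the inclusion
  it agrees with the identity on their images, and \<open>eq_from_cocone\<close> makes it the
  identity.\<close>

lemma basics_dense:
  assumes X: "X \<in> Obj DCPO"
  shows "carr (MO X) = dcl (MO X) (basics X)"
proof
  let ?C = "dcl (MO X) (basics X)"
  let ?P = "sub_dcpo (MO X) ?C"
  note dM = MO_dcpo[OF X] and dX = is_dcpo_Obj[OF X]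
  show sub: "?C \<subseteq> carr (MO X)" by (rule dcl_subset_carr[OF basics_carr[OF X]])
  note cl = dclosed_dcl[of "MO X" "basics X"]
  have dP: "is_dcpo ?P" by (rule is_dcpo_sub_dcpo[OF dM cl sub])
  have P: "?P \<in> Obj DCPO"
    using dP MO_Obj[OF X] small_subset[OF _ sub] by (simp add: Obj_DCPO small_TYPE)
  have inC: "MA (disc n) X x t \<in> ?C"
    if "finite n" "x \<in> n \<rightarrow>\<^sub>E carr X" "t \<in> carr (MO (disc n))" for n x t
    unfolding MA_eq_bas(1)[OF X that] basics_def using MA_eq_bas(2,3)[OF X that] by (intro dcl.base) blast
  have "\<exists>h\<in>carr (cfun (MO X) ?P). \<forall>n x t. finite n \<longrightarrow> x \<in> n \<rightarrow>\<^sub>E carr X \<longrightarrow> t \<in> carr (MO (disc n)) \<longrightarrow>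
    h (MA (disc n) X x t) = MA (disc n) X x t"
  proof (rule extend_cocone[OF X P])
    fix n :: "'u set" and t assume n: "finite n" and t: "t \<in> carr (MO (disc n))"
    note dn = disc_Obj[OF n]
    have "continuous (cfun (disc n) X) (MO X) (\<lambda>x. MA (disc n) X x t)"
      using t dX dM by (intro continuous_comp[OF endo_continuous[OF endo dn X] continuous_eval] is_dcpo_cfun)
    then show "continuous (cfun (disc n) X) ?P (\<lambda>x. MA (disc n) X x t)"
      using inC[OF n _ t] dX by (intro continuous_into_sub_dcpo is_dcpo_cfun dM cl sub) (auto simp: cfun_disc)
  next
    fix n :: "'u set" and x assume n: "finite n" and x: "x \<in> n \<rightarrow>\<^sub>E carr X"
    note dn = disc_Obj[OF n]
    show "continuous (MO (disc n)) ?P (MA (disc n) X x)"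
      using inC[OF n x] x dX
      by (intro continuous_into_sub_dcpo MO_dcpo[OF dn] dM cl sub cfunD[OF MA_cfun[OF dn X]]) (auto simp: cfun_disc)
  next
    fix n m :: "'u set" and f x t
    assume *: "finite n" "finite m" "f \<in> n \<rightarrow>\<^sub>E m" "x \<in> m \<rightarrow>\<^sub>E carr X" "t \<in> carr (MO (disc n))"
    then show "MA (disc m) X x (MA (disc n) (disc m) f t) = MA (disc n) X (compose n x f) t"
      using dX by (subst MA_MA[OF disc_Obj disc_Obj X]) (auto simp: cfun_disc is_dcpo_disc)
  qed
  then obtain h where h: "h \<in> carr (cfun (MO X) ?P)" "\<And>n x t. finite n \<Longrightarrow> x \<in> n \<rightarrow>\<^sub>E carr X \<Longrightarrow>
    t \<in> carr (MO (disc n)) \<Longrightarrow> h (MA (disc n) X x t) = MA (disc n) X x t"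
    by blast
  have "continuous ?P (MO X) (\<lambda>x. x)" by (rule continuous_from_sub_dcpo[OF dM cl sub continuous_ident])
  then have hM: "h \<in> carr (cfun (MO X) (MO X))"
    using h(1) continuous_comp[OF cfunD[OF h(1)], of "MO X" "\<lambda>x. x"] dM sub by (auto simp: carr_cfun PiE_iff)
  have "h = (\<lambda>x\<in>carr (MO X). x)"
  proof (rule eq_from_cocone[OF X MO_Obj[OF X] hM ident_in_cfun])
    show "h (MA (disc n) X x t) = (\<lambda>x\<in>carr (MO X). x) (MA (disc n) X x t)"
      if "finite n" "x \<in> n \<rightarrow>\<^sub>E carr X" "t \<in> carr (MO (disc n))" for n x t
      using h(2)[OF that] inC[OF that] sub by auto
  qed
  then show "carr (MO X) \<subseteq> ?C" using cfun_carr[OF h(1)] by auto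
qed

end

section \<open>The equational presentation\<close>

context sf_monad
begin

abbreviation vs :: "nat \<Rightarrow> 'u trm list" where "vs k \<equiv> map Var [0..<k]"

text \<open>Kleisli composition: the \<open>l\<close>-ary operations \<open>us\<close> are
  substituted for the variables of \<open>s\<close>.\<close>

definition kl :: "nat \<Rightarrow> 'u list \<Rightarrow> 'u \<Rightarrow> 'u" where
  "kl l us s = mm (D l) (MA (D (length us)) (MO (D l)) (fn us) s)"

text \<open>A chosen listing of the chain along an ordinal, because formal joins are indexed by
  \<open>below\<close>; it exists by \<open>wchain_enumeration\<close>.\<close>

definition enum :: "nat \<Rightarrow> 'u set \<Rightarrow> 'u \<times> ('u \<Rightarrow> 'u)" where
  "enum k C = (SOME p. snd p ` below (fst p) = C \<and>
     (\<forall>j\<in>below (fst p). \<forall>i\<in>below j. (snd p i, snd p j) \<in> leq (MO (D k))))"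

definition chain_term :: "nat \<Rightarrow> 'u set \<Rightarrow> 'u ext_trm" where
  "chain_term k C = Join (fst (enum k C)) (\<lambda>i\<in>below (fst (enum k C)). Trm (Op (snd (enum k C) i) (vs k)))"

text \<open>The clone of \<open>M\<close>: its \<open>k\<close>-ary operations are the elements of \<open>M k\<close>.  The equations express
  substitution, the projections, and joins of well-ordered chains in \<open>M k\<close>.\<close>

definition eqs_subst :: "('u ext_trm \<times> 'u ext_trm) set" where
  "eqs_subst = (\<Union>l. (\<lambda>(us, s). (Trm (Op s (map (\<lambda>u. Op u (vs l)) us)), Trm (Op (kl l us s) (vs l)))) `
     (SIGMA us:lists (Sg l). Sg (length us)))"

definition eqs_proj :: "('u ext_trm \<times> 'u ext_trm) set" where
  "eqs_proj = (\<Union>k. (\<lambda>j. (Trm (Op (un (D k) (num j)) (vs k)), Trm (Var j))) ` {..<k})"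

definition eqs_join :: "('u ext_trm \<times> 'u ext_trm) set" where
  "eqs_join = (\<Union>k. (\<lambda>C. (chain_term k C, Trm (Op (join (MO (D k)) C) (vs k)))) ` {C. wchain (MO (D k)) C})"

definition eqs :: "('u ext_trm \<times> 'u ext_trm) set" where
  "eqs = eqs_subst \<union> eqs_proj \<union> eqs_join"

lemma small_Sg: "sml (Sg k)"
  using MO_Obj[OF D_Obj] by (simp add: Sg_def Obj_DCPO small_TYPE)

lemma signature_Sg: "is_signature Sg"
  using small_Sg by (simp add: is_signature_def small_TYPE)

lemma small_UN_nat: "(\<And>k::nat. sml (A k)) \<Longrightarrow> sml (\<Union>k. A k)"
  by (rule small_UNION[OF small_countable]) auto

text \<open>The chains are subsets of the small set \<open>M k\<close>, and each contributes one
  equation through its chosen listing.\<close>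

lemma small_eqs: "sml eqs"
proof -
  have "sml eqs_subst"
    unfolding eqs_subst_def by (intro small_UN_nat small_image small_Sigma small_lists small_Sg)
  moreover have "sml eqs_proj"
    unfolding eqs_proj_def by (intro small_UN_nat small_image small_finite) simp
  moreover have "sml {C. wchain (MO (D k)) C}" for k
    by (rule small_subset[OF small_Pow[OF small_Sg[of k]]]) (auto simp: wchain_def Sg_def)
  then have "sml eqs_join"
    unfolding eqs_join_def by (intro small_UN_nat small_image)
  ultimately show ?thesis unfolding eqs_def by (intro small_Un)
qed

lemma enum:
  assumes "wchain (MO (D k)) C"
  shows "snd (enum k C) ` below (fst (enum k C)) = C"
    and "j \<in> below (fst (enum k C)) \<Longrightarrow> i \<in> below j \<Longrightarrow> (snd (enum k C) i, snd (enum k C) j) \<in> leq (MO (D k))"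
proof -
  have "sml C" using small_subset[OF small_Sg[of k]] assms by (simp add: wchain_def Sg_def)
  then obtain \<alpha> :: 'u and t where "t ` below \<alpha> = C" "\<forall>j\<in>below \<alpha>. \<forall>i\<in>below j. (t i, t j) \<in> leq (MO (D k))"
    using wchain_enumeration[OF MO_dcpo[OF D_Obj] assms] by blast
  then have "\<exists>p :: 'u \<times> ('u \<Rightarrow> 'u). snd p ` below (fst p) = C \<and>
     (\<forall>j\<in>below (fst p). \<forall>i\<in>below j. (snd p i, snd p j) \<in> leq (MO (D k)))"
    by (intro exI[of _ "(\<alpha>, t)"]) simp
  from someI_ex[OF this]
  show "snd (enum k C) ` below (fst (enum k C)) = C"
    "j \<in> below (fst (enum k C)) \<Longrightarrow> i \<in> below j \<Longrightarrow> (snd (enum k C) i, snd (enum k C) j) \<in> leq (MO (D k))"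
    unfolding enum_def by blast+
qed

lemma enum_Sg: "wchain (MO (D k)) C \<Longrightarrow> i \<in> below (fst (enum k C)) \<Longrightarrow> snd (enum k C) i \<in> Sg k"
  using imageI[of i "below (fst (enum k C))" "snd (enum k C)"] enum(1)[of k C]
  by (auto simp: wchain_def Sg_def)

lemma join_Sg: "wchain (MO (D k)) C \<Longrightarrow> is_join (MO (D k)) C (join (MO (D k)) C)"
  by (rule is_join_join[OF MO_dcpo[OF D_Obj] wchain_directed[OF MO_dcpo[OF D_Obj]]])

lemma kl_Sg:
  assumes "set us \<subseteq> Sg l" "s \<in> Sg (length us)"
  shows "kl l us s \<in> Sg l"
  unfolding kl_def Sg_def using assms
  by (intro mm_carr D_Obj MA_carr[OF D_Obj MO_Obj[OF D_Obj]] fn_cfun MO_dcpo) (simp_all add: Sg_def)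

lemma Op_vs_trms: "s \<in> Sg k \<Longrightarrow> Op s (vs k) \<in> trms Sg"
  by (rule trms.Op) (auto intro: trms.Var)

lemma equations_Sg: "eqs \<subseteq> ext_trms Sg \<times> ext_trms Sg"
proof -
  have "eqs_subst \<subseteq> ext_trms Sg \<times> ext_trms Sg"
    by (auto simp: eqs_subst_def intro!: ext_trms.Trm Op_vs_trms kl_Sg trms.Op)
  moreover have "eqs_proj \<subseteq> ext_trms Sg \<times> ext_trms Sg"
    using un_carr[OF D_Obj] by (auto simp: eqs_proj_def Sg_def num_Nn intro!: ext_trms.Trm Op_vs_trms trms.Var)
  moreover have "chain_term k C \<in> ext_trms Sg" if C: "wchain (MO (D k)) C" for k C
    unfolding chain_term_def
  proof (rule ext_trms.Join)
    show "below (fst (enum k C)) \<noteq> {}" using enum(1)[OF C] C by (auto simp: wchain_def)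
    show "(\<lambda>i\<in>below (fst (enum k C)). Trm (Op (snd (enum k C) i) (vs k))) i \<in> ext_trms Sg"
      if "i \<in> below (fst (enum k C))" for i
      using that enum_Sg[OF C that] by (auto intro: ext_trms.Trm Op_vs_trms)
    have "(\<Union>i\<in>below (fst (enum k C)). ext_vars ((\<lambda>i\<in>below (fst (enum k C)). Trm (Op (snd (enum k C) i) (vs k))) i)) \<subseteq> {..<k}"
      by auto
    then show "finite (\<Union>i\<in>below (fst (enum k C)). ext_vars ((\<lambda>i\<in>below (fst (enum k C)). Trm (Op (snd (enum k C) i) (vs k))) i))"
      using finite_subset by blast
  qed simp
  then have "eqs_join \<subseteq> ext_trms Sg \<times> ext_trms Sg"
    using is_join_carr[OF join_Sg] by (auto simp: eqs_join_def Sg_def intro!: ext_trms.Trm Op_vs_trms)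
  ultimately show ?thesis by (simp add: eqs_def)
qed

sublocale V: variety U Sg eqs
  by unfold_locales (fact signature_Sg equations_Sg)+

lemma trm_val_vs: "map (trm_val A f) (vs k) = map f [0..<k]"
  by simp

text \<open>The members of the formal join are plain terms and so always defined; definedness
  reduces to monotonicity along the listing.\<close>

lemma ext_val_chain_term:
  assumes C: "wchain (MO (D k)) C"
  shows "ext_val A f (chain_term k C) =
    (if \<forall>j\<in>below (fst (enum k C)). \<forall>i\<in>below j.
        (opn A (snd (enum k C) i) (map f [0..<k]), opn A (snd (enum k C) j) (map f [0..<k])) \<in> leq (und A)
     then Some (join (und A) ((\<lambda>t. opn A t (map f [0..<k])) ` C)) else None)"
proof -
  let ?\<alpha> = "fst (enum k C)" and ?t = "snd (enum k C)"
  let ?g = "\<lambda>i\<in>below ?\<alpha>. Trm (Op (?t i) (vs k))"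
  have val: "ext_val A f (?g i) = Some (opn A (?t i) (map f [0..<k]))" if "i \<in> below ?\<alpha>" for i
    using that trm_val_vs[of A f k] by (simp del: map_map)
  have val': "ext_val A f (?g i) = Some (opn A (?t i) (map f [0..<k]))" if "j \<in> below ?\<alpha>" "i \<in> below j" for i j
    using val[OF below_trans[OF that(2,1)]] .
  have all: "(\<forall>i\<in>below ?\<alpha>. ext_val A f (?g i) \<noteq> None) = True" using val by simp
  have mono: "(\<forall>j\<in>below ?\<alpha>. \<forall>i\<in>below j. (the (ext_val A f (?g i)), the (ext_val A f (?g j))) \<in> leq (und A)) \<longleftrightarrow>
    (\<forall>j\<in>below ?\<alpha>. \<forall>i\<in>below j. (opn A (?t i) (map f [0..<k]), opn A (?t j) (map f [0..<k])) \<in> leq (und A))"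
    using val val' by (intro ball_cong) auto
  have "(\<lambda>i. the (ext_val A f (?g i))) ` below ?\<alpha> = (\<lambda>t. opn A t (map f [0..<k])) ` ?t ` below ?\<alpha>"
    unfolding image_image using val by (intro image_cong) auto
  then have img: "(\<lambda>i. the (ext_val A f (?g i))) ` below ?\<alpha> = (\<lambda>t. opn A t (map f [0..<k])) ` C"
    by (simp only: enum(1)[OF C])
  show ?thesis unfolding chain_term_def ext_val.simps all mono img by (simp only: simp_thms)
qed

lemma satisfiesD:
  assumes "A \<in> models Sg eqs" "e \<in> eqs" "f \<in> UNIV \<rightarrow> carr (und A)"
  shows "ext_val A f (fst e) \<noteq> None" "ext_val A f (snd e) \<noteq> None" "ext_val A f (fst e) = ext_val A f (snd e)"
  using assms unfolding models_def satisfies_def by blast+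

section \<open>Models of the clone as Eilenberg--Moore algebras\<close>

context
  fixes A
  assumes A: "A \<in> models Sg eqs"
begin

text \<open>Assignments are total on the infinite set of variables, so over an empty carrier there
  is none, even for the empty list. Each use below therefore exhibits a point of the
  carrier.\<close>

lemma assignment:
  assumes "set xs \<subseteq> carr (und A)" "carr (und A) \<noteq> {}"
  obtains f where "f \<in> UNIV \<rightarrow> carr (und A)" "map f [0..<length xs] = xs"
proof -
  obtain a where "a \<in> carr (und A)" using assms(2) by blast
  then have "(\<lambda>i. if i < length xs then xs ! i else a) \<in> UNIV \<rightarrow> carr (und A)"
    using assms(1) nth_mem by fastforce
  moreover have "map (\<lambda>i. if i < length xs then xs ! i else a) [0..<length xs] = xs"
    by (rule nth_equalityI) auto
  ultimately show thesis by (rule that)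
qed

lemma op_carr: "s \<in> Sg (length xs) \<Longrightarrow> set xs \<subseteq> carr (und A) \<Longrightarrow> opn A s xs \<in> carr (und A)"
  by (rule algebra_closed[OF models_algebra[OF A]])

lemma op_subst:
  assumes us: "set us \<subseteq> Sg (length xs)" and s: "s \<in> Sg (length us)" and xs: "set xs \<subseteq> carr (und A)"
  shows "opn A s (map (\<lambda>u. opn A u xs) us) = opn A (kl (length xs) us s) xs"
proof -
  let ?e = "(Trm (Op s (map (\<lambda>u. Op u (vs (length xs))) us)), Trm (Op (kl (length xs) us s) (vs (length xs))))"
  have "carr (und A) \<noteq> {}" using op_carr[OF kl_Sg[OF us s] xs] by blast
  then obtain f where f: "f \<in> UNIV \<rightarrow> carr (und A)" "map f [0..<length xs] = xs" using assignment[OF xs] by blast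
  have "?e \<in> eqs" unfolding eqs_def eqs_subst_def using us s by force
  from satisfiesD(3)[OF A this f(1)] show ?thesis using f(2) by (simp add: comp_def)
qed

lemma op_proj:
  assumes xs: "set xs \<subseteq> carr (und A)" and j: "j < length xs"
  shows "opn A (un (D (length xs)) (num j)) xs = xs ! j"
proof -
  let ?e = "(Trm (Op (un (D (length xs)) (num j)) (vs (length xs))), Trm (Var j))"
  have "carr (und A) \<noteq> {}" using xs nth_mem[OF j] by blast
  then obtain f where f: "f \<in> UNIV \<rightarrow> carr (und A)" "map f [0..<length xs] = xs" using assignment[OF xs] by blast
  have "?e \<in> eqs" unfolding eqs_def eqs_proj_def using j by force
  from satisfiesD(3)[OF A this f(1)] have "opn A (un (D (length xs)) (num j)) xs = f j" using f(2) by (simp add: comp_def)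
  moreover have "f j = xs ! j" using f(2) j by (metis add_0 diff_zero length_upt nth_map nth_upt)
  ultimately show ?thesis by simp
qed

text \<open>Satisfying a join equation includes definedness of the formal join, so the values
  increase along the chain, and equality of both sides says that its join is preserved.
  \<open>continuous_wchains\<close> passes from chains to directed sets.\<close>

lemma op_continuous:
  assumes xs: "set xs \<subseteq> carr (und A)"
  shows "continuous (MO (D (length xs))) (und A) (\<lambda>t. opn A t xs)"
proof (rule continuous_wchains[OF MO_dcpo[OF D_Obj] V.models_dcpo[OF A]])
  show op: "opn A t xs \<in> carr (und A)" if "t \<in> carr (MO (D (length xs)))" for t
    using op_carr[OF _ xs] that by (simp add: Sg_def)
  fix C x assume C: "wchain (MO (D (length xs))) C" and x: "is_join (MO (D (length xs))) C x"
  let ?k = "length xs"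
  have jx: "join (MO (D ?k)) C = x" by (rule join_eq[OF MO_dcpo[OF D_Obj] x])
  let ?e = "(chain_term ?k C, Trm (Op x (vs ?k)))"
  have "carr (und A) \<noteq> {}" using op[OF is_join_carr[OF x]] by blast
  then obtain f where f: "f \<in> UNIV \<rightarrow> carr (und A)" "map f [0..<?k] = xs" using assignment[OF xs] by blast
  have e: "?e \<in> eqs" unfolding eqs_def eqs_join_def using C jx by auto
  note sat = satisfiesD[OF A e f(1)]
  note v = ext_val_chain_term[OF C, of A f, unfolded f(2)]
  have mono: "(opn A (snd (enum ?k C) i) xs, opn A (snd (enum ?k C) j) xs) \<in> leq (und A)"
    if "j \<in> below (fst (enum ?k C))" "i \<in> below j" for i j
    using sat(1) v that by (auto split: if_splits)
  have "ext_val A f (chain_term ?k C) = Some (join (und A) ((\<lambda>t. opn A t xs) ` C))"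
    using sat(1) v by (simp split: if_splits)
  moreover have "ext_val A f (snd ?e) = Some (opn A x xs)" using f(2) by (simp add: comp_def)
  ultimately have jeq: "join (und A) ((\<lambda>t. opn A t xs) ` C) = opn A x xs" using sat(3) by simp
  have "(\<lambda>t. opn A t xs) ` snd (enum ?k C) ` below (fst (enum ?k C)) = (\<lambda>i. opn A (snd (enum ?k C) i) xs) ` below (fst (enum ?k C))"
    by (simp only: image_image)
  then have img: "(\<lambda>t. opn A t xs) ` C = (\<lambda>i. opn A (snd (enum ?k C) i) xs) ` below (fst (enum ?k C))"
    by (simp only: enum(1)[OF C])
  have "directed (und A) ((\<lambda>i. opn A (snd (enum ?k C) i) xs) ` below (fst (enum ?k C)))"
  proof (rule directed_chain[OF V.models_dcpo[OF A]])
    show "below (fst (enum ?k C)) \<noteq> {}" using enum(1)[OF C] C by (auto simp: wchain_def)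
    show "opn A (snd (enum ?k C) i) xs \<in> carr (und A)" if "i \<in> below (fst (enum ?k C))" for i
      using op enum_Sg[OF C that] by (simp add: Sg_def)
  qed (use mono in auto)
  then show "is_join (und A) ((\<lambda>t. opn A t xs) ` C) (opn A x xs)"
    using is_join_join[OF V.models_dcpo[OF A]] jeq img by metis
qed

text \<open>Renaming of variables is substitution of projections, by the unit law
  \<open>mm_MA_un\<close>.\<close>

lemma op_reindex:
  assumes g: "g \<in> Nn k \<rightarrow>\<^sub>E Nn (length xs)" and s: "s \<in> Sg k" and xs: "set xs \<subseteq> carr (und A)"
  shows "opn A (MA (D k) (D (length xs)) g s) xs = opn A s (map (\<lambda>i. fn xs (g (num i))) [0..<k])"
proof -
  let ?l = "length xs"
  let ?us = "map (\<lambda>i. un (D ?l) (g (num i))) [0..<k]"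
  have gc: "g \<in> carr (cfun (D k) (D ?l))" using g by (simp add: cfun_disc is_dcpo_disc)
  have gi: "g (num i) \<in> Nn ?l" if "i < k" for i using g num_Nn[OF that] by auto
  have us: "set ?us \<subseteq> Sg ?l" using gi un_carr[OF D_Obj] by (auto simp: Sg_def)
  have "fn ?us = compose (Nn k) (un (D ?l)) g"
    by (rule eq_fnI[symmetric]) (auto simp: num_Nn)
  then have "MA (D k) (MO (D ?l)) (fn ?us) s = MA (D ?l) (MO (D ?l)) (un (D ?l)) (MA (D k) (D ?l) g s)"
    using MA_MA[OF D_Obj D_Obj MO_Obj[OF D_Obj] gc un_cfun[OF D_Obj]] s by (simp add: Sg_def)
  then have kl: "kl ?l ?us s = MA (D k) (D ?l) g s"
    using mm_MA_un[OF D_Obj MA_carr[OF D_Obj D_Obj gc]] s by (simp add: kl_def Sg_def)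
  have "opn A s (map (\<lambda>u. opn A u xs) ?us) = opn A (kl ?l ?us s) xs"
    using us s xs by (intro op_subst) simp_all
  moreover have "map (\<lambda>u. opn A u xs) ?us = map (\<lambda>i. fn xs (g (num i))) [0..<k]"
  proof -
    have "opn A (un (D ?l) (g (num i))) xs = fn xs (g (num i))" if i: "i < k" for i
    proof -
      obtain j where j: "g (num i) = num j" "j < ?l" using gi[OF i] by (auto simp: Nn_def)
      then show ?thesis using op_proj[OF xs j(2)] by simp
    qed
    then show ?thesis by simp
  qed
  ultimately show ?thesis by (simp only: kl)
qed

text \<open>The cocone of a model: the variables of \<open>t\<close> are renamed along the
  enumeration of \<open>n\<close>, and the resulting operation acts on the listed values of
  \<open>x\<close>.\<close>

definition phi :: "'u set \<Rightarrow> ('u \<Rightarrow> 'u) \<Rightarrow> 'u \<Rightarrow> 'u" where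
  "phi n x t = opn A (MA (disc n) (D (length (en n))) (ix n) t) (map x (en n))"

lemma ix_cfun: "finite n \<Longrightarrow> ix n \<in> carr (cfun (disc n) (D (length (en n))))"
  using ix_PiE by (simp add: cfun_disc is_dcpo_disc)

text \<open>The cocone \<open>phi\<close> is continuous in \<open>x\<close> as operations are,
  continuous in \<open>t\<close> by the join equations, and dinatural by the substitution and
  projection equations; so \<open>extend_cocone\<close> applies.\<close>

lemma structure_map:
  "\<exists>a\<in>carr (cfun (MO (und A)) (und A)). \<forall>ys t. set ys \<subseteq> carr (und A) \<longrightarrow> t \<in> Sg (length ys) \<longrightarrow>
    a (bas (und A) ys t) = opn A t ys"
proof -
  let ?X = "und A"
  have X: "?X \<in> Obj DCPO" using V.models_Obj[OF A] .
  note dX = is_dcpo_Obj[OF X]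
  have ixt: "MA (disc n) (D (length (en n))) (ix n) t \<in> Sg (length (en n))" if "finite n" "t \<in> carr (MO (disc n))" for n t
    using MA_carr[OF disc_Obj[OF that(1)] D_Obj ix_cfun[OF that(1)] that(2)] by (simp add: Sg_def)
  have xen: "set (map x (en n)) \<subseteq> carr ?X" if "finite n" "x \<in> n \<rightarrow>\<^sub>E carr ?X" for n x
    using that en(2)[OF that(1)] by auto
  have "\<exists>h\<in>carr (cfun (MO ?X) ?X). \<forall>n x t. finite n \<longrightarrow> x \<in> n \<rightarrow>\<^sub>E carr ?X \<longrightarrow> t \<in> carr (MO (disc n)) \<longrightarrow>
    h (MA (disc n) ?X x t) = phi n x t"
  proof (rule extend_cocone[OF X X])
    fix n :: "'u set" and t assume n: "finite n" and t: "t \<in> carr (MO (disc n))"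
    have "continuous (cfun (disc n) ?X) (power_dcpo ?X (length (en n))) (\<lambda>x. map (\<lambda>g. g x) (map (\<lambda>v x. x v) (en n)))"
      using en(2)[OF n] by (intro continuous_into_power_dcpo is_dcpo_cfun dX) (auto intro!: continuous_eval dX)
    then have "continuous (cfun (disc n) ?X) ?X (\<lambda>x. opn A (MA (disc n) (D (length (en n))) (ix n) t) (map (\<lambda>g. g x) (map (\<lambda>v x. x v) (en n))))"
      by (rule continuous_comp[OF _ algebra_continuous[OF models_algebra[OF A] ixt[OF n t]] is_dcpo_cfun[OF dX]])
    then show "continuous (cfun (disc n) ?X) ?X (\<lambda>x. phi n x t)" by (simp add: phi_def comp_def)
  next
    fix n :: "'u set" and x assume n: "finite n" and x: "x \<in> n \<rightarrow>\<^sub>E carr ?X"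
    have "continuous (MO (D (length (en n)))) ?X (\<lambda>t. opn A t (map x (en n)))"
      using op_continuous[OF xen[OF n x]] by simp
    then show "continuous (MO (disc n)) ?X (phi n x)"
      unfolding phi_def
      by (rule continuous_comp[OF cfunD[OF MA_cfun[OF disc_Obj[OF n] D_Obj ix_cfun[OF n]]] _ MO_dcpo[OF disc_Obj[OF n]]])
  next
    fix n m :: "'u set" and f x t
    assume n: "finite n" and m: "finite m" and f: "f \<in> n \<rightarrow>\<^sub>E m" and x: "x \<in> m \<rightarrow>\<^sub>E carr ?X" and t: "t \<in> carr (MO (disc n))"
    let ?k = "length (en n)" and ?l = "length (en m)"
    \<comment> \<open>The map \<open>f\<close> read on positions in the enumerations of
      \<open>n\<close> and \<open>m\<close>.\<close>
    let ?g = "\<lambda>v\<in>Nn ?k. ix m (f (en n ! inv num v))"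
    have fc: "f \<in> carr (cfun (disc n) (disc m))" using f by (simp add: cfun_disc is_dcpo_disc)
    have fe: "f (en n ! i) \<in> m" if "i < ?k" for i using f en(2)[OF n] nth_mem[OF that] by auto
    have g: "?g \<in> Nn ?k \<rightarrow>\<^sub>E Nn ?l"
      using fe PiE_mem[OF ix_PiE[OF m]] by (auto simp: Nn_def inj_num)
    then have gc: "?g \<in> carr (cfun (D ?k) (D ?l))" by (simp add: cfun_disc is_dcpo_disc)
    have "compose n (ix m) f = compose n ?g (ix n)"
    proof (rule extensionalityI[of _ n])
      fix v assume v: "v \<in> n"
      obtain i where i: "i < ?k" "ix n v = num i" "en n ! i = v" using ix[OF n v] by blast
      then show "compose n (ix m) f v = compose n ?g (ix n) v" using v by (simp add: num_Nn inj_num)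
    qed (simp_all add: compose_def)
    then have "MA (disc m) (D ?l) (ix m) (MA (disc n) (disc m) f t) = MA (D ?k) (D ?l) ?g (MA (disc n) (D ?k) (ix n) t)"
      using MA_MA[OF disc_Obj[OF n] disc_Obj[OF m] D_Obj fc ix_cfun[OF m] t]
        MA_MA[OF disc_Obj[OF n] D_Obj D_Obj ix_cfun[OF n] gc t] by simp
    then have "phi m x (MA (disc n) (disc m) f t) = opn A (MA (D ?k) (D (length (map x (en m)))) ?g (MA (disc n) (D ?k) (ix n) t)) (map x (en m))"
      by (simp add: phi_def)
    also have "\<dots> = opn A (MA (disc n) (D ?k) (ix n) t) (map (\<lambda>i. fn (map x (en m)) (?g (num i))) [0..<?k])"
      using g by (intro op_reindex ixt n t xen[OF m x]) simp
    also have "map (\<lambda>i. fn (map x (en m)) (?g (num i))) [0..<?k] = map (compose n x f) (en n)"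
    proof (rule nth_equalityI)
      fix i assume "i < length (map (\<lambda>i. fn (map x (en m)) (?g (num i))) [0..<?k])"
      then have i: "i < ?k" by simp
      then have "en n ! i \<in> n" using en(2)[OF n] nth_mem[OF i] by blast
      then show "map (\<lambda>i. fn (map x (en m)) (?g (num i))) [0..<?k] ! i = map (compose n x f) (en n) ! i"
        using i fn_ix[OF m fe[OF i], of x] by (simp add: num_Nn inj_num)
    qed simp
    finally show "phi m x (MA (disc n) (disc m) f t) = phi n (compose n x f) t" by (simp add: phi_def)
  qed
  then obtain a where a: "a \<in> carr (cfun (MO ?X) ?X)"
    "\<And>n x t. finite n \<Longrightarrow> x \<in> n \<rightarrow>\<^sub>E carr ?X \<Longrightarrow> t \<in> carr (MO (disc n)) \<Longrightarrow> a (MA (disc n) ?X x t) = phi n x t"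
    by blast
  have "a (bas ?X ys t) = opn A t ys" if ys: "set ys \<subseteq> carr ?X" and t: "t \<in> Sg (length ys)" for ys t
  proof -
    let ?n = "Nn (length ys)"
    note fy = fn_PiE[OF ys]
    have "a (bas ?X ys t) = phi ?n (fn ys) t"
      unfolding bas_def using a(2)[OF finite_Nn fy] t by (simp add: Sg_def)
    also have "\<dots> = opn A t (map (\<lambda>i. fn (map (fn ys) (en ?n)) (ix ?n (num i))) [0..<length ys])"
      unfolding phi_def using op_reindex[OF _ t xen[OF finite_Nn fy], of "ix ?n"] ix_PiE[OF finite_Nn] by simp
    also have "map (\<lambda>i. fn (map (fn ys) (en ?n)) (ix ?n (num i))) [0..<length ys] = ys"
      by (rule nth_equalityI) (simp_all add: fn_ix num_Nn)
    finally show ?thesis .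
  qed
  then show ?thesis using a(1) by blast
qed

end

section \<open>Freeness of the values of the monad\<close>

definition opM :: "'u dcpo \<Rightarrow> 'u \<Rightarrow> 'u list \<Rightarrow> 'u" where
  "opM X t xs = mm X (bas (MO X) xs t)"

lemma opM_carr: "X \<in> Obj DCPO \<Longrightarrow> set xs \<subseteq> carr (MO X) \<Longrightarrow> t \<in> Sg (length xs) \<Longrightarrow> opM X t xs \<in> carr (MO X)"
  unfolding opM_def by (intro mm_carr bas_carr MO_Obj)

lemma opM_natural:
  assumes "X \<in> Obj DCPO" "Y \<in> Obj DCPO" "f \<in> carr (cfun X Y)" "set xs \<subseteq> carr (MO X)" "t \<in> Sg (length xs)"
  shows "MA X Y f (opM X t xs) = opM Y t (map (MA X Y f) xs)"
  unfolding opM_def using assms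
  by (simp add: mm_natural[symmetric] bas_carr MO_Obj MA_bas MA_cfun)

lemma opM_mm:
  assumes "X \<in> Obj DCPO" "set xs \<subseteq> carr (MO (MO X))" "t \<in> Sg (length xs)"
  shows "mm X (opM (MO X) t xs) = opM X t (map (mm X) xs)"
  unfolding opM_def using assms by (simp add: mm_mm bas_carr MO_Obj MA_bas mm_cfun)

text \<open>By the unit law \<open>mm_MA_un\<close>, a basic element is an operation applied to
  generators; this is why a homomorphism is determined on basic elements.\<close>

lemma opM_un:
  assumes X: "X \<in> Obj DCPO" and ys: "set ys \<subseteq> carr X" and t: "t \<in> Sg (length ys)"
  shows "opM X t (map (un X) ys) = bas X ys t"
  unfolding opM_def using MA_bas[OF X MO_Obj[OF X] un_cfun[OF X] ys t] mm_MA_un[OF X bas_carr[OF X ys t]] by simp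

text \<open>The substitution law inside \<open>M X\<close>: naturality moves the map induced by
  \<open>ys\<close> past the operation, and what remains over the variables is \<open>kl\<close> by
  definition.\<close>

lemma opM_bas:
  assumes X: "X \<in> Obj DCPO" and ys: "set ys \<subseteq> carr X" and us: "set us \<subseteq> Sg (length ys)" and t: "t \<in> Sg (length us)"
  shows "opM X t (map (bas X ys) us) = bas X ys (kl (length ys) us t)"
proof -
  let ?l = "length ys"
  have fy: "fn ys \<in> carr (cfun (D ?l) X)" using fn_cfun[OF is_dcpo_Obj[OF X] ys refl] .
  have us': "set us \<subseteq> carr (MO (D ?l))" using us by (simp add: Sg_def)
  have "bas X ys (kl ?l us t) = MA (D ?l) X (fn ys) (opM (D ?l) t us)"
    by (simp add: bas_def kl_def opM_def)
  also have "\<dots> = opM X t (map (MA (D ?l) X (fn ys)) us)"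
    by (rule opM_natural[OF D_Obj X fy us' t])
  finally show ?thesis by (simp add: bas_def[abs_def])
qed

text \<open>Continuity in the arguments comes from the local continuity of the functor; continuity
  in the symbol, \<open>opM_continuous\<close>, comes from continuity of the maps it
  produces.\<close>

lemma opM_sepcont:
  assumes X: "X \<in> Obj DCPO" and t: "t \<in> Sg n"
  shows "sepcont (MO X) (MO X) n (opM X t)"
proof (rule sepcontI)
  fix xs assume "length xs = n" "set xs \<subseteq> carr (MO X)"
  then show "opM X t xs \<in> carr (MO X)" using opM_carr[OF X] t by simp
next
  fix us vs assume *: "Suc (length us + length vs) = n" "set us \<subseteq> carr (MO X)" "set vs \<subseteq> carr (MO X)"
  note MX = MO_Obj[OF X] and dMX = MO_dcpo[OF X]
  have "continuous (MO X) (cfun (D n) (MO X)) (\<lambda>x. fn (us @ x # vs))"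
    using * by (intro continuous_fn dMX) auto
  then have "continuous (MO X) (MO (MO X)) (\<lambda>x. MA (D n) (MO X) (fn (us @ x # vs)) t)"
    using t by (intro continuous_comp[OF continuous_comp[OF _ endo_continuous[OF endo D_Obj MX]] continuous_eval] dMX MO_dcpo[OF MX])
      (simp_all add: Sg_def)
  then have "continuous (MO X) (MO X) (\<lambda>x. mm X (MA (D n) (MO X) (fn (us @ x # vs)) t))"
    by (rule continuous_comp[OF _ cfunD[OF mm_cfun[OF X]] dMX])
  then show "continuous (MO X) (MO X) (\<lambda>x. opM X t (us @ x # vs))"
    using *(1) by (simp add: opM_def bas_def)
qed

lemma opM_continuous:
  assumes X: "X \<in> Obj DCPO" and xs: "set xs \<subseteq> carr (MO X)"
  shows "continuous (MO (D (length xs))) (MO X) (\<lambda>t. opM X t xs)"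
  unfolding opM_def bas_def
  by (rule continuous_comp[OF cfunD[OF MA_cfun[OF D_Obj MO_Obj[OF X] fn_cfun[OF MO_dcpo[OF X] xs refl]]]
    cfunD[OF mm_cfun[OF X]] MO_dcpo[OF D_Obj]])

definition free_alg :: "'u dcpo \<Rightarrow> 'u algebra" where
  "free_alg X = \<lparr>und = MO X,
     opn = (\<lambda>t xs. if t \<in> Sg (length xs) \<and> set xs \<subseteq> carr (MO X) then opM X t xs else undefined)\<rparr>"

lemma und_free_alg [simp]: "und (free_alg X) = MO X"
  by (simp add: free_alg_def)

lemma opn_free_alg: "t \<in> Sg (length xs) \<Longrightarrow> set xs \<subseteq> carr (MO X) \<Longrightarrow> opn (free_alg X) t xs = opM X t xs"
  by (simp add: free_alg_def)

lemma free_alg_algebra: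
  assumes X: "X \<in> Obj DCPO"
  shows "is_algebra Sg (free_alg X)"
proof (rule is_algebraI)
  show "und (free_alg X) \<in> Obj DCPO" using MO_Obj[OF X] by simp
  show "sepcont (und (free_alg X)) (und (free_alg X)) n (opn (free_alg X) s)" if "s \<in> Sg n" for n s
    using sepcont_cong[OF opM_sepcont[OF X that]] opn_free_alg that by simp
qed (auto simp: free_alg_def)

text \<open>The substitution equations come from associativity and naturality of the multiplication,
  the projection equations from naturality of the unit and the unit law \<open>mm_un\<close>, the
  join equations from continuity in the symbol.\<close>

lemma free_alg_models:
  assumes X: "X \<in> Obj DCPO"
  shows "free_alg X \<in> models Sg eqs"
proof -
  let ?A = "free_alg X"
  note alg = free_alg_algebra[OF X] and dM = MO_dcpo[OF X]
  have "satisfies ?A e" if ee: "e \<in> eqs" for e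
    unfolding satisfies_def
  proof
    fix f :: "nat \<Rightarrow> 'u" assume "f \<in> UNIV \<rightarrow> carr (und ?A)"
    then have f: "f \<in> UNIV \<rightarrow> carr (MO X)" by simp
    have fk: "set (map f [0..<k]) \<subseteq> carr (MO X)" for k using f by auto
    have opk: "opn ?A u (map f [0..<k]) = opM X u (map f [0..<k])" if "u \<in> Sg k" for u k
      using that fk by (intro opn_free_alg) simp_all
    have val: "trm_val ?A f (Op u (vs k)) = opM X u (map f [0..<k])" if "u \<in> Sg k" for u k
      using opk[OF that] by (simp add: comp_def)
    consider (subst) "e \<in> eqs_subst" | (proj) "e \<in> eqs_proj" | (join) "e \<in> eqs_join" using ee by (auto simp: eqs_def)
    then show "ext_val ?A f (fst e) \<noteq> None \<and> ext_val ?A f (snd e) \<noteq> None \<and> ext_val ?A f (fst e) = ext_val ?A f (snd e)"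
    proof cases
      case subst
      then obtain l us s where e: "e = (Trm (Op s (map (\<lambda>u. Op u (vs l)) us)), Trm (Op (kl l us s) (vs l)))"
        and us: "set us \<subseteq> Sg l" and s: "s \<in> Sg (length us)"
        by (auto simp: eqs_subst_def)
      let ?xs = "map f [0..<l]"
      have bx: "set (map (bas (MO X) ?xs) us) \<subseteq> carr (MO (MO X))"
        using bas_carr[OF MO_Obj[OF X] fk[of l]] us by auto
      have ops: "set (map (\<lambda>u. opM X u ?xs) us) \<subseteq> carr (MO X)" using opM_carr[OF X fk[of l]] us by auto
      have "map (trm_val ?A f) (map (\<lambda>u. Op u (vs l)) us) = map (\<lambda>u. opM X u ?xs) us"
        using val us by auto
      then have "trm_val ?A f (Op s (map (\<lambda>u. Op u (vs l)) us)) = opM X s (map (\<lambda>u. opM X u ?xs) us)"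
        using opn_free_alg[OF _ ops, of s] s by (simp only: trm_val.simps length_map)
      also have "map (\<lambda>u. opM X u ?xs) us = map (mm X) (map (bas (MO X) ?xs) us)" by (simp add: opM_def)
      also have "opM X s \<dots> = mm X (opM (MO X) s (map (bas (MO X) ?xs) us))"
        using opM_mm[OF X bx] s by simp
      also have "opM (MO X) s (map (bas (MO X) ?xs) us) = bas (MO X) ?xs (kl l us s)"
        using opM_bas[OF MO_Obj[OF X] fk[of l], of us s] us s by simp
      also have "mm X \<dots> = trm_val ?A f (Op (kl l us s) (vs l))"
        using val[OF kl_Sg[OF us s]] by (simp only: opM_def)
      finally show ?thesis unfolding e by simp
    next
      case proj
      then obtain k j where e: "e = (Trm (Op (un (D k) (num j)) (vs k)), Trm (Var j))" and j: "j < k"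
        by (auto simp: eqs_proj_def)
      let ?xs = "map f [0..<k]"
      have u: "un (D k) (num j) \<in> Sg k" using un_carr[OF D_Obj] num_Nn[OF j] by (simp add: Sg_def)
      have fx: "fn ?xs \<in> carr (cfun (D k) (MO X))" using fk by (intro fn_cfun dM) auto
      have "opM X (un (D k) (num j)) ?xs = mm X (un (MO X) (fn ?xs (num j)))"
        using un_natural[OF D_Obj MO_Obj[OF X] fx, of "num j"] num_Nn[OF j] by (simp add: opM_def bas_def)
      also have "\<dots> = f j" using j f by (simp add: mm_un[OF X] Pi_iff)
      finally show ?thesis unfolding e using val[OF u] by simp
    next
      case join
      then obtain k C where e: "e = (chain_term k C, Trm (Op (join (MO (D k)) C) (vs k)))" and C: "wchain (MO (D k)) C"
        by (auto simp: eqs_join_def)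
      let ?xs = "map f [0..<k]" and ?x = "Defs.join (MO (D k)) C"
      have CS: "C \<subseteq> Sg k" using C by (auto simp: wchain_def Sg_def)
      have x: "is_join (MO (D k)) C ?x" by (rule join_Sg[OF C])
      have xS: "?x \<in> Sg k" using is_join_carr[OF x] by (simp add: Sg_def)
      have cont: "continuous (MO (D k)) (MO X) (\<lambda>t. opM X t ?xs)" using opM_continuous[OF X fk[of k]] by simp
      have "(opn ?A (snd (enum k C) i) ?xs, opn ?A (snd (enum k C) j) ?xs) \<in> leq (und ?A)"
        if ij: "j \<in> below (fst (enum k C))" "i \<in> below j" for i j
        using continuous_mono[OF cont MO_dcpo[OF D_Obj] enum(2)[OF C ij]]
          enum_Sg[OF C ij(1)] enum_Sg[OF C below_trans[OF ij(2,1)]] by (simp add: opk)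
      then have v: "ext_val ?A f (chain_term k C) = Some (Defs.join (und ?A) ((\<lambda>t. opn ?A t ?xs) ` C))"
        unfolding ext_val_chain_term[OF C] by simp
      have "is_join (MO X) ((\<lambda>t. opM X t ?xs) ` C) (opM X ?x ?xs)"
        by (rule continuous_join[OF cont wchain_directed[OF MO_dcpo[OF D_Obj] C] x])
      moreover have "(\<lambda>t. opn ?A t ?xs) ` C = (\<lambda>t. opM X t ?xs) ` C"
        using opk CS by (intro image_cong) auto
      ultimately have "Defs.join (und ?A) ((\<lambda>t. opn ?A t ?xs) ` C) = opM X ?x ?xs"
        using join_eq[OF dM] by simp
      then show ?thesis unfolding e using v val[OF xS] by (simp del: trm_val.simps)
    qed
  qed
  then show ?thesis using alg by (simp add: models_def)
qed

text \<open>The lists of generators are concatenated, and each operation is renamed into its own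
  block of variables, the second block being shifted by the length of the first.\<close>

lemma common_basis:
  assumes X: "X \<in> Obj DCPO" and "set xs \<subseteq> basics X"
  shows "\<exists>ys us. set ys \<subseteq> carr X \<and> set us \<subseteq> Sg (length ys) \<and> xs = map (bas X ys) us"
  using assms(2)
proof (induction xs)
  case Nil
  then show ?case by (intro exI[of _ "[]"]) simp
next
  case (Cons x xs)
  then obtain ys us where ys: "set ys \<subseteq> carr X" "set us \<subseteq> Sg (length ys)" "xs = map (bas X ys) us" by auto
  obtain zs u where zs: "set zs \<subseteq> carr X" "u \<in> Sg (length zs)" "x = bas X zs u"
    using Cons.prems by (auto simp: basics_def)
  let ?ws = "zs @ ys"
  let ?f = "fn (map num [0..<length zs])" and ?g = "fn (map num [length zs..<length zs + length ys])"
  have ws: "set ?ws \<subseteq> carr X" using ys zs by simp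
  have f: "?f \<in> Nn (length zs) \<rightarrow>\<^sub>E Nn (length ?ws)"
  proof -
    have "set (map num [0..<length zs]) \<subseteq> Nn (length ?ws)" by (auto simp: Nn_def)
    from fn_PiE[OF this] show ?thesis by simp
  qed
  have g: "?g \<in> Nn (length ys) \<rightarrow>\<^sub>E Nn (length ?ws)"
  proof -
    have "set (map num [length zs..<length zs + length ys]) \<subseteq> Nn (length ?ws)" by (auto simp: Nn_def)
    from fn_PiE[OF this] show ?thesis by simp
  qed
  have "compose (Nn (length zs)) (fn ?ws) ?f = fn zs"
    by (rule eq_fnI) (simp_all add: num_Nn nth_append)
  then have x: "x = bas X ?ws (MA (D (length zs)) (D (length ?ws)) ?f u)"
    using bas_MA[OF X ws finite_Nn f, of u] zs(2,3) by (simp add: bas_def Sg_def)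
  have "compose (Nn (length ys)) (fn ?ws) ?g = fn ys"
    by (rule eq_fnI) (simp_all add: num_Nn nth_append)
  then have "bas X ys v = bas X ?ws (MA (D (length ys)) (D (length ?ws)) ?g v)" if "v \<in> Sg (length ys)" for v
    using bas_MA[OF X ws finite_Nn g, of v] that by (simp add: bas_def Sg_def)
  then have xs: "xs = map (bas X ?ws) (map (MA (D (length ys)) (D (length ?ws)) ?g) us)"
    using ys(2,3) by auto
  have "MA (D (length zs)) (D (length ?ws)) ?f u \<in> Sg (length ?ws)"
    using MA_carr[OF D_Obj D_Obj, of ?f] f zs(2) by (simp add: Sg_def cfun_disc is_dcpo_disc)
  moreover have "set (map (MA (D (length ys)) (D (length ?ws)) ?g) us) \<subseteq> Sg (length ?ws)"
    using MA_carr[OF D_Obj D_Obj, of ?g] g ys(2) by (auto simp: Sg_def cfun_disc is_dcpo_disc)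
  ultimately show ?case
    using ws x xs by (intro exI[of _ ?ws] exI[of _ "MA (D (length zs)) (D (length ?ws)) ?f u # map (MA (D (length ys)) (D (length ?ws)) ?g) us"]) simp
qed

text \<open>On basic elements over a common list both sides reduce to a single operation by the
  substitution equations; separate continuity and density extend this to all arguments.\<close>

lemma structure_map_op:
  assumes A: "A \<in> models Sg eqs" and a: "a \<in> carr (cfun (MO (und A)) (und A))"
    and abas: "\<And>ys t. set ys \<subseteq> carr (und A) \<Longrightarrow> t \<in> Sg (length ys) \<Longrightarrow> a (bas (und A) ys t) = opn A t ys"
    and t: "t \<in> Sg (length xs)" and xs: "set xs \<subseteq> carr (MO (und A))"
  shows "a (opM (und A) t xs) = opn A t (map a xs)"
proof -
  let ?X = "und A"
  have X: "?X \<in> Obj DCPO" using V.models_Obj[OF A] .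
  note dX = is_dcpo_Obj[OF X] and dM = MO_dcpo[OF X]
  have ac: "a z \<in> carr ?X" if "z \<in> carr (MO ?X)" for z using cfun_carr[OF a that] .
  show ?thesis
  proof (rule sepcont_eq_on_dcl[OF dX, where P = "MO ?X" and Y = "basics ?X" and n = "length xs" and zs = xs
      and f = "\<lambda>xs. a (opM ?X t xs)" and g = "\<lambda>xs. opn A t (map a xs)"])
    show "sepcont (MO ?X) ?X (length xs) (\<lambda>xs. a (opM ?X t xs))"
      using t opM_carr[OF X] sepcont_continuous[OF opM_sepcont[OF X t]]
      by (intro sepcontI) (auto intro!: ac continuous_comp[OF _ cfunD[OF a] dM])
    show "sepcont (MO ?X) ?X (length xs) (\<lambda>xs. opn A t (map a xs))"
    proof (rule sepcontI)
      show "opn A t (map a ys) \<in> carr ?X" if "length ys = length xs" "set ys \<subseteq> carr (MO ?X)" for ys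
        using that t ac by (intro op_carr[OF A]) auto
      show "continuous (MO ?X) ?X (\<lambda>x. opn A t (map a (us @ x # vs)))"
        if *: "Suc (length us + length vs) = length xs" "set us \<subseteq> carr (MO ?X)" "set vs \<subseteq> carr (MO ?X)" for us vs
      proof -
        have "continuous ?X ?X (\<lambda>x. opn A t (map a us @ x # map a vs))"
          using * ac by (intro sepcont_continuous[OF algebra_sepcont[OF models_algebra[OF A] t]]) auto
        from continuous_comp[OF cfunD[OF a] this dM] show ?thesis by simp
      qed
    qed
    show "basics ?X \<subseteq> carr (MO ?X)" by (rule basics_carr[OF X])
    show "set xs \<subseteq> dcl (MO ?X) (basics ?X)" using xs unfolding basics_dense[OF X, symmetric] .
    fix zs assume zs: "set zs \<subseteq> basics ?X" "length zs = length xs"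
    obtain ys us where ys: "set ys \<subseteq> carr ?X" "set us \<subseteq> Sg (length ys)" "zs = map (bas ?X ys) us"
      using common_basis[OF X zs(1)] by blast
    have tu: "t \<in> Sg (length us)" using t zs(2) ys(3) by simp
    have "a (opM ?X t zs) = opn A (kl (length ys) us t) ys"
      unfolding ys(3) opM_bas[OF X ys(1,2) tu] by (rule abas[OF ys(1) kl_Sg[OF ys(2) tu]])
    also have "\<dots> = opn A t (map (\<lambda>u. opn A u ys) us)" by (rule op_subst[OF A ys(2) tu ys(1), symmetric])
    also have "map (\<lambda>u. opn A u ys) us = map a zs" unfolding ys(3) using abas[OF ys(1)] ys(2) by auto
    finally show "a (opM ?X t zs) = opn A t (map a zs)" .
  qed simp
qed

text \<open>The extension of \<open>f\<close> is the structure map of \<open>B\<close> after the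
  image of \<open>f\<close> under the functor. Uniqueness holds because a homomorphism has forced
  values on the elements \<open>bas X ys t\<close>.\<close>

lemma free_alg_free:
  assumes X: "X \<in> Obj DCPO"
  shows "is_free Sg eqs X (free_alg X) (un X)"
  unfolding is_free_def
proof (intro conjI ballI)
  show "free_alg X \<in> models Sg eqs" by (rule free_alg_models[OF X])
  show "un X \<in> carr (cfun X (und (free_alg X)))" using un_cfun[OF X] by simp
  fix B f assume B: "B \<in> models Sg eqs" and f: "f \<in> carr (cfun X (und B))"
  have OB: "und B \<in> Obj DCPO" using V.models_Obj[OF B] .
  note dM = MO_dcpo[OF X]
  obtain a where a: "a \<in> carr (cfun (MO (und B)) (und B))"
    "\<And>ys t. set ys \<subseteq> carr (und B) \<Longrightarrow> t \<in> Sg (length ys) \<Longrightarrow> a (bas (und B) ys t) = opn B t ys"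
    using structure_map[OF B] by blast
  note a_op = structure_map_op[OF B a]
  \<comment> \<open>The generator \<open>x\<close> is the unary projection applied to the list
    \<open>[x]\<close>, so the projection equation evaluates it.\<close>
  have a_un: "a (un (und B) x) = x" if x: "x \<in> carr (und B)" for x
  proof -
    have fx: "fn [x] \<in> carr (cfun (D 1) (und B))" using x by (intro fn_cfun is_dcpo_Obj[OF OB]) auto
    have "un (und B) x = MA (D 1) (und B) (fn [x]) (un (D 1) (num 0))"
      using un_natural[OF D_Obj OB fx, of "num 0"] num_Nn[of 0 1] by simp
    also have "\<dots> = bas (und B) [x] (un (D 1) (num 0))" by (simp add: bas_def)
    finally have "a (un (und B) x) = opn B (un (D 1) (num 0)) [x]"
      using a(2)[of "[x]" "un (D 1) (num 0)"] x un_carr[OF D_Obj, of "num 0" 1] num_Nn[of 0 1] by (simp add: Sg_def)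
    also have "\<dots> = x" using op_proj[OF B, of "[x]" 0] x by simp
    finally show ?thesis .
  qed
  let ?h = "compose (carr (MO X)) a (MA X (und B) f)"
  have hc: "?h \<in> carr (cfun (MO X) (und B))" by (rule compose_in_cfun[OF MA_cfun[OF X OB f] a(1) dM])
  have "?h \<in> alg_hom Sg (free_alg X) B"
  proof (rule alg_homI)
    show "?h \<in> carr (cfun (und (free_alg X)) (und B))" using hc by simp
    fix s xs assume s: "s \<in> Sg (length xs)" "set xs \<subseteq> carr (und (free_alg X))"
    then have xs: "set xs \<subseteq> carr (MO X)" by simp
    have "?h (opn (free_alg X) s xs) = a (opM (und B) s (map (MA X (und B) f) xs))"
      using opn_free_alg[OF s(1) xs] opM_carr[OF X xs s(1)] opM_natural[OF X OB f xs s(1)] by simp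
    also have "\<dots> = opn B s (map a (map (MA X (und B) f) xs))"
      using s(1) xs MA_carr[OF X OB f] by (intro a_op) auto
    also have "map a (map (MA X (und B) f) xs) = map ?h xs" using xs by auto
    finally show "?h (opn (free_alg X) s xs) = opn B s (map ?h xs)" .
  qed
  moreover have "?h (un X x) = f x" if x: "x \<in> carr X" for x
    using x un_carr[OF X x] un_natural[OF X OB f x] a_un[OF cfun_carr[OF f x]] by simp
  moreover have "h = ?h" if h: "h \<in> alg_hom Sg (free_alg X) B" "\<forall>x\<in>carr X. h (un X x) = f x" for h
  proof (rule eq_on_bas[OF X OB _ hc])
    show "h \<in> carr (cfun (MO X) (und B))" using alg_hom_cfun[OF h(1)] by simp
    have bas_val: "m (bas X ys t) = opn B t (map f ys)"
      if m: "m \<in> alg_hom Sg (free_alg X) B" "\<forall>x\<in>carr X. m (un X x) = f x" and ys: "set ys \<subseteq> carr X" "t \<in> Sg (length ys)" for m ys t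
    proof -
      have uys: "set (map (un X) ys) \<subseteq> carr (MO X)" using ys(1) un_carr[OF X] by auto
      have "m (bas X ys t) = m (opn (free_alg X) t (map (un X) ys))"
        using opM_un[OF X ys] opn_free_alg[OF _ uys, of t] ys(2) by simp
      also have "\<dots> = opn B t (map m (map (un X) ys))"
        using ys(2) uys by (intro alg_hom_op[OF m(1)]) simp_all
      also have "map m (map (un X) ys) = map f ys" using m(2) ys(1) by auto
      finally show ?thesis .
    qed
    have h': "?h \<in> alg_hom Sg (free_alg X) B" "\<forall>x\<in>carr X. ?h (un X x) = f x"
      using calculation by auto
    show "h (bas X ys t) = ?h (bas X ys t)" if "set ys \<subseteq> carr X" "t \<in> Sg (length ys)" for ys t
      using bas_val[OF h that] bas_val[OF h' that] by simp
  qed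
  ultimately show "\<exists>!h. h \<in> alg_hom Sg (free_alg X) B \<and> (\<forall>x\<in>carr X. h (un X x) = f x)"
    by (intro ex1I[of _ ?h]) blast+
qed

sublocale F: free_algebras U Sg eqs free_alg un
  by unfold_locales (rule free_alg_free)

text \<open>\<open>mm X\<close> and \<open>MA X Y f\<close> are homomorphisms with the prescribed
  values on generators, so they are the maps defined by freeness. Hence \<open>M\<close> is itself a
  free-algebra monad for this choice and not merely isomorphic to one.\<close>

lemma is_free_monad_self: "F.is_free_monad M"
  unfolding F.is_free_monad_def
proof (intro conjI ballI)
  have n1: "nat_trans DCPO DCPO id_functor (Fun M) un" and n2: "nat_trans DCPO DCPO (Fun M \<odot> Fun M) (Fun M) mm"
    using is_monad by (simp_all add: is_monad_def)
  show "un \<in> extensional (Obj DCPO)" "mm \<in> extensional (Obj DCPO)" using n1 n2 by (simp_all add: nat_trans_DCPO)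
  fix X :: "'u dcpo" assume X: "X \<in> Obj DCPO"
  show "MO X = und (free_alg X)" "un X = un X" by simp_all
  show "mm X = F.mu X"
    unfolding F.mu_def
  proof (rule F.ext_unique)
    show "und (free_alg X) \<in> Obj DCPO" "free_alg X \<in> models Sg eqs" using MO_Obj[OF X] free_alg_models[OF X] by simp_all
    show "(\<lambda>x\<in>carr (und (free_alg X)). x) \<in> carr (cfun (und (free_alg X)) (und (free_alg X)))" by (rule ident_in_cfun)
    show "mm X \<in> alg_hom Sg (free_alg (und (free_alg X))) (free_alg X)"
    proof (rule alg_homI)
      show "mm X \<in> carr (cfun (und (free_alg (und (free_alg X)))) (und (free_alg X)))" using mm_cfun[OF X] by simp
      fix s xs assume s: "s \<in> Sg (length xs)" "set xs \<subseteq> carr (und (free_alg (und (free_alg X))))"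
      then have xs: "set xs \<subseteq> carr (MO (MO X))" by simp
      have m: "set (map (mm X) xs) \<subseteq> carr (MO X)" using xs mm_carr[OF X] by auto
      show "mm X (opn (free_alg (und (free_alg X))) s xs) = opn (free_alg X) s (map (mm X) xs)"
        using opn_free_alg[OF s(1) xs] opn_free_alg[OF _ m, of s] s(1) opM_mm[OF X xs s(1)] by simp
    qed
    show "mm X (un (und (free_alg X)) x) = (\<lambda>x\<in>carr (und (free_alg X)). x) x" if "x \<in> carr (und (free_alg X))" for x
      using that mm_un[OF X] by simp
  qed
  fix Y :: "'u dcpo" and f assume Y: "Y \<in> Obj DCPO" and f: "f \<in> carr (cfun X Y)"
  show "MA X Y f = F.TA X Y f"
    unfolding F.TA_def
  proof (rule F.ext_unique[OF X free_alg_models[OF Y]])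
    show "compose (carr X) (un Y) f \<in> carr (cfun X (und (free_alg Y)))" by (rule F.compose_eta[OF X Y f])
    show "MA X Y f (un X x) = compose (carr X) (un Y) f x" if "x \<in> carr X" for x
      using that un_natural[OF X Y f] by simp
    show "MA X Y f \<in> alg_hom Sg (free_alg X) (free_alg Y)"
    proof (rule alg_homI)
      show "MA X Y f \<in> carr (cfun (und (free_alg X)) (und (free_alg Y)))" using MA_cfun[OF X Y f] by simp
      fix s xs assume s: "s \<in> Sg (length xs)" "set xs \<subseteq> carr (und (free_alg X))"
      then have xs: "set xs \<subseteq> carr (MO X)" by simp
      have m: "set (map (MA X Y f) xs) \<subseteq> carr (MO Y)" using xs MA_carr[OF X Y f] by auto
      show "MA X Y f (opn (free_alg X) s xs) = opn (free_alg Y) s (map (MA X Y f) xs)"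
        using opn_free_alg[OF s(1) xs] opn_free_alg[OF _ m, of s] s(1) opM_natural[OF X Y f xs s(1)] by simp
    qed
  qed
qed

end

section \<open>The correspondence\<close>

text \<open>A concrete functor keeps the underlying function of each homomorphism, so a concrete
  isomorphism is given by its object maps together with equality of the sets of
  homomorphisms.\<close>

definition same_models ::
    "'u signature \<Rightarrow> ('u ext_trm \<times> 'u ext_trm) set \<Rightarrow> 'u signature \<Rightarrow> ('u ext_trm \<times> 'u ext_trm) set \<Rightarrow>
     ('u algebra \<Rightarrow> 'u algebra) \<Rightarrow> ('u algebra \<Rightarrow> 'u algebra) \<Rightarrow> bool" where
  "same_models S E S' E' I J \<longleftrightarrow>
     (\<forall>A\<in>models S E. I A \<in> models S' E' \<and> und (I A) = und A \<and> J (I A) = A) \<and>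
     (\<forall>B\<in>models S' E'. J B \<in> models S E \<and> und (J B) = und B \<and> I (J B) = B) \<and>
     (\<forall>A\<in>models S E. \<forall>A'\<in>models S E. alg_hom S A A' = alg_hom S' (I A) (I A'))"

lemma same_models_swap: "same_models S E S' E' I J \<Longrightarrow> same_models S' E' S E J I"
  unfolding same_models_def by (intro conjI ballI) simp_all

lemma concretely_isomorphic_iff:
  "concretely_isomorphic (variety_of S E) (variety_of S' E') \<longleftrightarrow> (\<exists>I J. same_models S E S' E' I J)"
proof
  assume "concretely_isomorphic (variety_of S E) (variety_of S' E')"
  then obtain I J where I: "is_functor (variety_of S E) (variety_of S' E') I"
    and J: "is_functor (variety_of S' E') (variety_of S E) J"
    and JI: "eq_functor (variety_of S E) (J \<odot> I) id_functor"
    and IJ: "eq_functor (variety_of S' E') (I \<odot> J) id_functor"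
    and f: "eq_functor (variety_of S E) (forget \<odot> I) forget"
    unfolding concretely_isomorphic_def by blast
  have IO: "FObj I A \<in> models S' E'" "und (FObj I A) = und A" "FObj J (FObj I A) = A" if "A \<in> models S E" for A
    using I JI f that by (auto simp: is_functor_def eq_functor_def)
  have JO: "FObj J B \<in> models S E" "FObj I (FObj J B) = B" if "B \<in> models S' E'" for B
    using J IJ that by (auto simp: is_functor_def eq_functor_def)
  have JO': "und (FObj J B) = und B" if "B \<in> models S' E'" for B
    using IO(2)[OF JO(1)[OF that]] JO(2)[OF that] by simp
  have IA: "FArr I A A' h = h" if "A \<in> models S E" "A' \<in> models S E" "h \<in> alg_hom S A A'" for A A' h
    using f that by (auto simp: eq_functor_def)
  have IH: "h \<in> alg_hom S' (FObj I A) (FObj I A')" if "A \<in> models S E" "A' \<in> models S E" "h \<in> alg_hom S A A'" for A A' h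
  proof -
    have "FArr I A A' h \<in> alg_hom S' (FObj I A) (FObj I A')"
      using I that unfolding is_functor_def variety_of_simps by blast
    then show ?thesis using IA[OF that] by simp
  qed
  \<comment> \<open>Only \<open>I\<close> is known to keep functions unchanged; for \<open>J\<close>
    this follows because it is inverse to \<open>I\<close>.\<close>
  have JH: "h \<in> alg_hom S A A'" if A: "A \<in> models S E" "A' \<in> models S E" and h: "h \<in> alg_hom S' (FObj I A) (FObj I A')" for A A' h
  proof -
    have "FArr J (FObj I A) (FObj I A') h \<in> alg_hom S (FObj J (FObj I A)) (FObj J (FObj I A'))"
      using J IO(1) A h unfolding is_functor_def variety_of_simps by blast
    then have Jh: "FArr J (FObj I A) (FObj I A') h \<in> alg_hom S A A'" using IO(3) A by simp
    have "FArr (I \<odot> J) (FObj I A) (FObj I A') h = FArr id_functor (FObj I A) (FObj I A') h"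
      using IJ IO(1)[OF A(1)] IO(1)[OF A(2)] h unfolding eq_functor_def variety_of_simps by blast
    then have "FArr I A A' (FArr J (FObj I A) (FObj I A') h) = h"
      using IO(3)[OF A(1)] IO(3)[OF A(2)] by simp
    then show ?thesis using IA[OF A Jh] Jh by simp
  qed
  have "same_models S E S' E' (FObj I) (FObj J)"
    unfolding same_models_def using IO JO JO' IH JH by blast
  then show "\<exists>I J. same_models S E S' E' I J" by blast
next
  assume "\<exists>I J. same_models S E S' E' I J"
  then obtain I J where sm: "same_models S E S' E' I J" by blast
  let ?F = "\<lambda>I. \<lparr>FObj = I, FArr = \<lambda>A B h. h\<rparr>"
  have f: "is_functor (variety_of R D) (variety_of R' D') (?F I)" if "same_models R D R' D' I J" for R D R' D' I J
    unfolding is_functor_def using that by (auto simp: same_models_def)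
  have "is_functor (variety_of S E) (variety_of S' E') (?F I)" by (rule f[OF sm])
  moreover have "is_functor (variety_of S' E') (variety_of S E) (?F J)" by (rule f[OF same_models_swap[OF sm]])
  ultimately show "concretely_isomorphic (variety_of S E) (variety_of S' E')"
    unfolding concretely_isomorphic_def using sm
    by (intro exI[of _ "?F I"] exI[of _ "?F J"]) (auto simp: eq_functor_def same_models_def)
qed

lemma same_models_trans:
  assumes "same_models S E S' E' I J" "same_models S' E' S'' E'' I' J'"
  shows "same_models S E S'' E'' (\<lambda>A. I' (I A)) (\<lambda>B. J (J' B))"
  using assms unfolding same_models_def by simp

lemma same_models_refl: "same_models S E S E (\<lambda>A. A) (\<lambda>A. A)"
  by (simp add: same_models_def)

context two_varieties
begin

lemma EM_hom_of_monad_morphism: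
  assumes \<tau>: "monad_morphism DCPO M N \<tau>" and B: "B \<in> models S' E'" and B': "B' \<in> models S' E'" and f: "f \<in> alg_hom S' B B'"
  shows "f \<in> alg_hom S (V.EM (und B) (compose (carr (V.TO (und B))) (W.str B) (\<tau> (und B))))
    (V.EM (und B') (compose (carr (V.TO (und B'))) (W.str B') (\<tau> (und B'))))"
proof (rule alg_homI)
  let ?X = "und B" and ?Y = "und B'"
  have X: "?X \<in> Obj DCPO" and Y: "?Y \<in> Obj DCPO" using W.models_Obj B B' by blast+
  have fc: "f \<in> carr (cfun ?X ?Y)" by (rule alg_hom_cfun[OF f])
  have t: "\<tau> ?X \<in> carr (cfun (V.TO ?X) (W.TO ?X))"
    "u \<in> carr (V.TO ?X) \<Longrightarrow> \<tau> ?Y (V.TA ?X ?Y f u) = W.TA ?X ?Y f (\<tau> ?X u)" for u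
    using \<tau> X Y fc unfolding monad_morphism_iff by blast+
  show "f \<in> carr (cfun (und (V.EM ?X (compose (carr (V.TO ?X)) (W.str B) (\<tau> ?X))))
    (und (V.EM ?Y (compose (carr (V.TO ?Y)) (W.str B') (\<tau> ?Y)))))"
    using fc by simp
  fix s xs assume s: "s \<in> S (length xs)" "set xs \<subseteq> carr (und (V.EM ?X (compose (carr (V.TO ?X)) (W.str B) (\<tau> ?X))))"
  then have xs: "set xs \<subseteq> carr ?X" by simp
  let ?u = "opn (T ?X) s (map (eta ?X) xs)"
  have e: "set (map (eta ?X) xs) \<subseteq> carr (V.TO ?X)" using xs V.eta_carr[OF X] by auto
  have u: "?u \<in> carr (V.TO ?X)" using s(1) e by (intro algebra_closed[OF V.T_algebra[OF X]]) simp_all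
  have "f (W.str B (\<tau> ?X ?u)) = W.str B' (\<tau> ?Y (V.TA ?X ?Y f ?u))"
    using W.str_natural[OF B B' f cfun_carr[OF t(1) u]] t(2)[OF u] by simp
  also have "V.TA ?X ?Y f ?u = opn (T ?Y) s (map (V.TA ?X ?Y f) (map (eta ?X) xs))"
    using s(1) e by (intro alg_hom_op[OF V.TA_hom[OF X Y fc]]) simp_all
  also have "map (V.TA ?X ?Y f) (map (eta ?X) xs) = map (eta ?Y) (map f xs)"
    using xs V.TA_eta[OF X Y fc] by auto
  finally have *: "f (W.str B (\<tau> ?X ?u)) = W.str B' (\<tau> ?Y (opn (T ?Y) s (map (eta ?Y) (map f xs))))" .
  have fxs: "set (map f xs) \<subseteq> carr ?Y" using xs cfun_carr[OF fc] by auto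
  then have "set (map (eta ?Y) (map f xs)) \<subseteq> carr (V.TO ?Y)" using V.eta_carr[OF Y] by auto
  then have "opn (T ?Y) s (map (eta ?Y) (map f xs)) \<in> carr (V.TO ?Y)"
    using s(1) by (intro algebra_closed[OF V.T_algebra[OF Y]]) simp_all
  then show "f (opn (V.EM ?X (compose (carr (V.TO ?X)) (W.str B) (\<tau> ?X))) s xs) =
    opn (V.EM ?Y (compose (carr (V.TO ?Y)) (W.str B') (\<tau> ?Y))) s (map f xs)"
    unfolding V.EM_def using * s(1) xs fxs u by simp
qed

lemma swap: "two_varieties S' E' T' eta' S E T eta N M"
  by (intro two_varieties.intro two_varieties_axioms.intro V.free_algebras_axioms W.free_algebras_axioms M N)

text \<open>The isomorphism and its inverse induce monad morphisms in both directions. Their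
  composites are homomorphisms on free algebras that fix the generators, hence identities.\<close>

lemma monad_isomorphic_of_same_models:
  assumes sm: "same_models S E S' E' I J"
  shows "monad_isomorphic DCPO M N"
proof -
  interpret WV: two_varieties U S' E' T' eta' S E T eta N M by (rule swap)
  have I: "A \<in> models S E \<Longrightarrow> I A \<in> models S' E'" "A \<in> models S E \<Longrightarrow> und (I A) = und A" "A \<in> models S E \<Longrightarrow> J (I A) = A"
    and J: "B \<in> models S' E' \<Longrightarrow> J B \<in> models S E" "B \<in> models S' E' \<Longrightarrow> und (J B) = und B" "B \<in> models S' E' \<Longrightarrow> I (J B) = B"
    and h: "A \<in> models S E \<Longrightarrow> A' \<in> models S E \<Longrightarrow> alg_hom S A A' = alg_hom S' (I A) (I A')"
    and h': "B \<in> models S' E' \<Longrightarrow> B' \<in> models S' E' \<Longrightarrow> alg_hom S' B B' = alg_hom S (J B) (J B')" for A A' B B'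
    using sm same_models_swap[OF sm] unfolding same_models_def by blast+
  define \<sigma> where "\<sigma> X = V.ext X (J (T' X)) (eta' X)" for X
  define \<tau> where "\<tau> X = W.ext X (I (T X)) (eta X)" for X
  have \<sigma>: "monad_morphism DCPO M N (\<lambda>X\<in>Obj DCPO. \<sigma> X)"
    unfolding \<sigma>_def by (rule monad_morphism_of_functor) (use J h' in auto)
  have \<tau>: "monad_morphism DCPO N M (\<lambda>X\<in>Obj DCPO. \<tau> X)"
    unfolding \<tau>_def by (rule WV.monad_morphism_of_functor) (use I h in auto)
  have \<sigma>X: "\<sigma> X \<in> alg_hom S (T X) (J (T' X))" "\<And>x. x \<in> carr X \<Longrightarrow> \<sigma> X (eta X x) = eta' X x"
    and \<tau>X: "\<tau> X \<in> alg_hom S' (T' X) (I (T X))" "\<And>x. x \<in> carr X \<Longrightarrow> \<tau> X (eta' X x) = eta X x" if X: "X \<in> Obj DCPO" for X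
  proof -
    note TX = V.T_models[OF X] and T'X = W.T_models[OF X]
    have e: "eta' X \<in> carr (cfun X (und (J (T' X))))" "eta X \<in> carr (cfun X (und (I (T X))))"
      using W.eta_cfun[OF X] V.eta_cfun[OF X] by (simp_all add: J(2)[OF T'X] I(2)[OF TX])
    show "\<sigma> X \<in> alg_hom S (T X) (J (T' X))" "\<And>x. x \<in> carr X \<Longrightarrow> \<sigma> X (eta X x) = eta' X x"
      unfolding \<sigma>_def using V.ext_hom[OF X J(1)[OF T'X] e(1)] V.ext_eta[OF X J(1)[OF T'X] e(1)] by auto
    show "\<tau> X \<in> alg_hom S' (T' X) (I (T X))" "\<And>x. x \<in> carr X \<Longrightarrow> \<tau> X (eta' X x) = eta X x"
      unfolding \<tau>_def using W.ext_hom[OF X I(1)[OF TX] e(2)] W.ext_eta[OF X I(1)[OF TX] e(2)] by auto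
  qed
  have \<tau>\<sigma>: "compose (carr (V.TO X)) (\<tau> X) (\<sigma> X) = (\<lambda>z\<in>carr (V.TO X). z)" if X: "X \<in> Obj DCPO" for X
  proof (rule V.hom_eqI[OF X V.T_models[OF X]])
    note TX = V.T_models[OF X] and T'X = W.T_models[OF X]
    have "\<tau> X \<in> alg_hom S (J (T' X)) (T X)"
      using \<tau>X(1)[OF X] h'[OF T'X I(1)[OF TX]] I(3)[OF TX] by simp
    then show "compose (carr (V.TO X)) (\<tau> X) (\<sigma> X) \<in> alg_hom S (T X) (T X)"
      by (rule alg_hom_compose[OF V.T_algebra[OF X] \<sigma>X(1)[OF X]])
    show "(\<lambda>z\<in>carr (V.TO X). z) \<in> alg_hom S (T X) (T X)" by (rule alg_hom_ident[OF V.T_algebra[OF X]])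
  qed (use X \<sigma>X(2) \<tau>X(2) V.eta_carr in simp)
  have \<sigma>\<tau>: "compose (carr (W.TO X)) (\<sigma> X) (\<tau> X) = (\<lambda>z\<in>carr (W.TO X). z)" if X: "X \<in> Obj DCPO" for X
  proof (rule W.hom_eqI[OF X W.T_models[OF X]])
    note TX = V.T_models[OF X] and T'X = W.T_models[OF X]
    have "\<sigma> X \<in> alg_hom S' (I (T X)) (T' X)"
      using \<sigma>X(1)[OF X] h[OF TX J(1)[OF T'X]] J(3)[OF T'X] by simp
    then show "compose (carr (W.TO X)) (\<sigma> X) (\<tau> X) \<in> alg_hom S' (T' X) (T' X)"
      by (rule alg_hom_compose[OF W.T_algebra[OF X] \<tau>X(1)[OF X]])
    show "(\<lambda>z\<in>carr (W.TO X). z) \<in> alg_hom S' (T' X) (T' X)" by (rule alg_hom_ident[OF W.T_algebra[OF X]])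
  qed (use X \<sigma>X(2) \<tau>X(2) W.eta_carr in simp)
  note M' = V.is_free_monadD(1)[OF M] and N' = W.is_free_monadD(1)[OF N]
  show ?thesis
    unfolding monad_isomorphic_def using \<sigma> \<tau> \<tau>\<sigma> \<sigma>\<tau>
    by (intro exI[of _ "\<lambda>X\<in>Obj DCPO. \<sigma> X"] exI[of _ "\<lambda>X\<in>Obj DCPO. \<tau> X"])
      (simp add: Let_def Comp_DCPO Ide_DCPO M' N')
qed

text \<open>Restricting along one monad morphism and then along its inverse returns the original
  structure map; \<open>EM_str\<close> turns this into equality of algebras.\<close>

lemma same_models_of_monad_isomorphic:
  assumes "monad_isomorphic DCPO M N"
  shows "\<exists>I J. same_models S E S' E' I J"
proof -
  interpret WV: two_varieties U S' E' T' eta' S E T eta N M by (rule swap)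
  note M' = V.is_free_monadD(1)[OF M] and N' = W.is_free_monadD(1)[OF N]
  obtain \<sigma> \<tau> where \<sigma>: "monad_morphism DCPO M N \<sigma>" and \<tau>: "monad_morphism DCPO N M \<tau>"
    and inv: "\<forall>X\<in>Obj DCPO. compose (carr (V.TO X)) (\<tau> X) (\<sigma> X) = (\<lambda>z\<in>carr (V.TO X). z) \<and>
      compose (carr (W.TO X)) (\<sigma> X) (\<tau> X) = (\<lambda>z\<in>carr (W.TO X). z)"
    using assms unfolding monad_isomorphic_def Let_def Comp_DCPO Ide_DCPO by (auto simp: M' N')
  define J where "J B = V.EM (und B) (compose (carr (V.TO (und B))) (W.str B) (\<sigma> (und B)))" for B
  define I where "I A = W.EM (und A) (compose (carr (W.TO (und A))) (V.str A) (\<tau> (und A)))" for A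
  have \<sigma>c: "\<sigma> X z \<in> carr (W.TO X)" if "X \<in> Obj DCPO" "z \<in> carr (V.TO X)" for X z
    using \<sigma> that unfolding monad_morphism_iff by (meson cfun_carr)
  have \<tau>c: "\<tau> X z \<in> carr (V.TO X)" if "X \<in> Obj DCPO" "z \<in> carr (W.TO X)" for X z
    using \<tau> that unfolding WV.monad_morphism_iff by (meson cfun_carr)
  have i1: "\<tau> X (\<sigma> X z) = z" if "X \<in> Obj DCPO" "z \<in> carr (V.TO X)" for X z
    using fun_cong[OF conjunct1[OF inv[rule_format, OF that(1)]], of z] that(2) by simp
  have i2: "\<sigma> X (\<tau> X z) = z" if "X \<in> Obj DCPO" "z \<in> carr (W.TO X)" for X z
    using fun_cong[OF conjunct2[OF inv[rule_format, OF that(1)]], of z] that(2) by simp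
  note J = functor_of_monad_morphism[OF \<sigma>, folded J_def] and Jh = EM_hom_of_monad_morphism[OF \<sigma>, folded J_def]
  note I = WV.functor_of_monad_morphism[OF \<tau>, folded I_def] and Ih = WV.EM_hom_of_monad_morphism[OF \<tau>, folded I_def]
  have uJ: "und (J B) = und B" and uI: "und (I A) = und A" for A B
    by (simp_all add: J_def I_def)
  have JI: "J (I A) = A" if A: "A \<in> models S E" for A
  proof -
    have X: "und A \<in> Obj DCPO" using V.models_Obj[OF A] .
    have "compose (carr (V.TO (und A))) (compose (carr (W.TO (und A))) (V.str A) (\<tau> (und A))) (\<sigma> (und A)) = V.str A"
      using cfun_ext[OF alg_hom_cfun[OF V.str_hom[OF A]]] \<sigma>c[OF X] i1[OF X]
      by (auto simp: compose_def fun_eq_iff PiE_iff extensional_def)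
    then show ?thesis
      using I(2)[OF A] V.EM_str[OF A] by (simp add: J_def uI)
  qed
  have IJ: "I (J B) = B" if B: "B \<in> models S' E'" for B
  proof -
    have X: "und B \<in> Obj DCPO" using W.models_Obj[OF B] .
    have "compose (carr (W.TO (und B))) (compose (carr (V.TO (und B))) (W.str B) (\<sigma> (und B))) (\<tau> (und B)) = W.str B"
      using cfun_ext[OF alg_hom_cfun[OF W.str_hom[OF B]]] \<tau>c[OF X] i2[OF X]
      by (auto simp: compose_def fun_eq_iff PiE_iff extensional_def)
    then show ?thesis
      using J(2)[OF B] W.EM_str[OF B] by (simp add: I_def uJ)
  qed
  have "alg_hom S A A' = alg_hom S' (I A) (I A')" if A: "A \<in> models S E" "A' \<in> models S E" for A A'
  proof
    show "alg_hom S A A' \<subseteq> alg_hom S' (I A) (I A')" using Ih[OF A] by blast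
    show "alg_hom S' (I A) (I A') \<subseteq> alg_hom S A A'"
      using Jh[OF I(1)[OF A(1)] I(1)[OF A(2)]] by (auto simp: JI A)
  qed
  then have "same_models S E S' E' I J"
    unfolding same_models_def using I(1) J(1) uI uJ IJ JI by simp
  then show ?thesis by blast
qed

lemma isomorphic_iff:
  "concretely_isomorphic (variety_of S E) (variety_of S' E') \<longleftrightarrow> monad_isomorphic DCPO M N"
  unfolding concretely_isomorphic_iff
  using monad_isomorphic_of_same_models same_models_of_monad_isomorphic by blast

end

text \<open>Records the data used in comparisons: a presentation and chosen free algebras whose
  monad is \<open>M\<close>, in place of an adjunction. It follows from
  \<open>free_algebra_monad\<close> for a variety, and every strongly finitary monad is presented in
  this sense.\<close>

definition presents :: "'u alg_category \<Rightarrow> 'u dcpo_monad \<Rightarrow> bool" where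
  "presents V M \<longleftrightarrow> (\<exists>S E T eta. free_algebras S E T eta \<and> small TYPE('u) E \<and>
     V = variety_of S E \<and> free_algebras.is_free_monad S T eta M)"

section \<open>Isomorphism classes of varieties and of monads\<close>

context universe
begin

lemma varieties_iff:
  "(V :: 'u alg_category) \<in> varieties \<longleftrightarrow> (\<exists>S E. variety S E \<and> small TYPE('u) E \<and> V = variety_of S E)"
proof -
  have "variety S E \<longleftrightarrow> is_signature S \<and> E \<subseteq> ext_trms S \<times> ext_trms S" for S :: "'u signature" and E
    using universe_axioms by (auto simp: variety_def variety_axioms_def)
  then show ?thesis unfolding varieties_def variety_of_eq by blast
qed

lemma presents_free_algebra_monad:
  assumes "(V :: 'u alg_category) \<in> varieties" "free_algebra_monad V M"
  shows "presents V M"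
proof -
  obtain S E where SE: "variety S E" "small TYPE('u) E" "V = variety_of S E"
    using assms(1) by (auto simp: varieties_iff)
  interpret variety U S E by (rule SE(1))
  obtain F \<eta> \<epsilon> where "adjunction DCPO (variety_of S E) F forget \<eta> \<epsilon>" "M = induced_monad DCPO F forget \<eta> \<epsilon>"
    using assms(2) unfolding SE(3) free_algebra_monad_def by blast
  then show ?thesis
    using adjunction_free_algebras SE(2,3) unfolding presents_def by blast
qed

lemma ex_free_algebra_monad:
  assumes "(V :: 'u alg_category) \<in> varieties"
  shows "\<exists>M. free_algebra_monad V M"
proof -
  obtain S E where SE: "variety S E" "V = variety_of S E"
    using assms by (auto simp: varieties_iff)
  interpret variety U S E by (rule SE(1))
  show ?thesis using ex_adjunction unfolding SE(2) free_algebra_monad_def by blast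
qed

lemma presents_sf_monads: "presents (V :: 'u alg_category) M \<Longrightarrow> M \<in> sf_monads"
proof -
  assume "presents V M"
  then obtain S E T eta where "free_algebras S E T eta" and M: "free_algebras.is_free_monad S T eta M"
    unfolding presents_def by blast
  then interpret free_algebras U S E T eta by simp
  show ?thesis
    using enriched_free_monad[OF M] strongly_finitary_free_monad[OF M] by (simp add: sf_monads_def)
qed

lemma presents_varieties: "presents (V :: 'u alg_category) M \<Longrightarrow> V \<in> varieties"
  unfolding presents_def varieties_iff free_algebras_def by blast

lemma presents_isomorphic_iff:
  assumes "presents (V :: 'u alg_category) M" "presents (W :: 'u alg_category) N"
  shows "concretely_isomorphic V W \<longleftrightarrow> monad_isomorphic DCPO M N"
proof -
  obtain S E T eta where V: "free_algebras S E T eta" "V = variety_of S E" "free_algebras.is_free_monad S T eta M"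
    using assms(1) unfolding presents_def by blast
  obtain S' E' T' eta' where W: "free_algebras S' E' T' eta'" "W = variety_of S' E'" "free_algebras.is_free_monad S' T' eta' N"
    using assms(2) unfolding presents_def by blast
  interpret two_varieties U S E T eta S' E' T' eta' M N
    using V W by (intro two_varieties.intro two_varieties_axioms.intro)
  show ?thesis unfolding V(2) W(2) by (rule isomorphic_iff)
qed

lemma ex_presents: "(M :: 'u dcpo_monad) \<in> sf_monads \<Longrightarrow> \<exists>V. presents V M"
proof -
  assume "M \<in> sf_monads"
  then interpret sf_monad U M by unfold_locales
  show ?thesis
    unfolding presents_def using F.free_algebras_axioms small_eqs is_free_monad_self small_TYPE by blast
qed

lemma equiv_concrete_iso: "equiv (varieties :: 'u alg_category set) concrete_iso"
proof (rule equivI)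
  show "concrete_iso \<subseteq> (varieties :: 'u alg_category set) \<times> varieties" by (auto simp: concrete_iso_def)
  show "refl_on (varieties :: 'u alg_category set) concrete_iso"
  proof (rule refl_onI)
    fix V :: "'u alg_category" assume V: "V \<in> varieties"
    then obtain S E where "V = variety_of S E" unfolding varieties_iff by blast
    then have "concretely_isomorphic V V" using same_models_refl concretely_isomorphic_iff by blast
    then show "(V, V) \<in> concrete_iso" using V by (simp add: concrete_iso_def)
  qed
  show "sym (concrete_iso :: 'u alg_category rel)"
  proof (rule symI)
    fix V W :: "'u alg_category" assume "(V, W) \<in> concrete_iso"
    then have VW: "V \<in> varieties" "W \<in> varieties" "concretely_isomorphic V W" by (auto simp: concrete_iso_def)
    obtain S E S' E' where V: "V = variety_of S E" and W: "W = variety_of S' E'" using VW unfolding varieties_iff by blast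
    obtain I J where "same_models S E S' E' I J" using VW(3) unfolding V W concretely_isomorphic_iff by blast
    from same_models_swap[OF this] have "concretely_isomorphic W V" unfolding V W concretely_isomorphic_iff by blast
    then show "(W, V) \<in> concrete_iso" using VW by (simp add: concrete_iso_def)
  qed
  show "trans (concrete_iso :: 'u alg_category rel)"
  proof (rule transI)
    fix V W Z :: "'u alg_category" assume "(V, W) \<in> concrete_iso" "(W, Z) \<in> concrete_iso"
    then have VW: "V \<in> varieties" "W \<in> varieties" "Z \<in> varieties" "concretely_isomorphic V W" "concretely_isomorphic W Z"
      by (auto simp: concrete_iso_def)
    obtain S E S' E' S'' E'' where V: "V = variety_of S E" and W: "W = variety_of S' E'" and Z: "Z = variety_of S'' E''"
      using VW unfolding varieties_iff by blast
    obtain I J where 1: "same_models S E S' E' I J" using VW(4) unfolding V W concretely_isomorphic_iff by blast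
    obtain I' J' where 2: "same_models S' E' S'' E'' I' J'" using VW(5) unfolding W Z concretely_isomorphic_iff by blast
    from same_models_trans[OF 1 2] have "concretely_isomorphic V Z" unfolding V Z concretely_isomorphic_iff by blast
    then show "(V, Z) \<in> concrete_iso" using VW by (simp add: concrete_iso_def)
  qed
qed

text \<open>Every strongly finitary monad is presented by a variety, so the relation on monads is
  the one on varieties transported along \<open>presents\<close>; in this way no monad morphisms
  have to be composed.\<close>

lemma equiv_monad_iso: "equiv (sf_monads :: 'u dcpo_monad set) monad_iso"
proof (rule equivI)
  have iff: "(M, N) \<in> monad_iso \<longleftrightarrow> (V, W) \<in> concrete_iso"
    if "presents V M" "presents W N" for M N :: "'u dcpo_monad" and V W
    using presents_isomorphic_iff[OF that] presents_sf_monads that presents_varieties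
    by (auto simp: monad_iso_def concrete_iso_def)
  have sub: "M \<in> sf_monads" "N \<in> sf_monads" if "(M, N) \<in> monad_iso" for M N :: "'u dcpo_monad"
    using that by (auto simp: monad_iso_def)
  show "monad_iso \<subseteq> (sf_monads :: 'u dcpo_monad set) \<times> sf_monads" by (auto simp: monad_iso_def)
  have rV: "refl_on (varieties :: 'u alg_category set) concrete_iso"
    and sV: "sym (concrete_iso :: 'u alg_category rel)" and tV: "trans (concrete_iso :: 'u alg_category rel)"
    using equiv_concrete_iso by (simp_all add: equiv_def)
  show "refl_on (sf_monads :: 'u dcpo_monad set) monad_iso"
  proof (rule refl_onI)
    fix M :: "'u dcpo_monad" assume "M \<in> sf_monads"
    then obtain V where V: "presents V M" using ex_presents by blast
    show "(M, M) \<in> monad_iso" using iff[OF V V] refl_onD[OF rV presents_varieties[OF V]] by blast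
  qed
  show "sym (monad_iso :: 'u dcpo_monad rel)"
  proof (rule symI)
    fix M N :: "'u dcpo_monad" assume MN: "(M, N) \<in> monad_iso"
    obtain V W where V: "presents V M" and W: "presents W N"
      using ex_presents[OF sub(1)[OF MN]] ex_presents[OF sub(2)[OF MN]] by blast
    have "(V, W) \<in> concrete_iso" using MN iff[OF V W] by blast
    then show "(N, M) \<in> monad_iso" using iff[OF W V] symD[OF sV] by blast
  qed
  show "trans (monad_iso :: 'u dcpo_monad rel)"
  proof (rule transI)
    fix M N L :: "'u dcpo_monad" assume MN: "(M, N) \<in> monad_iso" and NL: "(N, L) \<in> monad_iso"
    obtain V W Z where V: "presents V M" and W: "presents W N" and Z: "presents Z L"
      using ex_presents[OF sub(1)[OF MN]] ex_presents[OF sub(1)[OF NL]] ex_presents[OF sub(2)[OF NL]] by blast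
    have "(V, W) \<in> concrete_iso" "(W, Z) \<in> concrete_iso" using MN NL iff[OF V W] iff[OF W Z] by blast+
    then have "(V, Z) \<in> concrete_iso" by (rule transD[OF tV])
    then show "(M, L) \<in> monad_iso" using iff[OF V Z] by blast
  qed
qed

end

theorem corollary5p8:
  assumes "inaccessible_universe TYPE('u)"
  shows "equiv (varieties :: 'u alg_category set) concrete_iso \<and>
         equiv (sf_monads :: 'u dcpo_monad set) monad_iso \<and>
         (\<forall>V \<in> (varieties :: 'u alg_category set).
            (\<exists>M. free_algebra_monad V M) \<and>
            (\<forall>M. free_algebra_monad V M \<longrightarrow> M \<in> sf_monads)) \<and>
         (\<exists>\<Phi>. bij_betw \<Phi> ((varieties :: 'u alg_category set) // concrete_iso)
                          ((sf_monads :: 'u dcpo_monad set) // monad_iso) \<and>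
               (\<forall>V\<in>varieties. \<forall>M. free_algebra_monad V M \<longrightarrow>
                  \<Phi> (concrete_iso `` {V}) = monad_iso `` {M}))"
proof -
  interpret universe "TYPE('u)" by unfold_locales (rule assms)
  note eV = equiv_concrete_iso and eM = equiv_monad_iso
  have iff: "(M, N) \<in> monad_iso \<longleftrightarrow> (V, W) \<in> concrete_iso"
    if "presents V M" "presents W N" for M N :: "'u dcpo_monad" and V W
    using presents_isomorphic_iff[OF that] presents_sf_monads that presents_varieties
    by (auto simp: monad_iso_def concrete_iso_def)
  have ex: "\<exists>M. presents V M" if "V \<in> varieties" for V :: "'u alg_category"
    using presents_free_algebra_monad[OF that] ex_free_algebra_monad[OF that] by blast
  \<comment> \<open>The class of some monad presented by some member of \<open>c\<close>;
    \<open>presents_isomorphic_iff\<close> makes it independent of both choices, and its converse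
    direction makes \<Phi> injective.\<close>
  define \<Phi> where "\<Phi> c = monad_iso `` {SOME M. \<exists>V\<in>c. presents V M}" for c :: "'u alg_category set"
  have \<Phi>: "\<Phi> (concrete_iso `` {V}) = monad_iso `` {M}" if VM: "presents V M" for V and M :: "'u dcpo_monad"
  proof -
    let ?M = "SOME M. \<exists>W\<in>concrete_iso `` {V}. presents W M"
    have "V \<in> concrete_iso `` {V}" using equiv_class_self[OF eV presents_varieties[OF VM]] .
    then have "\<exists>M. \<exists>W\<in>concrete_iso `` {V}. presents W M" using VM by blast
    from someI_ex[OF this] obtain W where "(V, W) \<in> concrete_iso" "presents W ?M" by blast
    then have "(M, ?M) \<in> monad_iso" using iff[OF VM] by blast
    then show ?thesis unfolding \<Phi>_def by (rule equiv_class_eq[OF eM, symmetric])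
  qed
  have "inj_on \<Phi> (varieties // concrete_iso)"
  proof (rule inj_onI)
    fix c d assume c: "c \<in> varieties // concrete_iso" and d: "d \<in> varieties // concrete_iso" and eq: "\<Phi> c = \<Phi> d"
    obtain V W where V: "V \<in> varieties" "c = concrete_iso `` {V}" and W: "W \<in> varieties" "d = concrete_iso `` {W}"
      using c d by (auto elim!: quotientE)
    obtain M N where M: "presents V M" and N: "presents W N" using ex V(1) W(1) by blast
    have "monad_iso `` {M} = monad_iso `` {N}" using eq \<Phi>[OF M] \<Phi>[OF N] V(2) W(2) by simp
    then have "(M, N) \<in> monad_iso" using eq_equiv_class[OF _ eM] presents_sf_monads[OF N] by blast
    then show "c = d" unfolding V(2) W(2) using iff[OF M N] equiv_class_eq[OF eV] by blast
  qed
  moreover have "\<Phi> ` (varieties // concrete_iso) = sf_monads // monad_iso"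
  proof
    show "\<Phi> ` (varieties // concrete_iso) \<subseteq> sf_monads // monad_iso"
    proof
      fix m assume "m \<in> \<Phi> ` (varieties // concrete_iso)"
      then obtain V where V: "V \<in> varieties" "m = \<Phi> (concrete_iso `` {V})" by (auto elim!: quotientE)
      obtain M where M: "presents V M" using ex V(1) by blast
      show "m \<in> sf_monads // monad_iso"
        unfolding V(2) \<Phi>[OF M] by (rule quotientI[OF presents_sf_monads[OF M]])
    qed
    show "sf_monads // monad_iso \<subseteq> \<Phi> ` (varieties // concrete_iso)"
    proof
      fix m assume "m \<in> (sf_monads :: 'u dcpo_monad set) // monad_iso"
      then obtain M where M: "M \<in> sf_monads" "m = monad_iso `` {M}" by (auto elim!: quotientE)
      obtain V where V: "presents V M" using ex_presents[OF M(1)] by blast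
      show "m \<in> \<Phi> ` (varieties // concrete_iso)"
        unfolding M(2) \<Phi>[OF V, symmetric] by (intro imageI quotientI presents_varieties[OF V])
    qed
  qed
  ultimately have bij: "bij_betw \<Phi> (varieties // concrete_iso) (sf_monads // monad_iso)" by (simp add: bij_betw_def)
  show ?thesis
  proof (intro conjI ballI exI[of _ \<Phi>] bij eV eM allI impI)
    fix V :: "'u alg_category" assume V: "V \<in> varieties"
    show "\<exists>M. free_algebra_monad V M" by (rule ex_free_algebra_monad[OF V])
    fix M assume "free_algebra_monad V M"
    note M = presents_free_algebra_monad[OF V this]
    show "M \<in> sf_monads" by (rule presents_sf_monads[OF M])
    show "\<Phi> (concrete_iso `` {V}) = monad_iso `` {M}" by (rule \<Phi>[OF M])
  qed
qed

end
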